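(* Let $\Omega\subset \mathbb R^2$ be a compact domain bounded by a simple closed curve $C$ of class $\mathcal C^2$. Then $$\int_{C\times C}\theta\sin\theta\,\frac{dx\,dy}{\|y-x\|^2}=4\int_{NT(\Omega)}\frac{dz\,dw}{\|z-w\|^4},$$ where $NT(\Omega)\subset\Omega\times\Omega$ is the set of point pairs $(z,w)$ such that any circle $\xi\subset\mathbb R^2$ containing $z$ and $w$ intersects $\mathbb R^2\setminus\Omega$ (i.e. $z,w\in\xi\Rightarrow\xi\not\subset\Omega$).
   Context: $dx,dy$ are Euclidean length elements on $C$; $dz,dw$ are area elements (Lebesgue measure) of $\mathbb R^2$; $\|\cdot\|$ is the Euclidean norm. Angle function $\theta$: orient $C$. For distinct $x,y\in C$ consider the oriented angle at $x$ from $C$ to the oriented circle (or line) through $x$ that is positively tangent to $C$ at $y$. This angle (defined modulo $2\pi$) has a unique continuous determination $\theta\colon C\times C\to\mathbb R$ that vanishes on the diagonal; $\theta$ is symmetric and independent of the orientation of $C$. *)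

theory Defs
  imports "HOL-Analysis.Analysis"
begin

text \<open>The Euclidean plane is identified with \<^typ>\<open>complex\<close>; its area measure is \<^term>\<open>lborel :: complex measure\<close>.\<close>

section \<open>Simple closed curves of class C2\<close>

text \<open>A regular 1-periodic parametrization; the speed is arbitrary, so every simple closed curve of
  class C2 in the plane is the path image of such a map.\<close>

definition C2_simple_closed :: "(real \<Rightarrow> complex) \<Rightarrow> bool" where
  "C2_simple_closed \<gamma> \<longleftrightarrow>
     (\<forall>t. \<gamma> (t + 1) = \<gamma> t) \<and> simple_path \<gamma> \<and>
     \<gamma> C1_differentiable_on UNIV \<and>
     (\<lambda>t. vector_derivative \<gamma> (at t)) C1_differentiable_on UNIV \<and>
     (\<forall>t. vector_derivative \<gamma> (at t) \<noteq> 0)"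

definition unit_tangent :: "(real \<Rightarrow> complex) \<Rightarrow> real \<Rightarrow> complex" where
  "unit_tangent \<gamma> t = sgn (vector_derivative \<gamma> (at t))"

text \<open>The Euclidean length element on the curve, as a Borel measure on the plane: the push-forward
  of the speed of one period.\<close>

definition length_measure :: "(real \<Rightarrow> complex) \<Rightarrow> complex measure" where
  "length_measure \<gamma> =
     distr (density lborel (\<lambda>t. ennreal (indicator {0..1} t * norm (vector_derivative \<gamma> (at t))))) borel \<gamma>"

definition compact_domain :: "complex set \<Rightarrow> bool" where
  "compact_domain \<Omega> \<longleftrightarrow> compact \<Omega> \<and> connected (interior \<Omega>) \<and> closure (interior \<Omega>) = \<Omega>"


section \<open>The angle function\<close>

text \<open>\<open>OCircle c r\<close> is the circle with centre \<open>c\<close> and radius \<open>\<bar>r\<bar>\<close>, oriented counterclockwise for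
  \<open>r > 0\<close> and clockwise for \<open>r < 0\<close>; \<open>OLine p u\<close> is the line through \<open>p\<close> oriented by the unit
  vector \<open>u\<close>.\<close>

datatype oriented_circle = OCircle complex real | OLine complex complex

fun is_oriented_circle :: "oriented_circle \<Rightarrow> bool" where
  "is_oriented_circle (OCircle c r) \<longleftrightarrow> r \<noteq> 0"
| "is_oriented_circle (OLine p u) \<longleftrightarrow> norm u = 1"

fun oc_points :: "oriented_circle \<Rightarrow> complex set" where
  "oc_points (OCircle c r) = sphere c \<bar>r\<bar>"
| "oc_points (OLine p u) = range (\<lambda>s. p + of_real s * u)"

text \<open>The positive unit tangent vector at a point of the circle or line.\<close>

fun oc_direction :: "oriented_circle \<Rightarrow> complex \<Rightarrow> complex" where
  "oc_direction (OCircle c r) x = \<i> * (x - c) / of_real r"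
| "oc_direction (OLine p u) x = u"

definition is_oriented_angle :: "complex \<Rightarrow> complex \<Rightarrow> real \<Rightarrow> bool" where
  "is_oriented_angle u v a \<longleftrightarrow> v = cis a * u"

text \<open>In the last clause \<open>\<xi>\<close> is the oriented circle or line through \<open>x = \<gamma> s\<close> that is positively
  tangent to the curve at \<open>y = \<gamma> t\<close>; the angle is measured at \<open>x\<close>, from the curve to \<open>\<xi>\<close>.\<close>

definition is_angle_function :: "(real \<Rightarrow> complex) \<Rightarrow> (complex \<Rightarrow> complex \<Rightarrow> real) \<Rightarrow> bool" where
  "is_angle_function \<gamma> \<theta> \<longleftrightarrow>
     continuous_on (path_image \<gamma> \<times> path_image \<gamma>) (\<lambda>(x, y). \<theta> x y) \<and>
     (\<forall>x \<in> path_image \<gamma>. \<theta> x x = 0) \<and>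
     (\<forall>s t. \<gamma> s \<noteq> \<gamma> t \<longrightarrow>
        (\<exists>\<xi>. is_oriented_circle \<xi> \<and> \<gamma> s \<in> oc_points \<xi> \<and> \<gamma> t \<in> oc_points \<xi> \<and>
             oc_direction \<xi> (\<gamma> t) = unit_tangent \<gamma> t \<and>
             is_oriented_angle (unit_tangent \<gamma> s) (oc_direction \<xi> (\<gamma> s)) (\<theta> (\<gamma> s) (\<gamma> t))))"

text \<open>Such a function is determined only on pairs of points of the curve; its values elsewhere are
  unspecified.\<close>

definition angle_function :: "(real \<Rightarrow> complex) \<Rightarrow> complex \<Rightarrow> complex \<Rightarrow> real" where
  "angle_function \<gamma> = (SOME \<theta>. is_angle_function \<gamma> \<theta>)"


section \<open>Pairs of points not joined by a circle in the domain\<close>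

definition NT :: "complex set \<Rightarrow> (complex \<times> complex) set" where
  "NT \<Omega> = {(z, w). z \<in> \<Omega> \<and> w \<in> \<Omega> \<and>
     (\<forall>c r. r > 0 \<and> z \<in> sphere c r \<and> w \<in> sphere c r \<longrightarrow> sphere c r \<inter> - \<Omega> \<noteq> {})}"

end

theory Submission
  imports Defs "HOL-Complex_Analysis.Complex_Analysis"
begin

text \<open>Replace \<open>1/\<parallel>z - w\<parallel>\<^sup>4\<close> by bounded kernels \<open>kern eps (\<parallel>z - w\<parallel>\<^sup>2)\<close>, which are at most
  a constant multiple of it and converge to it as \<open>eps\<close> tends to 0. Over \<open>\<Omega> \<times> \<Omega>\<close>, two applications of Green's formula turn the integral into a
  boundary integral over pairs of points of the curve. Over the complement of \<open>NT \<Omega>\<close>, every pair lies on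
  a circle in \<open>\<Omega>\<close>; enlarging its disc within \<open>\<Omega>\<close> through the two points, until it touches the curve, shows
  that almost every pair lies on a unique extremal circle, which is tangent to the curve at one point.
  The touching point and the inscribed angle are coordinates in which the integral is explicit. Both
  integrals have an expansion \<open>a/eps\<^sup>2 - 4 L/eps + c + o(1)\<close> with \<open>L\<close> the length of the curve. A pair in
  \<open>NT \<Omega>\<close> with a small distance lies close to the curve, so the integral over \<open>NT \<Omega>\<close> is \<open>o(1/eps\<^sup>2)\<close>
  and the coefficients \<open>a\<close> agree. It is therefore bounded, hence by Fatou's lemma and dominated convergence
  \<open>1/\<parallel>z - w\<parallel>\<^sup>4\<close> is integrable over \<open>NT \<Omega>\<close>, with integral the difference
  \<open>- chord_energy / 2 - pi\<^sup>2 / 2\<close> of the constants. On the other side \<open>\<theta>\<close> is twice the chord angle minus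
  the two tangent angles, and integration by parts gives \<open>- 2 chord_energy - 2 rot\<^sup>2\<close>, where
  \<open>rot = \<plusminus> pi\<close> by Hopf's theorem on tangent rotation.\<close>

section \<open>Change of variables in the plane\<close>

text \<open>Over \<open>\<Omega> \<times> \<Omega>\<close> and over the linked pairs 1/r^4 is not
  integrable at the diagonal, so the value on \<open>NT \<Omega>\<close> is visible only as a
  difference of two divergent quantities. A smooth function of the squared distance, instead of a
  cut-off at distance eps, lets Green's formula apply without excised discs. The passage from
  \<open>kP\<close> to \<open>kern\<close> is an Euler operator that annihilates R^-1 and R^-(3/2)
  and sends R^-2 to 8 R^-2. Regularized versions of the two annihilated powers can therefore be
  added with coefficients singular in eps; they are the sources of the terms in 1/eps^2 and 1/eps.
  On the side of the tangent discs everything depends on the largest radii \<open>maxrad\<close>, of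
  which only measurability and bounds are known. In the limit of the constant term they are
  multiplied by the limit 0 of \<open>kern_moment cap1\<close>; what survives is the total turning
  of the curve, weighted by the limit pi/2 of \<open>kern_moment cap2\<close>. This is why the
  constant pi^2/2 does not depend on the domain. The number \<open>chord_energy\<close> occurs on
  both sides and is never evaluated.\<close>

definition vec_of_complex :: "complex \<Rightarrow> real^2" where
  "vec_of_complex z = vector [Re z, Im z]"

definition complex_of_vec :: "real^2 \<Rightarrow> complex" where
  "complex_of_vec v = Complex (v$1) (v$2)"

definition pair_of_vec :: "real^2 \<Rightarrow> real \<times> real" where
  "pair_of_vec v = (v$1, v$2)"

lemma complex_of_vec_of_complex [simp]: "complex_of_vec (vec_of_complex z) = z"
  by (simp add: complex_of_vec_def vec_of_complex_def)

lemma vec_of_complex_of_vec [simp]: "vec_of_complex (complex_of_vec v) = v"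
  by (simp add: complex_of_vec_def vec_of_complex_def vec_eq_iff forall_2)

lemma Basis_real2: "(Basis :: (real^2) set) = {axis 1 1, axis 2 1}"
  by (auto simp: Basis_vec_def UNIV_2)

lemma linear_complex_of_vec: "linear complex_of_vec"
  by (intro linearI) (auto simp: complex_of_vec_def complex_eq_iff)

lemma linear_vec_of_complex: "linear vec_of_complex"
  by (intro linearI) (auto simp: vec_of_complex_def vec_eq_iff forall_2)

lemma linear_pair_of_vec: "linear pair_of_vec"
  by (intro linearI) (auto simp: pair_of_vec_def)

lemma complex_of_vec_measurable [measurable]: "complex_of_vec \<in> borel_measurable borel"
  and pair_of_vec_measurable [measurable]: "pair_of_vec \<in> borel_measurable borel"
  using linear_complex_of_vec linear_pair_of_vec
  by (simp_all add: borel_measurable_continuous_onI linear_continuous_on linear_conv_bounded_linear)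

lemma distr_complex_of_vec: "distr lborel borel complex_of_vec = lborel"
proof (rule lborel_eqI[symmetric])
  fix l u :: complex assume lu: "\<And>b. b \<in> Basis \<Longrightarrow> l \<bullet> b \<le> u \<bullet> b"
  have le: "Re l \<le> Re u" "Im l \<le> Im u"
    using lu[of 1] lu[of \<i>] by (auto simp: Basis_complex_def)
  have eq: "complex_of_vec -` box l u = box (vec_of_complex l) (vec_of_complex u)"
    by (auto simp: box_def complex_of_vec_def vec_of_complex_def Basis_complex_def Basis_real2 inner_axis)
  have "emeasure (distr lborel borel complex_of_vec) (box l u) = emeasure lborel (box (vec_of_complex l) (vec_of_complex u))"
    by (subst emeasure_distr) (auto simp: eq)
  also have "\<dots> = ennreal (\<Prod>b\<in>Basis. (vec_of_complex u - vec_of_complex l) \<bullet> b)"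
    by (rule emeasure_lborel_box) (auto simp: Basis_real2 inner_axis vec_of_complex_def le)
  also have "(\<Prod>b\<in>Basis. (vec_of_complex u - vec_of_complex l) \<bullet> b) = (\<Prod>b\<in>Basis. (u - l) \<bullet> b)"
    by (simp add: Basis_real2 Basis_complex_def inner_axis vec_of_complex_def axis_eq_axis complex_eq_iff)
  finally show "emeasure (distr lborel borel complex_of_vec) (box l u) = (\<Prod>b\<in>Basis. (u - l) \<bullet> b)" .
qed simp

lemma distr_pair_of_vec: "distr lborel borel pair_of_vec = lborel"
proof (rule lborel_eqI[symmetric])
  fix l u :: "real \<times> real" assume lu: "\<And>b. b \<in> Basis \<Longrightarrow> l \<bullet> b \<le> u \<bullet> b"
  have le: "fst l \<le> fst u" "snd l \<le> snd u"
    using lu[of "(1,0)"] lu[of "(0,1)"] by (auto simp: Basis_prod_def inner_prod_def)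
  have eq: "pair_of_vec -` box l u = box (vector [fst l, snd l]) (vector [fst u, snd u])"
    by (auto simp: box_def pair_of_vec_def Basis_prod_def Basis_real2 inner_axis inner_prod_def)
  have "emeasure (distr lborel borel pair_of_vec) (box l u) = emeasure lborel (box (vector [fst l, snd l] :: real^2) (vector [fst u, snd u]))"
    by (subst emeasure_distr) (auto simp: eq)
  also have "\<dots> = ennreal (\<Prod>b\<in>Basis. (vector [fst u, snd u] - vector [fst l, snd l] :: real^2) \<bullet> b)"
    by (rule emeasure_lborel_box) (auto simp: Basis_real2 inner_axis le)
  also have "(\<Prod>b\<in>Basis. (vector [fst u, snd u] - vector [fst l, snd l] :: real^2) \<bullet> b) = (\<Prod>b\<in>Basis. (u - l) \<bullet> b)"
    by (simp add: Basis_real2 Basis_prod_def inner_axis axis_eq_axis inner_prod_def)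
  finally show "emeasure (distr lborel borel pair_of_vec) (box l u) = (\<Prod>b\<in>Basis. (u - l) \<bullet> b)" .
qed simp

lemma negligible_linear_preimage_vec:
  assumes "negligible N" shows "negligible (vec_of_complex ` N)"
  by (rule negligible_differentiable_image_negligible[OF _ assms])
     (auto intro!: linear_imp_differentiable_on linear_vec_of_complex)

text \<open>The area formula is applied in \<open>real^2\<close>, where Jacobians are determinants
  of matrices, and carried over by \<open>vec_of_complex\<close> and \<open>pair_of_vec\<close>;
  \<open>Im (cnj (p x) * q x)\<close> is the determinant with columns p and q. If \<open>W\<close>
  has infinite measure, the Jacobian fails to be integrable and both sides are infinite. The
  derivative is taken within \<open>S\<close> because the later parameter domain is bounded by a
  function known only to be measurable.\<close>

lemma emeasure_differentiable_image_complex: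
  fixes \<Phi> :: "real \<times> real \<Rightarrow> complex"
  assumes S [measurable]: "S \<in> sets borel" and W [measurable]: "W \<in> sets borel"
    and der: "\<And>x. x \<in> S \<Longrightarrow> (\<Phi> has_derivative (\<lambda>h. fst h *\<^sub>R p x + snd h *\<^sub>R q x)) (at x within S)"
    and inj: "inj_on \<Phi> S"
    and sub: "\<Phi> ` S \<subseteq> W" and neg: "negligible (W - \<Phi> ` S)"
    and [measurable]: "(\<lambda>x. indicator S x * \<bar>Im (cnj (p x) * q x)\<bar>) \<in> borel_measurable borel"
  shows "emeasure lborel W = (\<integral>\<^sup>+x. ennreal (indicator S x * \<bar>Im (cnj (p x) * q x)\<bar>) \<partial>lborel)"
proof -
  define S' where "S' = pair_of_vec -` S"
  define W' where "W' = complex_of_vec -` W"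
  define g where "g = vec_of_complex \<circ> \<Phi> \<circ> pair_of_vec"
  define g' where "g' v = (\<lambda>h. vec_of_complex (fst (pair_of_vec h) *\<^sub>R p (pair_of_vec v) + snd (pair_of_vec h) *\<^sub>R q (pair_of_vec v)))" for v
  define J where "J x = indicator S x * \<bar>Im (cnj (p x) * q x)\<bar>" for x
  have [measurable]: "J \<in> borel_measurable borel" unfolding J_def by measurable
  have S' [measurable]: "S' \<in> sets borel" unfolding S'_def using measurable_sets[OF pair_of_vec_measurable S] by simp
  have W' [measurable]: "W' \<in> sets borel" unfolding W'_def using measurable_sets[OF complex_of_vec_measurable W] by simp
  have derg: "(g has_derivative g' v) (at v within S')" if "v \<in> S'" for v
  proof -
    have 1: "(\<Phi> has_derivative (\<lambda>h. fst h *\<^sub>R p (pair_of_vec v) + snd h *\<^sub>R q (pair_of_vec v))) (at (pair_of_vec v) within pair_of_vec ` S')"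
      by (rule has_derivative_subset[OF der]) (use that in \<open>auto simp: S'_def\<close>)
    have 2: "(pair_of_vec has_derivative pair_of_vec) (at v within S')"
      by (rule linear_imp_has_derivative[OF linear_pair_of_vec])
    have 3: "((\<Phi> \<circ> pair_of_vec) has_derivative ((\<lambda>h. fst h *\<^sub>R p (pair_of_vec v) + snd h *\<^sub>R q (pair_of_vec v)) \<circ> pair_of_vec)) (at v within S')"
      by (rule diff_chain_within[OF 2 1])
    have 4: "(vec_of_complex has_derivative vec_of_complex) (at x within A)" for x A
      by (rule linear_imp_has_derivative[OF linear_vec_of_complex])
    show ?thesis
      using diff_chain_within[OF 3 4] by (simp add: g_def g'_def o_def)
  qed
  have injv: "inj vec_of_complex" by (metis complex_of_vec_of_complex injI)
  have injp: "inj pair_of_vec" by (auto simp: inj_on_def pair_of_vec_def vec_eq_iff forall_2)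
  have injg: "inj_on g S'"
    unfolding g_def
    by (rule inj_onI) (use inj injv injp in \<open>auto simp: S'_def inj_on_def\<close>)
  have det: "\<bar>det (matrix (g' v))\<bar> = \<bar>Im (cnj (p (pair_of_vec v)) * q (pair_of_vec v))\<bar>" for v
    by (simp add: det_2 matrix_def g'_def vec_of_complex_def pair_of_vec_def axis_def mult.commute)
  have eqimg: "g ` S' = vec_of_complex ` \<Phi> ` S"
  proof -
    have "pair_of_vec ` S' = S"
    proof safe
      fix a b assume "(a,b) \<in> S"
      then show "(a,b) \<in> pair_of_vec ` S'"
        by (intro image_eqI[of _ _ "vector [a,b]"]) (auto simp: S'_def pair_of_vec_def)
    qed (auto simp: S'_def)
    then show ?thesis by (auto simp: g_def image_comp[symmetric])
  qed
  have Wv: "W' = vec_of_complex ` W"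
    unfolding W'_def by (force simp: image_iff intro: exI[of _ "complex_of_vec _"])
  have diff: "negligible (W' - g ` S')"
  proof -
    have "W' - g ` S' = vec_of_complex ` (W - \<Phi> ` S)"
      unfolding eqimg Wv using injv by (simp add: image_set_diff)
    then show ?thesis using negligible_linear_preimage_vec[OF neg] by simp
  qed
  have subg: "g ` S' \<subseteq> W'" unfolding eqimg Wv using sub by blast
  have "emeasure lborel W = emeasure (distr lborel borel complex_of_vec) W"
    by (simp add: distr_complex_of_vec)
  also have "\<dots> = emeasure lborel W'"
    by (subst emeasure_distr) (auto simp: W'_def)
  finally have e1: "emeasure lborel W = emeasure lborel W'" .
  have "(\<integral>\<^sup>+x. J x \<partial>lborel) = (\<integral>\<^sup>+x. J x \<partial>distr lborel borel pair_of_vec)"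
    by (simp add: distr_pair_of_vec)
  also have "\<dots> = (\<integral>\<^sup>+v. J (pair_of_vec v) \<partial>lborel)"
    by (subst nn_integral_distr) auto
  also have "\<dots> = (\<integral>\<^sup>+v. ennreal (indicator S' v * \<bar>det (matrix (g' v))\<bar>) \<partial>lborel)"
    by (intro nn_integral_cong) (auto simp: J_def det S'_def indicator_def)
  finally have e2: "(\<integral>\<^sup>+x. J x \<partial>lborel) = (\<integral>\<^sup>+v. ennreal (indicator S' v * \<bar>det (matrix (g' v))\<bar>) \<partial>lborel)" .
  have S'l: "S' \<in> sets lebesgue" by simp
  have sym: "negligible (sym_diff (g ` S') W')"
    using diff subg by (simp add: Diff_eq_empty_iff[THEN iffD2])
  have lm: "g ` S' \<in> lmeasurable \<longleftrightarrow> W' \<in> lmeasurable"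
    using sym by (metis lmeasurable_negligible_symdiff sup_commute)
  have meas: "measure lebesgue (g ` S') = measure lebesgue W'" if "W' \<in> lmeasurable"
    using sym that lm by (metis measure_negligible_symdiff)
  have Jm: "(\<lambda>v. indicator S' v * \<bar>det (matrix (g' v))\<bar>) \<in> borel_measurable borel"
  proof -
    have "(\<lambda>v. indicator S' v * \<bar>det (matrix (g' v))\<bar>) = (\<lambda>v. J (pair_of_vec v))"
      by (auto simp: J_def det S'_def indicator_def)
    then show ?thesis by simp
  qed
  have restr: "(\<lambda>v. indicator S' v * \<bar>det (matrix (g' v))\<bar>) = (\<lambda>v. if v \<in> S' then \<bar>det (matrix (g' v))\<bar> else 0)"
    by (auto simp: indicator_def)
  show ?thesis
  proof (cases "W' \<in> lmeasurable")
    case True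
    then have "g ` S' \<in> lmeasurable" using lm by simp
    then have hi: "((\<lambda>v. \<bar>det (matrix (g' v))\<bar>) has_integral measure lebesgue W') S'"
      using has_measure_differentiable_image[OF S'l derg injg] meas[OF True] by blast
    have "((\<lambda>v. indicator S' v * \<bar>det (matrix (g' v))\<bar>) has_integral measure lebesgue W') UNIV"
      unfolding restr has_integral_restrict_UNIV by (rule hi)
    then have "(\<integral>\<^sup>+v. ennreal (indicator S' v * \<bar>det (matrix (g' v))\<bar>) \<partial>lborel) = ennreal (measure lebesgue W')"
      using nn_integral_has_integral_lborel[OF Jm] by simp
    moreover have "ennreal (measure lebesgue W') = emeasure lborel W'"
    proof -
      have "emeasure lebesgue W' = ennreal (measure lebesgue W')"
        using True by (simp add: fmeasurable_def emeasure_eq_ennreal_measure)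
      then show ?thesis by (simp add: emeasure_completion)
    qed
    ultimately show ?thesis unfolding e1 J_def[symmetric] e2 by simp
  next
    case False
    have inf: "emeasure lborel W' = \<infinity>"
      proof -
      have "\<not> emeasure lborel W' < top" using False by (auto simp: fmeasurable_def emeasure_completion)
      then show ?thesis by (metis top.not_eq_extremum infinity_ennreal_def)
    qed
    have "\<not> (\<lambda>v. \<bar>det (matrix (g' v))\<bar>) integrable_on S'"
      using measurable_differentiable_image_eq[OF S'l derg injg] lm False by blast
    then have ni: "\<not> (\<lambda>v. indicator S' v * \<bar>det (matrix (g' v))\<bar>) integrable_on UNIV"
      unfolding restr integrable_restrict_UNIV .
    have "(\<integral>\<^sup>+v. ennreal (indicator S' v * \<bar>det (matrix (g' v))\<bar>) \<partial>lborel) = \<infinity>"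
    proof (rule ccontr)
      assume "\<not> ?thesis"
      then have "integrable lborel (\<lambda>v. indicator S' v * \<bar>det (matrix (g' v))\<bar>)"
        using Jm by (intro integrableI_nonneg) (auto simp: top.not_eq_extremum)
      then show False using ni integrable_on_lborel by blast
    qed
    then show ?thesis unfolding e1 J_def[symmetric] e2 inf by simp
  qed
qed

section \<open>Polar coordinates with arbitrary origin and zero direction\<close>

definition polar_map :: "complex \<Rightarrow> complex \<Rightarrow> real \<times> real \<Rightarrow> complex" where
  "polar_map c b x = c + b * (of_real (fst x) * cis (snd x))"

definition polar_domain :: "(real \<times> real) set" where
  "polar_domain = {0<..} \<times> {-pi<..<pi}"

lemma borel_measurable_fst_real: "(fst :: real \<times> real \<Rightarrow> real) \<in> borel_measurable borel"
  by (intro borel_measurable_continuous_onI continuous_intros)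

lemma polar_domain_borel [measurable]: "polar_domain \<in> sets borel"
  unfolding polar_domain_def by (intro borel_open open_Times) auto

lemma polar_map_measurable [measurable]: "polar_map c b \<in> borel_measurable borel"
  unfolding polar_map_def cis_conv_exp
  by (intro borel_measurable_continuous_onI continuous_intros)

lemma polar_map_inj: "b \<noteq> 0 \<Longrightarrow> inj_on (polar_map c b) polar_domain"
proof (rule inj_onI)
  fix x y assume b: "b \<noteq> 0" and x: "x \<in> polar_domain" and y: "y \<in> polar_domain" and eq: "polar_map c b x = polar_map c b y"
  have e: "of_real (fst x) * cis (snd x) = of_real (fst y) * cis (snd y)"
    using eq b by (simp add: polar_map_def)
  then have "norm (of_real (fst x) * cis (snd x)) = norm (of_real (fst y) * cis (snd y))" by simp
  then have f: "fst x = fst y" using x y by (simp add: norm_mult polar_domain_def mem_Times_iff)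
  have "cis (snd x) = cis (snd y)" using e f x by (simp add: polar_domain_def mem_Times_iff)
  then have "Arg (cis (snd x)) = Arg (cis (snd y))" by simp
  then have "snd x = snd y" using x y
    by (subst (asm) (1 2) cis_Arg_unique[of "cis _", OF _ _ _]) (auto simp: polar_domain_def mem_Times_iff)
  with f show "x = y" by (simp add: prod_eq_iff)
qed

text \<open>Only the centre and the ray of argument pi are missed, and both lie on one line.\<close>

lemma polar_map_image_negligible:
  assumes "b \<noteq> 0"
  shows "negligible (UNIV - polar_map c b ` polar_domain)"
proof -
  have "UNIV - polar_map c b ` polar_domain \<subseteq> (\<lambda>s::real. c - b * of_real s) ` UNIV"
  proof
    fix z assume z: "z \<in> UNIV - polar_map c b ` polar_domain"
    define w where "w = (z - c) / b"
    have zw: "z = c + b * w" using assms by (simp add: w_def)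
    have wr: "w = of_real (norm w) * cis (Arg w)" using rcis_cmod_Arg[of w] by (simp add: rcis_def)
    show "z \<in> range (\<lambda>s::real. c - b * of_real s)"
    proof (cases "w = 0 \<or> Arg w = pi")
      case True
      then have "w = of_real (- norm w)" using wr by (auto simp: cis_pi)
      then have "z = c - b * of_real (norm w)" using zw by (metis mult_minus_right of_real_minus uminus_add_conv_diff add.commute)
      then show ?thesis by blast
    next
      case False
      then have "(norm w, Arg w) \<in> polar_domain" using Arg_bounded[of w] by (auto simp: polar_domain_def)
      moreover have "polar_map c b (norm w, Arg w) = z" using zw wr by (simp add: polar_map_def)
      ultimately show ?thesis using z by blast
    qed
  qed
  moreover have "negligible ((\<lambda>s::real. c - b * of_real s) ` UNIV)"
    by (rule negligible_differentiable_image_lowdim)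
       (auto simp: differentiable_on_def differentiable_def intro!: exI derivative_eq_intros)
  ultimately show ?thesis using negligible_subset by blast
qed

lemma polar_measure:
  assumes b: "norm b = 1"
  shows "distr (density lborel (\<lambda>x. ennreal (indicator polar_domain x * fst x))) borel (polar_map c b) = lborel"
proof (rule measure_eqI)
  note borel_measurable_fst_real [measurable]
  fix B assume "B \<in> sets (distr (density lborel (\<lambda>x. ennreal (indicator polar_domain x * fst x))) borel (polar_map c b))"
  then have B [measurable]: "B \<in> sets borel" by simp
  have b0: "b \<noteq> 0" using b by auto
  define S where "S = polar_domain \<inter> polar_map c b -` B"
  have S [measurable]: "S \<in> sets borel" unfolding S_def
    using measurable_sets[OF polar_map_measurable[of c b] B] by auto
  define p where "p x = b * cis (snd x)" for x :: "real \<times> real"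
  define q where "q x = b * (of_real (fst x) * (\<i> * cis (snd x)))" for x :: "real \<times> real"
  have Jac: "\<bar>Im (cnj (p x) * q x)\<bar> = \<bar>fst x\<bar>" for x
  proof -
    have "cnj (p x) * q x = (cnj b * b) * (cnj (cis (snd x)) * cis (snd x)) * (\<i> * of_real (fst x))"
      by (simp add: p_def q_def)
    also have "\<dots> = \<i> * of_real (fst x)"
      by (simp add: complex_norm_square[symmetric] b mult.commute[of "cnj _"] )
    finally show ?thesis by simp
  qed
  have der: "(polar_map c b has_derivative (\<lambda>h. fst h *\<^sub>R p x + snd h *\<^sub>R q x)) (at x within S)" for x
  proof -
    have 1: "((\<lambda>x. \<i> * complex_of_real (snd x)) has_derivative (\<lambda>h. \<i> * complex_of_real (snd h))) (at x within S)"
      by (auto intro!: derivative_eq_intros)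
    have 2: "((\<lambda>x. cis (snd x)) has_derivative (\<lambda>h. cis (snd x) * (\<i> * complex_of_real (snd h)))) (at x within S)"
      unfolding cis_conv_exp
      by (rule has_derivative_compose[OF 1 DERIV_exp[unfolded has_field_derivative_def]])
    show ?thesis
      unfolding polar_map_def p_def q_def
      by (auto intro!: derivative_eq_intros 2 simp: scaleR_conv_of_real algebra_simps fun_eq_iff)
  qed
  have "emeasure lborel B = (\<integral>\<^sup>+x. ennreal (indicator S x * \<bar>Im (cnj (p x) * q x)\<bar>) \<partial>lborel)"
  proof (rule emeasure_differentiable_image_complex[OF S B der])
    show "inj_on (polar_map c b) S" using polar_map_inj[OF b0] unfolding S_def by (rule inj_on_subset) auto
    show "polar_map c b ` S \<subseteq> B" by (auto simp: S_def)
    show "negligible (B - polar_map c b ` S)"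
      by (rule negligible_subset[OF polar_map_image_negligible[OF b0, of c]]) (auto simp: S_def)
    show "(\<lambda>x. indicator S x * \<bar>Im (cnj (p x) * q x)\<bar>) \<in> borel_measurable borel"
      unfolding Jac by measurable
  qed
  also have "\<dots> = (\<integral>\<^sup>+x. ennreal (indicator polar_domain x * fst x) * indicator (polar_map c b -` B) x \<partial>lborel)"
    unfolding Jac by (intro nn_integral_cong) (auto simp: S_def polar_domain_def indicator_def)
  also have "\<dots> = emeasure (distr (density lborel (\<lambda>x. ennreal (indicator polar_domain x * fst x))) borel (polar_map c b)) B"
    using measurable_sets[OF polar_map_measurable[of c b] B]
    by (subst emeasure_distr) (auto simp: emeasure_density)
  finally show "emeasure (distr (density lborel (\<lambda>x. ennreal (indicator polar_domain x * fst x))) borel (polar_map c b)) B = emeasure lborel B" ..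
qed simp

lemma nn_integral_polar:
  assumes b: "norm b = 1" and [measurable]: "f \<in> borel_measurable borel"
  shows "(\<integral>\<^sup>+z. f z \<partial>lborel) =
    (\<integral>\<^sup>+r. \<integral>\<^sup>+\<phi>. ennreal (indicator {0<..} r * r) * indicator {-pi<..<pi} \<phi> * f (c + b * (of_real r * cis \<phi>)) \<partial>lborel \<partial>lborel)"
proof -
  note borel_measurable_fst_real [measurable]
  have "(\<integral>\<^sup>+z. f z \<partial>lborel) = (\<integral>\<^sup>+z. f z \<partial>distr (density lborel (\<lambda>x. ennreal (indicator polar_domain x * fst x))) borel (polar_map c b))"
    by (simp add: polar_measure[OF b])
  also have "\<dots> = (\<integral>\<^sup>+x. ennreal (indicator polar_domain x * fst x) * f (polar_map c b x) \<partial>lborel)"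
    by (simp add: nn_integral_distr nn_integral_density)
  also have "\<dots> = (\<integral>\<^sup>+x. ennreal (indicator polar_domain x * fst x) * f (polar_map c b x) \<partial>(lborel \<Otimes>\<^sub>M lborel))"
    by (simp add: lborel_prod)
  also have "\<dots> = (\<integral>\<^sup>+r. \<integral>\<^sup>+\<phi>. ennreal (indicator polar_domain (r,\<phi>) * r) * f (polar_map c b (r,\<phi>)) \<partial>lborel \<partial>lborel)"
    by (subst lborel.nn_integral_fst[symmetric]) (auto simp: lborel_prod)
  also have "\<dots> = (\<integral>\<^sup>+r. \<integral>\<^sup>+\<phi>. ennreal (indicator {0<..} r * r) * indicator {-pi<..<pi} \<phi> * f (c + b * (of_real r * cis \<phi>)) \<partial>lborel \<partial>lborel)"
    by (intro nn_integral_cong) (auto simp: polar_domain_def polar_map_def indicator_def)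
  finally show ?thesis .
qed

lemma integral_polar:
  fixes f :: "complex \<Rightarrow> 'a::{banach, second_countable_topology}"
  assumes b: "norm b = 1" and [measurable]: "f \<in> borel_measurable borel"
  shows "integrable lborel f \<longleftrightarrow> integrable lborel (\<lambda>x. (indicator polar_domain x * fst x) *\<^sub>R f (polar_map c b x))" (is ?A)
    and "integral\<^sup>L lborel f = (\<integral>x. (indicator polar_domain x * fst x) *\<^sub>R f (polar_map c b x) \<partial>lborel)" (is ?B)
proof -
  note borel_measurable_fst_real [measurable]
  have pos: "AE x in lborel. 0 \<le> indicator polar_domain x * fst x"
    by (auto simp: polar_domain_def indicator_def)
  show ?A
    by (subst polar_measure[OF b, of c, symmetric], subst integrable_distr_eq, simp, simp)
       (rule integrable_density, auto intro: pos)
  show ?B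
    by (subst (1) polar_measure[OF b, of c, symmetric], subst integral_distr, simp, simp)
       (rule integral_density, auto intro: pos)
qed

section \<open>The Cauchy-Pompeiu formula\<close>

text \<open>In polar coordinates about \<zeta> the area factor r cancels the singularity 1/r, and
  the support of \<open>b\<close> confines r to [0, X + Y]. The bound is uniform in \<zeta>, as the
  later interchange of the area integral with a curve integral requires.\<close>

lemma nn_integral_cauchy_kernel_le:
  fixes b :: "complex \<Rightarrow> complex"
  assumes [measurable]: "b \<in> borel_measurable borel"
    and B: "\<And>z. norm (b z) \<le> B" and supp: "\<And>z. norm z \<ge> X \<Longrightarrow> b z = 0" and \<zeta>: "norm \<zeta> \<le> Y"
    and X: "X \<ge> 0" and Y: "Y \<ge> 0"
  shows "(\<integral>\<^sup>+z. ennreal (norm (b z / (\<zeta> - z))) \<partial>lborel) \<le> ennreal (2 * pi * B * (X + Y))"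
proof -
  have B0: "B \<ge> 0" using B[of 0] norm_ge_zero order_trans by blast
  have "(\<integral>\<^sup>+z. ennreal (norm (b z / (\<zeta> - z))) \<partial>lborel) =
    (\<integral>\<^sup>+r. \<integral>\<^sup>+\<phi>. ennreal (indicator {0<..} r * r) * indicator {-pi<..<pi} \<phi> *
       ennreal (norm (b (\<zeta> + 1 * (of_real r * cis \<phi>)) / (\<zeta> - (\<zeta> + 1 * (of_real r * cis \<phi>))))) \<partial>lborel \<partial>lborel)"
    by (rule nn_integral_polar) auto
  also have "\<dots> \<le> (\<integral>\<^sup>+r. \<integral>\<^sup>+\<phi>. ennreal B * indicator {0..X+Y} r * indicator {-pi<..<pi} \<phi> \<partial>lborel \<partial>lborel)"
  proof (intro nn_integral_mono)
    fix r \<phi> :: real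
    let ?z = "\<zeta> + 1 * (of_real r * cis \<phi>)"
    show "ennreal (indicator {0<..} r * r) * indicator {-pi<..<pi} \<phi> * ennreal (norm (b ?z / (\<zeta> - ?z)))
      \<le> ennreal B * indicator {0..X+Y} r * indicator {-pi<..<pi} \<phi>"
    proof (cases "r > 0")
      case r: True
      have eq: "ennreal r * ennreal (norm (b ?z / (\<zeta> - ?z))) = ennreal (norm (b ?z))"
        using r by (subst ennreal_mult'[symmetric]) (auto simp: norm_divide norm_mult)
      have "ennreal (norm (b ?z)) \<le> ennreal B * indicator {0..X+Y} r"
      proof (cases "r \<le> X + Y")
        case True then show ?thesis using r B by (simp add: ennreal_leI)
      next
        case False
        have "norm ?z \<ge> r - norm \<zeta>" using r norm_diff_ineq[of "of_real r * cis \<phi>" \<zeta>] by (simp add: norm_mult add.commute)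
        then have "b ?z = 0" using False \<zeta> by (intro supp) linarith
        then show ?thesis by simp
      qed
      then have "indicator {-pi<..<pi} \<phi> * (ennreal r * ennreal (norm (b ?z / (\<zeta> - ?z)))) \<le> indicator {-pi<..<pi} \<phi> * (ennreal B * indicator {0..X+Y} r)"
        unfolding eq by (intro mult_left_mono) auto
      then show ?thesis using r by (simp add: mult_ac)
    qed simp
  qed
  also have "\<dots> = ennreal B * (\<integral>\<^sup>+r. indicator {0..X+Y} r * (\<integral>\<^sup>+\<phi>. indicator {-pi<..<pi} \<phi> \<partial>lborel) \<partial>(lborel :: real measure))"
    by (simp add: nn_integral_cmult mult.assoc)
  also have "\<dots> = ennreal B * (ennreal (2*pi) * ennreal (X+Y))"
    using X Y by (simp add: nn_integral_cmult_indicator mult.commute[of "indicator _ _"])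
  also have "\<dots> = ennreal (2 * pi * B * (X + Y))"
  proof -
    have "2 * pi * B * (X + Y) = B * (2 * pi * (X + Y))" by simp
    then show ?thesis using X Y B0 by (simp only: ennreal_mult) (simp add: ennreal_mult del: ennreal_plus)
  qed
  finally show ?thesis .
qed

lemma bounded_of_compact_support:
  fixes b :: "complex \<Rightarrow> complex"
  assumes "continuous_on UNIV b" and "\<And>z. norm z \<ge> X \<Longrightarrow> b z = 0"
  shows "\<exists>B. \<forall>z. norm (b z) \<le> B"
proof -
  have "compact (b ` cball 0 X)"
    by (intro compact_continuous_image continuous_on_subset[OF assms(1)]) auto
  then obtain B where B: "\<And>y. y \<in> b ` cball 0 X \<Longrightarrow> norm y \<le> B"
    using compact_imp_bounded bounded_iff by metis
  have "norm (b z) \<le> max B 0" for z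
    using B[of "b z"] assms(2)[of z] by (cases "norm z \<le> X") (auto simp: le_max_iff_disj)
  then show ?thesis by blast
qed

text \<open>\<open>a\<close> and \<open>b\<close> are the Wirtinger derivatives \<open>\<partial>g/\<partial>z\<close> and \<open>\<partial>g/\<partial>cnj z\<close>.\<close>

definition wirtinger :: "(complex \<Rightarrow> complex) \<Rightarrow> (complex \<Rightarrow> complex) \<Rightarrow> (complex \<Rightarrow> complex) \<Rightarrow> bool" where
  "wirtinger g a b \<longleftrightarrow> (\<forall>z. (g has_derivative (\<lambda>h. a z * h + b z * cnj h)) (at z)) \<and> continuous_on UNIV a \<and> continuous_on UNIV b"

lemma wirtingerD:
  assumes "wirtinger g a b"
  shows "(g has_derivative (\<lambda>h. a z * h + b z * cnj h)) (at z)" "continuous_on UNIV a" "continuous_on UNIV b" "continuous_on A g"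
  using assms unfolding wirtinger_def
  by (auto intro!: continuous_at_imp_continuous_on intro: has_derivative_continuous)

text \<open>In polar coordinates about \<zeta> the integrand becomes \<open>H\<close>, which is -1/2
  times \<open>F1 + F2\<close>. Here \<open>F1\<close> is the radial derivative of g and
  \<open>F2\<close> is the angular derivative up to the factor -i r. The radial part contributes - g
  \<zeta> for each direction, the angular part nothing because g returns to its value after a full
  turn.\<close>

lemma cauchy_pompeiu:
  fixes g a b :: "complex \<Rightarrow> complex"
  assumes W: "wirtinger g a b"
    and supp: "\<And>z. norm z \<ge> X \<Longrightarrow> g z = 0" "\<And>z. norm z \<ge> X \<Longrightarrow> b z = 0" and X: "X \<ge> 0"
  shows "integrable lborel (\<lambda>z. b z / (\<zeta> - z))" "(\<integral>z. b z / (\<zeta> - z) \<partial>lborel) = pi * g \<zeta>"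
proof -
  note der = wirtingerD(1)[OF W] and ca = wirtingerD(2)[OF W] and cb = wirtingerD(3)[OF W]
  have [measurable]: "b \<in> borel_measurable borel" using cb by (rule borel_measurable_continuous_onI)
  obtain B where B: "\<And>z. norm (b z) \<le> B" using bounded_of_compact_support[OF cb supp(2)] by blast
  show int: "integrable lborel (\<lambda>z. b z / (\<zeta> - z))"
  proof (rule integrableI_bounded)
    show "(\<integral>\<^sup>+z. ennreal (norm (b z / (\<zeta> - z))) \<partial>lborel) < \<infinity>"
      using nn_integral_cauchy_kernel_le[of b B X \<zeta> "norm \<zeta>", OF _ B supp(2)] X
      by (simp add: order_le_less_trans[OF _ ennreal_less_top])
  qed simp
  define R where "R = X + norm \<zeta> + 1"
  have R: "R > 0" using X by (simp add: R_def add_nonneg_pos)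
  define pt where "pt x = \<zeta> + of_real (fst x) * cis (snd x)" for x :: "real \<times> real"
  have far: "norm (pt x) \<ge> X" if "fst x \<ge> R" for x
  proof -
    have "norm (pt x) \<ge> fst x - norm \<zeta>" using that R norm_diff_ineq[of "of_real (fst x) * cis (snd x)" \<zeta>]
      by (simp add: norm_mult add.commute pt_def)
    then show ?thesis using that by (simp add: R_def)
  qed
  define H where "H x = - (b (pt x) * cis (- snd x))" for x
  define F1 where "F1 x = a (pt x) * cis (snd x) + b (pt x) * cis (- snd x)" for x
  define F2 where "F2 x = - a (pt x) * cis (snd x) + b (pt x) * cis (- snd x)" for x
  have cpt: "continuous_on A pt" for A unfolding pt_def cis_conv_exp by (intro continuous_intros)
  have ccis: "continuous_on A (\<lambda>x::real\<times>real. cis (snd x))" "continuous_on A (\<lambda>x::real\<times>real. cis (- snd x))" for A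
    unfolding cis_conv_exp by (intro continuous_intros)+
  have capt: "continuous_on A (\<lambda>x. a (pt x))" "continuous_on A (\<lambda>x. b (pt x))" for A
    by (rule continuous_on_compose2[OF ca cpt] continuous_on_compose2[OF cb cpt]; simp)+
  have cF1: "continuous_on A F1" and cF2: "continuous_on A F2" and cH: "continuous_on A H" for A
    unfolding F1_def F2_def H_def by (intro continuous_intros ccis capt)+
  have HF: "H x = (-1/2) * (F1 x + F2 x)" for x by (simp add: H_def F1_def F2_def field_simps)
  have eqF: "(indicator polar_domain x * fst x) *\<^sub>R (b (polar_map \<zeta> 1 x) / (\<zeta> - polar_map \<zeta> 1 x))
     = indicator (box (0,-pi) (R,pi)) x *\<^sub>R H x" for x
  proof (cases "x \<in> polar_domain")
    case True
    then have x: "fst x > 0" "-pi < snd x" "snd x < pi" by (auto simp: polar_domain_def)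
    have e: "cis (- snd x) = 1 / cis (snd x)" by (metis cis_inverse inverse_eq_divide)
    have gen: "complex_of_real r * (\<beta> / (\<zeta> - (\<zeta> + 1 * (complex_of_real r * c)))) = - (\<beta> * (1 / c))" if "r \<noteq> 0" "c \<noteq> 0" for r \<beta> c
      using that by (simp add: divide_simps)
    have L: "(indicator polar_domain x * fst x) *\<^sub>R (b (polar_map \<zeta> 1 x) / (\<zeta> - polar_map \<zeta> 1 x)) = H x"
      using x True gen[of "fst x" "cis (snd x)" "b (pt x)"] by (simp only: polar_map_def H_def pt_def e scaleR_conv_of_real indicator_eq_1_iff mult_1_left) (simp add: pt_def)
    show ?thesis
    proof (cases "fst x < R")
      case True
      then have "x \<in> box (0,-pi) (R,pi)" using x by (cases x) (auto simp: box_def Basis_prod_def)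
      then show ?thesis using L by simp
    next
      case False
      then have "H x = 0" using far[of x] supp(2) by (simp add: H_def)
      then show ?thesis using L by simp
    qed
  next
    case False
    then have "x \<notin> box (0,-pi) (R,pi)" by (cases x) (auto simp: box_def Basis_prod_def polar_domain_def)
    then show ?thesis using False by simp
  qed
  have inn1: "integral (cbox 0 R) (\<lambda>r. F1 (r, \<phi>)) = - g \<zeta>" for \<phi>
  proof -
    have "((\<lambda>r. g (pt (r,\<phi>))) has_vector_derivative F1 (r,\<phi>)) (at r within {0..R})" for r
    proof -
      have 1: "((\<lambda>r. pt (r,\<phi>)) has_derivative (\<lambda>h. of_real h * cis \<phi>)) (at r within {0..R})"
        unfolding pt_def by (auto intro!: derivative_eq_intros)
      show ?thesis
        unfolding has_vector_derivative_def F1_def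
        using has_derivative_compose[OF 1 der[of "pt (r,\<phi>)"]]
        by (simp add: scaleR_conv_of_real algebra_simps cis_cnj)
    qed
    then have "((\<lambda>r. F1 (r, \<phi>)) has_integral (g (pt (R,\<phi>)) - g (pt (0,\<phi>)))) {0..R}"
      using R by (intro fundamental_theorem_of_calculus) auto
    moreover have "g (pt (R,\<phi>)) = 0" using far[of "(R,\<phi>)"] supp(1) by simp
    moreover have "g (pt (0,\<phi>)) = g \<zeta>" by (simp add: pt_def)
    ultimately show ?thesis by (auto simp: integral_unique)
  qed
  have inn2: "integral (cbox (-pi) pi) (\<lambda>\<phi>. F2 (r, \<phi>)) = 0" if r: "r > 0" for r
  proof -
    have "((\<lambda>\<phi>. g (pt (r,\<phi>))) has_vector_derivative (- \<i> * of_real r) * F2 (r,\<phi>)) (at \<phi> within {-pi..pi})" for \<phi>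
    proof -
      have c: "(cis has_derivative (\<lambda>h. of_real h * (\<i> * cis \<phi>))) (at \<phi> within {-pi..pi})"
      proof -
        have 1: "((\<lambda>x. \<i> * complex_of_real x) has_derivative (\<lambda>h. \<i> * complex_of_real h)) (at \<phi> within {-pi..pi})"
          by (auto intro!: derivative_eq_intros)
        have "((\<lambda>x. cis x) has_derivative (\<lambda>h. cis \<phi> * (\<i> * complex_of_real h))) (at \<phi> within {-pi..pi})"
          unfolding cis_conv_exp
          by (rule has_derivative_compose[OF 1 DERIV_exp[unfolded has_field_derivative_def]])
        then show ?thesis by (simp add: mult_ac)
      qed
      have 1: "((\<lambda>\<phi>. pt (r,\<phi>)) has_derivative (\<lambda>h. of_real r * (of_real h * (\<i> * cis \<phi>)))) (at \<phi> within {-pi..pi})"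
        unfolding pt_def by (auto intro!: derivative_eq_intros c simp: scaleR_conv_of_real fun_eq_iff)
      show ?thesis
        unfolding has_vector_derivative_def F2_def
        using has_derivative_compose[OF 1 der[of "pt (r,\<phi>)"]]
        by (simp add: scaleR_conv_of_real algebra_simps cis_cnj fun_eq_iff)
    qed
    then have "((\<lambda>\<phi>. (- \<i> * of_real r) * F2 (r, \<phi>)) has_integral (g (pt (r,pi)) - g (pt (r,-pi)))) {-pi..pi}"
      using R by (intro fundamental_theorem_of_calculus) auto
    moreover have "pt (r,pi) = pt (r,-pi)" by (simp add: pt_def cis.ctr)
    ultimately have "((\<lambda>\<phi>. (- \<i> * of_real r) * F2 (r, \<phi>)) has_integral 0) {-pi..pi}" by simp
    then have "((\<lambda>\<phi>. (\<i> / of_real r) * ((- \<i> * of_real r) * F2 (r, \<phi>))) has_integral (\<i> / of_real r) * 0) {-pi..pi}"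
      by (rule has_integral_mult_right)
    then show ?thesis using r by (simp add: integral_unique)
  qed
  have I1: "integral (cbox (0,-pi) (R,pi)) F1 = - (2 * pi) * g \<zeta>"
  proof -
    have "integral (cbox (0,-pi) (R,pi)) F1 = integral (cbox 0 R) (\<lambda>r. integral (cbox (-pi) pi) (\<lambda>\<phi>. F1 (r,\<phi>)))"
      by (rule integral_prod_continuous[OF cF1])
    also have "\<dots> = integral (cbox (-pi) pi) (\<lambda>\<phi>. integral (cbox 0 R) (\<lambda>r. F1 (r,\<phi>)))"
      by (rule integral_swap_continuous) (use cF1 in \<open>simp add: case_prod_eta\<close>)
    also have "\<dots> = - (2 * pi) * g \<zeta>"
      unfolding inn1 using pi_gt_zero by (simp add: scaleR_conv_of_real)
    finally show ?thesis .
  qed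
  have I2: "integral (cbox (0,-pi) (R,pi)) F2 = 0"
  proof -
    have "integral (cbox (0,-pi) (R,pi)) F2 = integral (cbox 0 R) (\<lambda>r. integral (cbox (-pi) pi) (\<lambda>\<phi>. F2 (r,\<phi>)))"
      by (rule integral_prod_continuous[OF cF2])
    \<comment> \<open>At r = 0 the angular derivative vanishes and says nothing about
      \<open>F2\<close>; this single radius is dropped.\<close>
    also have "\<dots> = integral (cbox 0 R) (\<lambda>r. 0)"
      by (rule integral_spike[of "{0}"]) (use inn2 in \<open>auto simp: less_le\<close>)
    finally show ?thesis by simp
  qed
  have "(\<integral>z. b z / (\<zeta> - z) \<partial>lborel) = (\<integral>x. indicator (box (0,-pi) (R,pi)) x *\<^sub>R H x \<partial>lborel)"
    by (subst integral_polar(2)[of 1 _ \<zeta>]) (simp_all only: eqF norm_one, measurable)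
  also have "\<dots> = integral (box (0,-pi) (R,pi)) H"
  proof -
    have "set_integrable lborel (cbox (0,-pi) (R,pi)) H"
      unfolding set_integrable_def by (rule borel_integrable_compact) (auto intro: cH)
    then have "set_integrable lborel (box (0,-pi) (R,pi)) H"
      by (rule set_integrable_subset) (auto simp: box_subset_cbox)
    from set_borel_integral_eq_integral(2)[OF this] show ?thesis by (simp add: set_lebesgue_integral_def)
  qed
  also have "\<dots> = integral (cbox (0,-pi) (R,pi)) (\<lambda>x. (-1/2) * (F1 x + F2 x))"
    unfolding HF integral_open_interval ..
  also have "\<dots> = (-1/2) * (integral (cbox (0,-pi) (R,pi)) F1 + integral (cbox (0,-pi) (R,pi)) F2)"
    by (simp add: integral_add integrable_continuous cF1 cF2 integral_mult_right)
  also have "\<dots> = pi * g \<zeta>" by (simp add: I1 I2)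
  finally show "(\<integral>z. b z / (\<zeta> - z) \<partial>lborel) = pi * g \<zeta>" .
qed

text \<open>The Cauchy-Pompeiu formula integrated along the curve, with the two integrals
  interchanged. Off the curve the inner integral is 2 pi i times the winding number, which is how
  the domain enters Green's formula.\<close>

lemma integral_winding_kernel:
  fixes \<gamma> vel :: "real \<Rightarrow> complex" and g a b :: "complex \<Rightarrow> complex"
  assumes cg: "continuous_on UNIV \<gamma>" and cd: "continuous_on UNIV vel"
    and W: "wirtinger g a b"
    and supp: "\<And>z. norm z \<ge> X \<Longrightarrow> g z = 0" "\<And>z. norm z \<ge> X \<Longrightarrow> b z = 0" and X: "X \<ge> 0"
  shows "(\<lambda>z. b z * (\<integral>t. indicator {0..1} t *\<^sub>R (vel t / (\<gamma> t - z)) \<partial>lborel)) \<in> borel_measurable borel" (is "?w \<in> _")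
    and "(\<integral>z. b z * (\<integral>t. indicator {0..1} t *\<^sub>R (vel t / (\<gamma> t - z)) \<partial>lborel) \<partial>lborel)
      = pi * integral {0..1} (\<lambda>t. g (\<gamma> t) * vel t)" (is "?I = _")
proof -
  note cb = wirtingerD(3)[OF W] and cgg = wirtingerD(4)[OF W]
  have [measurable]: "b \<in> borel_measurable borel" "\<gamma> \<in> borel_measurable borel" "vel \<in> borel_measurable borel"
    using cb cg cd by (auto intro: borel_measurable_continuous_onI)
  obtain B where B: "\<And>z. norm (b z) \<le> B" using bounded_of_compact_support[OF cb supp(2)] by blast
  have "bounded (\<gamma> ` {0..1})" "bounded (vel ` {0..1})"
    by (intro compact_imp_bounded compact_continuous_image continuous_on_subset[OF cg] continuous_on_subset[OF cd]; simp)+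
  then obtain Y0 Z0 where YZ0: "\<And>t. t \<in> {0..1} \<Longrightarrow> norm (\<gamma> t) \<le> Y0" "\<And>t. t \<in> {0..1} \<Longrightarrow> norm (vel t) \<le> Z0"
    by (metis bounded_iff image_eqI)
  define Y where "Y = \<bar>Y0\<bar>" define Z where "Z = \<bar>Z0\<bar>"
  have YZ: "\<And>t. t \<in> {0..1} \<Longrightarrow> norm (\<gamma> t) \<le> Y" "\<And>t. t \<in> {0..1} \<Longrightarrow> norm (vel t) \<le> Z" "Y \<ge> 0" "Z \<ge> 0"
    using YZ0 unfolding Y_def Z_def by force+
  define F where "F = (\<lambda>x::real\<times>complex. indicator {0..1} (fst x) *\<^sub>R (vel (fst x) * (b (snd x) / (\<gamma> (fst x) - snd x))))"
  have [measurable]: "F \<in> borel_measurable (lborel \<Otimes>\<^sub>M lborel)" unfolding F_def by measurable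
  show "?w \<in> borel_measurable borel"
    by measurable
  have "integrable (lborel \<Otimes>\<^sub>M lborel) F"
  proof (rule integrableI_bounded)
    have "(\<integral>\<^sup>+x. ennreal (norm (F x)) \<partial>(lborel \<Otimes>\<^sub>M lborel)) = (\<integral>\<^sup>+t. \<integral>\<^sup>+z. ennreal (norm (F (t,z))) \<partial>lborel \<partial>lborel)"
      by (subst lborel.nn_integral_fst[symmetric]) auto
    also have "\<dots> \<le> (\<integral>\<^sup>+t. indicator {0..1::real} t * (ennreal Z * ennreal (2 * pi * B * (X + Y))) \<partial>lborel)"
    proof (intro nn_integral_mono)
      fix t :: real
      show "(\<integral>\<^sup>+z. ennreal (norm (F (t,z))) \<partial>lborel) \<le> indicator {0..1::real} t * (ennreal Z * ennreal (2 * pi * B * (X + Y)))"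
      proof (cases "t \<in> {0..1}")
        case True
        have "(\<integral>\<^sup>+z. ennreal (norm (F (t,z))) \<partial>lborel) = (\<integral>\<^sup>+z. ennreal (norm (vel t)) * ennreal (norm (b z / (\<gamma> t - z))) \<partial>lborel)"
          using True by (intro nn_integral_cong) (simp add: F_def norm_mult norm_divide ennreal_mult'[symmetric])
        also have "\<dots> = ennreal (norm (vel t)) * (\<integral>\<^sup>+z. ennreal (norm (b z / (\<gamma> t - z))) \<partial>lborel)"
          by (rule nn_integral_cmult) simp
        also have "\<dots> \<le> ennreal Z * ennreal (2 * pi * B * (X + Y))"
          using nn_integral_cauchy_kernel_le[of b B X "\<gamma> t" Y, OF _ B supp(2)] X YZ True
          by (intro mult_mono ennreal_leI) auto
        finally show ?thesis using True by simp
      qed (simp add: F_def)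
    qed
    also have "\<dots> < \<infinity>"
      by (subst nn_integral_multc) (auto simp: ennreal_mult_less_top)
    finally show "(\<integral>\<^sup>+x. ennreal (norm (F x)) \<partial>(lborel \<Otimes>\<^sub>M lborel)) < \<infinity>" .
  qed simp
  then have int: "integrable (lborel \<Otimes>\<^sub>M lborel) (case_prod (\<lambda>t z. F (t,z)))" by simp
  have "?I = (\<integral>z. (\<integral>t. F (t,z) \<partial>lborel) \<partial>lborel)"
    by (intro Bochner_Integration.integral_cong refl, subst integral_mult_right_zero[symmetric])
       (auto intro!: Bochner_Integration.integral_cong simp: F_def scaleR_conv_of_real)
  also have "\<dots> = (\<integral>t. (\<integral>z. F (t,z) \<partial>lborel) \<partial>lborel)"
    by (rule lborel_pair.Fubini_integral[OF int])
  also have "\<dots> = (\<integral>t. indicator {0..1} t *\<^sub>R (pi * (g (\<gamma> t) * vel t)) \<partial>lborel)"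
  proof (intro Bochner_Integration.integral_cong refl)
    fix t :: real
    have "(\<integral>z. F (t,z) \<partial>lborel) = indicator {0..1} t *\<^sub>R (vel t * (\<integral>z. b z / (\<gamma> t - z) \<partial>lborel))"
      by (simp add: F_def del: times_divide_eq_right)
    also have "\<dots> = indicator {0..1} t *\<^sub>R (pi * (g (\<gamma> t) * vel t))"
      by (subst cauchy_pompeiu(2)[OF W supp X]) (auto simp: algebra_simps)
    finally show "(\<integral>z. F (t,z) \<partial>lborel) = indicator {0..1} t *\<^sub>R (pi * (g (\<gamma> t) * vel t))" .
  qed
  also have "\<dots> = integral {0..1} (\<lambda>t. pi * (g (\<gamma> t) * vel t))"
  proof -
    have "set_integrable lborel {0..1} (\<lambda>t. pi * (g (\<gamma> t) * vel t))"
      by (intro borel_integrable_atLeastAtMost' continuous_intros continuous_on_compose2[OF cgg[of UNIV]] continuous_on_subset[OF cg] continuous_on_subset[OF cd]) auto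
    from set_borel_integral_eq_integral(2)[OF this] show ?thesis unfolding set_lebesgue_integral_def .
  qed
  also have "\<dots> = pi * integral {0..1} (\<lambda>t. g (\<gamma> t) * vel t)" by simp
  finally show "?I = pi * integral {0..1} (\<lambda>t. g (\<gamma> t) * vel t)" .
qed

section \<open>Chord angles of a closed curve\<close>

lemma cis_eq_cis_iff: "cis x = cis y \<longleftrightarrow> (\<exists>n::int. x = y + 2 * pi * n)"
proof -
  have "cis x = cis y \<longleftrightarrow> sin x = sin y \<and> cos x = cos y" by (auto simp: complex_eq_iff)
  then show ?thesis using sin_cos_eq_iff[of x y] by (simp add: mult.commute)
qed

text \<open>Distinct values with the same \<open>cis\<close> are at least 2 pi apart, so the range
  is discrete. All comparisons of angle lifts rest on this.\<close>

lemma constant_on_if_cis_constant: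
  fixes f :: "'a::topological_space \<Rightarrow> real"
  assumes "connected S" "continuous_on S f" and c: "\<And>x. x \<in> S \<Longrightarrow> cis (f x) = c"
  shows "f constant_on S"
proof (rule continuous_discrete_range_constant[OF assms(1,2)])
  fix x assume x: "x \<in> S"
  have "2 * pi \<le> norm (f y - f x)" if y: "y \<in> S" "f y \<noteq> f x" for y
  proof -
    obtain n :: int where n: "f y = f x + 2 * pi * n" using c[OF x] c[OF y(1)] cis_eq_cis_iff by metis
    then have "n \<noteq> 0" using y by auto
    then have "\<bar>real_of_int n\<bar> \<ge> 1" by linarith
    then have "2 * pi * 1 \<le> 2 * pi * \<bar>real_of_int n\<bar>" by (intro mult_left_mono) auto
    then show ?thesis using n by (simp add: abs_mult)
  qed
  then show "\<exists>e>0. \<forall>y. y \<in> S \<and> f y \<noteq> f x \<longrightarrow> e \<le> norm (f y - f x)"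
    by (intro exI[of _ "2*pi"]) auto
qed

text \<open>Near x the quotient f y / f x is close to 1 and avoids the branch cut, so the increment
  of \<alpha> is the imaginary part of its principal logarithm.\<close>

lemma continuous_argument_has_derivative:
  fixes f :: "real \<Rightarrow> complex" and \<alpha> :: "real \<Rightarrow> real"
  assumes f: "(f has_vector_derivative f') (at x)" and fx: "f x \<noteq> 0" and \<alpha>: "isCont \<alpha> x"
    and ev: "\<forall>\<^sub>F y in nhds x. sgn (f y) = cis (\<alpha> y)"
  shows "(\<alpha> has_real_derivative Im (f' / f x)) (at x)"
proof -
  define h where "h y = \<alpha> x + Im (Ln (f y / f x))" for y
  have "((\<lambda>y. f y / f x) has_vector_derivative f' / f x) (at x)"
    using has_vector_derivative_divide[OF f] by simp
  moreover have "(Ln has_field_derivative inverse (f x / f x)) (at (f x / f x))"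
    using fx by (intro has_field_derivative_Ln) auto
  ultimately have "((Ln \<circ> (\<lambda>y. f y / f x)) has_vector_derivative (f' / f x) * inverse (f x / f x)) (at x)"
    by (intro field_vector_diff_chain_at)
  then have "((\<lambda>y. Ln (f y / f x)) has_vector_derivative f' / f x) (at x)"
    using fx by (simp add: o_def)
  then have "((\<lambda>y. Im (Ln (f y / f x))) has_vector_derivative Im (f' / f x)) (at x)"
    by (rule bounded_linear.has_vector_derivative[OF bounded_linear_Im])
  then have h: "(h has_real_derivative Im (f' / f x)) (at x)"
    unfolding h_def has_real_derivative_iff_has_vector_derivative
    using has_vector_derivative_add[OF has_vector_derivative_const] by fastforce
  have sx: "sgn (f x) = cis (\<alpha> x)" using ev by (rule eventually_nhds_x_imp_x)
  have "\<forall>\<^sub>F y in nhds x. dist (\<alpha> y) (\<alpha> x) < pi"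
    using \<alpha> tendstoD[of \<alpha> "\<alpha> x" "nhds x" pi] by (simp add: isCont_def tendsto_at_iff_tendsto_nhds)
  with ev have "\<forall>\<^sub>F y in nhds x. h y = \<alpha> y"
  proof eventually_elim
    case (elim y)
    have fy: "f y \<noteq> 0" using elim(1) by auto
    have "sgn (f y / f x) = cis (\<alpha> y - \<alpha> x)"
      using elim(1) sx by (simp add: sgn_divide cis_divide)
    then have "Arg (f y / f x) = \<alpha> y - \<alpha> x"
      using elim(2) by (intro cis_Arg_unique) (auto simp: dist_real_def)
    then show ?case using fx fy by (simp add: h_def Arg_eq_Im_Ln)
  qed
  then show ?thesis using h by (subst DERIV_cong_ev[OF refl _ refl, symmetric]) auto
qed

lemma has_vector_derivative_cis:
  assumes "(f has_real_derivative f') (at t)"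
  shows "((\<lambda>t. cis (f t)) has_vector_derivative f' *\<^sub>R (\<i> * cis (f t))) (at t)"
proof -
  have "(f has_vector_derivative f') (at t)"
    using assms by (simp add: has_real_derivative_iff_has_vector_derivative)
  from bounded_linear.has_vector_derivative[OF bounded_linear_of_real this]
  have 1: "((\<lambda>t. \<i> * complex_of_real (f t)) has_vector_derivative \<i> * of_real f') (at t)"
    by (rule has_vector_derivative_mult_right)
  have "(exp \<circ> (\<lambda>t. \<i> * complex_of_real (f t)) has_vector_derivative \<i> * of_real f' * exp (\<i> * complex_of_real (f t))) (at t)"
    by (rule field_vector_diff_chain_at[OF 1 DERIV_exp])
  then show ?thesis by (simp add: o_def cis_conv_exp[symmetric] scaleR_conv_of_real mult_ac)
qed

section \<open>Closed C2 curves, their chords and chord directions\<close>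

locale C2_curve =
  fixes \<gamma> :: "real \<Rightarrow> complex"
  assumes C2: "C2_simple_closed \<gamma>"
begin

definition vel :: "real \<Rightarrow> complex" where "vel t = vector_derivative \<gamma> (at t)"
definition acc :: "real \<Rightarrow> complex" where "acc t = vector_derivative vel (at t)"

lemma vel_eq: "vel = (\<lambda>t. vector_derivative \<gamma> (at t))" by (auto simp: vel_def)

lemma deriv_\<gamma>: "(\<gamma> has_vector_derivative vel t) (at t)"
  using C2 unfolding C2_simple_closed_def C1_differentiable_on_eq vel_def
  by (simp add: vector_derivative_works)

lemma deriv_vel: "(vel has_vector_derivative acc t) (at t)"
  using C2 unfolding C2_simple_closed_def C1_differentiable_on_eq acc_def vel_eq
  by (simp add: vector_derivative_works)

lemma continuous_acc: "continuous_on A acc"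
proof -
  have "continuous_on UNIV (\<lambda>t. vector_derivative vel (at t))"
    using C2 unfolding C2_simple_closed_def C1_differentiable_on_eq vel_eq by simp
  then show ?thesis unfolding acc_def by (rule continuous_on_subset) simp
qed

lemma continuous_\<gamma>: "continuous_on A \<gamma>"
  by (meson continuous_at_imp_continuous_on deriv_\<gamma> has_vector_derivative_continuous)

lemma continuous_vel: "continuous_on A vel"
  by (meson continuous_at_imp_continuous_on deriv_vel has_vector_derivative_continuous)

lemma vel_nz [simp]: "vel t \<noteq> 0"
  using C2 by (simp add: C2_simple_closed_def vel_def)

lemma \<gamma>_measurable [measurable]: "\<gamma> \<in> borel_measurable borel"
  and vel_measurable [measurable]: "vel \<in> borel_measurable borel"
  and acc_measurable [measurable]: "acc \<in> borel_measurable borel"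
  using continuous_\<gamma> continuous_vel continuous_acc by (auto intro: borel_measurable_continuous_onI)

lemma periodic_\<gamma>: "\<gamma> (t + 1) = \<gamma> t" using C2 by (simp add: C2_simple_closed_def)

lemma periodic_deriv:
  fixes f f' :: "real \<Rightarrow> complex"
  assumes "\<And>t. (f has_vector_derivative f' t) (at t)" "\<And>t. f (t + 1) = f t"
  shows "f' (t + 1) = f' t"
proof -
  have "((\<lambda>s. s + 1) has_vector_derivative 1) (at t)" by (auto intro!: derivative_eq_intros)
  from vector_diff_chain_at[OF this assms(1)] have "(f has_vector_derivative f' (t + 1)) (at t)"
    by (simp add: o_def assms(2))
  then show ?thesis using assms(1) vector_derivative_unique_at by blast
qed

lemma periodic_vel: "vel (t + 1) = vel t" by (rule periodic_deriv[OF deriv_\<gamma> periodic_\<gamma>])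
lemma periodic_acc: "acc (t + 1) = acc t" by (rule periodic_deriv[OF deriv_vel periodic_vel])

lemma periodic_int:
  fixes f :: "real \<Rightarrow> 'a" assumes "\<And>t. f (t + 1) = f t" shows "f (t + of_int k) = f t"
proof (induction k rule: int_induct[of _ 0])
  case (step1 i) then show ?case using assms[of "t + of_int i"] by (simp add: algebra_simps)
next
  case (step2 i) then show ?case using assms[of "t + of_int i - 1"] by (simp add: algebra_simps)
qed simp

lemma \<gamma>_frac: "\<gamma> (frac t) = \<gamma> t"
  using periodic_int[of \<gamma> t "- \<lfloor>t\<rfloor>", OF periodic_\<gamma>] by (simp add: frac_def)

lemma \<gamma>_eq_iff: "\<gamma> s = \<gamma> t \<longleftrightarrow> (\<exists>k::int. s = t + k)"
proof
  assume "\<gamma> s = \<gamma> t"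
  then have "\<gamma> (frac s) = \<gamma> (frac t)" by (simp add: \<gamma>_frac)
  moreover have "loop_free \<gamma>" using C2 by (simp add: C2_simple_closed_def simple_path_def)
  ultimately have "frac s = frac t \<or> frac s = 0 \<and> frac t = 1 \<or> frac s = 1 \<and> frac t = 0"
    unfolding loop_free_def using frac_ge_0 frac_lt_1 less_imp_le by (metis atLeastAtMost_iff)
  then have "frac s = frac t" using frac_lt_1[of s] frac_lt_1[of t] by linarith
  then show "\<exists>k::int. s = t + k" by (intro exI[of _ "\<lfloor>s\<rfloor> - \<lfloor>t\<rfloor>"]) (simp add: frac_def algebra_simps)
next
  assume "\<exists>k::int. s = t + k" then show "\<gamma> s = \<gamma> t" using periodic_int[of \<gamma>, OF periodic_\<gamma>] by auto
qed

lemma \<gamma>_neq: "s < t \<Longrightarrow> t < s + 1 \<Longrightarrow> \<gamma> t \<noteq> \<gamma> s"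
proof
  assume "s < t" "t < s + 1" "\<gamma> t = \<gamma> s"
  then obtain k :: int where "t = s + k" "0 < real_of_int k" "real_of_int k < 1" using \<gamma>_eq_iff by force
  then have "0 < k" "k < 1" by simp_all
  then show False by simp
qed

lemma range_\<gamma>: "range \<gamma> = path_image \<gamma>"
proof -
  have "\<gamma> t \<in> \<gamma> ` {0..1}" for t
    using \<gamma>_frac[of t] frac_ge_0[of t] frac_lt_1[of t] by (intro image_eqI[of _ _ "frac t"]) auto
  then show ?thesis by (auto simp: path_image_def)
qed

text \<open>Every ordered pair of curve points has parameters in this set, and both edges lie over
  the diagonal. Unlike the torus of parameters modulo 1, it is convex, so continuous logarithms
  exist on it.\<close>

definition strip :: "(real \<times> real) set" where
  "strip = {p. fst p \<le> snd p \<and> snd p \<le> fst p + 1}"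

lemma strip_iff [simp]: "(s,t) \<in> strip \<longleftrightarrow> s \<le> t \<and> t \<le> s + 1" by (simp add: strip_def)

lemma convex_strip: "convex strip"
proof -
  have "strip = {p :: real \<times> real. inner (1,-1) p \<le> 0} \<inter> {p. inner (-1,1) p \<le> 1}"
    by (auto simp: strip_def inner_prod_def)
  show ?thesis unfolding \<open>strip = _\<close> by (intro convex_Int convex_halfspace_le)
qed

text \<open>The difference quotient of \<gamma>, written as an integral so that it extends
  continuously across the diagonal.\<close>

definition mean_velocity :: "real \<times> real \<Rightarrow> complex" where
  "mean_velocity p = integral {0..1} (\<lambda>\<tau>. vel (fst p + \<tau> * (snd p - fst p)))"

lemma mean_velocity_diag [simp]: "mean_velocity (s,s) = vel s" by (simp add: mean_velocity_def)

lemma mean_velocity: "\<gamma> t - \<gamma> s = (t - s) *\<^sub>R mean_velocity (s,t)"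
proof -
  have "((\<lambda>\<tau>. \<gamma> (s + \<tau> * (t - s))) has_vector_derivative (t - s) *\<^sub>R vel (s + \<tau> * (t - s))) (at \<tau> within {0..1})" for \<tau>
  proof -
    have "((\<lambda>\<tau>. s + \<tau> * (t - s)) has_vector_derivative (t - s)) (at \<tau> within {0..1})"
      by (auto intro!: derivative_eq_intros)
    from vector_diff_chain_within[OF this has_vector_derivative_at_within[OF deriv_\<gamma>]]
    show ?thesis by (simp add: o_def)
  qed
  then have "((\<lambda>\<tau>. (t - s) *\<^sub>R vel (s + \<tau> * (t - s))) has_integral (\<gamma> (s + 1 * (t - s)) - \<gamma> (s + 0 * (t - s)))) {0..1}"
    by (intro fundamental_theorem_of_calculus) auto
  from integral_unique[OF this] show ?thesis by (simp add: mean_velocity_def)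
qed

lemma continuous_mean_velocity: "continuous_on A mean_velocity"
proof -
  have "continuous_on (UNIV \<times> cbox 0 1) (\<lambda>(p::real\<times>real, \<tau>::real). vel (fst p + \<tau> * (snd p - fst p)))"
    unfolding case_prod_beta by (intro continuous_on_compose2[OF continuous_vel[of UNIV]] continuous_intros) auto
  from integral_continuous_on_param[OF this] show ?thesis
    unfolding mean_velocity_def[abs_def] by (auto intro: continuous_on_subset)
qed

text \<open>The chord divided by a positive factor that removes its zeros at both edges of the strip;
  at the edges it is \<open>vel s\<close> and \<open>- vel s\<close>.\<close>

definition chord :: "real \<times> real \<Rightarrow> complex" where
  "chord p = (if snd p - fst p \<le> 1/2 then mean_velocity p / of_real (fst p + 1 - snd p)
     else - mean_velocity (fst p + 1, snd p) / of_real (snd p - fst p))"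

lemma chord_eq:
  assumes "s \<le> t" "t \<le> s + 1" shows "\<gamma> t - \<gamma> s = of_real ((t - s) * (s + 1 - t)) * chord (s,t)"
proof (cases "t - s \<le> 1/2")
  case True
  then have "complex_of_real (s + 1 - t) \<noteq> 0" by (subst of_real_eq_0_iff) simp
  then show ?thesis using mean_velocity[of t s] True
    by (simp add: chord_def scaleR_conv_of_real del: of_real_diff of_real_add)
next
  case False
  then have nz: "complex_of_real (t - s) \<noteq> 0" by (subst of_real_eq_0_iff) auto
  have e: "complex_of_real (t - (s + 1)) = - complex_of_real (s + 1 - t)" by simp
  show ?thesis using mean_velocity[of t "s + 1"] False nz
    by (simp add: e chord_def scaleR_conv_of_real periodic_\<gamma> del: of_real_diff of_real_add)
qed

lemma chord_left [simp]: "chord (s,s) = vel s" by (simp add: chord_def)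
lemma chord_right [simp]: "chord (s,s+1) = - vel s" by (simp add: chord_def periodic_vel)

lemma continuous_chord: "continuous_on strip chord"
  unfolding chord_def
proof (rule continuous_on_cases_le)
  show "continuous_on {p \<in> strip. snd p - fst p \<le> 1/2} (\<lambda>p. mean_velocity p / of_real (fst p + 1 - snd p))"
  proof -
    have "complex_of_real (fst p + 1 - snd p) \<noteq> 0" if "p \<in> {p \<in> strip. snd p - fst p \<le> 1/2}" for p
      using that by (simp only: of_real_eq_0_iff) auto
    then show ?thesis by (intro continuous_on_divide continuous_on_of_real continuous_on_diff continuous_on_add
      continuous_on_fst continuous_on_snd continuous_on_id continuous_on_const continuous_mean_velocity) blast
  qed
  show "continuous_on {p \<in> strip. 1/2 \<le> snd p - fst p} (\<lambda>p. - mean_velocity (fst p + 1, snd p) / of_real (snd p - fst p))"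
  proof -
    have nz: "complex_of_real (snd p - fst p) \<noteq> 0" if "p \<in> {p \<in> strip. 1/2 \<le> snd p - fst p}" for p
      using that by (simp only: of_real_eq_0_iff) auto
    have "continuous_on {p \<in> strip. 1/2 \<le> snd p - fst p} (\<lambda>p. mean_velocity (fst p + 1, snd p))"
      by (rule continuous_on_compose2[OF continuous_mean_velocity[of UNIV]]) (intro continuous_intros, simp)
    then show ?thesis by (intro continuous_on_divide continuous_on_of_real continuous_on_diff continuous_on_minus
      continuous_on_fst continuous_on_snd continuous_on_id) (use nz in blast)+
  qed
  fix p assume p: "p \<in> strip" "snd p - fst p = 1/2"
  obtain s t where st: "p = (s,t)" by (cases p)
  have t: "t = s + 1/2" using p st by simp
  show "mean_velocity p / of_real (fst p + 1 - snd p) = - mean_velocity (fst p + 1, snd p) / of_real (snd p - fst p)"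
  proof -
    have a: "\<gamma> t - \<gamma> s = (1/2) *\<^sub>R mean_velocity (s,t)" using mean_velocity[of t s] t by simp
    have "\<gamma> t - \<gamma> s = (-1/2) *\<^sub>R mean_velocity (s+1,t)" using mean_velocity[of t "s+1"] t by (simp add: periodic_\<gamma>)
    then have "mean_velocity (s+1,t) = (-2) *\<^sub>R (\<gamma> t - \<gamma> s)" by simp
    moreover have "mean_velocity (s,t) = 2 *\<^sub>R (\<gamma> t - \<gamma> s)" using a by simp
    ultimately have c: "mean_velocity (s,t) = - mean_velocity (s+1,t)" by simp
    have f: "fst p + 1 - snd p = 1/2" using p by simp
    show ?thesis unfolding f p(2) unfolding st using c by simp
  qed
qed (intro continuous_intros)

lemma chord_nz: "p \<in> strip \<Longrightarrow> chord p \<noteq> 0"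
proof -
  assume p: "p \<in> strip"
  obtain s t where st: "p = (s,t)" by (cases p)
  consider "t = s" | "t = s + 1" | "s < t" "t < s + 1" using p st by fastforce
  then show ?thesis
  proof cases
    case 3 then show ?thesis using chord_eq[of s t] \<gamma>_neq[of s t] st by auto
  qed (auto simp: st)
qed

lemma sgn_chord: "s < t \<Longrightarrow> t < s + 1 \<Longrightarrow> sgn (chord (s,t)) = sgn (\<gamma> t - \<gamma> s)"
proof -
  assume st: "s < t" "t < s + 1"
  have e: "\<gamma> t - \<gamma> s = of_real ((t - s) * (s + 1 - t)) * chord (s,t)" using chord_eq st by simp
  have "sgn ((t - s) * (s + 1 - t)) = 1" using st by simp
  then show ?thesis unfolding e sgn_mult sgn_of_real by simp
qed

text \<open>Exchanging the end points preserves the removed factor (t - s) (s + 1 - t) and reverses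
  the chord. This sign is the origin of the odd multiple of pi in \<open>rot\<close>.\<close>

lemma chord_swap: assumes "s \<le> t" "t \<le> s + 1" shows "chord (t, s+1) = - chord (s,t)"
proof (cases "s < t \<and> t < s + 1")
  case True
  have f: "(s + 1 - t) * (t + 1 - (s + 1)) = (t - s) * (s + 1 - t)" by (simp add: algebra_simps)
  have "of_real ((t - s) * (s + 1 - t)) * chord (s,t) = \<gamma> t - \<gamma> s" using chord_eq[of s t] True by simp
  moreover have "of_real ((t - s) * (s + 1 - t)) * chord (t,s+1) = \<gamma> s - \<gamma> t"
    using chord_eq[of t "s+1"] True unfolding f periodic_\<gamma> by simp
  ultimately have "of_real ((t - s) * (s + 1 - t)) * (chord (s,t) + chord (t,s+1)) = 0"
    unfolding distrib_left by simp
  moreover have "(t - s) * (s + 1 - t) \<noteq> 0" using True by auto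
  ultimately have "chord (s,t) + chord (t,s+1) = 0" by (simp only: mult_eq_0_iff of_real_eq_0_iff) auto
  then show ?thesis by (simp add: add_eq_0_iff)
next
  case False
  then have "t = s \<or> t = s + 1" using assms by auto
  then show ?thesis by (auto simp: periodic_vel)
qed

definition is_lift :: "(real \<times> real \<Rightarrow> real) \<Rightarrow> bool" where
  "is_lift A \<longleftrightarrow> continuous_on strip A \<and> (\<forall>p\<in>strip. sgn (chord p) = cis (A p))"

definition ang :: "real \<times> real \<Rightarrow> real" where "ang = (SOME A. is_lift A)"

lemma is_lift_ang: "is_lift ang"
proof -
  obtain L where L: "continuous_on strip L" "\<And>p. p \<in> strip \<Longrightarrow> chord p = exp (L p)"
    using continuous_logarithm_on_contractible[OF continuous_chord convex_imp_contractible[OF convex_strip] chord_nz] by blast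
  have "is_lift (\<lambda>p. Im (L p))"
    unfolding is_lift_def using L
    by (auto intro!: continuous_intros simp: exp_eq_polar[of "L _"] sgn_mult sgn_of_real)
  then show ?thesis unfolding ang_def by (rule someI[of is_lift])
qed

lemma continuous_ang: "continuous_on strip ang"
  and cis_ang: "s \<le> t \<Longrightarrow> t \<le> s + 1 \<Longrightarrow> cis (ang (s,t)) = sgn (chord (s,t))"
  using is_lift_ang by (auto simp: is_lift_def)

text \<open>Half of the total rotation of the tangent, since \<open>ang (1,1) - ang (0,0)\<close> is
  twice this number. Hopf's argument reads it off from a chord that turns from the velocity to its
  opposite.\<close>

definition rot :: real where "rot = ang (0,1) - ang (0,0)"

text \<open>The change of \<open>ang\<close> under the swap is continuous on the strip and has
  \<open>cis\<close> equal to -1 everywhere, hence is constant; its value is read off at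
  (0,0).\<close>

lemma ang_swap: assumes "s \<le> t" "t \<le> s + 1" shows "ang (t, s+1) = ang (s,t) + rot"
proof -
  define f where "f p = ang (snd p, fst p + 1) - ang p" for p
  have 1: "continuous_on strip f" unfolding f_def
    by (intro continuous_intros continuous_on_compose2[OF continuous_ang] continuous_ang) (auto simp: strip_def)
  have "cis (f p) = -1" if p: "p \<in> strip" for p
  proof -
    obtain s t where st: "p = (s,t)" by (cases p)
    have "cis (f p) = sgn (chord (t,s+1)) / sgn (chord (s,t))"
      using p by (simp add: f_def st cis_divide[symmetric] cis_ang)
    then show ?thesis using p chord_nz[of "(s,t)"] by (simp add: chord_swap st sgn_minus sgn_zero_iff)
  qed
  from constant_on_if_cis_constant[OF convex_connected[OF convex_strip] 1 this]
  obtain c where c: "\<And>p. p \<in> strip \<Longrightarrow> f p = c" unfolding constant_on_def by blast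
  have "f (0,0) = rot" by (simp add: f_def rot_def)
  then show ?thesis using c[of "(s,t)"] c[of "(0,0)"] assms by (simp add: f_def)
qed

lemma ang_shift: "s \<le> t \<Longrightarrow> t \<le> s + 1 \<Longrightarrow> ang (s+1, t+1) = ang (s,t) + 2 * rot"
  using ang_swap[of s t] ang_swap[of t "s+1"] by simp

lemma cis_rot: "cis rot = -1"
proof -
  have "cis rot = cis (ang (0,1)) / cis (ang (0,0))" by (simp add: rot_def cis_divide)
  then show ?thesis using cis_ang[of 0 1] cis_ang[of 0 0] chord_right[of 0] by (simp add: sgn_minus sgn_zero_iff)
qed

end

section \<open>The uniform measure on one period\<close>

definition U01 :: "real measure" where "U01 = density lborel (indicator {0..1})"

lemma sets_U01 [simp, measurable_cong]: "sets U01 = sets borel"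
  and space_U01 [simp]: "space U01 = UNIV"
  by (auto simp: U01_def)

lemma emeasure_U01_UNIV: "emeasure U01 UNIV = 1"
  by (simp add: U01_def emeasure_density)

interpretation U01: finite_measure U01
  by standard (simp add: emeasure_U01_UNIV)

interpretation U01_pair: pair_sigma_finite U01 U01 ..

interpretation U01_pair: finite_measure "U01 \<Otimes>\<^sub>M U01"
proof
  have "emeasure (U01 \<Otimes>\<^sub>M U01) (UNIV \<times> UNIV) = 1"
    by (subst U01.emeasure_pair_measure_Times) (auto simp: emeasure_U01_UNIV)
  then show "emeasure (U01 \<Otimes>\<^sub>M U01) (space (U01 \<Otimes>\<^sub>M U01)) \<noteq> \<infinity>" by (simp add: space_pair_measure)
qed

lemma integral_U01:
  fixes f :: "real \<Rightarrow> 'a::{banach, second_countable_topology}"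
  assumes [measurable]: "f \<in> borel_measurable borel"
  shows "integral\<^sup>L U01 f = (LINT t:{0..1}|lborel. f t)"
proof -
  have "U01 = density lborel (\<lambda>t. ennreal (indicator {0..1::real} t))"
    unfolding U01_def by (rule density_cong) (auto simp: indicator_def)
  note eq = this
  show ?thesis unfolding set_lebesgue_integral_def eq by (rule integral_density) auto
qed

lemma nn_integral_U01:
  assumes [measurable]: "f \<in> borel_measurable borel"
  shows "integral\<^sup>N U01 f = (\<integral>\<^sup>+t. indicator {0..1} t * f t \<partial>lborel)"
  unfolding U01_def by (subst nn_integral_density) auto

lemma AE_U01: "(AE t in U01. P t) \<longleftrightarrow> (AE t in lborel. t \<in> {0..1} \<longrightarrow> P t)"
  unfolding U01_def by (subst AE_density) (auto simp: indicator_def)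

lemma integrable_U01_bounded:
  fixes f :: "real \<Rightarrow> 'a::{banach, second_countable_topology}"
  assumes "f \<in> borel_measurable borel" "\<And>t. norm (f t) \<le> B"
  shows "integrable U01 f"
  by (rule U01.integrable_const_bound[of _ B]) (use assms in \<open>auto simp: measurable_cong_sets[OF sets_U01 refl]\<close>)

lemma integral_U01_eq_integral:
  fixes f :: "real \<Rightarrow> real"
  assumes [measurable]: "f \<in> borel_measurable borel" and B: "\<And>t. norm (f t) \<le> B"
  shows "integral\<^sup>L U01 f = integral {0..1} f" "set_integrable lborel {a..b} f" "f integrable_on {a..b}"
proof -
  show *: "set_integrable lborel {a..b} f" for a b :: real
    unfolding set_integrable_def
    by (rule integrableI_bounded_set[of "{a..b}" _ _ B]) (use B in \<open>auto simp: indicator_def emeasure_lborel_Icc_eq\<close>)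
  show "f integrable_on {a..b}" by (rule set_borel_integral_eq_integral(1)[OF *])
  show "integral\<^sup>L U01 f = integral {0..1} f"
    by (simp add: integral_U01 set_borel_integral_eq_integral(2)[OF *])
qed

lemma integral_periodic:
  fixes f :: "real \<Rightarrow> real"
  assumes f [measurable]: "f \<in> borel_measurable borel" and B: "\<And>t. norm (f t) \<le> B" and per: "\<And>t. f (t + 1) = f t"
    and s: "0 \<le> s" "s \<le> 1"
  shows "integral {s..s+1} f = integral {0..1} f"
proof -
  note int = integral_U01_eq_integral(3)[OF f B]
  have "integral {s..s+1} f = integral {s..1} f + integral {1..s+1} f"
    using s by (intro Henstock_Kurzweil_Integration.integral_combine[symmetric] int) auto
  also have "integral {1..s+1} f = integral {0..s} (\<lambda>t. f (t + 1))"
    using integral_shift_real_ivl[of 1 1 "s+1" f] by simp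
  also have "\<dots> = integral {0..s} f" by (simp add: per)
  also have "integral {s..1} f + integral {0..s} f = integral {0..1} f"
    using s by (subst add.commute, intro Henstock_Kurzweil_Integration.integral_combine int) auto
  finally show ?thesis .
qed

section \<open>Rotation rates and quantitative chord estimates\<close>

context C2_curve
begin

lemma isCont_ang_snd: "s < t \<Longrightarrow> t < s + 1 \<Longrightarrow> isCont (\<lambda>t. ang (s,t)) t"
proof -
  assume st: "s < t" "t < s + 1"
  have "continuous_on {s<..<s+1} (\<lambda>t. ang (s,t))"
    by (rule continuous_on_compose2[OF continuous_ang]) (auto intro!: continuous_intros)
  then show ?thesis using st by (simp add: continuous_on_eq_continuous_at)
qed

lemma ang_deriv_snd:
  assumes st: "s < t" "t < s + 1"
  shows "((\<lambda>t. ang (s,t)) has_real_derivative Im (vel t / (\<gamma> t - \<gamma> s))) (at t)"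
proof (rule continuous_argument_has_derivative[OF _ _ isCont_ang_snd[OF st]])
  show "((\<lambda>t. \<gamma> t - \<gamma> s) has_vector_derivative vel t) (at t)"
    using has_vector_derivative_diff[OF deriv_\<gamma> has_vector_derivative_const] by fastforce
  show "\<gamma> t - \<gamma> s \<noteq> 0" using \<gamma>_neq[OF st] by simp
  have "\<forall>\<^sub>F y in nhds t. y \<in> {s<..<s+1}" using st by (intro eventually_nhds_in_open) auto
  then show "\<forall>\<^sub>F y in nhds t. sgn (\<gamma> y - \<gamma> s) = cis (ang (s,y))"
    by eventually_elim (auto simp: cis_ang sgn_chord)
qed

text \<open>Signed curvature times speed: the rotation rate of the tangent.\<close>

definition turn :: "real \<Rightarrow> real" where "turn t = Im (acc t / vel t)"

lemma ang_deriv_diag: "((\<lambda>t. ang (t,t)) has_real_derivative turn t) (at t)"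
  unfolding turn_def
proof (rule continuous_argument_has_derivative[OF deriv_vel vel_nz])
  have "continuous_on UNIV (\<lambda>t. ang (t,t))"
    by (rule continuous_on_compose2[OF continuous_ang]) (auto intro!: continuous_intros)
  then show "isCont (\<lambda>t. ang (t,t)) t" by (simp add: continuous_on_eq_continuous_at)
  show "\<forall>\<^sub>F y in nhds t. sgn (vel y) = cis (ang (y,y))" by (simp add: cis_ang)
qed

lemma continuous_turn: "continuous_on A turn"
  unfolding turn_def by (intro continuous_intros continuous_acc continuous_vel) auto

lemma turn_measurable [measurable]: "turn \<in> borel_measurable borel"
  using continuous_turn by (rule borel_measurable_continuous_onI)

lemma periodic_turn: "turn (t + 1) = turn t" by (simp add: turn_def periodic_acc periodic_vel)

lemma periodic_bounded:
  fixes f :: "real \<Rightarrow> 'a::real_normed_vector"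
  assumes "continuous_on UNIV f" "\<And>t. f (t + 1) = f t"
  shows "\<exists>B>0. \<forall>t. norm (f t) \<le> B"
proof -
  have "compact (f ` {0..1})" by (intro compact_continuous_image continuous_on_subset[OF assms(1)]) auto
  then obtain B where B: "\<forall>y\<in>f ` {0..1}. norm y \<le> B" using compact_imp_bounded bounded_iff by metis
  have "norm (f t) \<le> max B 1" for t
  proof -
    have "f (frac t) = f t" using periodic_int[of f t "- \<lfloor>t\<rfloor>"] assms(2) by (simp add: frac_def)
    moreover have "frac t \<in> {0..1}" using frac_ge_0[of t] frac_lt_1[of t] by simp
    ultimately have "f t \<in> f ` {0..1}" by (metis imageI)
    then have "norm (f t) \<le> B" using B by blast
    then show ?thesis by simp
  qed
  then show ?thesis by (intro exI[of _ "max B 1"]) auto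
qed

lemma chord_shift: assumes "s \<le> t" "t \<le> s + 1" shows "chord (s+1,t+1) = chord (s,t)"
  using chord_swap[OF assms] chord_swap[of t "s+1"] assms by simp

text \<open>The regularized chord does not vanish on a compact set whose simultaneous integer shifts
  cover the strip, and it is invariant under these shifts; c is the minimum of its norm.\<close>

lemma dist_lower_bound:
  "\<exists>c>0. \<forall>s t. s \<le> t \<and> t \<le> s + 1 \<longrightarrow> c * ((t - s) * (s + 1 - t)) \<le> norm (\<gamma> t - \<gamma> s)"
proof -
  let ?K = "(\<lambda>p. (fst p, fst p + snd p)) ` ({0..1} \<times> {0..1::real})"
  have sub: "?K \<subseteq> strip" by (auto simp: strip_def)
  have "compact ?K" by (intro compact_continuous_image compact_Times continuous_intros) auto
  moreover have "?K \<noteq> {}" by auto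
  moreover have "continuous_on ?K (\<lambda>p. norm (chord p))"
    by (intro continuous_intros continuous_on_subset[OF continuous_chord sub])
  ultimately obtain q where q: "q \<in> ?K" "\<And>p. p \<in> ?K \<Longrightarrow> norm (chord q) \<le> norm (chord p)"
    using continuous_attains_inf[of ?K "\<lambda>p. norm (chord p)"] by blast
  have pos: "norm (chord q) > 0" using chord_nz q(1) sub by auto
  have "norm (chord q) * ((t - s) * (s + 1 - t)) \<le> norm (\<gamma> t - \<gamma> s)" if st: "s \<le> t" "t \<le> s + 1" for s t
  proof -
    have "chord (frac s, frac s + (t - s)) = chord (s, s + (t - s))"
    proof -
      have per: "chord ((x + 1), (x + 1) + (t - s)) = chord (x, x + (t - s))" for x
        using chord_shift[of x "x + (t - s)"] st by (simp add: algebra_simps)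
      show ?thesis
        using periodic_int[of "\<lambda>x. chord (x, x + (t - s))" s "- \<lfloor>s\<rfloor>", OF per] by (simp add: frac_def)
    qed
    then have ce: "chord (frac s, frac s + (t - s)) = chord (s, t)" by simp
    have "(frac s, frac s + (t - s)) \<in> ?K"
      using frac_ge_0[of s] frac_lt_1[of s] st by (intro image_eqI[of _ _ "(frac s, t - s)"]) auto
    from q(2)[OF this] have le: "norm (chord q) \<le> norm (chord (s,t))" unfolding ce .
    have "norm (\<gamma> t - \<gamma> s) = ((t - s) * (s + 1 - t)) * norm (chord (s,t))"
      using st unfolding chord_eq[OF st] norm_mult norm_of_real by (simp add: abs_mult)
    then show ?thesis using mult_right_mono[OF le, of "(t - s) * (s + 1 - t)"] st by (simp add: mult.commute)
  qed
  then show ?thesis using pos by blast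
qed

lemma period_into_strip:
  fixes s t :: real
  obtains k :: int where "s \<le> t + k" "t + k < s + 1"
  using that[of "- \<lfloor>t - s\<rfloor>"] floor_correct[of "t - s"] by force

text \<open>The component of a chord normal to the curve is quadratic in the parameter distance,
  because the velocity is Lipschitz; the lower bound on chords turns this into a bound by the
  squared chord. Bounded angular velocities and tangent balls of a fixed radius both follow from it,
  and this is where two derivatives of \<gamma> are spent.\<close>

lemma chord_normal_bound:
  "\<exists>M>0. \<forall>s t. \<bar>Im (cnj (vel s) * (\<gamma> t - \<gamma> s))\<bar> \<le> M * (norm (\<gamma> t - \<gamma> s))\<^sup>2"
proof -
  obtain V where V: "V > 0" "\<And>t. norm (vel t) \<le> V" using periodic_bounded[OF continuous_vel periodic_vel] by blast
  obtain W where W: "W > 0" "\<And>t. norm (acc t) \<le> W" using periodic_bounded[OF continuous_acc periodic_acc] by blast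
  obtain c where c: "c > 0" "\<And>s t. s \<le> t \<Longrightarrow> t \<le> s + 1 \<Longrightarrow> c * ((t - s) * (s + 1 - t)) \<le> norm (\<gamma> t - \<gamma> s)"
    using dist_lower_bound by blast
  have lip: "norm (vel x - vel y) \<le> W * \<bar>x - y\<bar>" for x y
  proof -
    have "onorm (\<lambda>h::real. h *\<^sub>R acc x) \<le> W" for x
      by (rule onorm_le) (simp add: mult.commute[of "\<bar>_\<bar>"] mult_right_mono W(2))
    then show ?thesis
      using differentiable_bound[of UNIV vel "\<lambda>x h. h *\<^sub>R acc x" W x y] deriv_vel
      by (simp add: has_vector_derivative_def)
  qed
  have tay: "\<bar>Im (cnj (vel s) * (\<gamma> t - \<gamma> s))\<bar> \<le> V * W * (t - s)\<^sup>2" for s t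
  proof -
    define S where "S = closed_segment s t"
    define h where "h x = Im (cnj (vel s) * (\<gamma> x - \<gamma> s))" for x
    have hd: "(h has_derivative (\<lambda>y. y *\<^sub>R Im (cnj (vel s) * vel x))) (at x within S)" for x
    proof -
      have "(h has_vector_derivative Im (cnj (vel s) * (vel x - 0))) (at x within S)"
        unfolding h_def
        by (intro bounded_linear.has_vector_derivative[OF bounded_linear_Im] has_vector_derivative_mult_right
           has_vector_derivative_diff has_vector_derivative_const has_vector_derivative_at_within[OF deriv_\<gamma>])
      then show ?thesis by (simp add: has_vector_derivative_def)
    qed
    have bd: "onorm (\<lambda>y::real. y *\<^sub>R Im (cnj (vel s) * vel x)) \<le> V * W * \<bar>t - s\<bar>" if x: "x \<in> S" for x
    proof -
      have e: "Im (cnj (vel s) * vel x) = Im (cnj (vel s) * (vel x - vel s))" by (simp add: algebra_simps)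
      have "\<bar>Im (cnj (vel s) * (vel x - vel s))\<bar> \<le> norm (vel s) * norm (vel x - vel s)"
        using abs_Im_le_cmod[of "cnj (vel s) * (vel x - vel s)"] by (simp add: norm_mult)
      also have "\<dots> \<le> V * (W * \<bar>x - s\<bar>)" using V lip[of x s] W by (intro mult_mono) auto
      also have "\<dots> \<le> V * (W * \<bar>t - s\<bar>)"
        using x V W unfolding S_def closed_segment_eq_real_ivl by (intro mult_left_mono) (auto split: if_splits)
      finally have "norm (Im (cnj (vel s) * vel x)) \<le> V * W * \<bar>t - s\<bar>" unfolding e by simp
      then have b: "norm (Im (cnj (vel s) * vel x)) \<le> V * W * \<bar>t - s\<bar>" .
      show ?thesis
      proof (rule onorm_le)
        fix y :: real
        show "norm (y *\<^sub>R Im (cnj (vel s) * vel x)) \<le> V * W * \<bar>t - s\<bar> * norm y"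
          using mult_left_mono[OF b norm_ge_zero[of y]] unfolding norm_scaleR by (simp only: real_norm_def mult.commute)
      qed
    qed
    have "norm (h t - h s) \<le> V * W * \<bar>t - s\<bar> * norm (t - s)"
      by (rule differentiable_bound[OF convex_closed_segment[of s t] hd[unfolded S_def] bd[unfolded S_def]]) auto
    then show ?thesis by (simp add: h_def power2_eq_square mult.assoc)
  qed
  define M where "M = 4 * V * W / c\<^sup>2"
  have "\<bar>Im (cnj (vel s) * (\<gamma> t0 - \<gamma> s))\<bar> \<le> M * (norm (\<gamma> t0 - \<gamma> s))\<^sup>2" for s t0
  proof -
    obtain k :: int where k: "s \<le> t0 + k" "t0 + k < s + 1" by (rule period_into_strip)
    define t where "t = t0 + k"
    have gt: "\<gamma> t = \<gamma> t0" using \<gamma>_eq_iff t_def by blast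
    have st: "s \<le> t" "t \<le> s + 1" using k by (auto simp: t_def)
    define m where "m = min (t - s) (s + 1 - t)"
    have m: "0 \<le> m" using st by (auto simp: m_def)
    have "m = t - s \<or> m = s + 1 - t" by (auto simp: m_def)
    then have 1: "\<bar>Im (cnj (vel s) * (\<gamma> t - \<gamma> s))\<bar> \<le> V * W * m\<^sup>2"
    proof
      assume "m = s + 1 - t"
      moreover have "(t - (s + 1))\<^sup>2 = (s + 1 - t)\<^sup>2" by (simp add: power2_commute)
      ultimately show ?thesis using tay[of "s+1" t] by (simp add: periodic_\<gamma> periodic_vel)
    qed (use tay in simp)
    \<comment> \<open>The two factors add up to 1, so the larger one is at least 1/2.\<close>
    have "m * (1/2) \<le> (t - s) * (s + 1 - t)"
    proof (cases "t - s \<le> s + 1 - t")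
      case True
      then have "(t - s) * (1/2) \<le> (t - s) * (s + 1 - t)" using st by (intro mult_left_mono) auto
      then show ?thesis using True by (simp add: m_def)
    next
      case False
      then have "(1/2) * (s + 1 - t) \<le> (t - s) * (s + 1 - t)" using st by (intro mult_right_mono) auto
      then show ?thesis using False by (simp add: m_def)
    qed
    then have "c * (m * (1/2)) \<le> norm (\<gamma> t - \<gamma> s)" using c(2)[OF st] c(1) by (meson mult_left_mono less_imp_le order_trans)
    then have "(c * (m * (1/2)))\<^sup>2 \<le> (norm (\<gamma> t - \<gamma> s))\<^sup>2" using c m by (intro power_mono) auto
    then have "m\<^sup>2 \<le> 4 / c\<^sup>2 * (norm (\<gamma> t - \<gamma> s))\<^sup>2" using c(1) by (simp add: field_simps power_mult_distrib)
    then have "V * W * m\<^sup>2 \<le> V * W * (4 / c\<^sup>2 * (norm (\<gamma> t - \<gamma> s))\<^sup>2)" using V W by (intro mult_left_mono) auto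
    with 1 show ?thesis unfolding gt[symmetric] M_def by (simp add: mult_ac)
  qed
  then show ?thesis using V W c by (intro exI[of _ M]) (auto simp: M_def)
qed

end

section \<open>The angle function\<close>

lemma complex_mult_cnj_norm: "z * cnj z = of_real ((norm z)\<^sup>2)"
  by (rule complex_norm_square[symmetric])

lemma sgn_square_complex: "z \<noteq> 0 \<Longrightarrow> (sgn z)\<^sup>2 * cnj z = z" for z :: complex
proof -
  assume z: "z \<noteq> 0"
  have "(sgn z)\<^sup>2 * cnj z = z * (z * cnj z) / (norm z)\<^sup>2"
    by (simp add: sgn_eq power2_eq_square)
  also have "\<dots> = z" using z by (simp add: complex_mult_cnj_norm power_divide)
  finally show ?thesis .
qed

text \<open>The tangent directions of a circle at two of its points are mirror images of each other
  in the chord, and u -> d^2 * cnj u is reflection in the line of unit direction d.\<close>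

lemma oriented_circle_direction:
  assumes xy: "x \<noteq> y" and \<xi>: "is_oriented_circle \<xi>" "x \<in> oc_points \<xi>" "y \<in> oc_points \<xi>"
  shows "oc_direction \<xi> x = (sgn (y - x))\<^sup>2 * cnj (oc_direction \<xi> y)"
proof (cases \<xi>)
  case (OCircle c r)
  define a b where "a = x - c" and "b = y - c"
  have r: "r \<noteq> 0" and na: "norm a = \<bar>r\<bar>" and nb: "norm b = \<bar>r\<bar>"
    using \<xi> OCircle by (auto simp: a_def b_def dist_norm norm_minus_commute)
  have aa: "a * cnj a = of_real (r\<^sup>2)" and ang_vel: "b * cnj b = of_real (r\<^sup>2)"
    unfolding complex_mult_cnj_norm na nb by auto
  have yx: "y - x = b - a" by (simp add: a_def b_def)
  have ne: "b - a \<noteq> 0" using xy yx by auto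
  have e: "(\<i> * a / r) * cnj (b - a) = (b - a) * cnj (\<i> * b / r)"
    using aa ang_vel r by (simp add: field_simps)
  have "cnj (b - a) \<noteq> 0" using ne by simp
  moreover have "(\<i> * a / r) * cnj (b - a) = ((sgn (b - a))\<^sup>2 * cnj (\<i> * b / r)) * cnj (b - a)"
  proof -
    have "((sgn (b - a))\<^sup>2 * cnj (\<i> * b / r)) * cnj (b - a) = ((sgn (b - a))\<^sup>2 * cnj (b - a)) * cnj (\<i> * b / r)"
      by (simp only: mult_ac)
    from this[unfolded sgn_square_complex[OF ne], symmetric] show ?thesis unfolding e .
  qed
  ultimately have "\<i> * a / r = (sgn (b - a))\<^sup>2 * cnj (\<i> * b / r)" by (metis mult_right_cancel)
  then show ?thesis by (simp add: OCircle yx a_def[symmetric] b_def[symmetric])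
next
  case (OLine p u)
  obtain s1 s2 where s: "x = p + of_real s1 * u" "y = p + of_real s2 * u" and u: "norm u = 1"
    using \<xi> OLine by auto
  have yx: "y - x = of_real (s2 - s1) * u" by (simp add: s algebra_simps)
  have "s2 - s1 \<noteq> 0" using xy s by auto
  then have "(sgn (y - x))\<^sup>2 = u\<^sup>2" using u unfolding yx sgn_mult sgn_of_real
    by (simp add: sgn_if power_mult_distrib sgn_eq)
  moreover have "u * cnj u = 1" by (simp add: complex_mult_cnj_norm u)
  ultimately show ?thesis by (simp add: OLine power2_eq_square mult.assoc)
qed

text \<open>The reflected direction v is the only candidate at x. If it equals u, the two points lie
  on a line of direction u; otherwise the directions determine the centre and the signed
  radius.\<close>

lemma oriented_circle_exists:
  assumes xy: "x \<noteq> y" and u: "norm u = 1"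
  shows "\<exists>\<xi>. is_oriented_circle \<xi> \<and> x \<in> oc_points \<xi> \<and> y \<in> oc_points \<xi> \<and> oc_direction \<xi> y = u"
proof -
  define d where "d = y - x"
  define v where "v = (sgn d)\<^sup>2 * cnj u"
  have d: "d \<noteq> 0" using xy by (simp add: d_def)
  have uu: "u * cnj u = 1" by (simp add: complex_mult_cnj_norm u)
  have nv: "norm v = 1" by (simp add: v_def norm_mult norm_power norm_sgn d u)
  have u0: "u \<noteq> 0" and v0: "v \<noteq> 0" using u nv by auto
  have cu: "cnj u = 1 / u" and cv: "cnj v = 1 / v"
    using uu u0 v0 complex_mult_cnj_norm[of v] nv by (auto simp: field_simps)
  have sv: "(sgn d)\<^sup>2 = u * v" using uu by (simp add: v_def mult_ac)
  show ?thesis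
  proof (cases "v = u")
    case True
    then have "(sgn d)\<^sup>2 = u\<^sup>2" using sv by (simp add: power2_eq_square)
    then have "sgn d = u \<or> sgn d = - u" by (simp add: power2_eq_iff)
    moreover have "d = of_real (norm d) * sgn d" by (simp add: sgn_eq d)
    ultimately have "x = y + of_real (- norm d) * u \<or> x = y + of_real (norm d) * u"
      unfolding d_def by (auto simp: algebra_simps)
    then have "x \<in> oc_points (OLine y u)" unfolding oc_points.simps by (elim disjE) blast+
    moreover have "y \<in> oc_points (OLine y u)" by (auto intro: range_eqI[of _ _ 0])
    ultimately show ?thesis using u by (intro exI[of _ "OLine y u"]) auto
  next
    case False
    \<comment> \<open>The centre must satisfy y - c = -i r u and x - c = -i r v. Subtracting gives i
      d = r (u - v), so q is the signed radius; it is real because it equals its conjugate.\<close>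
    define q where "q = \<i> * d / (u - v)"
    have uv: "u - v \<noteq> 0" using False by simp
    have cd: "cnj d = d / (u * v)" using sgn_square_complex[OF d] u0 v0 by (simp add: sv field_simps)
    have "cnj q = - \<i> * (d / (u * v)) / (1 / u - 1 / v)" by (simp add: q_def cd cu cv)
    also have "1 / u - 1 / v = - (u - v) / (u * v)" using u0 v0 by (simp add: field_simps)
    also have "- \<i> * (d / (u * v)) / (- (u - v) / (u * v)) = q" using u0 v0 uv by (simp add: q_def field_simps)
    finally obtain r where r: "q = of_real r" by (metis Reals_cases complex_is_Real_iff Reals_cnj_iff)
    have r0: "r \<noteq> 0" using r uv d by (auto simp: q_def)
    have dr: "\<i> * d = of_real r * (u - v)" using r uv by (simp add: q_def field_simps)
    define c where "c = y + \<i> * of_real r * u"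
    have xc: "x - c = - \<i> * of_real r * v"
    proof -
      have "x - c = - (d + \<i> * of_real r * u)" by (simp add: c_def d_def)
      also have "d = - \<i> * (\<i> * d)" by simp
      also have "\<dots> = - \<i> * (of_real r * (u - v))" unfolding dr ..
      finally show ?thesis by (simp add: algebra_simps)
    qed
    have yc: "y - c = - \<i> * of_real r * u" by (simp add: c_def)
    have "norm (x - c) = \<bar>r\<bar>" "norm (y - c) = \<bar>r\<bar>" unfolding xc yc by (simp_all add: norm_mult nv u)
    then have "x \<in> oc_points (OCircle c r)" "y \<in> oc_points (OCircle c r)" by (auto simp: dist_norm norm_minus_commute)
    moreover have "oc_direction (OCircle c r) y = u" using r0 by (simp add: yc)
    ultimately show ?thesis using r0 by (intro exI[of _ "OCircle c r"]) auto
  qed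
qed

text \<open>Eliminates the circle: existence and the reflection rule leave an explicit value for
  \<open>cis a\<close>.\<close>

lemma oriented_angle_condition:
  assumes "x \<noteq> y" "norm u = 1" "norm u' = 1"
  shows "(\<exists>\<xi>. is_oriented_circle \<xi> \<and> x \<in> oc_points \<xi> \<and> y \<in> oc_points \<xi> \<and> oc_direction \<xi> y = u \<and>
     is_oriented_angle u' (oc_direction \<xi> x) a) \<longleftrightarrow> cis a = (sgn (y - x))\<^sup>2 / (u' * u)"
proof -
  have nz: "u \<noteq> 0" "u' \<noteq> 0" using assms by auto
  then have uu: "cnj u = 1 / u" using assms complex_mult_cnj_norm[of u] by (simp add: field_simps)
  from nz have eq: "cis a = (sgn (y - x))\<^sup>2 / (u' * u) \<longleftrightarrow> (sgn (y - x))\<^sup>2 * cnj u = cis a * u'"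
    by (auto simp: uu field_simps)
  show ?thesis unfolding eq is_oriented_angle_def
    using oriented_circle_exists[OF assms(1,2)] oriented_circle_direction[OF assms(1)] by metis
qed

section \<open>Existence and uniqueness of the continuous angle\<close>

context C2_curve
begin

definition ut :: "real \<Rightarrow> complex" where "ut t = sgn (vel t)"

lemma unit_tangent_eq: "unit_tangent \<gamma> = ut" by (auto simp: unit_tangent_def ut_def vel_def)
lemma norm_ut [simp]: "norm (ut t) = 1" by (simp add: ut_def norm_sgn)
lemma ut_nz [simp]: "ut t \<noteq> 0" using norm_ut[of t] by (metis norm_zero zero_neq_one)
lemma periodic_ut: "ut (t + 1) = ut t" by (simp add: ut_def periodic_vel)
lemma cis_ang_diag: "cis (ang (t,t)) = ut t" by (simp add: cis_ang ut_def)

definition theta_lift :: "real \<times> real \<Rightarrow> real" where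
  "theta_lift p = 2 * ang p - ang (fst p, fst p) - ang (snd p, snd p)"

lemma continuous_theta_lift: "continuous_on strip theta_lift"
  unfolding theta_lift_def
  by (intro continuous_intros continuous_ang continuous_on_compose2[OF continuous_ang]) auto

lemma theta_lift_left [simp]: "theta_lift (s,s) = 0" by (simp add: theta_lift_def)
lemma theta_lift_right [simp]: "theta_lift (s,s+1) = 0"
  using ang_swap[of s s] ang_swap[of s "s+1"] by (simp add: theta_lift_def)
lemma theta_lift_shift: "s \<le> t \<Longrightarrow> t \<le> s + 1 \<Longrightarrow> theta_lift (s+1,t+1) = theta_lift (s,t)"
  using ang_shift[of s t] ang_shift[of s s] ang_shift[of t t] by (simp add: theta_lift_def)
lemma theta_lift_shift_int: "s \<le> t \<Longrightarrow> t \<le> s + 1 \<Longrightarrow> theta_lift (s + of_int k, t + of_int k) = theta_lift (s,t)"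
proof -
  assume st: "s \<le> t" "t \<le> s + 1"
  have "theta_lift (x + 1, (x + 1) + (t - s)) = theta_lift (x, x + (t - s))" for x
    using theta_lift_shift[of x "x + (t - s)"] st by (simp add: algebra_simps)
  from periodic_int[of "\<lambda>x. theta_lift (x, x + (t - s))", OF this, of s k] show ?thesis by (simp add: algebra_simps)
qed

lemma cis_theta_lift:
  assumes "s < t" "t < s + 1"
  shows "cis (theta_lift (s,t)) = (sgn (\<gamma> t - \<gamma> s))\<^sup>2 / (ut s * ut t)"
proof -
  have "cis (theta_lift (s,t)) = (cis (ang (s,t)))\<^sup>2 / (cis (ang (s,s)) * cis (ang (t,t)))"
    by (simp add: theta_lift_def cis_divide[symmetric] Complex.DeMoivre)
  then show ?thesis using assms by (simp add: cis_ang sgn_chord ut_def)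
qed

definition theta :: "complex \<Rightarrow> complex \<Rightarrow> real" where
  "theta x y = (THE a. \<exists>s t. s \<le> t \<and> t \<le> s + 1 \<and> \<gamma> s = x \<and> \<gamma> t = y \<and> theta_lift (s,t) = a)"

text \<open>Two strip parameters of one pair differ by a common integer shift or lie on opposite
  edges, where both values are 0.\<close>

lemma theta_lift_well_defined:
  assumes "s \<le> t" "t \<le> s + 1" "s' \<le> t'" "t' \<le> s' + 1" "\<gamma> s = \<gamma> s'" "\<gamma> t = \<gamma> t'"
  shows "theta_lift (s,t) = theta_lift (s',t')"
proof -
  obtain k l :: int where kl: "s' = s + k" "t' = t + l" using assms(5,6) \<gamma>_eq_iff by metis
  have "\<bar>real_of_int (l - k)\<bar> \<le> 1" using assms kl by auto
  then have "l - k \<in> {-1,0,1}" by auto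
  then consider "l = k" | "l = k + 1" | "l = k - 1" by fastforce
  then show ?thesis
  proof cases
    case 1 then show ?thesis using kl theta_lift_shift_int assms by simp
  next
    case 2
    then have "t = s" "t' = s' + 1" using assms kl by auto
    then show ?thesis by simp
  next
    case 3
    then have "t = s + 1" "t' = s'" using assms kl by auto
    then show ?thesis by simp
  qed
qed

lemma theta_eq: "s \<le> t \<Longrightarrow> t \<le> s + 1 \<Longrightarrow> theta (\<gamma> s) (\<gamma> t) = theta_lift (s,t)"
  unfolding theta_def by (rule the_equality) (auto intro: theta_lift_well_defined)

lemma in_path_imageE: assumes "x \<in> path_image \<gamma>" obtains s where "s \<in> {0..1}" "x = \<gamma> s"
  using assms unfolding path_image_def by blast

lemma into_stripE: obtains t' :: real where "s \<le> t'" "t' < s + 1" "\<gamma> t' = \<gamma> t" "ut t' = ut t" "vel t' = vel t"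
proof -
  obtain k :: int where "s \<le> t + k" "t + k < s + 1" by (rule period_into_strip)
  moreover have "\<gamma> (t + k) = \<gamma> t" "ut (t + k) = ut t" "vel (t + k) = vel t"
    using periodic_int[of \<gamma>] periodic_int[of ut] periodic_int[of vel] periodic_\<gamma> periodic_ut periodic_vel by auto
  ultimately show thesis using that by blast
qed

text \<open>A compact part \<open>K\<close> of the strip maps onto all pairs of curve points.
  Preimages of closed sets under \<open>theta\<close> are therefore images of compact sets, that is,
  continuity passes to the quotient.\<close>

lemma continuous_theta: "continuous_on (path_image \<gamma> \<times> path_image \<gamma>) (\<lambda>(x,y). theta x y)"
proof -
  define K where "K = (\<lambda>p. (fst p, fst p + snd p)) ` ({0..1} \<times> {0..1::real})"
  define G where "G p = (\<gamma> (fst p), \<gamma> (snd p))" for p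
  have K: "compact K" unfolding K_def by (intro compact_continuous_image compact_Times continuous_intros) auto
  have Ks: "K \<subseteq> strip" by (auto simp: K_def strip_def)
  have contG: "continuous_on A G" for A unfolding G_def
    by (intro continuous_intros continuous_on_compose2[OF continuous_\<gamma>[of UNIV]]) auto
  have GK: "G ` K = path_image \<gamma> \<times> path_image \<gamma>"
  proof
    show "G ` K \<subseteq> path_image \<gamma> \<times> path_image \<gamma>" by (auto simp: G_def range_\<gamma>[symmetric])
    show "path_image \<gamma> \<times> path_image \<gamma> \<subseteq> G ` K"
    proof clarify
      fix x y assume "x \<in> path_image \<gamma>" "y \<in> path_image \<gamma>"
      then obtain s t where s: "s \<in> {0..1}" "x = \<gamma> s" and "y = \<gamma> t" by (metis in_path_imageE)
      moreover obtain t' where t': "s \<le> t'" "t' < s + 1" "\<gamma> t' = \<gamma> t" by (rule into_stripE)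
      moreover have "(s,t') \<in> K" unfolding K_def using s t' by (intro image_eqI[of _ _ "(s, t' - s)"]) auto
      ultimately show "(x,y) \<in> G ` K" by (intro image_eqI[of _ _ "(s,t')"]) (auto simp: G_def)
    qed
  qed
  have comp: "theta (fst (G p)) (snd (G p)) = theta_lift p" if "p \<in> K" for p
    using that Ks theta_eq[of "fst p" "snd p"] by (auto simp: G_def strip_def)
  have "closed ((\<lambda>(x,y). theta x y) -` B \<inter> (path_image \<gamma> \<times> path_image \<gamma>))" if B: "closed B" for B
  proof -
    have "(\<lambda>(x,y). theta x y) -` B \<inter> (path_image \<gamma> \<times> path_image \<gamma>) = G ` (K \<inter> theta_lift -` B)"
    proof (intro set_eqI iffI)
      fix z assume "z \<in> (\<lambda>(x,y). theta x y) -` B \<inter> (path_image \<gamma> \<times> path_image \<gamma>)"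
      then obtain p where "p \<in> K" "z = G p" "theta (fst z) (snd z) \<in> B" unfolding GK[symmetric] by (auto simp: case_prod_beta)
      then show "z \<in> G ` (K \<inter> theta_lift -` B)" using comp[of p] by auto
    next
      fix z assume "z \<in> G ` (K \<inter> theta_lift -` B)"
      then obtain p where "p \<in> K" "z = G p" "theta_lift p \<in> B" by auto
      then show "z \<in> (\<lambda>(x,y). theta x y) -` B \<inter> (path_image \<gamma> \<times> path_image \<gamma>)"
        using comp[of p] unfolding GK[symmetric] by (auto simp: case_prod_beta)
    qed
    moreover have "compact (K \<inter> theta_lift -` B)"
    proof -
      have "closed (theta_lift -` B \<inter> K)"
        using continuous_on_closed_vimage[OF compact_imp_closed[OF K], of theta_lift] B
          continuous_on_subset[OF continuous_theta_lift Ks] by blast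
      from compact_Int_closed[OF K this] show ?thesis by (simp add: Int_commute inf.left_commute)
    qed
    ultimately show ?thesis using compact_continuous_image[OF contG] compact_imp_closed by metis
  qed
  moreover have "closed (path_image \<gamma> \<times> path_image \<gamma>)"
    using compact_continuous_image[OF contG K] GK compact_imp_closed by metis
  ultimately show ?thesis by (subst continuous_on_closed_vimage) auto
qed

lemma is_angle_function_theta: "is_angle_function \<gamma> theta"
  unfolding is_angle_function_def
proof (intro conjI ballI allI impI)
  show "continuous_on (path_image \<gamma> \<times> path_image \<gamma>) (\<lambda>(x, y). theta x y)" by (rule continuous_theta)
  show "theta x x = 0" if "x \<in> path_image \<gamma>" for x
    using that theta_eq[of _ _] by (metis in_path_imageE theta_lift_left order_refl le_add_same_cancel1 zero_le_one)
  fix s t assume ne: "\<gamma> s \<noteq> \<gamma> t"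
  obtain t' where t': "s \<le> t'" "t' < s + 1" "\<gamma> t' = \<gamma> t" "ut t' = ut t" by (rule into_stripE)
  then have st: "s < t'" using ne by (metis less_le)
  have "cis (theta (\<gamma> s) (\<gamma> t')) = (sgn (\<gamma> t' - \<gamma> s))\<^sup>2 / (ut s * ut t')"
    using cis_theta_lift[OF st t'(2)] theta_eq[of s t'] st t' by simp
  then show "\<exists>\<xi>. is_oriented_circle \<xi> \<and> \<gamma> s \<in> oc_points \<xi> \<and> \<gamma> t \<in> oc_points \<xi> \<and>
             oc_direction \<xi> (\<gamma> t) = unit_tangent \<gamma> t \<and>
             is_oriented_angle (unit_tangent \<gamma> s) (oc_direction \<xi> (\<gamma> s)) (theta (\<gamma> s) (\<gamma> t))"
    unfolding unit_tangent_eq using oriented_angle_condition[OF ne norm_ut norm_ut] t' by simp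
qed

text \<open>The function selected by \<open>SOME\<close> has to be identified through uniqueness.
  Pulled back to the strip, its difference from \<open>theta_lift\<close> is continuous with values
  in the multiples of 2 pi, and it vanishes at (0,0).\<close>

lemma angle_function_eq:
  assumes "s \<le> t" "t \<le> s + 1"
  shows "angle_function \<gamma> (\<gamma> s) (\<gamma> t) = theta_lift (s,t)"
proof -
  define \<theta> where "\<theta> = angle_function \<gamma>"
  have af: "is_angle_function \<gamma> \<theta>"
    unfolding \<theta>_def angle_function_def using is_angle_function_theta by (rule someI[of "is_angle_function \<gamma>"])
  define f where "f p = \<theta> (\<gamma> (fst p)) (\<gamma> (snd p)) - theta_lift p" for p
  have "continuous_on strip (\<lambda>p. (\<lambda>(x,y). \<theta> x y) (\<gamma> (fst p), \<gamma> (snd p)))"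
  proof (rule continuous_on_compose2[of "path_image \<gamma> \<times> path_image \<gamma>"])
    show "continuous_on (path_image \<gamma> \<times> path_image \<gamma>) (\<lambda>(x,y). \<theta> x y)" using af by (simp add: is_angle_function_def)
    show "continuous_on strip (\<lambda>p. (\<gamma> (fst p), \<gamma> (snd p)))"
      by (intro continuous_intros continuous_on_compose2[OF continuous_\<gamma>[of UNIV]]) auto
  qed (auto simp: range_\<gamma>[symmetric])
  then have contf: "continuous_on strip f" unfolding f_def by (intro continuous_intros continuous_theta_lift) simp
  have diag: "\<theta> (\<gamma> x) (\<gamma> x) = 0" for x using af range_\<gamma> unfolding is_angle_function_def by blast
  have "cis (f p) = 1" if p: "p \<in> strip" for p
  proof -
    obtain s t where st: "p = (s,t)" by (cases p)
    consider "t = s" | "t = s + 1" | "s < t" "t < s + 1" using p st by fastforce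
    then show ?thesis
    proof cases
      case 3
      have ne: "\<gamma> s \<noteq> \<gamma> t" using \<gamma>_neq[OF 3] by simp
      then have "cis (\<theta> (\<gamma> s) (\<gamma> t)) = (sgn (\<gamma> t - \<gamma> s))\<^sup>2 / (ut s * ut t)"
        using af oriented_angle_condition[OF ne norm_ut norm_ut] unfolding is_angle_function_def unit_tangent_eq by blast
      also have "\<dots> = cis (theta_lift (s,t))" using cis_theta_lift[OF 3] by simp
      finally show ?thesis by (simp add: f_def st cis_divide[symmetric])
    qed (auto simp: f_def st diag periodic_\<gamma>)
  qed
  from constant_on_if_cis_constant[OF convex_connected[OF convex_strip] contf this]
  obtain c where c: "\<And>p. p \<in> strip \<Longrightarrow> f p = c" unfolding constant_on_def by blast
  have "f (0,0) = 0" by (simp add: f_def diag)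
  then have "f (s,t) = 0" using c[of "(0,0)"] c[of "(s,t)"] assms by simp
  then show ?thesis by (simp add: f_def \<theta>_def)
qed

lemma continuous_angle_function: "continuous_on (path_image \<gamma> \<times> path_image \<gamma>) (\<lambda>(x,y). angle_function \<gamma> x y)"
  using is_angle_function_theta someI[of "is_angle_function \<gamma>" theta]
  unfolding angle_function_def is_angle_function_def by blast

end

lemma Im_divide_eq: "Im (z / w) = Im (z * cnj w) / (norm w)\<^sup>2"
  by (simp add: complex_div_cnj[of z w])

text \<open>At a zero of the first factor, boundedness of the second is enough. This serves the
  boundary terms of a partial integration: \<open>theta_lift\<close> vanishes on the diagonal, where
  of the other factor only a bound is known.\<close>

lemma continuous_on_mult_zero_bounded:
  fixes f g :: "real \<Rightarrow> real"
  assumes f: "continuous_on S f" and g: "\<And>x. x \<in> S \<Longrightarrow> \<bar>g x\<bar> \<le> B"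
    and fg: "\<And>x. x \<in> S \<Longrightarrow> f x \<noteq> 0 \<or> x \<in> T \<Longrightarrow> continuous (at x within S) g"
  shows "continuous_on S (\<lambda>x. f x * g x)"
  unfolding continuous_on_eq_continuous_within
proof
  fix x assume x: "x \<in> S"
  show "continuous (at x within S) (\<lambda>x. f x * g x)"
  proof (cases "f x \<noteq> 0 \<or> x \<in> T")
    case True
    then show ?thesis using f fg[OF x] x by (auto intro!: continuous_intros simp: continuous_on_eq_continuous_within)
  next
    case False
    have "(f \<longlongrightarrow> 0) (at x within S)" using f x False by (auto simp: continuous_on_def)
    then have "((\<lambda>y. f y * g y) \<longlongrightarrow> 0) (at x within S)"
    proof (rule Lim_null_comparison[rotated, OF tendsto_mult_right_zero[OF tendsto_norm_zero]])
      show "\<forall>\<^sub>F y in at x within S. norm (f y * g y) \<le> B * norm (f y)"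
        unfolding eventually_at_filter
        by (rule always_eventually) (use g in \<open>auto simp: abs_mult mult.commute[of "\<bar>f _\<bar>"] intro!: mult_right_mono\<close>)
    qed
    then show ?thesis using False by (simp add: continuous_within)
  qed
qed

lemma U01_pair_integrable_bounded:
  fixes f :: "real \<times> real \<Rightarrow> real"
  assumes [measurable]: "f \<in> borel_measurable (borel \<Otimes>\<^sub>M borel)" and B: "\<And>x. \<bar>f x\<bar> \<le> B"
  shows "integrable (U01 \<Otimes>\<^sub>M U01) f"
  by (rule U01_pair.integrable_const_bound[of _ B]) (use B in auto)

section \<open>The integral of the angle function by partial integration\<close>

context C2_curve
begin

text \<open>The rotation rate of the chord from \<gamma> s as its end point \<gamma> t moves. On the
  diagonal the value is 0 by the convention for division by 0.\<close>

definition ang_vel :: "real \<Rightarrow> real \<Rightarrow> real" where "ang_vel s t = Im (vel t / (\<gamma> t - \<gamma> s))"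

lemma ang_vel_measurable [measurable]: "(\<lambda>p. ang_vel (fst p) (snd p)) \<in> borel_measurable (borel \<Otimes>\<^sub>M borel)"
  "(\<lambda>p. ang_vel (snd p) (fst p)) \<in> borel_measurable (borel \<Otimes>\<^sub>M borel)"
  "ang_vel s \<in> borel_measurable borel" "(\<lambda>s. ang_vel s t) \<in> borel_measurable borel"
  unfolding ang_vel_def by measurable

lemma ang_vel_bounded: "\<exists>M>0. \<forall>s t. \<bar>ang_vel s t\<bar> \<le> M"
proof -
  obtain M where M: "M > 0" "\<And>s t. \<bar>Im (cnj (vel s) * (\<gamma> t - \<gamma> s))\<bar> \<le> M * (norm (\<gamma> t - \<gamma> s))\<^sup>2"
    using chord_normal_bound by blast
  have "\<bar>ang_vel s t\<bar> \<le> M" for s t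
  proof (cases "\<gamma> s = \<gamma> t")
    case True then show ?thesis using M(1) by (simp add: ang_vel_def)
  next
    case False
    then have p: "(norm (\<gamma> t - \<gamma> s))\<^sup>2 > 0" by simp
    have "vel t * cnj (\<gamma> t - \<gamma> s) = - cnj (cnj (vel t) * (\<gamma> s - \<gamma> t))" by (simp add: algebra_simps)
    then have "Im (vel t * cnj (\<gamma> t - \<gamma> s)) = Im (cnj (vel t) * (\<gamma> s - \<gamma> t))"
      by (metis cnj.simps(2) minus_complex.simps(2) minus_minus uminus_complex.simps(2))
    then have "\<bar>ang_vel s t\<bar> = \<bar>Im (cnj (vel t) * (\<gamma> s - \<gamma> t))\<bar> / (norm (\<gamma> t - \<gamma> s))\<^sup>2"
      unfolding ang_vel_def Im_divide_eq abs_divide by simp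
    also have "\<dots> \<le> M" using M(2)[of t s] p by (simp add: divide_le_eq norm_minus_commute)
    finally show ?thesis .
  qed
  then show ?thesis using M(1) by blast
qed

lemma periodic_ang_vel: "ang_vel s (t + 1) = ang_vel s t" "ang_vel (s + 1) t = ang_vel s t"
  by (simp_all add: ang_vel_def periodic_\<gamma> periodic_vel)

lemma continuous_ang_snd: "continuous_on {s..s+1} (\<lambda>t. ang (s,t))"
  by (rule continuous_on_compose2[OF continuous_ang]) (auto intro!: continuous_intros)

text \<open>One circuit of the end point turns the chord from the velocity at s to its
  opposite.\<close>

lemma integral_ang_vel:
  assumes "s \<in> {0..1}" shows "(\<integral>t. ang_vel s t \<partial>U01) = rot"
proof -
  obtain M where M: "\<And>s t. \<bar>ang_vel s t\<bar> \<le> M" using ang_vel_bounded by blast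
  have "(\<integral>t. ang_vel s t \<partial>U01) = integral {0..1} (ang_vel s)"
    by (rule integral_U01_eq_integral(1)[of _ M]) (use M in auto)
  also have "\<dots> = integral {s..s+1} (ang_vel s)"
    by (rule integral_periodic[symmetric, of _ M]) (use M assms periodic_ang_vel in auto)
  also have "(ang_vel s has_integral (ang (s,s+1) - ang (s,s))) {s..s+1}"
    by (rule fundamental_theorem_of_calculus_interior[OF _ continuous_ang_snd])
       (auto simp: ang_vel_def has_real_derivative_iff_has_vector_derivative[symmetric] intro: ang_deriv_snd)
  then have "integral {s..s+1} (ang_vel s) = ang (s,s+1) - ang (s,s)" by (rule integral_unique)
  also have "\<dots> = rot" using ang_swap[of s s] by simp
  finally show ?thesis .
qed

lemma turn_bounded: "\<exists>K>0. \<forall>t. \<bar>turn t\<bar> \<le> K"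
  using periodic_bounded[OF continuous_turn periodic_turn] by simp

lemma integral_turn: "(\<integral>t. turn t \<partial>U01) = 2 * rot"
proof -
  obtain K where K: "\<And>t. \<bar>turn t\<bar> \<le> K" using turn_bounded by blast
  have "(\<integral>t. turn t \<partial>U01) = integral {0..1} turn"
    by (rule integral_U01_eq_integral(1)[of _ K]) (use K in auto)
  also have "(turn has_integral (ang (1,1) - ang (0,0))) {0..1}"
    by (rule fundamental_theorem_of_calculus)
       (auto simp: has_real_derivative_iff_has_vector_derivative[symmetric] intro: DERIV_subset ang_deriv_diag)
  then have "integral {0..1} turn = ang (1,1) - ang (0,0)" by (rule integral_unique)
  also have "\<dots> = 2 * rot" using ang_shift[of 0 0] by simp
  finally show ?thesis .
qed

lemma continuous_theta_snd: "continuous_on {s..s+1} (\<lambda>t. theta_lift (s,t))"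
  by (rule continuous_on_compose2[OF continuous_theta_lift]) (auto intro!: continuous_intros)

lemma theta_deriv_snd:
  assumes st: "s < t" "t < s + 1"
  shows "((\<lambda>t. theta_lift (s,t)) has_real_derivative 2 * ang_vel s t - turn t) (at t)"
proof -
  have "((\<lambda>t. 2 * ang (s,t) - ang (s,s) - ang (t,t)) has_real_derivative 2 * ang_vel s t - 0 - turn t) (at t)"
    unfolding ang_vel_def by (intro DERIV_diff DERIV_cmult ang_deriv_snd[OF st] DERIV_const ang_deriv_diag)
  then show ?thesis by (simp add: theta_lift_def)
qed

text \<open>For fixed s the lift is Lipschitz in t and vanishes at both t = s and t = s + 1, so it
  is bounded by the distance to either end, hence by the chord. Consequently \<theta> sin \<theta>
  over the squared distance is bounded.\<close>

lemma theta_lift_le_dist: "\<exists>C>0. \<forall>s t. s \<le> t \<and> t \<le> s + 1 \<longrightarrow> \<bar>theta_lift (s,t)\<bar> \<le> C * norm (\<gamma> t - \<gamma> s)"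
proof -
  obtain M where M: "M > 0" "\<And>s t. \<bar>ang_vel s t\<bar> \<le> M" using ang_vel_bounded by blast
  obtain K where K: "K > 0" "\<And>t. \<bar>turn t\<bar> \<le> K" using turn_bounded by blast
  obtain c where c: "c > 0" "\<And>s t. s \<le> t \<Longrightarrow> t \<le> s + 1 \<Longrightarrow> c * ((t - s) * (s + 1 - t)) \<le> norm (\<gamma> t - \<gamma> s)"
    using dist_lower_bound by blast
  define C where "C = 2 * M + K"
  have C: "C > 0" using M K by (simp add: C_def)
  have lip: "\<bar>theta_lift (s,b) - theta_lift (s,a)\<bar> \<le> C * (b - a)" if "s \<le> a" "a < b" "b \<le> s + 1" for s a b
  proof -
    have "\<exists>l z. a < z \<and> z < b \<and> ((\<lambda>t. theta_lift (s,t)) has_real_derivative l) (at z) \<and> theta_lift (s,b) - theta_lift (s,a) = (b - a) * l"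
    proof (rule MVT[OF that(2)])
      show "continuous_on {a..b} (\<lambda>t. theta_lift (s,t))"
        by (rule continuous_on_subset[OF continuous_theta_snd[of s]]) (use that in auto)
      show "(\<lambda>t. theta_lift (s,t)) differentiable (at x)" if "a < x" "x < b" for x
        using theta_deriv_snd[of s x] that \<open>s \<le> a\<close> \<open>b \<le> s+1\<close> real_differentiable_def by auto
    qed
    then obtain l z where z: "a < z" "z < b" "((\<lambda>t. theta_lift (s,t)) has_real_derivative l) (at z)"
      "theta_lift (s,b) - theta_lift (s,a) = (b - a) * l" by blast
    have "l = 2 * ang_vel s z - turn z" using theta_deriv_snd[of s z] z that DERIV_unique by fastforce
    then have "\<bar>l\<bar> \<le> C" using M(2)[of s z] K(2)[of z] by (simp add: C_def)
    then show ?thesis unfolding z(4) abs_mult using that by (simp add: mult.commute mult_left_mono)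
  qed
  have "\<bar>theta_lift (s,t)\<bar> \<le> (2 * C / c) * norm (\<gamma> t - \<gamma> s)" if st: "s \<le> t" "t \<le> s + 1" for s t
  proof -
    have 1: "\<bar>theta_lift (s,t)\<bar> \<le> C * (t - s)" using lip[of s s t] st by (cases "t = s") auto
    have 2: "\<bar>theta_lift (s,t)\<bar> \<le> C * (s + 1 - t)" using lip[of s t "s+1"] st by (cases "t = s + 1") auto
    have "\<bar>theta_lift (s,t)\<bar> \<le> 2 * C * ((t - s) * (s + 1 - t))"
    proof (cases "t - s \<le> 1/2")
      case True
      then have "(t - s) * (1/2) \<le> (t - s) * (s + 1 - t)" using st by (intro mult_left_mono) auto
      then have "C * (t - s) \<le> C * (2 * ((t - s) * (s + 1 - t)))" using C by (intro mult_left_mono) auto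
      then show ?thesis using 1 by simp
    next
      case False
      then have "(1/2) * (s + 1 - t) \<le> (t - s) * (s + 1 - t)" using st by (intro mult_right_mono) auto
      then have "C * (s + 1 - t) \<le> C * (2 * ((t - s) * (s + 1 - t)))" using C by (intro mult_left_mono) auto
      then show ?thesis using 2 by simp
    qed
    also have "\<dots> = (2 * C / c) * (c * ((t - s) * (s + 1 - t)))" using c(1) by simp
    also have "\<dots> \<le> (2 * C / c) * norm (\<gamma> t - \<gamma> s)" using c(2)[OF st] C c(1) by (intro mult_left_mono) auto
    finally show ?thesis .
  qed
  then show ?thesis using C c(1) by (intro exI[of _ "2 * C / c"]) auto
qed

definition angle_fun :: "real \<Rightarrow> real \<Rightarrow> real" where
  "angle_fun s t = angle_function \<gamma> (\<gamma> s) (\<gamma> t)"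

lemma angle_fun_eq: "s \<le> t \<Longrightarrow> t \<le> s + 1 \<Longrightarrow> angle_fun s t = theta_lift (s,t)"
  by (simp add: angle_fun_def angle_function_eq)

lemma periodic_angle_fun: "angle_fun s (t + 1) = angle_fun s t" "angle_fun (s + 1) t = angle_fun s t"
  by (simp_all add: angle_fun_def periodic_\<gamma>)

lemma continuous_angle_fun: "continuous_on UNIV (\<lambda>p. angle_fun (fst p) (snd p))"
proof -
  have "continuous_on UNIV (\<lambda>p. (\<lambda>(x,y). angle_function \<gamma> x y) (\<gamma> (fst p), \<gamma> (snd p)))"
  proof (rule continuous_on_compose2[OF continuous_angle_function])
    show "continuous_on UNIV (\<lambda>p. (\<gamma> (fst p), \<gamma> (snd p)))"
      by (intro continuous_intros continuous_on_compose2[OF continuous_\<gamma>[of UNIV]]) auto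
  qed (auto simp: range_\<gamma>[symmetric])
  then show ?thesis by (simp add: angle_fun_def)
qed

lemma angle_fun_measurable [measurable]: "(\<lambda>p. angle_fun (fst p) (snd p)) \<in> borel_measurable (borel \<Otimes>\<^sub>M borel)"
  using borel_measurable_continuous_onI[OF continuous_angle_fun] by (simp add: borel_prod)

lemma angle_fun_measurable_snd [measurable]: "angle_fun s \<in> borel_measurable borel"
proof -
  have "(\<lambda>t. (\<lambda>p. angle_fun (fst p) (snd p)) (s,t)) \<in> borel_measurable borel" by measurable
  then show ?thesis by simp
qed

lemma angle_fun_le_dist: "\<exists>C>0. \<forall>s t. \<bar>angle_fun s t\<bar> \<le> C * norm (\<gamma> t - \<gamma> s)"
proof -
  obtain C where C: "C > 0" "\<And>s t. s \<le> t \<Longrightarrow> t \<le> s + 1 \<Longrightarrow> \<bar>theta_lift (s,t)\<bar> \<le> C * norm (\<gamma> t - \<gamma> s)"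
    using theta_lift_le_dist by blast
  have "\<bar>angle_fun s t\<bar> \<le> C * norm (\<gamma> t - \<gamma> s)" for s t
  proof -
    obtain t' where t': "s \<le> t'" "t' < s + 1" "\<gamma> t' = \<gamma> t" by (rule into_stripE)
    then show ?thesis using C(2)[of s t'] angle_fun_eq[of s t'] by (simp add: angle_fun_def)
  qed
  then show ?thesis using C(1) by blast
qed

definition energy :: "real \<Rightarrow> real \<Rightarrow> real" where
  "energy s t = norm (vel s) * norm (vel t) * (angle_fun s t * sin (angle_fun s t) / (norm (\<gamma> t - \<gamma> s))\<^sup>2)"

lemma energy_measurable [measurable]: "(\<lambda>p. energy (fst p) (snd p)) \<in> borel_measurable (borel \<Otimes>\<^sub>M borel)"
  "energy s \<in> borel_measurable borel"
  unfolding energy_def by measurable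

lemma energy_bounded: "\<exists>B>0. \<forall>s t. \<bar>energy s t\<bar> \<le> B"
proof -
  obtain V where V: "V > 0" "\<And>t. norm (vel t) \<le> V" using periodic_bounded[OF continuous_vel periodic_vel] by blast
  obtain C where C: "C > 0" "\<And>s t. \<bar>angle_fun s t\<bar> \<le> C * norm (\<gamma> t - \<gamma> s)" using angle_fun_le_dist by blast
  have "\<bar>energy s t\<bar> \<le> V * V * C\<^sup>2" for s t
  proof -
    have "\<bar>angle_fun s t * sin (angle_fun s t)\<bar> \<le> \<bar>angle_fun s t\<bar> * \<bar>angle_fun s t\<bar>"
      unfolding abs_mult by (intro mult_left_mono abs_sin_x_le_abs_x) auto
    also have "\<dots> \<le> (C * norm (\<gamma> t - \<gamma> s)) * (C * norm (\<gamma> t - \<gamma> s))"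
      using C by (intro mult_mono) auto
    finally have "\<bar>angle_fun s t * sin (angle_fun s t) / (norm (\<gamma> t - \<gamma> s))\<^sup>2\<bar> \<le> C\<^sup>2"
      by (cases "\<gamma> t = \<gamma> s") (simp_all add: divide_le_eq power2_eq_square mult_ac)
    then have "norm (vel s) * norm (vel t) * \<bar>angle_fun s t * sin (angle_fun s t) / (norm (\<gamma> t - \<gamma> s))\<^sup>2\<bar> \<le> V * V * C\<^sup>2"
      using V by (intro mult_mono) auto
    then show ?thesis by (simp add: energy_def abs_mult)
  qed
  then show ?thesis using V C by (intro exI[of _ "V * V * C\<^sup>2"]) auto
qed

text \<open>The two factors on the right are the partial derivatives of \<open>theta_lift\<close> in
  t and in s. The t-derivative of the second factor is 2 Im (vel s * vel t / (\<gamma> s - \<gamma>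
  t)^2), which is -2 times the speeds times sin \<theta> over the squared distance. Hence the
  integrand on the left is \<open>h t - (1/2) * f' t\<close> with f = \<theta> times the
  s-derivative, and f vanishes at both ends of the period.\<close>

lemma energy_inner:
  assumes s: "s \<in> {0..1}"
  shows "(\<integral>t. energy s t \<partial>U01) = (\<integral>t. (1/2) * ((2 * ang_vel s t - turn t) * (2 * ang_vel t s - turn s)) \<partial>U01)"
proof -
  obtain M where M: "M > 0" "\<And>s t. \<bar>ang_vel s t\<bar> \<le> M" using ang_vel_bounded by blast
  obtain K where K: "K > 0" "\<And>t. \<bar>turn t\<bar> \<le> K" using turn_bounded by blast
  obtain E where E: "\<And>s t. \<bar>energy s t\<bar> \<le> E" using energy_bounded by blast
  define h where "h t = (1/2) * ((2 * ang_vel s t - turn t) * (2 * ang_vel t s - turn s))" for t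
  define f where "f t = theta_lift (s,t) * (2 * ang_vel t s - turn s)" for t
  define f' where "f' t = 2 * h t + theta_lift (s,t) * (2 * Im (vel s * vel t / (\<gamma> s - \<gamma> t)\<^sup>2))" for t
  have hB: "\<bar>h t\<bar> \<le> (2 * M + K) * (2 * M + K)" for t
  proof -
    have "\<bar>2 * ang_vel s t - turn t\<bar> \<le> 2 * M + K" "\<bar>2 * ang_vel t s - turn s\<bar> \<le> 2 * M + K"
      using M(2)[of s t] M(2)[of t s] K(2)[of t] K(2)[of s] by auto
    then have "\<bar>2 * ang_vel s t - turn t\<bar> * \<bar>2 * ang_vel t s - turn s\<bar> \<le> (2 * M + K) * (2 * M + K)" by (intro mult_mono) auto
    moreover have "0 \<le> (2 * M + K) * (2 * M + K)" using M(1) K(1) by (intro mult_nonneg_nonneg) auto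
    moreover have "\<bar>h t\<bar> = (1/2) * (\<bar>2 * ang_vel s t - turn t\<bar> * \<bar>2 * ang_vel t s - turn s\<bar>)" by (simp add: h_def abs_mult)
    ultimately show ?thesis by linarith
  qed
  have h_meas [measurable]: "h \<in> borel_measurable borel" unfolding h_def by measurable
  have bder: "((\<lambda>t. ang_vel t s) has_real_derivative Im (vel s * vel t / (\<gamma> s - \<gamma> t)\<^sup>2)) (at t)" if "\<gamma> s \<noteq> \<gamma> t" for t
  proof -
    have "((\<lambda>t. \<gamma> s - \<gamma> t) has_vector_derivative (0 - vel t)) (at t)"
      by (intro has_vector_derivative_diff has_vector_derivative_const deriv_\<gamma>)
    moreover have "((\<lambda>z. vel s / z) has_field_derivative - (vel s / (\<gamma> s - \<gamma> t)\<^sup>2)) (at (\<gamma> s - \<gamma> t))"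
      using that by (auto intro!: derivative_eq_intros simp: power2_eq_square)
    ultimately have "((\<lambda>z. vel s / z) \<circ> (\<lambda>t. \<gamma> s - \<gamma> t) has_vector_derivative (0 - vel t) * - (vel s / (\<gamma> s - \<gamma> t)\<^sup>2)) (at t)"
      by (rule field_vector_diff_chain_at)
    then have "((\<lambda>t. vel s / (\<gamma> s - \<gamma> t)) has_vector_derivative (vel s * vel t / (\<gamma> s - \<gamma> t)\<^sup>2)) (at t)"
      by (simp add: o_def mult.commute)
    from bounded_linear.has_vector_derivative[OF bounded_linear_Im this]
    show ?thesis unfolding ang_vel_def by (simp add: has_real_derivative_iff_has_vector_derivative)
  qed
  have fder: "(f has_vector_derivative f' t) (at t)" if t: "t \<in> {s<..<s+1}" for t
  proof -
    have ne: "\<gamma> s \<noteq> \<gamma> t" using \<gamma>_neq[of s t] t by auto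
    have "(f has_real_derivative ((2 * ang_vel s t - turn t) * (2 * ang_vel t s - turn s)
       + (2 * Im (vel s * vel t / (\<gamma> s - \<gamma> t)\<^sup>2) - 0) * theta_lift (s,t))) (at t)"
      unfolding f_def using t
      by (intro DERIV_mult theta_deriv_snd DERIV_diff DERIV_cmult bder[OF ne] DERIV_const) auto
    then show ?thesis by (simp add: has_real_derivative_iff_has_vector_derivative f'_def h_def mult.commute)
  qed
  have fcont: "continuous_on {s..s+1} f"
    unfolding f_def
  proof (rule continuous_on_mult_zero_bounded[OF continuous_theta_snd, where B="2*M+K" and T="{}"])
    fix t assume "t \<in> {s..s+1}"
    show "\<bar>2 * ang_vel t s - turn s\<bar> \<le> 2 * M + K" using M(2)[of t s] K(2)[of s] by auto
    assume "theta_lift (s,t) \<noteq> 0 \<or> t \<in> {}"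
    then have "t \<noteq> s" "t \<noteq> s + 1" by auto
    then have "\<gamma> s \<noteq> \<gamma> t" using \<gamma>_neq[of s t] \<open>t \<in> _\<close> by auto
    then have "isCont (\<lambda>t. ang_vel t s) t" using bder DERIV_isCont by blast
    then have "isCont (\<lambda>t. 2 * ang_vel t s - turn s) t" by (intro isCont_diff isCont_mult) auto
    then show "continuous (at t within {s..s+1}) (\<lambda>t. 2 * ang_vel t s - turn s)"
      by (rule continuous_at_imp_continuous_at_within)
  qed
  have "(f' has_integral (f (s+1) - f s)) {s..s+1}"
    by (rule fundamental_theorem_of_calculus_interior[OF _ fcont fder]) auto
  then have f0: "(f' has_integral 0) {s..s+1}" by (simp add: f_def)
  have key: "energy s t = h t - (1/2) * f' t" if t: "t \<in> {s<..<s+1}" for t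
  proof -
    have ne: "\<gamma> t - \<gamma> s \<noteq> 0" using \<gamma>_neq[of s t] t by auto
    have "vel s * vel t / (\<gamma> s - \<gamma> t)\<^sup>2
       = of_real (norm (vel s) * norm (vel t) / (norm (\<gamma> t - \<gamma> s))\<^sup>2) * (ut s * ut t / (sgn (\<gamma> t - \<gamma> s))\<^sup>2)"
      using ne by (simp add: ut_def sgn_eq power_divide power2_commute[of "\<gamma> s"] )
    also have "ut s * ut t / (sgn (\<gamma> t - \<gamma> s))\<^sup>2 = cis (- theta_lift (s,t))"
    proof -
      have "cis (- theta_lift (s,t)) = 1 / cis (theta_lift (s,t))" by (metis cis_inverse inverse_eq_divide)
      then show ?thesis using cis_theta_lift[of s t] t by simp
    qed
    finally have "Im (vel s * vel t / (\<gamma> s - \<gamma> t)\<^sup>2) =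
        - (norm (vel s) * norm (vel t) / (norm (\<gamma> t - \<gamma> s))\<^sup>2) * sin (theta_lift (s,t))"
      by (simp del: of_real_mult of_real_divide)
    then show ?thesis using t by (simp add: energy_def f'_def angle_fun_eq diff_divide_distrib mult_ac)
  qed
  have "(\<integral>t. energy s t \<partial>U01) = integral {0..1} (energy s)"
    by (rule integral_U01_eq_integral(1)[of _ E]) (use E in auto)
  also have "\<dots> = integral {s..s+1} (energy s)"
    by (rule integral_periodic[symmetric, of _ E])
       (use E s in \<open>auto simp: energy_def periodic_angle_fun periodic_\<gamma> periodic_vel\<close>)
  also have "\<dots> = integral {s..s+1} (\<lambda>t. h t - (1/2) * f' t)"
  proof (rule integral_spike[of "{s,s+1}"])
    fix x assume "x \<in> {s..s+1} - {s,s+1}"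
    then have "x \<in> {s<..<s+1}" by auto
    from key[OF this] show "h x - (1/2) * f' x = energy s x" ..
  qed simp
  also have "\<dots> = integral {s..s+1} h - (1/2) * integral {s..s+1} f'"
    using integral_U01_eq_integral(3)[of h "(2*M+K)*(2*M+K)"] hB f0
    by (subst Henstock_Kurzweil_Integration.integral_diff) (auto intro: has_integral_integrable)
  also have "\<dots> = integral {s..s+1} h" using integral_unique[OF f0] by simp
  also have "\<dots> = integral {0..1} h"
    by (rule integral_periodic[of _ "(2*M+K)*(2*M+K)"]) (use hB s in \<open>auto simp: h_def periodic_ang_vel periodic_turn\<close>)
  also have "\<dots> = (\<integral>t. h t \<partial>U01)"
    by (rule integral_U01_eq_integral(1)[symmetric, of _ "(2*M+K)*(2*M+K)"]) (use hB in auto)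
  finally show ?thesis unfolding h_def .
qed

text \<open>The quantity shared by both sides of the theorem. The sign makes the integrand agree
  with the product of the normal components of the two velocities, divided by the fourth power of
  the distance.\<close>

definition chord_energy :: real where
  "chord_energy = (\<integral>p. - (ang_vel (fst p) (snd p) * ang_vel (snd p) (fst p)) \<partial>(U01 \<Otimes>\<^sub>M U01))"

text \<open>Expanding the product leaves -2 \<open>chord_energy\<close>. The two mixed terms
  separate, since \<open>ang_vel\<close> integrates to \<open>rot\<close> for each fixed first
  argument and \<open>turn\<close> to 2 \<open>rot\<close>; together with the pure
  \<open>turn\<close> term they contribute (-2 - 2 + 2) times the square of
  \<open>rot\<close>.\<close>

lemma integral_energy: "(\<integral>p. energy (fst p) (snd p) \<partial>(U01 \<Otimes>\<^sub>M U01)) = - 2 * chord_energy - 2 * rot\<^sup>2"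
proof -
  obtain M where M: "M > 0" "\<And>s t. \<bar>ang_vel s t\<bar> \<le> M" using ang_vel_bounded by blast
  obtain K where K: "K > 0" "\<And>t. \<bar>turn t\<bar> \<le> K" using turn_bounded by blast
  obtain E where E: "\<And>s t. \<bar>energy s t\<bar> \<le> E" using energy_bounded by blast
  have AE01: "AE s in U01. s \<in> {0..1}" by (simp add: AE_U01)
  let ?P = "U01 \<Otimes>\<^sub>M U01"
  define h1 where "h1 p = ang_vel (fst p) (snd p) * ang_vel (snd p) (fst p)" for p
  define h2 where "h2 p = ang_vel (fst p) (snd p) * turn (fst p)" for p
  define h3 where "h3 p = ang_vel (snd p) (fst p) * turn (snd p)" for p
  define h4 where "h4 p = turn (fst p) * turn (snd p)" for p
  have [measurable]: "h1 \<in> borel_measurable (borel \<Otimes>\<^sub>M borel)" "h2 \<in> borel_measurable (borel \<Otimes>\<^sub>M borel)"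
    "h3 \<in> borel_measurable (borel \<Otimes>\<^sub>M borel)" "h4 \<in> borel_measurable (borel \<Otimes>\<^sub>M borel)"
    unfolding h1_def h2_def h3_def h4_def by measurable
  have bd: "\<bar>a * b\<bar> \<le> (M + K) * (M + K)" if "\<bar>a\<bar> \<le> M + K" "\<bar>b\<bar> \<le> M + K" for a b
    unfolding abs_mult using that by (intro mult_mono) auto
  have MK: "\<bar>ang_vel s t\<bar> \<le> M + K" "\<bar>turn t\<bar> \<le> M + K" for s t
    using M(2)[of s t] K(2)[of t] M(1) K(1) by linarith+
  have int: "integrable ?P h1" "integrable ?P h2" "integrable ?P h3" "integrable ?P h4"
    by (rule U01_pair_integrable_bounded[of _ "(M+K)*(M+K)"]; simp add: h1_def h2_def h3_def h4_def bd MK)+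
  have "(\<integral>p. energy (fst p) (snd p) \<partial>?P) = (\<integral>s. (\<integral>t. energy s t \<partial>U01) \<partial>U01)"
    using U01_pair.integral_fst'[OF U01_pair_integrable_bounded[of "\<lambda>p. energy (fst p) (snd p)" E]] E by simp
  also have "\<dots> = (\<integral>s. (\<integral>t. 2 * h1 (s,t) - h2 (s,t) - h3 (s,t) + (1/2) * h4 (s,t) \<partial>U01) \<partial>U01)"
  proof (rule integral_cong_AE)
    show "AE s in U01. (\<integral>t. energy s t \<partial>U01) = (\<integral>t. 2 * h1 (s,t) - h2 (s,t) - h3 (s,t) + (1/2) * h4 (s,t) \<partial>U01)"
      using AE01
    proof eventually_elim
      case (elim s)
      show ?case unfolding energy_inner[OF elim]
        by (intro Bochner_Integration.integral_cong refl) (simp add: h1_def h2_def h3_def h4_def algebra_simps)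
    qed
    have "(\<lambda>s. \<integral>t. (\<lambda>p. energy (fst p) (snd p)) (s,t) \<partial>U01) \<in> borel_measurable U01" by measurable
    then show "(\<lambda>s. \<integral>t. energy s t \<partial>U01) \<in> borel_measurable U01" by simp
  qed measurable
  also have "\<dots> = (\<integral>p. 2 * h1 p - h2 p - h3 p + (1/2) * h4 p \<partial>?P)"
    using U01_pair.integral_fst'[of "\<lambda>p. 2 * h1 p - h2 p - h3 p + (1/2) * h4 p"] int by simp
  also have "\<dots> = 2 * (\<integral>p. h1 p \<partial>?P) - (\<integral>p. h2 p \<partial>?P) - (\<integral>p. h3 p \<partial>?P) + (1/2) * (\<integral>p. h4 p \<partial>?P)"
    using int by simp
  also have "(\<integral>p. h1 p \<partial>?P) = - chord_energy" by (simp add: chord_energy_def h1_def)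
  also have "(\<integral>p. h2 p \<partial>?P) = 2 * rot\<^sup>2"
  proof -
    have "(\<integral>p. h2 p \<partial>?P) = (\<integral>s. (\<integral>t. h2 (s,t) \<partial>U01) \<partial>U01)" using U01_pair.integral_fst'[OF int(2)] by simp
    also have "\<dots> = (\<integral>s. rot * turn s \<partial>U01)"
      by (rule integral_cong_AE) (use AE01 in \<open>auto simp: h2_def integral_ang_vel\<close>)
    finally show ?thesis by (simp add: integral_turn power2_eq_square)
  qed
  also have "(\<integral>p. h3 p \<partial>?P) = 2 * rot\<^sup>2"
  proof -
    have "(\<integral>p. h3 p \<partial>?P) = (\<integral>t. (\<integral>s. h3 (s,t) \<partial>U01) \<partial>U01)" using U01_pair.integral_snd[of "\<lambda>s t. h3 (s,t)"] int(3) by simp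
    also have "\<dots> = (\<integral>t. rot * turn t \<partial>U01)"
      by (rule integral_cong_AE) (use AE01 in \<open>auto simp: h3_def integral_ang_vel\<close>)
    finally show ?thesis by (simp add: integral_turn power2_eq_square)
  qed
  also have "(\<integral>p. h4 p \<partial>?P) = 4 * rot\<^sup>2"
  proof -
    have "(\<integral>p. h4 p \<partial>?P) = (\<integral>s. (\<integral>t. h4 (s,t) \<partial>U01) \<partial>U01)" using U01_pair.integral_fst'[OF int(4)] by simp
    then show ?thesis by (simp add: h4_def integral_turn power2_eq_square)
  qed
  finally show ?thesis by simp
qed

end

section \<open>Tangent discs\<close>

text \<open>A path leaving [0, pi] would take a value in (pi, 2 pi) or in (-pi, 0), where the sine
  is negative; the minimum with 3 pi / 2 and the maximum with - pi / 2 keep the intermediate value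
  in these intervals.\<close>

lemma continuous_sin_nonneg_stays:
  fixes f :: "real \<Rightarrow> real"
  assumes ab: "a \<le> b" and f: "continuous_on {a..b} f" and s: "\<And>x. x \<in> {a..b} \<Longrightarrow> sin (f x) \<ge> 0"
    and fa: "0 \<le> f a" "f a \<le> pi"
  shows "0 \<le> f b \<and> f b \<le> pi"
proof (rule ccontr)
  assume "\<not> ?thesis"
  then consider "f b > pi" | "f b < 0" by linarith
  then show False
  proof cases
    case 1
    define v where "v = min (f b) (3 * pi / 2)"
    have v: "pi < v" "v < 2 * pi" "f a \<le> v" "v \<le> f b" using 1 fa pi_gt_zero by (auto simp: v_def min_less_iff_disj)
    obtain x where "x \<in> {a..b}" "f x = v" using IVT'[of f a v b] v f ab by auto
    then show False using s[of x] sin_lt_zero[of v] v by simp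
  next
    case 2
    define v where "v = max (f b) (- (pi / 2))"
    have v: "-pi < v" "v < 0" "v \<le> f a" "f b \<le> v" using 2 fa pi_gt_zero by (auto simp: v_def less_max_iff_disj)
    obtain x where "x \<in> {a..b}" "f x = v" using IVT2'[of f b v a] v f ab by auto
    then show False using s[of x] sin_lt_zero[of "v + 2 * pi"] v by simp
  qed
qed

lemma second_derivative_nonneg_at_min:
  fixes f f' :: "real \<Rightarrow> real"
  assumes f: "\<And>x. (f has_real_derivative f' x) (at x)" and D: "(f' has_real_derivative D) (at t)"
    and min: "\<And>x. f t \<le> f x"
  shows "f' t = 0" "D \<ge> 0"
proof -
  show f0: "f' t = 0" by (rule DERIV_local_min[OF f, of 1]) (use min in auto)
  show "D \<ge> 0"
  proof (rule ccontr)
    assume "\<not> D \<ge> 0"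
    then have "D < 0" by simp
    from DERIV_neg_dec_right[OF D this] f0 obtain d where d: "d > 0" "\<And>h. 0 < h \<Longrightarrow> h < d \<Longrightarrow> f' (t + h) < 0" by auto
    obtain z where z: "t < z" "z < t + d / 2" "f (t + d/2) - f t = (t + d/2 - t) * f' z"
      using MVT2[of t "t + d/2" f f'] f d(1) by auto
    have "f' z < 0" using d(2)[of "z - t"] z d(1) by auto
    then have "(t + d/2 - t) * f' z < 0" using d(1) by (simp add: mult_pos_neg)
    then show False using z(3) min[of "t + d/2"] by linarith
  qed
qed

section \<open>The domain and the two sides of its boundary\<close>

locale C2_domain = C2_curve +
  fixes \<Omega> :: "complex set"
  assumes dom: "compact_domain \<Omega>" and fr: "frontier \<Omega> = path_image \<gamma>"
begin

lemma simple_\<gamma>: "simple_path \<gamma>" using C2 by (simp add: C2_simple_closed_def)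

lemma closed_\<gamma>: "pathfinish \<gamma> = pathstart \<gamma>"
  using periodic_\<gamma>[of 0] by (simp add: pathfinish_def pathstart_def)

lemmas jordan = Jordan_inside_outside[OF simple_\<gamma> closed_\<gamma>]

lemma compact_\<Omega>: "compact \<Omega>" using dom by (simp add: compact_domain_def)
lemma closed_\<Omega>: "closed \<Omega>" by (rule compact_imp_closed[OF compact_\<Omega>])

lemma in_C [simp]: "\<gamma> t \<in> path_image \<gamma>" using range_\<gamma> by blast

lemma C_ne: "path_image \<gamma> \<noteq> {}" by (simp add: path_image_nonempty)

text \<open>Inside and outside of the curve are connected and miss the frontier, so each lies in
  \<Omega> or avoids it. The outside is unbounded and must avoid \<Omega>. If the inside did too,
  \<Omega> would lie in the curve and have empty interior, which \<open>compact_domain\<close>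
  excludes for a set with nonempty frontier.\<close>

lemma interior_\<Omega>: "interior \<Omega> = inside (path_image \<gamma>)"
  and compl_\<Omega>: "- \<Omega> = outside (path_image \<gamma>)"
proof -
  let ?I = "inside (path_image \<gamma>)" and ?O = "outside (path_image \<gamma>)"
  have un: "?I \<union> ?O = - path_image \<gamma>" using jordan by blast
  have O: "?O \<inter> \<Omega> = {}"
  proof (rule ccontr)
    assume ne: "?O \<inter> \<Omega> \<noteq> {}"
    have "?O \<subseteq> \<Omega>"
    proof (rule ccontr)
      assume "\<not> ?O \<subseteq> \<Omega>"
      then have "?O \<inter> frontier \<Omega> \<noteq> {}" using ne jordan by (intro connected_Int_frontier) auto
      then show False using fr un by auto
    qed
    then show False using jordan compact_imp_bounded[OF compact_\<Omega>] bounded_subset by blast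
  qed
  have I: "?I \<subseteq> \<Omega>"
  proof (rule ccontr)
    assume n: "\<not> ?I \<subseteq> \<Omega>"
    have "?I \<inter> \<Omega> = {}"
    proof (rule ccontr)
      assume "?I \<inter> \<Omega> \<noteq> {}"
      then have "?I \<inter> frontier \<Omega> \<noteq> {}" using n jordan by (intro connected_Int_frontier) auto
      then show False using fr un by auto
    qed
    then have "\<Omega> \<subseteq> path_image \<gamma>" using O un by blast
    then have "\<Omega> \<subseteq> frontier \<Omega>" using fr by simp
    then have "interior \<Omega> = {}" unfolding frontier_def using interior_subset[of \<Omega>] by blast
    then have "\<Omega> = {}" using dom by (simp add: compact_domain_def)
    then show False using fr C_ne by simp
  qed
  have C: "path_image \<gamma> \<subseteq> \<Omega>" using fr closed_\<Omega> by (simp add: frontier_subset_closed flip: fr)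
  show "interior \<Omega> = ?I"
  proof
    show "?I \<subseteq> interior \<Omega>" using I jordan by (intro interior_maximal) auto
    have "interior \<Omega> \<inter> path_image \<gamma> = {}" unfolding fr[symmetric] frontier_def by blast
    then show "interior \<Omega> \<subseteq> ?I" using interior_subset[of \<Omega>] un O by blast
  qed
  show "- \<Omega> = ?O" using I O C un by blast
qed

lemma \<Omega>_eq: "\<Omega> = interior \<Omega> \<union> path_image \<gamma>"
  using closed_\<Omega> by (auto simp: fr[symmetric] frontier_def interior_subset[THEN subsetD])

lemma null_C: "path_image \<gamma> \<in> null_sets lborel"
proof -
  have "negligible (\<gamma> ` UNIV)"
    by (rule negligible_differentiable_image_lowdim)
       (use deriv_\<gamma> in \<open>auto simp: differentiable_on_def differentiable_def has_vector_derivative_def\<close>)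
  then have "path_image \<gamma> \<in> null_sets lebesgue" by (simp add: range_\<gamma> negligible_iff_null_sets)
  moreover have "path_image \<gamma> \<in> sets lborel"
    using borel_compact[OF compact_simple_path_image[OF simple_\<gamma>]] by simp
  ultimately show ?thesis using null_sets_completion_iff by blast
qed

lemma interior_disjoint: "interior \<Omega> \<inter> path_image \<gamma> = {}" by (auto simp: fr[symmetric] frontier_def)

lemma connected_cases:
  assumes "connected S" "S \<inter> path_image \<gamma> = {}"
  shows "S \<subseteq> interior \<Omega> \<or> S \<subseteq> - \<Omega>"
proof (cases "S \<inter> \<Omega> = {}")
  case False
  then have "S \<subseteq> \<Omega>" using connected_Int_frontier[OF assms(1)] assms(2) fr by blast
  then show ?thesis using \<Omega>_eq assms(2) by blast
qed auto

lemma frontier_inside: "frontier (interior \<Omega>) = path_image \<gamma>" and frontier_outside: "frontier (- \<Omega>) = path_image \<gamma>"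
  using jordan by (auto simp: interior_\<Omega> compl_\<Omega>)

lemma speed_lower_bound: "\<exists>v>0. \<forall>t. v \<le> norm (vel t)"
proof -
  have "continuous_on UNIV (\<lambda>t. inverse (vel t))" by (intro continuous_intros continuous_vel) auto
  then obtain B where B: "B > 0" "\<And>t. norm (inverse (vel t)) \<le> B"
    using periodic_bounded[of "\<lambda>t. inverse (vel t)"] periodic_vel by auto
  have "1 / B \<le> norm (vel t)" for t
    using B(2)[of t] B(1) by (simp add: norm_inverse norm_divide field_simps)
  then show ?thesis using B(1) by (intro exI[of _ "1/B"]) auto
qed

text \<open>For a chord d from \<gamma> t, lying outside both tangent balls of radius \<rho> means
  that 2 \<rho> times its normal component is at most the squared norm of d. With the constant M of
  \<open>chord_normal_bound\<close> and a lower speed bound v this holds for \<rho> = v / (2 M). The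
  number eps is just a sign selecting the side.\<close>

lemma tangent_ball_disjoint: "\<exists>\<rho>>0. \<forall>t eps. eps\<^sup>2 = 1 \<longrightarrow> ball (\<gamma> t + of_real (eps * \<rho>) * (\<i> * ut t)) \<rho> \<inter> path_image \<gamma> = {}"
proof -
  obtain v where v: "v > 0" "\<And>t. v \<le> norm (vel t)" using speed_lower_bound by blast
  obtain M where M: "M > 0" "\<And>s t. \<bar>Im (cnj (vel s) * (\<gamma> t - \<gamma> s))\<bar> \<le> M * (norm (\<gamma> t - \<gamma> s))\<^sup>2"
    using chord_normal_bound by blast
  define \<rho> where "\<rho> = v / (2 * M)"
  have \<rho>: "\<rho> > 0" using v M by (simp add: \<rho>_def)
  have "\<rho> \<le> norm (\<gamma> s - (\<gamma> t + of_real (eps * \<rho>) * (\<i> * ut t)))" if e: "eps\<^sup>2 = 1" for s t eps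
  proof -
    define d where "d = \<gamma> s - \<gamma> t"
    have "\<bar>eps\<bar> = 1" using e by (auto simp: power2_eq_1_iff)
    have "norm (vel t) * Im (cnj (ut t) * d) = Im (cnj (vel t) * d)"
    proof -
      have "vel t = of_real (norm (vel t)) * ut t" by (simp add: ut_def sgn_eq)
      then have "cnj (vel t) * d = of_real (norm (vel t)) * (cnj (ut t) * d)" by (metis complex_cnj_complex_of_real complex_cnj_mult mult.assoc)
      moreover have "Im (of_real a * w) = a * Im w" for a w by simp
      ultimately show ?thesis by metis
    qed
    then have "norm (vel t) * \<bar>Im (cnj (ut t) * d)\<bar> \<le> M * (norm d)\<^sup>2"
      using M(2)[of t s] by (metis abs_mult abs_norm_cancel d_def)
    moreover have "v * \<bar>Im (cnj (ut t) * d)\<bar> \<le> norm (vel t) * \<bar>Im (cnj (ut t) * d)\<bar>" using v by (intro mult_right_mono) auto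
    ultimately have "v * \<bar>Im (cnj (ut t) * d)\<bar> \<le> M * (norm d)\<^sup>2" by simp
    then have b: "2 * \<rho> * \<bar>Im (cnj (ut t) * d)\<bar> \<le> (norm d)\<^sup>2" using M(1) by (simp add: \<rho>_def field_simps)
    have "(norm (d - of_real (eps * \<rho>) * (\<i> * ut t)))\<^sup>2 = (norm d)\<^sup>2 - 2 * (eps * \<rho>) * Im (cnj (ut t) * d) + (eps * \<rho>)\<^sup>2 * (norm (ut t))\<^sup>2"
      unfolding cmod_power2 by (simp add: power2_eq_square algebra_simps)
    also have "\<dots> = (norm d)\<^sup>2 - 2 * (eps * \<rho>) * Im (cnj (ut t) * d) + \<rho>\<^sup>2" using e by (simp add: power_mult_distrib)
    also have "\<dots> \<ge> \<rho>\<^sup>2"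
    proof -
      have "2 * (eps * \<rho>) * Im (cnj (ut t) * d) \<le> \<bar>2 * (eps * \<rho>) * Im (cnj (ut t) * d)\<bar>" by (rule abs_ge_self)
      also have "\<dots> = 2 * \<rho> * \<bar>Im (cnj (ut t) * d)\<bar>" using \<rho> \<open>\<bar>eps\<bar> = 1\<close> by (simp add: abs_mult)
      finally show ?thesis using b by linarith
    qed
    finally have "\<rho> \<le> norm (d - of_real (eps * \<rho>) * (\<i> * ut t))" using \<rho> by (simp add: power2_le_iff_abs_le)
    then show ?thesis by (simp add: d_def algebra_simps)
  qed
  then have "\<forall>t eps. eps\<^sup>2 = 1 \<longrightarrow> ball (\<gamma> t + of_real (eps * \<rho>) * (\<i> * ut t)) \<rho> \<inter> path_image \<gamma> = {}"
    unfolding range_\<gamma>[symmetric] by (auto simp: dist_norm norm_minus_commute not_less[symmetric])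
  then show ?thesis using \<rho> by blast
qed

definition \<rho>0 :: real where
  "\<rho>0 = (SOME \<rho>. \<rho> > 0 \<and> (\<forall>t eps. eps\<^sup>2 = 1 \<longrightarrow> ball (\<gamma> t + of_real (eps * \<rho>) * (\<i> * ut t)) \<rho> \<inter> path_image \<gamma> = {}))"

lemma \<rho>0: "\<rho>0 > 0" "eps\<^sup>2 = 1 \<Longrightarrow> ball (\<gamma> t + of_real (eps * \<rho>0) * (\<i> * ut t)) \<rho>0 \<inter> path_image \<gamma> = {}"
  using someI_ex[OF tangent_ball_disjoint[unfolded Bex_def]] unfolding \<rho>0_def by blast+

lemma continuous_ut: "continuous_on A ut"
  unfolding ut_def sgn_eq[abs_def] by (intro continuous_intros continuous_vel) auto

text \<open>The centres form a connected set off the curve, so the side cannot change along the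
  curve.\<close>

lemma tangent_ball_side:
  assumes e: "eps\<^sup>2 = 1"
  shows "(\<forall>t. ball (\<gamma> t + of_real (eps * \<rho>0) * (\<i> * ut t)) \<rho>0 \<subseteq> interior \<Omega>) \<or>
         (\<forall>t. ball (\<gamma> t + of_real (eps * \<rho>0) * (\<i> * ut t)) \<rho>0 \<subseteq> - \<Omega>)"
proof -
  define c where "c t = \<gamma> t + of_real (eps * \<rho>0) * (\<i> * ut t)" for t
  have b: "ball (c t) \<rho>0 \<subseteq> interior \<Omega> \<or> ball (c t) \<rho>0 \<subseteq> - \<Omega>" for t
    using connected_cases[OF connected_ball] \<rho>0(2)[OF e] by (simp add: c_def)
  have cin: "c t \<in> ball (c t) \<rho>0" for t using \<rho>0(1) by simp
  have "continuous_on UNIV c" unfolding c_def by (intro continuous_intros continuous_\<gamma> continuous_ut)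
  then have "connected (range c)" by (intro connected_continuous_image) auto
  moreover have "range c \<inter> path_image \<gamma> = {}" using \<rho>0(2)[OF e, folded c_def] cin by blast
  ultimately have "range c \<subseteq> interior \<Omega> \<or> range c \<subseteq> - \<Omega>" by (rule connected_cases)
  then show ?thesis
  proof
    assume "range c \<subseteq> interior \<Omega>"
    then have "ball (c t) \<rho>0 \<subseteq> interior \<Omega>" for t using b[of t] cin[of t] interior_subset[of \<Omega>] by blast
    then show ?thesis by (simp add: c_def)
  next
    assume "range c \<subseteq> - \<Omega>"
    then have "ball (c t) \<rho>0 \<subseteq> - \<Omega>" for t using b[of t] cin[of t] interior_subset[of \<Omega>] by blast
    then show ?thesis by (simp add: c_def)
  qed
qed

text \<open>At the nearest curve point the difference to q is normal to the curve; since it is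
  shorter than the radius, it points into one of the two tangent balls there.\<close>

lemma near_curve_in_tangent_ball:
  assumes x: "x \<in> path_image \<gamma>" and q: "q \<notin> path_image \<gamma>" "dist q x < \<rho>0"
  shows "\<exists>t eps. eps\<^sup>2 = 1 \<and> q \<in> ball (\<gamma> t + of_real (eps * \<rho>0) * (\<i> * ut t)) \<rho>0"
proof -
  have cp: "compact (path_image \<gamma>)" using simple_\<gamma> compact_simple_path_image by blast
  obtain y where y: "y \<in> path_image \<gamma>" "\<And>z. z \<in> path_image \<gamma> \<Longrightarrow> dist q y \<le> dist q z"
  proof -
    have "continuous_on (path_image \<gamma>) (dist q)" by (intro continuous_intros)
    from continuous_attains_inf[OF cp C_ne this] that show thesis by blast
  qed
  obtain t where t: "y = \<gamma> t" using y(1) range_\<gamma> by blast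
  define \<delta> where "\<delta> = norm (q - \<gamma> t)"
  have \<delta>: "0 < \<delta>" "\<delta> < \<rho>0" using y(2)[OF x] q y(1) t by (auto simp: \<delta>_def dist_norm)
  define f where "f s = (norm (q - \<gamma> s))\<^sup>2" for s
  have fd: "(f has_real_derivative - 2 * Re (cnj (q - \<gamma> s) * vel s)) (at s)" for s
  proof -
    have "((\<lambda>s. (q - \<gamma> s) \<bullet> (q - \<gamma> s)) has_derivative (\<lambda>h. (q - \<gamma> s) \<bullet> (0 - h *\<^sub>R vel s) + (0 - h *\<^sub>R vel s) \<bullet> (q - \<gamma> s))) (at s)"
      using deriv_\<gamma>[of s] by (intro has_derivative_inner has_derivative_diff has_derivative_const) (auto simp: has_vector_derivative_def)
    moreover have "f = (\<lambda>s. (q - \<gamma> s) \<bullet> (q - \<gamma> s))" by (auto simp: f_def power2_norm_eq_inner)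
    ultimately show ?thesis unfolding has_field_derivative_def
      by (elim has_derivative_eq_rhs ssubst) (simp add: fun_eq_iff inner_complex_def algebra_simps)
  qed
  have "- 2 * Re (cnj (q - \<gamma> t) * vel t) = 0"
  proof (rule DERIV_local_min[OF fd, of 1])
    show "\<forall>s. \<bar>t - s\<bar> < 1 \<longrightarrow> f t \<le> f s"
      using y(2) t by (auto simp: f_def dist_norm intro!: power_mono)
  qed simp
  then have "Re (cnj (q - \<gamma> t) * vel t) = 0" by simp
  then have re: "Re ((q - \<gamma> t) * cnj (ut t)) = 0"
    by (simp add: ut_def sgn_eq algebra_simps add_divide_distrib[symmetric])
  define \<tau> where "\<tau> = Im ((q - \<gamma> t) * cnj (ut t))"
  have "(q - \<gamma> t) * cnj (ut t) = of_real \<tau> * \<i>" using re by (simp add: complex_eq_iff \<tau>_def)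
  then have "(q - \<gamma> t) * (cnj (ut t) * ut t) = of_real \<tau> * \<i> * ut t" by (metis mult.assoc)
  moreover have "cnj (ut t) * ut t = 1" using complex_mult_cnj_norm[of "ut t"] by (simp add: mult.commute)
  ultimately have q\<tau>: "q - \<gamma> t = of_real \<tau> * (\<i> * ut t)" by (simp add: mult.assoc)
  have \<tau>: "\<bar>\<tau>\<bar> = \<delta>" unfolding \<delta>_def q\<tau> by (simp add: norm_mult)
  define eps where "eps = sgn \<tau>"
  have "\<tau> \<noteq> 0" using \<tau> \<delta> by auto
  then have e: "eps\<^sup>2 = 1" "\<tau> = eps * \<delta>" using \<tau> by (auto simp: eps_def sgn_if)
  have "q - (\<gamma> t + of_real (eps * \<rho>0) * (\<i> * ut t)) = of_real (eps * (\<delta> - \<rho>0)) * (\<i> * ut t)"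
    using q\<tau> by (simp add: e(2) algebra_simps)
  then have "dist (\<gamma> t + of_real (eps * \<rho>0) * (\<i> * ut t)) q = \<bar>eps\<bar> * \<bar>\<delta> - \<rho>0\<bar>"
    by (simp add: dist_norm norm_minus_commute norm_mult abs_mult del: of_real_mult of_real_diff)
  also have "\<dots> < \<rho>0" using \<delta> e(1) by (auto simp: power2_eq_1_iff)
  finally show ?thesis using e(1) by (intro exI[of _ t] exI[of _ eps]) simp
qed

text \<open>The curve is the frontier of the interior and of the complement alike. Both sets have
  points close to \<gamma> 0, and such points lie in tangent balls; so the two families of balls
  cannot lie on the same side.\<close>

lemma opposite_sides: "\<exists>\<sigma>. \<sigma>\<^sup>2 = (1::real) \<and>
    (\<forall>t. ball (\<gamma> t + of_real (\<sigma> * \<rho>0) * (\<i> * ut t)) \<rho>0 \<subseteq> interior \<Omega>) \<and>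
    (\<forall>t. ball (\<gamma> t + of_real (- \<sigma> * \<rho>0) * (\<i> * ut t)) \<rho>0 \<subseteq> - \<Omega>)"
proof -
  define B where "B eps t = ball (\<gamma> t + of_real (eps * \<rho>0) * (\<i> * ut t)) \<rho>0" for eps t
  have side: "(\<forall>t. B eps t \<subseteq> interior \<Omega>) \<or> (\<forall>t. B eps t \<subseteq> - \<Omega>)" if "eps\<^sup>2 = 1" for eps
    using tangent_ball_side[OF that] by (simp add: B_def)
  have near: "\<exists>q t eps. q \<in> S \<and> eps\<^sup>2 = 1 \<and> q \<in> B eps t" if S: "open S" "frontier S = path_image \<gamma>" for S
  proof -
    have "\<gamma> 0 \<in> frontier S" using S(2) in_C[of 0] by simp
    then have "\<gamma> 0 \<in> closure S" by (simp add: frontier_def)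
    then obtain q where q: "q \<in> S" "dist q (\<gamma> 0) < \<rho>0" using \<rho>0(1) unfolding closure_approachable by blast
    moreover have "q \<notin> path_image \<gamma>" using q S by (metis frontier_def DiffE interior_open)
    ultimately obtain t eps where "eps\<^sup>2 = 1" "q \<in> B eps t" using near_curve_in_tangent_ball[of "\<gamma> 0" q] in_C[of 0] unfolding B_def by blast
    then show ?thesis using q(1) by blast
  qed
  have not1: "\<not> (\<forall>eps t. eps\<^sup>2 = 1 \<longrightarrow> B eps t \<subseteq> interior \<Omega>)"
    using near[of "- \<Omega>"] frontier_outside closed_\<Omega> interior_subset[of \<Omega>] by blast
  have not2: "\<not> (\<forall>eps t. eps\<^sup>2 = 1 \<longrightarrow> B eps t \<subseteq> - \<Omega>)"
    using near[of "interior \<Omega>"] frontier_inside interior_subset[of \<Omega>] by blast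
  have pm: "eps\<^sup>2 = 1 \<longleftrightarrow> eps = 1 \<or> eps = -1" for eps :: real by (rule power2_eq_1_iff)
  have "((\<forall>t. B 1 t \<subseteq> interior \<Omega>) \<and> (\<forall>t. B (-1) t \<subseteq> - \<Omega>)) \<or> ((\<forall>t. B (-1) t \<subseteq> interior \<Omega>) \<and> (\<forall>t. B 1 t \<subseteq> - \<Omega>))"
    using side[of 1] side[of "-1"] not1 not2 unfolding pm by auto
  then show ?thesis
  proof
    assume "(\<forall>t. B 1 t \<subseteq> interior \<Omega>) \<and> (\<forall>t. B (-1) t \<subseteq> - \<Omega>)"
    then show ?thesis by (intro exI[of _ 1]) (simp add: B_def)
  next
    assume "(\<forall>t. B (-1) t \<subseteq> interior \<Omega>) \<and> (\<forall>t. B 1 t \<subseteq> - \<Omega>)"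
    then show ?thesis by (intro exI[of _ "-1"]) (simp add: B_def)
  qed
qed

text \<open>\<open>\<sigma> = 1\<close> if the curve runs counterclockwise around \<open>\<Omega>\<close> and \<open>\<sigma> = -1\<close> otherwise; \<open>nrm\<close> is the inner unit normal.\<close>

definition \<sigma> :: real where "\<sigma> = (SOME \<sigma>. \<sigma>\<^sup>2 = 1 \<and>
    (\<forall>t. ball (\<gamma> t + of_real (\<sigma> * \<rho>0) * (\<i> * ut t)) \<rho>0 \<subseteq> interior \<Omega>) \<and>
    (\<forall>t. ball (\<gamma> t + of_real (- \<sigma> * \<rho>0) * (\<i> * ut t)) \<rho>0 \<subseteq> - \<Omega>))"

definition nrm :: "real \<Rightarrow> complex" where "nrm t = of_real \<sigma> * (\<i> * ut t)"

lemma \<sigma>2: "\<sigma>\<^sup>2 = 1"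
  and inner_ball: "ball (\<gamma> t + of_real \<rho>0 * nrm t) \<rho>0 \<subseteq> interior \<Omega>"
  and outer_ball: "ball (\<gamma> t - of_real \<rho>0 * nrm t) \<rho>0 \<subseteq> - \<Omega>"
  using someI_ex[OF opposite_sides] unfolding \<sigma>_def[symmetric] nrm_def by (simp_all add: mult_ac)

lemma \<sigma>_cases: "\<sigma> = 1 \<or> \<sigma> = -1" using \<sigma>2 by (simp add: power2_eq_1_iff)

lemma norm_nrm [simp]: "norm (nrm t) = 1" using \<sigma>_cases by (auto simp: nrm_def norm_mult)

lemma continuous_nrm: "continuous_on A nrm"
  unfolding nrm_def by (intro continuous_intros continuous_ut)

lemma nrm_measurable [measurable]: "nrm \<in> borel_measurable borel"
  using continuous_nrm by (rule borel_measurable_continuous_onI)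

text \<open>Hopf's argument from a lowest point \<gamma> s: all chords from it point into the closed
  upper half plane, so their angle stays in an interval of length pi. As \<open>rot\<close> is an
  odd multiple of pi, only the sign remains, and the tangent at the lowest point decides it.\<close>

lemma rot_eq: "rot = \<sigma> * pi"
proof -
  have "continuous_on {0..1} (\<lambda>t. Im (\<gamma> t))" by (intro continuous_intros continuous_\<gamma>)
  from continuous_attains_inf[OF _ _ this]
  obtain s where s: "\<And>t. t \<in> {0..1} \<Longrightarrow> Im (\<gamma> s) \<le> Im (\<gamma> t)" by fastforce
  then have min: "Im (\<gamma> s) \<le> Im (\<gamma> t)" for t
    using s[of "frac t"] frac_ge_0[of t] frac_lt_1[of t] \<gamma>_frac[of t] by simp
  have "((\<lambda>t. Im (\<gamma> t)) has_real_derivative Im (vel s)) (at s)"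
    using bounded_linear.has_vector_derivative[OF bounded_linear_Im deriv_\<gamma>[of s]]
    by (simp add: has_real_derivative_iff_has_vector_derivative)
  then have "Im (vel s) = 0" by (rule DERIV_local_min[of _ _ _ 1]) (use min in auto)
  then have Imu: "Im (ut s) = 0" by (simp add: ut_def sgn_eq)
  then have "(Re (ut s))\<^sup>2 = 1" using cmod_power2[of "ut s"] by simp
  then have Reu: "Re (ut s) = 1 \<or> Re (ut s) = -1" by (simp add: power2_eq_1_iff)
  \<comment> \<open>This half plane is connected, misses the curve and is unbounded. The inner
    normal at the lowest point therefore points upwards, which forces the tangent there to be
    \<sigma>.\<close>
  have below: "{z. Im z < Im (\<gamma> s)} \<subseteq> - \<Omega>"
  proof -
    have "{z. Im z < Im (\<gamma> s)} \<inter> path_image \<gamma> = {}"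
    proof -
      have "\<not> Im (\<gamma> t) < Im (\<gamma> s)" for t using min[of t] by simp
      then show ?thesis unfolding range_\<gamma>[symmetric] by auto
    qed
    moreover have "connected {z. Im z < Im (\<gamma> s)}" by (intro convex_connected convex_halfspace_Im_lt)
    ultimately have "{z. Im z < Im (\<gamma> s)} \<subseteq> interior \<Omega> \<or> {z. Im z < Im (\<gamma> s)} \<subseteq> - \<Omega>" by (intro connected_cases)
    moreover have "\<not> {z. Im z < Im (\<gamma> s)} \<subseteq> interior \<Omega>"
    proof
      assume "{z. Im z < Im (\<gamma> s)} \<subseteq> interior \<Omega>"
      then have "{z. Im z < Im (\<gamma> s)} \<subseteq> \<Omega>" using interior_subset by blast
      then have "bounded {z. Im z < Im (\<gamma> s)}" using compact_imp_bounded[OF compact_\<Omega>] bounded_subset by blast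
      then obtain B where B: "\<And>z. Im z < Im (\<gamma> s) \<Longrightarrow> norm z \<le> B" unfolding bounded_iff by auto
      have "norm (Complex (\<bar>B\<bar> + 1) (Im (\<gamma> s) - 1)) \<ge> \<bar>B\<bar> + 1" using abs_Re_le_cmod[of "Complex (\<bar>B\<bar> + 1) (Im (\<gamma> s) - 1)"] by simp
      then show False using B[of "Complex (\<bar>B\<bar> + 1) (Im (\<gamma> s) - 1)"] by simp
    qed
    ultimately show ?thesis by blast
  qed
  have "\<gamma> s + of_real \<rho>0 * nrm s \<in> interior \<Omega>" using inner_ball[of s] \<rho>0(1) by (meson centre_in_ball subsetD)
  then have "\<not> Im (\<gamma> s + of_real \<rho>0 * nrm s) < Im (\<gamma> s)" using below interior_subset[of \<Omega>] by blast
  then have "\<not> \<rho>0 * (\<sigma> * Re (ut s)) < 0" by (simp add: nrm_def)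
  then have "\<sigma> * Re (ut s) \<ge> 0" using \<rho>0(1) mult_pos_neg not_less by metis
  then have us: "Re (ut s) = \<sigma>" using Reu \<sigma>_cases by auto
  have sin: "sin (ang (s,t)) \<ge> 0" if t: "t \<in> {s..s+1}" for t
  proof -
    consider "t = s" | "t = s + 1" | "s < t" "t < s + 1" using t by fastforce
    then show ?thesis
    proof cases
      case 1 then show ?thesis using cis_ang_diag[of s] Imu by (metis cis.simps(2) order_refl)
    next
      case 2
      then have "cis (ang (s,t)) = - ut s" by (simp add: cis_ang sgn_minus ut_def)
      then show ?thesis using Imu by (metis cis.simps(2) order_refl uminus_complex.simps(2) neg_0_equal_iff_equal)
    next
      case 3
      then have "cis (ang (s,t)) = sgn (\<gamma> t - \<gamma> s)" by (simp add: cis_ang sgn_chord)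
      then have "sin (ang (s,t)) = Im (sgn (\<gamma> t - \<gamma> s))" by (metis cis.simps(2))
      then show ?thesis using min[of t] by (simp add: sgn_eq)
    qed
  qed
  \<comment> \<open>The direction angle of the horizontal tangent at the lowest point, normalized to
    [0, pi].\<close>
  define a0 where "a0 = (if \<sigma> = 1 then 0 else pi)"
  have "cis (ang (s,s)) = cis a0"
    unfolding cis_ang_diag using us Imu \<sigma>_cases by (auto simp: a0_def complex_eq_iff)
  then obtain k :: int where k: "ang (s,s) = a0 + 2 * pi * k" using cis_eq_cis_iff by blast
  define f where "f t = ang (s,t) - 2 * pi * k" for t
  have "0 \<le> f (s+1) \<and> f (s+1) \<le> pi"
  proof (rule continuous_sin_nonneg_stays[of s "s+1" f])
    show "continuous_on {s..s+1} f" unfolding f_def by (intro continuous_intros continuous_ang_snd)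
    show "sin (f x) \<ge> 0" if "x \<in> {s..s+1}" for x
    proof -
      have "cis (f x) = cis (ang (s,x))" unfolding cis_eq_cis_iff by (intro exI[of _ "-k"]) (simp add: f_def)
      then have "sin (f x) = sin (ang (s,x))" by (metis cis.simps(2))
      then show ?thesis using sin[OF that] by simp
    qed
    show "0 \<le> f s" "f s \<le> pi" using k by (auto simp: f_def a0_def)
  qed simp
  moreover have "f (s+1) = a0 + rot" using k ang_swap[of s s] by (simp add: f_def)
  ultimately have r: "- a0 \<le> rot" "rot \<le> pi - a0" by auto
  have "cis rot = cis pi" by (simp add: cis_rot cis_pi)
  then obtain j :: int where j: "rot = pi + 2 * pi * j" using cis_eq_cis_iff by blast
  have j': "rot = pi * (1 + 2 * real_of_int j)" using j by (simp add: algebra_simps)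
  show ?thesis
  proof (cases "\<sigma> = 1")
    case True
    then have "0 \<le> rot" "rot \<le> pi" using r by (auto simp: a0_def)
    then have "0 \<le> 1 + 2 * real_of_int j" "1 + 2 * real_of_int j \<le> 1"
      using pi_gt_zero unfolding j' by (auto simp: zero_le_mult_iff)
    then have "j = 0" by linarith
    then show ?thesis using j True by simp
  next
    case False
    then have "-pi \<le> rot" "rot \<le> 0" using r by (auto simp: a0_def)
    then have "1 + 2 * real_of_int j \<le> 0" "pi * (-1) \<le> pi * (1 + 2 * real_of_int j)"
      using pi_gt_zero unfolding j' by (auto simp: mult_le_0_iff)
    then have "1 + 2 * real_of_int j \<le> 0" "-1 \<le> 1 + 2 * real_of_int j" using pi_gt_zero mult_le_cancel_left_pos by blast+
    then have "j = -1" by linarith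
    then show ?thesis using j False \<sigma>_cases by simp
  qed
qed

end

lemma cball_scaled: "\<rho> \<ge> 0 \<Longrightarrow> cball c \<rho> = (\<lambda>u. c + of_real \<rho> * u) ` cball 0 1" for c :: complex
proof (cases "\<rho> = 0")
  case True
  moreover have "cball (0::complex) 1 \<noteq> {}" by simp
  ultimately show ?thesis by (simp add: image_constant_conv)
next
  case False
  assume "\<rho> \<ge> 0"
  show ?thesis
  proof (intro set_eqI iffI)
    fix z assume "z \<in> cball c \<rho>"
    then show "z \<in> (\<lambda>u. c + of_real \<rho> * u) ` cball 0 1"
      using False \<open>\<rho> \<ge> 0\<close>
      by (intro image_eqI[of _ _ "(z - c) / of_real \<rho>"]) (auto simp: dist_norm norm_divide norm_minus_commute)
  next
    fix z assume "z \<in> (\<lambda>u. c + of_real \<rho> * u) ` cball 0 1"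
    then show "z \<in> cball c \<rho>" using \<open>\<rho> \<ge> 0\<close> by (auto simp: dist_norm norm_mult mult_left_le)
  qed
qed

text \<open>Each fixed point u of the unit disc gives the closed condition that c x + r x * u lies
  in \<open>S\<close>; the inclusion is the intersection of these conditions.\<close>

lemma closed_cball_subset:
  fixes c :: "'a::topological_space \<Rightarrow> complex"
  assumes "continuous_on UNIV c" "continuous_on UNIV r" "closed S"
  shows "closed {x. 0 \<le> r x \<and> cball (c x) (r x) \<subseteq> S}"
proof -
  have "{x. 0 \<le> r x \<and> cball (c x) (r x) \<subseteq> S} = {x. 0 \<le> r x} \<inter> (\<Inter>u\<in>cball 0 1. (\<lambda>x. c x + of_real (r x) * u) -` S)"
    (is "?A = ?B")
  proof (intro set_eqI)
    fix x show "x \<in> ?A \<longleftrightarrow> x \<in> ?B"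
    proof (cases "0 \<le> r x")
      case True
      then show ?thesis unfolding mem_Collect_eq by (subst cball_scaled[OF True]) blast
    qed simp
  qed
  moreover have "closed ((\<lambda>x. c x + of_real (r x) * u) -` S)" for u
    by (intro closed_vimage assms continuous_intros)
  moreover have "closed {x. 0 \<le> r x}" by (intro closed_Collect_le continuous_on_const assms)
  ultimately show ?thesis by (simp only:) (intro closed_Int closed_INT ballI)
qed

section \<open>The largest inner tangent discs\<close>

context C2_domain
begin

abbreviation tball :: "real \<Rightarrow> real \<Rightarrow> complex set" where
  "tball t \<rho> \<equiv> cball (\<gamma> t + of_real \<rho> * nrm t) \<rho>"

lemma norm_diff_nrm: "(norm (y - of_real \<rho> * nrm t))\<^sup>2 = (norm y)\<^sup>2 - 2 * \<rho> * (y \<bullet> nrm t) + \<rho>\<^sup>2"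
proof -
  have n: "(Re (nrm t))\<^sup>2 + (Im (nrm t))\<^sup>2 = 1" using cmod_power2[of "nrm t"] by simp
  have "(norm (y - of_real \<rho> * nrm t))\<^sup>2 = (norm y)\<^sup>2 - 2 * \<rho> * (y \<bullet> nrm t) + \<rho>\<^sup>2 * ((Re (nrm t))\<^sup>2 + (Im (nrm t))\<^sup>2)"
    unfolding cmod_power2 by (simp add: inner_complex_def power2_eq_square algebra_simps)
  then show ?thesis unfolding n by simp
qed

lemma in_tball_iff: assumes "\<rho> \<ge> 0" shows "\<gamma> t + y \<in> tball t \<rho> \<longleftrightarrow> (norm y)\<^sup>2 \<le> 2 * \<rho> * (y \<bullet> nrm t)"
proof -
  have "\<gamma> t + y \<in> tball t \<rho> \<longleftrightarrow> norm (y - of_real \<rho> * nrm t) \<le> \<rho>"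
    by (simp add: dist_norm norm_minus_commute)
  also have "\<dots> \<longleftrightarrow> (norm (y - of_real \<rho> * nrm t))\<^sup>2 \<le> \<rho>\<^sup>2"
    using assms by (simp add: power2_le_iff_abs_le)
  finally show ?thesis by (simp add: norm_diff_nrm)
qed

lemma in_ball_iff: assumes "\<rho> > 0" shows "\<gamma> t + y \<in> ball (\<gamma> t + of_real \<rho> * nrm t) \<rho> \<longleftrightarrow> (norm y)\<^sup>2 < 2 * \<rho> * (y \<bullet> nrm t)"
proof -
  have "\<gamma> t + y \<in> ball (\<gamma> t + of_real \<rho> * nrm t) \<rho> \<longleftrightarrow> norm (y - of_real \<rho> * nrm t) < \<rho>"
    by (simp add: dist_norm norm_minus_commute)
  also have "\<dots> \<longleftrightarrow> (norm (y - of_real \<rho> * nrm t))\<^sup>2 < \<rho>\<^sup>2"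
    using assms by (metis less_imp_le norm_ge_zero power2_less_imp_less power_strict_mono pos2)
  finally show ?thesis by (simp add: norm_diff_nrm)
qed

lemma tball_mono: assumes "0 \<le> \<rho>'" "\<rho>' \<le> \<rho>" shows "tball t \<rho>' \<subseteq> tball t \<rho>"
proof
  fix z assume z: "z \<in> tball t \<rho>'"
  define y where "y = z - \<gamma> t"
  have zy: "z = \<gamma> t + y" by (simp add: y_def)
  have 1: "(norm y)\<^sup>2 \<le> 2 * \<rho>' * (y \<bullet> nrm t)" using z in_tball_iff[OF assms(1)] unfolding zy by blast
  have "2 * \<rho>' * (y \<bullet> nrm t) \<le> 2 * \<rho> * (y \<bullet> nrm t)"
  proof (cases "\<rho>' = 0")
    case True
    then have "y = 0" using 1 by simp
    then show ?thesis by simp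
  next
    case False
    then have "0 \<le> y \<bullet> nrm t" using 1 assms(1) by (smt (verit) mult_nonneg_nonpos mult_pos_neg zero_le_power2)
    then show ?thesis using assms by (intro mult_right_mono) auto
  qed
  then have "(norm y)\<^sup>2 \<le> 2 * \<rho> * (y \<bullet> nrm t)" using 1 by linarith
  then show "z \<in> tball t \<rho>" using in_tball_iff[of \<rho> t y] assms unfolding zy by linarith
qed

lemma tball_strict: assumes "0 \<le> \<rho>'" "\<rho>' < \<rho>" shows "tball t \<rho>' - {\<gamma> t} \<subseteq> ball (\<gamma> t + of_real \<rho> * nrm t) \<rho>"
proof
  fix z assume z: "z \<in> tball t \<rho>' - {\<gamma> t}"
  define y where "y = z - \<gamma> t"
  have zy: "z = \<gamma> t + y" and y0: "y \<noteq> 0" using z by (auto simp: y_def)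
  have 1: "(norm y)\<^sup>2 \<le> 2 * \<rho>' * (y \<bullet> nrm t)" using z in_tball_iff[OF assms(1)] unfolding zy by blast
  have "(norm y)\<^sup>2 > 0" using y0 by simp
  with 1 have "0 < 2 * \<rho>' * (y \<bullet> nrm t)" by linarith
  then have "0 < y \<bullet> nrm t" using assms(1) by (simp add: zero_less_mult_iff)
  then have "2 * \<rho>' * (y \<bullet> nrm t) < 2 * \<rho> * (y \<bullet> nrm t)" using assms by (intro mult_strict_right_mono) auto
  then have "(norm y)\<^sup>2 < 2 * \<rho> * (y \<bullet> nrm t)" using 1 by linarith
  then show "z \<in> ball (\<gamma> t + of_real \<rho> * nrm t) \<rho>" using in_ball_iff[of \<rho> t y] assms unfolding zy by linarith
qed

definition good :: "(real \<times> real) set" where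
  "good = {p. 0 \<le> snd p \<and> tball (fst p) (snd p) \<subseteq> \<Omega>}"

lemma closed_good: "closed good"
  unfolding good_def
  by (intro closed_cball_subset closed_\<Omega> continuous_intros continuous_on_compose2[OF continuous_\<gamma>[of UNIV]] continuous_on_compose2[OF continuous_nrm[of UNIV]]) auto

definition \<Omega>rad :: real where "\<Omega>rad = (SOME R. R > 0 \<and> \<Omega> \<subseteq> cball 0 R)"

lemma \<Omega>rad: "\<Omega>rad > 0" "\<Omega> \<subseteq> cball 0 \<Omega>rad"
proof -
  obtain R where "R > 0" "\<Omega> \<subseteq> ball 0 R"
    using bounded_subset_ballD[OF compact_imp_bounded[OF compact_\<Omega>], of 0] by blast
  then have "\<exists>R. R > 0 \<and> \<Omega> \<subseteq> cball 0 R" using ball_subset_cball by blast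
  from someI_ex[OF this] show "\<Omega>rad > 0" "\<Omega> \<subseteq> cball 0 \<Omega>rad" unfolding \<Omega>rad_def by blast+
qed

lemma cball_radius_le: assumes "cball c r \<subseteq> \<Omega>" "r \<ge> 0" shows "r \<le> \<Omega>rad"
proof -
  have "cball c r \<subseteq> cball 0 \<Omega>rad" using assms \<Omega>rad by blast
  then show ?thesis using assms(2) unfolding cball_subset_cball_iff by (smt (verit) zero_le_dist)
qed

text \<open>The radius of the largest disc in \<open>\<Omega>\<close> touching the curve at \<open>\<gamma> t\<close>.\<close>

definition maxrad :: "real \<Rightarrow> real" where "maxrad t = Sup {\<rho>. (t,\<rho>) \<in> good}"

lemma \<rho>0_good: "(t, \<rho>0) \<in> good"
proof -
  have "closure (ball (\<gamma> t + of_real \<rho>0 * nrm t) \<rho>0) \<subseteq> closure \<Omega>"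
    using inner_ball[of t] interior_subset[of \<Omega>] by (intro closure_mono) auto
  then show ?thesis using \<rho>0(1) closed_\<Omega> by (simp add: good_def)
qed

lemma good_iff: "(t,\<rho>) \<in> good \<longleftrightarrow> 0 \<le> \<rho> \<and> \<rho> \<le> maxrad t"
proof -
  let ?S = "{\<rho>. (t,\<rho>) \<in> good}"
  have bdd: "bdd_above ?S" using cball_radius_le by (intro bdd_aboveI[of _ \<Omega>rad]) (auto simp: good_def)
  have ne: "?S \<noteq> {}" using \<rho>0_good by blast
  have "closed ((\<lambda>\<rho>. (t,\<rho>)) -` good)"
    by (rule continuous_closed_vimage[OF closed_good]) (intro continuous_intros)
  then have "closed ?S" by (simp add: vimage_def)
  from closed_contains_Sup[OF ne bdd this] have "(t, maxrad t) \<in> good" by (simp add: maxrad_def)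
  then have top: "tball t (maxrad t) \<subseteq> \<Omega>" by (simp add: good_def)
  show ?thesis
  proof
    assume "(t,\<rho>) \<in> good"
    then show "0 \<le> \<rho> \<and> \<rho> \<le> maxrad t" unfolding maxrad_def using bdd by (auto simp: good_def intro!: cSup_upper)
  next
    assume r: "0 \<le> \<rho> \<and> \<rho> \<le> maxrad t"
    then have "tball t \<rho> \<subseteq> \<Omega>" using tball_mono[of \<rho> "maxrad t" t] top by blast
    then show "(t,\<rho>) \<in> good" using r by (simp add: good_def)
  qed
qed

lemma tball_subset: "0 \<le> \<rho> \<Longrightarrow> \<rho> \<le> maxrad t \<Longrightarrow> tball t \<rho> \<subseteq> \<Omega>" using good_iff by (auto simp: good_def)

lemma maxrad_ge: "\<rho>0 \<le> maxrad t" using \<rho>0_good good_iff by blast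
lemma maxrad_pos: "0 < maxrad t" using maxrad_ge[of t] \<rho>0(1) by simp
lemma maxrad_le: "maxrad t \<le> \<Omega>rad"
  using cball_radius_le[OF tball_subset[of "maxrad t" t]] maxrad_pos[of t] by simp

text \<open>Superlevel sets are slices of the closed set \<open>good\<close>. Replacing c by max c 0
  accounts for \<open>good\<close> containing nonnegative radii only.\<close>

lemma maxrad_measurable [measurable]: "maxrad \<in> borel_measurable borel"
proof (rule borel_measurableI_ge)
  fix c :: real
  have "{t \<in> space borel. c \<le> maxrad t} = {t. (t, max c 0) \<in> good}"
    using maxrad_pos by (auto simp: good_iff less_imp_le)
  also have "\<dots> = (\<lambda>t. (t, max c 0)) -` good" by auto
  also have "closed \<dots>" by (rule continuous_closed_vimage[OF closed_good]) (intro continuous_intros)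
  finally show "{t \<in> space borel. c \<le> maxrad t} \<in> sets borel" by (rule borel_closed)
qed

lemma ball_subset_interior: "cball c r \<subseteq> \<Omega> \<Longrightarrow> ball c r \<subseteq> interior \<Omega>"
  by (rule interior_maximal) (use ball_subset_cball in blast, simp)

lemma not_in_ball: "cball c r \<subseteq> \<Omega> \<Longrightarrow> r \<le> dist c (\<gamma> t)"
proof -
  assume "cball c r \<subseteq> \<Omega>"
  from ball_subset_interior[OF this] have "\<gamma> t \<notin> ball c r" using interior_disjoint in_C by blast
  then show ?thesis by simp
qed

text \<open>Away from its touching point a smaller tangent disc lies in the open interior of the
  maximal one, and no curve point can be there.\<close>

lemma touch_unique: assumes "0 \<le> \<rho>" "\<rho> < maxrad t" "\<gamma> s \<in> tball t \<rho>" shows "\<gamma> s = \<gamma> t"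
proof (rule ccontr)
  assume "\<gamma> s \<noteq> \<gamma> t"
  then have "\<gamma> s \<in> ball (\<gamma> t + of_real (maxrad t) * nrm t) (maxrad t)" using tball_strict[OF assms(1,2)] assms(3) by blast
  then show False using not_in_ball[OF tball_subset[of "maxrad t" t]] maxrad_pos[of t] by (simp add: not_le[symmetric])
qed

lemma dist_square_deriv:
  "((\<lambda>s. (norm (\<gamma> s - c))\<^sup>2) has_real_derivative 2 * Re (cnj (\<gamma> s - c) * vel s)) (at s)"
proof -
  have "((\<lambda>s. (\<gamma> s - c) \<bullet> (\<gamma> s - c)) has_derivative (\<lambda>h. (\<gamma> s - c) \<bullet> (h *\<^sub>R vel s - 0) + (h *\<^sub>R vel s - 0) \<bullet> (\<gamma> s - c))) (at s)"
    using deriv_\<gamma>[of s] by (intro has_derivative_inner has_derivative_diff has_derivative_const) (auto simp: has_vector_derivative_def)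
  then show ?thesis unfolding has_field_derivative_def power2_norm_eq_inner
    by (elim has_derivative_eq_rhs) (simp add: fun_eq_iff inner_complex_def algebra_simps)
qed

lemma orthogonal_tangent:
  assumes "Re (cnj q * vel t) = 0"
  obtains \<tau> where "q = of_real \<tau> * nrm t" "\<bar>\<tau>\<bar> = norm q"
proof -
  have re: "Re (q * cnj (ut t)) = 0" using assms by (simp add: ut_def sgn_eq algebra_simps add_divide_distrib[symmetric])
  define \<tau> where "\<tau> = Im (q * cnj (ut t))"
  have "q * cnj (ut t) = of_real \<tau> * \<i>" using re by (simp add: complex_eq_iff \<tau>_def)
  then have "q * (cnj (ut t) * ut t) = of_real \<tau> * \<i> * ut t" by (metis mult.assoc)
  moreover have "cnj (ut t) * ut t = 1" using complex_mult_cnj_norm[of "ut t"] by (simp add: mult.commute)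
  ultimately have "q = of_real \<tau> * (\<i> * ut t)" by (simp add: mult.assoc)
  then have q: "q = of_real (\<sigma> * \<tau>) * nrm t" using \<sigma>_cases by (auto simp: nrm_def)
  then have "\<bar>\<sigma> * \<tau>\<bar> = norm q" by (simp add: norm_mult abs_mult)
  then show thesis using that q by blast
qed

text \<open>The distance to c is minimal at t, so c lies on the normal line. On the outer side the
  disc would contain points of the outer tangent ball, which lie outside \<Omega>.\<close>

lemma tangency:
  assumes c: "cball c r \<subseteq> \<Omega>" and r: "r > 0" and d: "dist c (\<gamma> t) = r"
  shows "c = \<gamma> t + of_real r * nrm t"
proof -
  have "2 * Re (cnj (\<gamma> t - c) * vel t) = 0"
  proof (rule DERIV_local_min[OF dist_square_deriv, of 1])
    show "\<forall>s. \<bar>t - s\<bar> < 1 \<longrightarrow> (norm (\<gamma> t - c))\<^sup>2 \<le> (norm (\<gamma> s - c))\<^sup>2"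
      using not_in_ball[OF c] d by (auto simp: dist_norm norm_minus_commute intro!: power_mono)
  qed simp
  then obtain \<tau> where \<tau>: "\<gamma> t - c = of_real \<tau> * nrm t" "\<bar>\<tau>\<bar> = norm (\<gamma> t - c)" using orthogonal_tangent by (metis mult_eq_0_iff zero_neq_numeral)
  have "\<bar>\<tau>\<bar> = r" using \<tau>(2) d by (simp add: dist_norm norm_minus_commute)
  moreover have "\<tau> \<noteq> r"
  proof
    assume "\<tau> = r"
    then have ce: "c = \<gamma> t - of_real r * nrm t" using \<tau>(1) by (simp add: algebra_simps)
    define \<delta> where "\<delta> = min r \<rho>0"
    have \<delta>: "0 < \<delta>" "\<delta> \<le> r" "\<delta> \<le> \<rho>0" using r \<rho>0(1) by (auto simp: \<delta>_def)
    define p where "p = \<gamma> t - of_real \<delta> * nrm t"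
    have "dist c p = \<bar>\<delta> - r\<bar>"
    proof -
      have "c - p = of_real (\<delta> - r) * nrm t" by (simp add: ce p_def algebra_simps)
      then show ?thesis by (simp add: dist_norm norm_mult del: of_real_diff)
    qed
    then have "p \<in> \<Omega>" using c \<delta> by auto
    moreover have "dist (\<gamma> t - of_real \<rho>0 * nrm t) p = \<bar>\<delta> - \<rho>0\<bar>"
    proof -
      have "(\<gamma> t - of_real \<rho>0 * nrm t) - p = of_real (\<delta> - \<rho>0) * nrm t" by (simp add: p_def algebra_simps)
      then show ?thesis by (simp add: dist_norm norm_mult del: of_real_diff)
    qed
    then have "p \<in> ball (\<gamma> t - of_real \<rho>0 * nrm t) \<rho>0" using \<delta> by simp
    then have "p \<in> - \<Omega>" using outer_ball[of t] by blast
    ultimately show False by blast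
  qed
  ultimately have "\<tau> = - r" by linarith
  then show ?thesis using \<tau>(1) by (simp add: algebra_simps)
qed

lemma ut_deriv: "(ut has_vector_derivative of_real (turn t) * (\<i> * ut t)) (at t)"
  using has_vector_derivative_cis[OF ang_deriv_diag] by (simp add: cis_ang_diag scaleR_conv_of_real)

lemma nrm_deriv: "(nrm has_vector_derivative - of_real (\<sigma> * turn t) * ut t) (at t)"
proof -
  have "((\<lambda>t. of_real \<sigma> * \<i> * ut t) has_vector_derivative of_real \<sigma> * \<i> * (of_real (turn t) * (\<i> * ut t))) (at t)"
    by (rule has_vector_derivative_mult_right[OF ut_deriv])
  moreover have "nrm = (\<lambda>t. of_real \<sigma> * \<i> * ut t)" by (auto simp: nrm_def)
  moreover have "of_real \<sigma> * \<i> * (of_real (turn t) * (\<i> * ut t)) = - of_real (\<sigma> * turn t) * ut t" by (simp add: complex_eq_iff)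
  ultimately show ?thesis by metis
qed

lemma vel_polar: "vel t = of_real (norm (vel t)) * ut t" by (simp add: ut_def sgn_eq)

text \<open>The squared distance from the curve to the centre is minimal at t, and its second
  derivative there is 2 \<open>norm (vel t)\<close> times this difference. Geometrically, an inner
  tangent disc is no larger than the osculating one. The difference is the speed of the centre when
  t varies with \<rho> fixed, and later a factor of the Jacobian.\<close>

lemma offset_speed_nonneg:
  assumes \<rho>: "0 \<le> \<rho>" "\<rho> \<le> maxrad t" shows "0 \<le> norm (vel t) - \<sigma> * turn t * \<rho>"
proof -
  define c where "c = \<gamma> t + of_real \<rho> * nrm t"
  define f' where "f' s = 2 * Re (cnj (\<gamma> s - c) * vel s)" for s
  define D where "D = 2 * ((norm (vel t))\<^sup>2 + Re (cnj (\<gamma> t - c) * acc t))"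
  have "((\<lambda>s. cnj (\<gamma> s - c) * vel s) has_vector_derivative (cnj (\<gamma> t - c) * acc t + cnj (vel t - 0) * vel t)) (at t)"
    by (intro has_vector_derivative_mult deriv_vel bounded_linear.has_vector_derivative[OF bounded_linear_cnj]
        has_vector_derivative_diff deriv_\<gamma> has_vector_derivative_const)
  from bounded_linear.has_vector_derivative[OF bounded_linear_Re this]
  have "((\<lambda>s. 2 * Re (cnj (\<gamma> s - c) * vel s)) has_vector_derivative 2 * Re (cnj (\<gamma> t - c) * acc t + cnj (vel t - 0) * vel t)) (at t)"
    by (rule has_vector_derivative_mult_right)
  moreover have "2 * Re (cnj (\<gamma> t - c) * acc t + cnj (vel t - 0) * vel t) = D"
    unfolding D_def cmod_power2 by (simp add: power2_eq_square)
  ultimately have "(f' has_real_derivative D) (at t)" unfolding f'_def[abs_def] has_real_derivative_iff_has_vector_derivative by metis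
  moreover have "(norm (\<gamma> t - c))\<^sup>2 \<le> (norm (\<gamma> s - c))\<^sup>2" for s
  proof -
    have "norm (\<gamma> t - c) = \<rho>" using \<rho> by (simp add: c_def norm_mult)
    moreover have "\<rho> \<le> norm (\<gamma> s - c)" using not_in_ball[OF tball_subset[OF \<rho>]] by (simp add: c_def dist_norm norm_minus_commute)
    ultimately show ?thesis using \<rho> by (intro power_mono) auto
  qed
  ultimately have D0: "D \<ge> 0"
    using second_derivative_nonneg_at_min(2)[of "\<lambda>s. (norm (\<gamma> s - c))\<^sup>2" f' D t] dist_square_deriv unfolding f'_def by blast
  have Re0: "Re (cnj (\<gamma> t - c) * acc t) = - (\<rho> * \<sigma> * turn t * norm (vel t))"
  proof -
    have gc: "\<gamma> t - c = - (of_real (\<rho> * \<sigma>) * (\<i> * ut t))" by (simp add: c_def nrm_def)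
    have 1: "Re (cnj (\<gamma> t - c) * acc t) = - (\<rho> * \<sigma> * Im (cnj (ut t) * acc t))"
      unfolding gc by (simp add: algebra_simps)
    have "turn t * norm (vel t) = Im (cnj (ut t) * acc t)"
    proof -
      have "vel t * cnj (vel t) = of_real ((norm (vel t))\<^sup>2)" by (rule complex_mult_cnj_norm)
      then have "acc t / vel t = acc t * cnj (vel t) / of_real ((norm (vel t))\<^sup>2)" by (simp add: complex_div_cnj[of "acc t"])
      also have "\<dots> = (cnj (ut t) * acc t) / of_real (norm (vel t))" by (simp add: ut_def sgn_eq power2_eq_square)
      finally have "turn t = Im (cnj (ut t) * acc t) / norm (vel t)" unfolding turn_def by (simp only: Im_divide_of_real)
      then show ?thesis by simp
    qed
    then show ?thesis unfolding 1 by (simp add: mult_ac)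
  qed
  have "0 \<le> norm (vel t) * (norm (vel t) - \<sigma> * turn t * \<rho>)"
    using D0 unfolding D_def Re0 by (simp add: power2_eq_square algebra_simps)
  then show ?thesis by (simp add: zero_le_mult_iff)
qed

end

context C2_domain
begin

section \<open>Pairs on a common circle\<close>

text \<open>Degenerate circles are admitted, which keeps this set closed; \<open>NT_eq\<close> shows that they do no harm.\<close>

definition linked :: "(complex \<times> complex) set" where
  "linked = {(z,w). \<exists>c r. 0 \<le> r \<and> z \<in> sphere c r \<and> w \<in> sphere c r \<and> sphere c r \<subseteq> \<Omega>}"

lemma linkedI: "0 \<le> r \<Longrightarrow> dist c z = r \<Longrightarrow> dist c w = r \<Longrightarrow> sphere c r \<subseteq> \<Omega> \<Longrightarrow> (z,w) \<in> linked"
  unfolding linked_def mem_Collect_eq case_prod_conv mem_sphere by blast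

lemma linkedE: assumes "(z,w) \<in> linked" obtains c r where "0 \<le> r" "dist c z = r" "dist c w = r" "sphere c r \<subseteq> \<Omega>"
  using assms unfolding linked_def mem_Collect_eq case_prod_conv mem_sphere by blast

lemma unbounded_outside: "\<not> bounded (- \<Omega>)" and connected_outside: "connected (- \<Omega>)"
  using jordan by (simp_all add: compl_\<Omega>)

text \<open>The complement of \<Omega> is connected and unbounded, so a circle in \<Omega> cannot
  enclose any of it.\<close>

lemma sphere_subset_iff: assumes "r \<ge> 0" shows "sphere c r \<subseteq> \<Omega> \<longleftrightarrow> cball c r \<subseteq> \<Omega>"
proof
  assume s: "sphere c r \<subseteq> \<Omega>"
  have "- \<Omega> \<inter> ball c r = {}"
  proof (rule ccontr)
    assume ne: "- \<Omega> \<inter> ball c r \<noteq> {}"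
    then have "ball c r \<noteq> {}" by blast
    then have "r > 0" by simp
    have "\<not> - \<Omega> \<subseteq> ball c r" using unbounded_outside bounded_subset bounded_ball by blast
    then have "- \<Omega> \<inter> frontier (ball c r) \<noteq> {}" using ne connected_outside by (intro connected_Int_frontier) auto
    then show False using s \<open>r > 0\<close> by auto
  qed
  then have b: "ball c r \<subseteq> \<Omega>" by blast
  show "cball c r \<subseteq> \<Omega>"
  proof
    fix x assume "x \<in> cball c r"
    then have "x \<in> sphere c r \<or> x \<in> ball c r" by (simp add: le_less disj_commute)
    then show "x \<in> \<Omega>" using s b by blast
  qed
qed (auto simp: sphere_cball[THEN subsetD])

text \<open>The set is a projection of a compact set of centres, radii and pairs; filled discs are
  used because their inclusion in \<Omega> is visibly a closed condition. Borel measurability of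
  \<open>NT \<Omega>\<close> and of the slices comes from here.\<close>

lemma compact_linked: "compact linked"
proof -
  define S :: "(complex \<times> real \<times> complex \<times> complex) set" where
    "S = {q. 0 \<le> fst (snd q) \<and> cball (fst q) (fst (snd q)) \<subseteq> \<Omega>}
      \<inter> {q. dist (fst q) (fst (snd (snd q))) = fst (snd q)} \<inter> {q. dist (fst q) (snd (snd (snd q))) = fst (snd q)}"
  have S: "(c,r,z,w) \<in> S \<longleftrightarrow> 0 \<le> r \<and> cball c r \<subseteq> \<Omega> \<and> dist c z = r \<and> dist c w = r" for c r z w
    by (auto simp: S_def)
  have "closed S" unfolding S_def by (intro closed_Int closed_cball_subset closed_Collect_eq closed_\<Omega> continuous_intros)
  moreover have "S \<subseteq> \<Omega> \<times> {0..\<Omega>rad} \<times> \<Omega> \<times> \<Omega>"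
  proof
    fix q assume q: "q \<in> S"
    obtain c r z w where "q = (c,r,z,w)" by (cases q)
    then show "q \<in> \<Omega> \<times> {0..\<Omega>rad} \<times> \<Omega> \<times> \<Omega>" using q cball_radius_le[of c r] by (auto simp: S subset_iff)
  qed
  ultimately have "compact S"
    using compact_Int_closed[of "\<Omega> \<times> {0..\<Omega>rad} \<times> \<Omega> \<times> \<Omega>" S] by (simp add: compact_Times compact_\<Omega> Int_absorb1)
  moreover have "continuous_on S (\<lambda>q. snd (snd q))" by (intro continuous_intros)
  ultimately have "compact ((\<lambda>q. snd (snd q)) ` S)" by (rule compact_continuous_image[rotated])
  moreover have "(\<lambda>q. snd (snd q)) ` S = linked"
  proof (intro set_eqI iffI)
    fix p assume "p \<in> (\<lambda>q. snd (snd q)) ` S"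
    then obtain c r z w where "(c,r,z,w) \<in> S" "p = (z,w)" by auto
    then show "p \<in> linked" using linkedI[of r c z w] sphere_subset_iff[of r c] by (simp add: S)
  next
    fix p assume p: "p \<in> linked"
    obtain z w where zw: "p = (z,w)" by (cases p)
    then have "(z,w) \<in> linked" using p by simp
    then obtain c r where "0 \<le> r" "dist c z = r" "dist c w = r" "sphere c r \<subseteq> \<Omega>" by (rule linkedE)
    then have "(c,r,z,w) \<in> S" using sphere_subset_iff[of r c] by (simp add: S)
    then show "p \<in> (\<lambda>q. snd (snd q)) ` S" unfolding zw by (intro image_eqI[of _ _ "(c,r,z,w)"]) simp_all
  qed
  ultimately show ?thesis by simp
qed

text \<open>Only pairs z = w need an argument, since there \<open>linked\<close> accepts the circle
  of radius 0. A genuine circle through z inside \<Omega> exists as well: a small one at an interior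
  point, the boundary of the inner tangent ball at a curve point.\<close>

lemma NT_eq: "NT \<Omega> = \<Omega> \<times> \<Omega> - linked"
proof (intro set_eqI iffI)
  fix x assume x: "x \<in> NT \<Omega>"
  obtain z w where zw: "x = (z,w)" by (cases x)
  have "(z,w) \<notin> linked"
  proof
    assume "(z,w) \<in> linked"
    then obtain c r where cr: "0 \<le> r" "z \<in> sphere c r" "w \<in> sphere c r" "sphere c r \<subseteq> \<Omega>" by (metis linkedE mem_sphere)
    show False
    proof (cases "r > 0")
      case True
      then show False using x cr unfolding zw NT_def by blast
    next
      case False
      then have eq: "w = z" using cr by auto
      have "z \<in> \<Omega>" using x zw by (simp add: NT_def)
      then consider "z \<in> interior \<Omega>" | "z \<in> path_image \<gamma>" using \<Omega>_eq by blast
      then have "\<exists>c r. r > 0 \<and> z \<in> sphere c r \<and> sphere c r \<subseteq> \<Omega>"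
      proof cases
        case 1
        then obtain e where e: "e > 0" "ball z e \<subseteq> \<Omega>" by (meson mem_interior)
        have "sphere (z + of_real (e/3)) (e/3) \<subseteq> ball z e"
        proof
          fix y assume "y \<in> sphere (z + of_real (e/3)) (e/3)"
          then have "dist (z + of_real (e/3)) y = e/3" by simp
          moreover have "dist z (z + of_real (e/3)) = e/3" using e(1) by (simp add: dist_norm)
          ultimately have "dist z y \<le> e/3 + e/3" using dist_triangle[of z y "z + of_real (e/3)"] by simp
          then show "y \<in> ball z e" using e(1) by simp
        qed
        then show ?thesis using e by (intro exI[of _ "z + of_real (e/3)"] exI[of _ "e/3"]) (auto simp: dist_norm)
      next
        case 2
        then obtain t where "z = \<gamma> t" using range_\<gamma> by blast
        moreover have "cball (\<gamma> t + of_real \<rho>0 * nrm t) \<rho>0 \<subseteq> \<Omega>" using \<rho>0_good by (simp add: good_def)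
        moreover have "sphere (\<gamma> t + of_real \<rho>0 * nrm t) \<rho>0 \<subseteq> cball (\<gamma> t + of_real \<rho>0 * nrm t) \<rho>0" by (rule sphere_cball)
        ultimately show ?thesis using \<rho>0(1)
          by (intro exI[of _ "\<gamma> t + of_real \<rho>0 * nrm t"] exI[of _ \<rho>0]) (auto simp: dist_norm norm_mult)
      qed
      then show False using x eq unfolding zw NT_def by blast
    qed
  qed
  then show "x \<in> \<Omega> \<times> \<Omega> - linked" using x zw by (simp add: NT_def)
next
  fix x assume x: "x \<in> \<Omega> \<times> \<Omega> - linked"
  then obtain z w where zw: "x = (z,w)" "z \<in> \<Omega>" "w \<in> \<Omega>" "(z,w) \<notin> linked" by auto
  then show "x \<in> NT \<Omega>" unfolding NT_def linked_def by (auto simp: less_imp_le)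
qed

lemma linked_subset: "linked \<subseteq> \<Omega> \<times> \<Omega>" by (auto simp: linked_def)

section \<open>Circles through two points at a fixed displacement\<close>

definition Tv :: "complex \<Rightarrow> complex set" where "Tv v = {z. (z, z + v) \<in> linked}"

lemma closed_Tv: "closed (Tv v)"
proof -
  have "closed ((\<lambda>z. (z, z + v)) -` linked)"
    by (intro continuous_closed_vimage[OF compact_imp_closed[OF compact_linked]] continuous_intros)
  then show ?thesis by (simp add: Tv_def vimage_def)
qed

text \<open>The circles through \<open>z\<close> and \<open>z + v\<close>, with \<open>k\<close> the cotangent of the inscribed angle.\<close>

definition circ_centre :: "complex \<Rightarrow> complex \<Rightarrow> real \<Rightarrow> complex" where
  "circ_centre v z k = z + v / 2 - of_real (norm v / 2 * k) * (\<i> * sgn v)"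

definition circ_rad :: "complex \<Rightarrow> real \<Rightarrow> real" where "circ_rad v k = norm v / 2 * sqrt (1 + k\<^sup>2)"

lemma circ_rad_pos: "v \<noteq> 0 \<Longrightarrow> 0 < circ_rad v k"
proof -
  have "1 + k\<^sup>2 > 0" by (rule add_pos_nonneg) auto
  then show "v \<noteq> 0 \<Longrightarrow> 0 < circ_rad v k" by (simp add: circ_rad_def)
qed

text \<open>Signed distance of x from the line through z and z + v.\<close>

definition height :: "complex \<Rightarrow> complex \<Rightarrow> complex \<Rightarrow> real" where
  "height v z x = Im (cnj (sgn v) * (x - (z + v / 2)))"

text \<open>The power of x with respect to the circle is affine in k, with slope
  \<open>norm v * height v z x\<close>. Lowering k thus enlarges the disc exactly on the side of
  positive height and shrinks it on the other side.\<close>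

lemma power_eq:
  assumes v: "v \<noteq> 0"
  shows "(dist (circ_centre v z k) x)\<^sup>2 - (circ_rad v k)\<^sup>2 = (norm (x - (z + v / 2)))\<^sup>2 + norm v * k * height v z x - (norm v / 2)\<^sup>2"
proof -
  define y where "y = x - (z + v / 2)"
  define h where "h = norm v / 2"
  have gen: "(norm (y + of_real a * (\<i> * e)))\<^sup>2 = (norm y)\<^sup>2 + 2 * a * Im (cnj e * y) + a\<^sup>2 * ((Re e)\<^sup>2 + (Im e)\<^sup>2)" for a e
    unfolding cmod_power2 by (simp add: power2_eq_square algebra_simps)
  have n: "(Re (sgn v))\<^sup>2 + (Im (sgn v))\<^sup>2 = 1" using cmod_power2[of "sgn v"] v by (simp add: norm_sgn)
  have "dist (circ_centre v z k) x = norm (y + of_real (h * k) * (\<i> * sgn v))"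
    unfolding dist_commute[of "circ_centre v z k"] by (simp add: circ_centre_def dist_norm y_def h_def algebra_simps)
  then have "(dist (circ_centre v z k) x)\<^sup>2 = (norm y)\<^sup>2 + 2 * (h * k) * Im (cnj (sgn v) * y) + (h * k)\<^sup>2 * ((Re (sgn v))\<^sup>2 + (Im (sgn v))\<^sup>2)"
    by (simp only: gen)
  moreover have "(circ_rad v k)\<^sup>2 = h\<^sup>2 * (1 + k\<^sup>2)" by (simp only: circ_rad_def h_def[symmetric] power_mult_distrib) simp
  moreover have nv: "norm v = 2 * h" by (simp add: h_def)
  moreover define W where "W = Im (cnj (sgn v) * y)"
  ultimately show ?thesis unfolding n height_def y_def[symmetric] W_def[symmetric] nv
    by (simp add: power2_eq_square algebra_simps)
qed

lemma dist_circ_centre: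
  assumes v: "v \<noteq> 0" shows "dist (circ_centre v z k) z = circ_rad v k" "dist (circ_centre v z k) (z + v) = circ_rad v k"
proof -
  have nv: "v = of_real (norm v) * sgn v" using v by (simp add: sgn_eq)
  have "cnj (sgn v) * v = of_real (norm v) * (sgn v * cnj (sgn v))" by (subst (2) nv) (simp add: mult_ac)
  then have c: "cnj (sgn v) * v = of_real (norm v)" using v by (simp add: complex_mult_cnj_norm norm_sgn)
  have "cnj (sgn v) * (z - (z + v/2)) = - (cnj (sgn v) * v) / 2" "cnj (sgn v) * (z + v - (z + v/2)) = (cnj (sgn v) * v) / 2"
    by (simp_all add: algebra_simps)
  then have 0: "height v z z = 0" "height v z (z + v) = 0" unfolding height_def c by simp_all
  have "z - (z + v/2) = - v/2" "z + v - (z + v/2) = v/2" by simp_all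
  then have 1: "norm (z - (z + v/2)) = norm v / 2" "norm (z + v - (z + v/2)) = norm v / 2" by (simp_all only: norm_minus_cancel norm_divide norm_numeral minus_divide_left[symmetric])
  have "(dist (circ_centre v z k) z)\<^sup>2 = (circ_rad v k)\<^sup>2" "(dist (circ_centre v z k) (z + v))\<^sup>2 = (circ_rad v k)\<^sup>2"
    using power_eq[OF v, of z k z] power_eq[OF v, of z k "z+v"] 0 1 by simp_all
  then show "dist (circ_centre v z k) z = circ_rad v k" "dist (circ_centre v z k) (z + v) = circ_rad v k"
    using circ_rad_pos[OF v, of k] by (auto simp: power2_eq_iff_nonneg)
qed

lemma circle_through_pair:
  assumes v: "v \<noteq> 0" and c: "dist c z = r" "dist c (z + v) = r"
  obtains k where "c = circ_centre v z k" "r = circ_rad v k"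
proof -
  define m where "m = c - (z + v / 2)"
  have "(norm (m + v/2))\<^sup>2 = (norm (m - v/2))\<^sup>2"
  proof -
    have "m + v/2 = c - z" "m - v/2 = c - (z + v)" by (simp_all add: m_def)
    then show ?thesis using c by (simp only: dist_norm)
  qed
  then have "m \<bullet> (v / 2) = 0" by (simp add: power2_norm_eq_inner inner_add_left inner_add_right inner_diff_left inner_diff_right inner_commute)
  then have re: "Re (m * cnj v) = 0" by (simp add: inner_complex_def add_divide_distrib[symmetric])
  have nv: "v = of_real (norm v) * sgn v" using v by (simp add: sgn_eq)
  have ss: "sgn v * cnj (sgn v) = 1" using v by (simp add: complex_mult_cnj_norm norm_sgn)
  have "Re (m * cnj (sgn v)) = 0" using re v by (simp add: sgn_eq algebra_simps add_divide_distrib[symmetric])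
  then have "m * cnj (sgn v) = \<i> * of_real (Im (m * cnj (sgn v)))" by (simp add: complex_eq_iff)
  then have "m * cnj (sgn v) * sgn v = \<i> * of_real (Im (m * cnj (sgn v))) * sgn v" by simp
  then have m: "m = of_real (Im (m * cnj (sgn v))) * (\<i> * sgn v)" using ss by (simp add: mult_ac)
  define k where "k = - Im (m * cnj (sgn v)) / (norm v / 2)"
  have gen: "h \<noteq> 0 \<Longrightarrow> - (h * (- x / h)) = x" for x h :: real by simp
  have "- (norm v / 2 * k) = Im (m * cnj (sgn v))" unfolding k_def by (rule gen) (use v in simp)
  then have "m = of_real (- (norm v / 2 * k)) * (\<i> * sgn v)" using m by metis
  then have "c = circ_centre v z k" by (simp add: circ_centre_def m_def algebra_simps)
  moreover from this have "r = circ_rad v k" using dist_circ_centre(1)[OF v, of z k] c by simp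
  ultimately show thesis by (rule that)
qed

text \<open>Law of sines: the radius of a circle in which a chord of length \<open>norm v\<close> is
  seen under the inscribed angle a.\<close>

definition rad :: "complex \<Rightarrow> real \<Rightarrow> real" where "rad v a = norm v / (2 * sin a)"

text \<open>\<open>touch_map v (t,a)\<close> is the point \<open>z\<close> for which the disc of radius \<open>rad v a\<close> touching the curve at \<open>\<gamma> t\<close>
  has \<open>z\<close> and \<open>z + v\<close> on its boundary, with inscribed angle \<open>a\<close> over that chord.\<close>

definition touch_map :: "complex \<Rightarrow> real \<times> real \<Rightarrow> complex" where
  "touch_map v p = \<gamma> (fst p) + of_real (rad v (snd p)) * nrm (fst p) + of_real (norm v / 2 * cot (snd p)) * (\<i> * sgn v) - v / 2"

text \<open>The cosine of the angle between v and the tangent direction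
  \<open>\<i> * nrm t\<close>.\<close>

definition co :: "complex \<Rightarrow> real \<Rightarrow> real" where "co v t = Im (cnj (nrm t) * sgn v)"

text \<open>The half-open period counts each touching point once. The strict radius bound makes the
  touching point unique, and the cosine condition says that it lies at positive
  \<open>height\<close>, on the side towards which the disc is enlarged.\<close>

definition touch_domain :: "complex \<Rightarrow> (real \<times> real) set" where
  "touch_domain v = {p. 0 \<le> fst p \<and> fst p < 1 \<and> 0 < snd p \<and> snd p < pi \<and> rad v (snd p) < maxrad (fst p) \<and> cos (snd p) < co v (fst p)}"

lemma circ_centre_touch_map: "circ_centre v (touch_map v (t,a)) (cot a) = \<gamma> t + of_real (rad v a) * nrm t"
  by (simp add: circ_centre_def touch_map_def)

lemma circ_rad_cot: assumes "0 < a" "a < pi" shows "circ_rad v (cot a) = rad v a"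
proof -
  have s: "sin a > 0" using assms by (rule sin_gt_zero)
  have "1 + (cot a)\<^sup>2 = (1 / sin a)\<^sup>2" using s sin_cos_squared_add[of a] by (simp add: cot_def field_simps power2_eq_square)
  then have "sqrt (1 + (cot a)\<^sup>2) = 1 / sin a" using s by (simp add: real_sqrt_unique)
  then show ?thesis by (simp add: circ_rad_def rad_def)
qed

lemma height_touch_map:
  assumes v: "v \<noteq> 0" and a: "0 < a" "a < pi"
  shows "height v (touch_map v (t,a)) (\<gamma> t) = rad v a * (co v t - cos a)"
proof -
  have s: "sin a > 0" using a by (rule sin_gt_zero)
  have ss: "cnj (sgn v) * sgn v = 1" using v complex_mult_cnj_norm[of "sgn v"] by (simp add: norm_sgn mult.commute)
  have "\<gamma> t - (touch_map v (t,a) + v/2) = - (of_real (rad v a) * nrm t) - of_real (norm v / 2 * cot a) * (\<i> * sgn v)"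
    by (simp add: touch_map_def)
  then have "cnj (sgn v) * (\<gamma> t - (touch_map v (t,a) + v/2)) =
     - (of_real (rad v a) * (cnj (sgn v) * nrm t)) - of_real (norm v / 2 * cot a) * (\<i> * (cnj (sgn v) * sgn v))"
    by (simp only: right_diff_distrib mult_minus_right mult_ac)
  then have "height v (touch_map v (t,a)) (\<gamma> t) = - (rad v a * Im (cnj (sgn v) * nrm t)) - norm v / 2 * cot a"
    unfolding height_def ss by simp
  also have "Im (cnj (sgn v) * nrm t) = - co v t" by (simp add: co_def mult.commute)
  also have "norm v / 2 * cot a = rad v a * cos a" using s by (simp add: rad_def cot_def)
  finally show ?thesis by (simp add: algebra_simps)
qed

lemma touch_map_in_Tv:
  assumes v: "v \<noteq> 0" and a: "0 < a" "a < pi" and r: "rad v a \<le> maxrad t"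
  shows "touch_map v (t,a) \<in> Tv v"
proof -
  let ?c = "\<gamma> t + of_real (rad v a) * nrm t"
  have pos: "rad v a > 0" using v sin_gt_zero[OF a] by (simp add: rad_def)
  have "dist ?c (touch_map v (t,a)) = rad v a" "dist ?c (touch_map v (t,a) + v) = rad v a"
    using dist_circ_centre[OF v, of "touch_map v (t,a)" "cot a"] unfolding circ_centre_touch_map circ_rad_cot[OF a] by auto
  moreover have "sphere ?c (rad v a) \<subseteq> \<Omega>" using tball_subset[OF less_imp_le[OF pos] r] sphere_cball by blast
  ultimately show ?thesis unfolding Tv_def mem_Collect_eq by (intro linkedI[OF less_imp_le[OF pos]])
qed

lemma cot_strict_antimono: assumes "0 < a" "a < b" "b < pi" shows "cot b < cot a"
proof -
  have s: "sin a > 0" "sin b > 0" using assms by (auto intro: sin_gt_zero)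
  have "sin (b - a) > 0" using assms by (intro sin_gt_zero) auto
  then have "sin b * cos a - cos b * sin a > 0" by (simp add: sin_diff)
  then show ?thesis using s by (simp add: cot_def divide_less_eq field_simps)
qed

text \<open>A larger angle has a smaller cotangent, which makes the power of the touching point
  negative. The curve point \<gamma> t would then be interior to a disc contained in
  \<Omega>.\<close>

lemma touch_no_larger_cap:
  assumes v: "v \<noteq> 0" and a: "0 < a" "a < b" "b < pi" and t: "cos a < co v t"
    and b: "cball (circ_centre v (touch_map v (t,a)) (cot b)) (circ_rad v (cot b)) \<subseteq> \<Omega>"
  shows False
proof -
  let ?z = "touch_map v (t,a)"
  have api: "a < pi" using a by simp
  have pos: "rad v a > 0" using v sin_gt_zero[OF a(1) api] by (simp add: rad_def)
  have "dist (circ_centre v ?z (cot a)) (\<gamma> t) = circ_rad v (cot a)"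
    unfolding circ_centre_touch_map circ_rad_cot[OF a(1) api] using pos by (simp add: dist_norm norm_mult)
  then have 0: "(norm (\<gamma> t - (?z + v / 2)))\<^sup>2 + norm v * cot a * height v ?z (\<gamma> t) - (norm v / 2)\<^sup>2 = 0"
    using power_eq[OF v, of ?z "cot a" "\<gamma> t"] by simp
  have "height v ?z (\<gamma> t) > 0" unfolding height_touch_map[OF v a(1) api] using pos t by simp
  moreover have "cot b < cot a" using cot_strict_antimono a by blast
  ultimately have "norm v * cot b * height v ?z (\<gamma> t) < norm v * cot a * height v ?z (\<gamma> t)"
    using v by simp
  then have "(dist (circ_centre v ?z (cot b)) (\<gamma> t))\<^sup>2 < (circ_rad v (cot b))\<^sup>2"
    using 0 power_eq[OF v, of ?z "cot b" "\<gamma> t"] by linarith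
  then have "dist (circ_centre v ?z (cot b)) (\<gamma> t) < circ_rad v (cot b)"
    by (rule power2_less_imp_less[OF _ less_imp_le[OF circ_rad_pos[OF v]]])
  then show False using not_in_ball[OF b, of t] by simp
qed

text \<open>Both angles are extremal for the same pair of points, hence equal. The two discs then
  coincide, and a disc below the maximal radius touches the curve at one point only.\<close>

lemma touch_map_inj: assumes v: "v \<noteq> 0" shows "inj_on (touch_map v) (touch_domain v)"
proof (rule inj_onI)
  fix p p' assume p: "p \<in> touch_domain v" and p': "p' \<in> touch_domain v" and eq: "touch_map v p = touch_map v p'"
  obtain t a where ta: "p = (t,a)" by (cases p)
  obtain t' a' where ta': "p' = (t',a')" by (cases p')
  have P: "0 \<le> t" "t < 1" "0 < a" "a < pi" "rad v a < maxrad t" "cos a < co v t"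
    using p by (auto simp: touch_domain_def ta)
  have P': "0 \<le> t'" "t' < 1" "0 < a'" "a' < pi" "rad v a' < maxrad t'" "cos a' < co v t'"
    using p' by (auto simp: touch_domain_def ta')
  have eq': "touch_map v (t,a) = touch_map v (t',a')" using eq ta ta' by simp
  have pos: "rad v a > 0" "rad v a' > 0" using v sin_gt_zero P P' by (simp_all add: rad_def)
  have in\<Omega>: "cball (circ_centre v (touch_map v (t,a)) (cot a)) (circ_rad v (cot a)) \<subseteq> \<Omega>"
    unfolding circ_centre_touch_map circ_rad_cot[OF P(3,4)] using tball_subset[of "rad v a" t] P pos by simp
  have in\<Omega>': "cball (circ_centre v (touch_map v (t',a')) (cot a')) (circ_rad v (cot a')) \<subseteq> \<Omega>"
    unfolding circ_centre_touch_map circ_rad_cot[OF P'(3,4)] using tball_subset[of "rad v a'" t'] P' pos by simp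
  have aa: "a = a'"
  proof (rule ccontr)
    assume "a \<noteq> a'"
    then consider "a < a'" | "a' < a" by linarith
    then show False
    proof cases
      case 1 then show False using touch_no_larger_cap[OF v P(3) 1 P'(4) P(6)] in\<Omega>' eq' by simp
    next
      case 2 then show False using touch_no_larger_cap[OF v P'(3) 2 P(4) P'(6)] in\<Omega> eq' by simp
    qed
  qed
  have "\<gamma> t + of_real (rad v a) * nrm t = \<gamma> t' + of_real (rad v a) * nrm t'"
    using circ_centre_touch_map[of v t a] circ_centre_touch_map[of v t' a'] eq' aa by simp
  then have "\<gamma> t' \<in> tball t (rad v a)" using pos by (simp add: dist_norm norm_mult)
  then have "\<gamma> t' = \<gamma> t" using touch_unique[of "rad v a" t t'] P pos by simp
  then obtain k :: int where "t' = t + k" using \<gamma>_eq_iff by blast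
  then have "k = 0" using P P' by auto
  then show "p = p'" using \<open>t' = t + k\<close> aa ta ta' by simp
qed

lemma param_in_unit: obtains s where "0 \<le> s" "s < 1" "\<gamma> s = \<gamma> t" "nrm s = nrm t"
proof -
  have "\<gamma> (frac t) = \<gamma> t" by (rule \<gamma>_frac)
  moreover have "ut (frac t) = ut t"
    using periodic_int[of ut t "- \<lfloor>t\<rfloor>", OF periodic_ut] by (simp add: frac_def)
  ultimately show thesis using that[of "frac t"] frac_ge_0[of t] frac_lt_1[of t] by (simp add: nrm_def)
qed

text \<open>Among the circles through z and z + v, those whose discs lie in \<Omega> form a compact
  set of parameters; the least one, \<open>k0\<close>, belongs to the extremal disc. Slightly
  smaller parameters admit points outside \<Omega>, and these accumulate at a touching
  point.\<close>

lemma Tv_touch: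
  assumes v: "v \<noteq> 0" and z: "z \<in> Tv v" "z \<notin> path_image \<gamma>" "z + v \<notin> path_image \<gamma>"
  shows "\<exists>t a. 0 \<le> t \<and> t < 1 \<and> 0 < a \<and> a < pi \<and> rad v a \<le> maxrad t \<and> cos a < co v t \<and> z = touch_map v (t,a)"
proof -
  define h where "h = norm v / 2"
  have h: "h > 0" using v by (simp add: h_def)
  define K where "K = {k. cball (circ_centre v z k) (circ_rad v k) \<subseteq> \<Omega>}"
  have ccont: "continuous_on A (circ_centre v z)" "continuous_on A (circ_rad v)" for A
    unfolding circ_centre_def[abs_def] circ_rad_def[abs_def] by (intro continuous_intros)+
  have "closed {k. 0 \<le> circ_rad v k \<and> cball (circ_centre v z k) (circ_rad v k) \<subseteq> \<Omega>}" by (intro closed_cball_subset ccont closed_\<Omega>)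
  then have "closed K" using circ_rad_pos[OF v] by (simp add: K_def less_imp_le)
  moreover have "bounded K"
  proof (rule boundedI[of _ "\<Omega>rad / h"])
    fix k assume "k \<in> K"
    then have "circ_rad v k \<le> \<Omega>rad" using cball_radius_le circ_rad_pos[OF v, of k] by (simp add: K_def)
    moreover have "h * \<bar>k\<bar> \<le> circ_rad v k" unfolding circ_rad_def h_def[symmetric] using h by (intro mult_left_mono real_le_rsqrt) auto
    ultimately show "norm k \<le> \<Omega>rad / h" using h by (simp add: field_simps)
  qed
  ultimately have cK: "compact K" using compact_eq_bounded_closed by blast
  have "(z, z + v) \<in> linked" using z(1) by (simp add: Tv_def)
  then obtain c r where cr: "0 \<le> r" "dist c z = r" "dist c (z + v) = r" "sphere c r \<subseteq> \<Omega>" by (rule linkedE)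
  obtain k where "c = circ_centre v z k" "r = circ_rad v k" using circle_through_pair[OF v cr(2,3)] by blast
  then have "k \<in> K" using cr sphere_subset_iff[of r c] by (simp add: K_def)
  then obtain k0 where k0: "k0 \<in> K" "\<And>k. k \<in> K \<Longrightarrow> k0 \<le> k" using compact_attains_inf[OF cK] by auto
  define P where "P k x = (norm (x - (z + v / 2)))\<^sup>2 + norm v * k * height v z x - (norm v / 2)\<^sup>2" for k x
  have P: "(dist (circ_centre v z k) x)\<^sup>2 - (circ_rad v k)\<^sup>2 = P k x" for k x unfolding P_def by (rule power_eq[OF v])
  have in_cball: "x \<in> cball (circ_centre v z k) (circ_rad v k) \<longleftrightarrow> P k x \<le> 0" for k x
    using P[of k x] circ_rad_pos[OF v, of k] by (simp add: abs_le_square_iff[symmetric] flip: P)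
  have "\<exists>x. x \<notin> \<Omega> \<and> P (k0 - inverse (real (Suc j))) x \<le> 0" for j
  proof -
    have "k0 - inverse (real (Suc j)) \<notin> K" using k0(2)[of "k0 - inverse (real (Suc j))"] by auto
    then show ?thesis unfolding K_def using in_cball by blast
  qed
  then obtain X where X: "\<And>j. X j \<notin> \<Omega>" "\<And>j. P (k0 - inverse (real (Suc j))) (X j) \<le> 0" by metis
  \<comment> \<open>The point is outside the disc of \<open>k0\<close> but inside that of a smaller
    parameter, so its power increases strictly with k.\<close>
  have Xpw: "height v z (X j) > 0" for j
  proof -
    have "P k0 (X j) > 0" using in_cball[of "X j" k0] k0(1) X(1)[of j] by (auto simp: K_def)
    then have "norm v * (k0 - inverse (real (Suc j))) * height v z (X j) < norm v * k0 * height v z (X j)"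
      using X(2)[of j] unfolding P_def by linarith
    then have "0 < norm v * inverse (real (Suc j)) * height v z (X j)" by (simp add: algebra_simps)
    moreover have "0 < norm v * inverse (real (Suc j))" using v by simp
    ultimately show ?thesis by (rule zero_less_mult_pos)
  qed
  have "bounded (range X)"
  proof -
    have "dist (circ_centre v z k) x \<le> circ_rad v k" if "P k x \<le> 0" for k x using in_cball[of x k] that by simp
    then have d: "dist (circ_centre v z (k0 - inverse (real (Suc j)))) (X j) \<le> circ_rad v (k0 - inverse (real (Suc j)))" for j using X(2) by blast
    have "compact (circ_centre v z ` {k0-1..k0})" "compact (circ_rad v ` {k0-1..k0})" by (intro compact_continuous_image ccont; simp)+
    then obtain B1 B2 where B: "\<And>k. k \<in> {k0-1..k0} \<Longrightarrow> norm (circ_centre v z k) \<le> B1" "\<And>k. k \<in> {k0-1..k0} \<Longrightarrow> norm (circ_rad v k) \<le> B2"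
      by (metis compact_imp_bounded bounded_iff imageI)
    have "norm (X j) \<le> B1 + B2" for j
    proof -
      define k where "k = k0 - inverse (real (Suc j))"
      have "inverse (real (Suc j)) \<le> 1" "0 \<le> inverse (real (Suc j))" by (auto simp: inverse_eq_divide)
      then have "k \<in> {k0-1..k0}" by (auto simp: k_def)
      then have "norm (circ_centre v z k) \<le> B1" "circ_rad v k \<le> B2" using B(1)[of k] B(2)[of k] by auto
      moreover have "norm (X j) \<le> norm (circ_centre v z k) + dist (circ_centre v z k) (X j)" by (simp add: dist_norm norm_minus_commute norm_triangle_sub)
      ultimately show ?thesis using d[of j] unfolding k_def by linarith
    qed
    then show ?thesis by (intro boundedI) auto
  qed
  then obtain x s where xs: "strict_mono s" "(X \<circ> s) \<longlonglongrightarrow> x"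
    using bounded_imp_convergent_subsequence[of X] by blast
  have kl: "(\<lambda>j. k0 - inverse (real (Suc (s j)))) \<longlonglongrightarrow> k0"
  proof -
    have "(\<lambda>j. k0 - inverse (real (Suc j))) \<longlonglongrightarrow> k0 - 0" by (intro tendsto_intros LIMSEQ_inverse_real_of_nat)
    from LIMSEQ_subseq_LIMSEQ[OF this xs(1)] show ?thesis by (simp add: o_def)
  qed
  have pwl: "(\<lambda>j. height v z ((X \<circ> s) j)) \<longlonglongrightarrow> height v z x"
    unfolding height_def by (intro tendsto_intros xs(2))
  then have pw0: "height v z x \<ge> 0" by (rule LIMSEQ_le_const) (use Xpw in \<open>auto intro!: less_imp_le\<close>)
  have "(\<lambda>j. P (k0 - inverse (real (Suc (s j)))) ((X \<circ> s) j)) \<longlonglongrightarrow> P k0 x"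
    unfolding P_def by (intro tendsto_intros xs(2) kl pwl)
  then have Px: "P k0 x \<le> 0" by (rule LIMSEQ_le_const2) (use X in auto)
  have "x \<in> \<Omega>" using Px in_cball k0(1) by (auto simp: K_def)
  moreover have "x \<in> closure (- \<Omega>)" unfolding closure_sequential using X(1) xs(2) by (intro exI[of _ "X \<circ> s"]) auto
  ultimately have xC: "x \<in> path_image \<gamma>" using \<Omega>_eq closure_complement[of \<Omega>] by blast
  then obtain t where t: "0 \<le> t" "t < 1" "\<gamma> t = x" using range_\<gamma> by (metis param_in_unit rangeE)
  have cb: "cball (circ_centre v z k0) (circ_rad v k0) \<subseteq> \<Omega>" using k0(1) by (simp add: K_def)
  have dx: "dist (circ_centre v z k0) x = circ_rad v k0"
    using not_in_ball[OF cb, of t] t Px in_cball[of x k0] by auto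
  then have Px0: "P k0 x = 0" using P[of k0 x] by simp
  \<comment> \<open>A point of the circle on the chord line is one of the two end points, and
    neither of them is on the curve.\<close>
  have "height v z x \<noteq> 0"
  proof
    assume 0: "height v z x = 0"
    define y where "y = x - (z + v/2)"
    have ny: "norm y = norm v / 2" using Px0 0 by (simp add: P_def y_def)
    have nv: "v = of_real (norm v) * sgn v" using v by (simp add: sgn_eq)
    have ss: "sgn v * cnj (sgn v) = 1" using v by (simp add: complex_mult_cnj_norm norm_sgn)
    have im: "Im (cnj (sgn v) * y) = 0" using 0 by (simp add: height_def y_def)
    define \<tau> where "\<tau> = Re (cnj (sgn v) * y)"
    have "cnj (sgn v) * y = of_real \<tau>" using im by (simp add: complex_eq_iff \<tau>_def)
    then have "sgn v * (cnj (sgn v) * y) = of_real \<tau> * sgn v" by (simp add: mult.commute)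
    then have y\<tau>: "y = of_real \<tau> * sgn v" using ss by (simp add: mult.assoc[symmetric])
    then have "\<bar>\<tau>\<bar> = norm v / 2" using ny v by (simp add: norm_mult norm_sgn)
    then have "\<tau> = norm v / 2 \<or> \<tau> = - norm v / 2" by linarith
    then have "y = v / 2 \<or> y = - v / 2"
      by (metis (no_types, opaque_lifting) nv y\<tau> minus_divide_left mult_minus_left of_real_divide of_real_minus of_real_numeral times_divide_eq_left)
    moreover have "x = (z + v / 2) + y" by (simp add: y_def)
    moreover have "(z + v / 2) + v / 2 = z + v" "(z + v / 2) + - v / 2 = z" by simp_all
    ultimately have "x = z + v \<or> x = z" by metis
    then show False using z xC by auto
  qed
  then have pwpos: "height v z x > 0" using pw0 by simp
  \<comment> \<open>The angle in (0, pi) with cotangent \<open>k0\<close>.\<close>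
  define a where "a = pi / 2 - arctan k0"
  have a: "0 < a" "a < pi" using arctan_bounded[of k0] by (auto simp: a_def)
  have cota: "cot a = k0"
  proof -
    have "cot a = tan (arctan k0)" unfolding a_def cot_def tan_def sin_diff cos_diff by simp
    then show ?thesis by (simp add: tan_arctan)
  qed
  have rra: "circ_rad v k0 = rad v a" using circ_rad_cot[OF a, of v] cota by simp
  have cen: "circ_centre v z k0 = \<gamma> t + of_real (rad v a) * nrm t"
    using tangency[OF cb circ_rad_pos[OF v], of t] dx t rra by simp
  have zt: "z = touch_map v (t,a)" using cen by (simp add: circ_centre_def touch_map_def cota algebra_simps)
  have "(t, rad v a) \<in> good" using cb circ_rad_pos[OF v, of k0] unfolding cen rra by (simp add: good_def)
  then have "rad v a \<le> maxrad t" using good_iff by blast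
  moreover have "cos a < co v t"
  proof -
    have "0 < rad v a * (co v t - cos a)" using pwpos height_touch_map[OF v a, of t] zt t by simp
    moreover have "rad v a > 0" using circ_rad_pos[OF v, of k0] rra by simp
    ultimately show ?thesis by (simp add: zero_less_mult_iff)
  qed
  ultimately show ?thesis using t a zt by blast
qed

end

section \<open>Integration over direction and inscribed angle\<close>

lemma borel_measurable_cnj [measurable]: "cnj \<in> borel_measurable borel"
  by (intro borel_measurable_continuous_onI continuous_intros)

lemma sin_level_finite: "finite {a::real. 0 < a \<and> a < pi \<and> sin a = s}"
proof (rule finite_subset)
  show "{a::real. 0 < a \<and> a < pi \<and> sin a = s} \<subseteq> {arcsin s, pi - arcsin s}"
  proof
    fix a :: real assume "a \<in> {a. 0 < a \<and> a < pi \<and> sin a = s}"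
    then have a: "0 < a" "a < pi" "s = sin a" by auto
    show "a \<in> {arcsin s, pi - arcsin s}"
    proof (cases "a \<le> pi / 2")
      case True then show ?thesis using a by (simp add: arcsin_sin)
    next
      case False
      then have "arcsin (sin (pi - a)) = pi - a" using a by (intro arcsin_sin) auto
      then show ?thesis using a by simp
    qed
  qed
qed simp

text \<open>The integrand is supported where the angle \<phi> is at most a in absolute value. This
  is the integral over all directions of a chord with given touching point and inscribed
  angle.\<close>

lemma nn_integral_cos_cap:
  assumes a: "0 < a" "a < pi"
  shows "(\<integral>\<^sup>+\<phi>. indicator {-pi<..<pi} \<phi> * ennreal (max 0 (cos \<phi> - cos a)) \<partial>lborel) = ennreal (2 * sin a - 2 * a * cos a)"
proof -
  have eq: "indicator {-pi<..<pi} \<phi> * ennreal (max 0 (cos \<phi> - cos a)) = ennreal (cos \<phi> - cos a) * indicator {-a..a} \<phi>" for \<phi> :: real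
  proof (cases "\<phi> \<in> {-pi<..<pi}")
    case True
    show ?thesis
    proof (cases "\<bar>\<phi>\<bar> \<le> a")
      case True
      then have "cos a \<le> cos \<bar>\<phi>\<bar>" using a by (intro cos_monotone_0_pi_le) auto
      then have "max 0 (cos \<phi> - cos a) = cos \<phi> - cos a" by simp
      moreover have "\<phi> \<in> {-a..a}" using True by auto
      ultimately show ?thesis using \<open>\<phi> \<in> {-pi<..<pi}\<close> by simp
    next
      case False
      then have "cos \<bar>\<phi>\<bar> < cos a" using a True by (intro cos_monotone_0_pi) auto
      then have "max 0 (cos \<phi> - cos a) = 0" by simp
      moreover have "\<phi> \<notin> {-a..a}" using False by auto
      ultimately show ?thesis by simp
    qed
  next
    case False
    then show ?thesis using a by (auto simp: indicator_def)
  qed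
  have "(\<integral>\<^sup>+\<phi>. ennreal (cos \<phi> - cos a) * indicator {-a..a} \<phi> \<partial>lborel) = ennreal ((sin a - a * cos a) - (sin (-a) - (-a) * cos a))"
  proof (rule nn_integral_FTC_Icc)
    fix x :: real assume "x \<in> {-a..a}"
    then have x: "-a \<le> x" "x \<le> a" by auto
    show "((\<lambda>x. sin x - x * cos a) has_real_derivative cos x - cos a) (at x)"
      by (auto intro!: derivative_eq_intros)
    have "cos a \<le> cos \<bar>x\<bar>" using a x by (intro cos_monotone_0_pi_le) auto
    then show "0 \<le> cos x - cos a" by simp
  qed (use a in auto)
  then show ?thesis unfolding eq by (simp add: algebra_simps)
qed

lemma sin_minus_mult_cos_nonneg:
  assumes "0 \<le> a" "a \<le> pi" shows "0 \<le> sin a - a * cos a"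
proof -
  have "(\<lambda>a. sin a - a * cos a) 0 \<le> (\<lambda>a. sin a - a * cos a) a"
  proof (rule DERIV_nonneg_imp_nondecreasing[OF assms(1)])
    fix x :: real assume x: "0 \<le> x" "x \<le> a"
    have "((\<lambda>a. sin a - a * cos a) has_real_derivative x * sin x) (at x)"
      by (auto intro!: derivative_eq_intros)
    moreover have "x * sin x \<ge> 0" using x assms by (intro mult_nonneg_nonneg sin_ge_zero) auto
    ultimately show "\<exists>y. ((\<lambda>a. sin a - a * cos a) has_real_derivative y) (at x) \<and> 0 \<le> y" by blast
  qed
  then show ?thesis by simp
qed

text \<open>The least inscribed angle over a chord of length r in discs of radius at most \<rho>.
  The truncation gives pi/2 beyond the diameter, where \<open>cap_cos\<close> is 0, so that
  \<open>pair_density\<close> vanishes there.\<close>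

definition cap_angle :: "real \<Rightarrow> real \<Rightarrow> real" where "cap_angle \<rho> r = arcsin (max 0 (min 1 (r / (2 * \<rho>))))"

definition cap_cos :: "real \<Rightarrow> real \<Rightarrow> real" where "cap_cos \<rho> r = sqrt (1 - (min 1 (r / (2 * \<rho>)))\<^sup>2)"

text \<open>The measure of the pairs at distance \<open>r\<close> on the discs of radius at most \<open>\<rho>\<close> that touch a boundary
  element of speed \<open>A\<close> and turning rate \<open>B\<close>; \<open>A - B x\<close> is the speed of the centre of the disc of radius \<open>x\<close>.\<close>

definition pair_density :: "real \<Rightarrow> real \<Rightarrow> real \<Rightarrow> real \<Rightarrow> real" where
  "pair_density A B \<rho> r = A * (2 * \<rho> * r * (pi - 2 * cap_angle \<rho> r)) - B * (\<rho>\<^sup>2 * r * (pi - 2 * cap_angle \<rho> r) + \<rho> * r\<^sup>2 * cap_cos \<rho> r)"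

text \<open>The radius condition confines a to the interval (u, pi - u) with sin u = r / (2 \<rho>),
  where the integrand has an elementary antiderivative. Beyond the diameter both sides are
  0.\<close>

lemma nn_integral_pair_density:
  assumes r: "r > 0" and \<rho>: "\<rho> > 0" and AB: "\<And>x. 0 \<le> x \<Longrightarrow> x \<le> \<rho> \<Longrightarrow> 0 \<le> A - B * x"
  shows "(\<integral>\<^sup>+a. ennreal (indicator {0<..<pi} a * indicator {..<\<rho>} (r / (2 * sin a)) * ((A - B * (r / (2 * sin a))) * (r\<^sup>2 * (sin a - a * cos a) / (sin a)\<^sup>2))) \<partial>lborel)
     = ennreal (pair_density A B \<rho> r)"
proof (cases "r < 2 * \<rho>")
  case True
  define s where "s = r / (2 * \<rho>)"
  have s: "0 < s" "s < 1" using r \<rho> True by (auto simp: s_def)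
  define u where "u = arcsin s"
  have u: "0 < u" "u < pi / 2" "sin u = s" using s arcsin_lt_bounded[of s] arcsin_less_arcsin[of 0 s] by (auto simp: u_def)
  \<comment> \<open>The derivative of a / sin a is (sin a - a cos a) / sin^2 a; the second bracket
    has the same derivative with one more power of the sine in the denominator.\<close>
  define F where "F a = r\<^sup>2 * (A * (a / sin a) - B * (r / 2) * (a / (2 * (sin a)\<^sup>2) - cos a / (2 * sin a)))" for a
  define f where "f a = (A - B * (r / (2 * sin a))) * (r\<^sup>2 * (sin a - a * cos a) / (sin a)\<^sup>2)" for a
  have sinpos: "sin a > 0" if "u \<le> a" "a \<le> pi - u" for a using that u by (intro sin_gt_zero) auto
  have Fd: "(F has_real_derivative f a) (at a)" if "u \<le> a" "a \<le> pi - u" for a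
  proof -
    have nz: "sin a \<noteq> 0" using sinpos[OF that] by simp
    have 1: "((\<lambda>a. a / sin a) has_real_derivative (sin a - a * cos a) / (sin a)\<^sup>2) (at a)"
      using nz by (auto intro!: derivative_eq_intros simp: power2_eq_square)
    have 2: "((\<lambda>a. a / (2 * (sin a)\<^sup>2) - cos a / (2 * sin a)) has_real_derivative (sin a - a * cos a) / (sin a)^3) (at a)"
    proof (rule DERIV_cong)
      show "((\<lambda>a. a / (2 * (sin a)\<^sup>2) - cos a / (2 * sin a)) has_real_derivative
        (1 * (2 * (sin a)\<^sup>2) - a * (2 * (2 * sin a * cos a))) / ((2 * (sin a)\<^sup>2) * (2 * (sin a)\<^sup>2))
        - ((- sin a) * (2 * sin a) - cos a * (2 * cos a)) / ((2 * sin a) * (2 * sin a))) (at a)"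
        using nz by (auto intro!: derivative_eq_intros simp: mult_ac)
      define S where "S = sin a"
      have "cos a * cos a = 1 - S * S" using sin_cos_squared_add[of a] by (simp add: S_def power2_eq_square)
      then have e: "(- S) * (2 * S) - cos a * (2 * cos a) = -2" by simp
      show "(1 * (2 * (sin a)\<^sup>2) - a * (2 * (2 * sin a * cos a))) / ((2 * (sin a)\<^sup>2) * (2 * (sin a)\<^sup>2))
        - ((- sin a) * (2 * sin a) - cos a * (2 * cos a)) / ((2 * sin a) * (2 * sin a)) = (sin a - a * cos a) / (sin a)^3"
        using nz unfolding S_def[symmetric] e by (simp add: field_simps power2_eq_square power3_eq_cube)
    qed
    have "(F has_real_derivative r\<^sup>2 * (A * ((sin a - a * cos a) / (sin a)\<^sup>2) - B * (r / 2) * ((sin a - a * cos a) / (sin a)^3))) (at a)"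
      unfolding F_def by (intro DERIV_cmult DERIV_diff 1 2)
    moreover have "r\<^sup>2 * (A * ((sin a - a * cos a) / (sin a)\<^sup>2) - B * (r / 2) * ((sin a - a * cos a) / (sin a)^3)) = f a"
    proof -
      define S W where "S = sin a" and "W = sin a - a * cos a"
      have "S \<noteq> 0" using nz by (simp add: S_def)
      then show ?thesis unfolding f_def W_def[symmetric] S_def[symmetric]
        by (simp add: field_simps power2_eq_square power3_eq_cube)
    qed
    ultimately show ?thesis by simp
  qed
  have cond: "r / (2 * sin a) < \<rho> \<longleftrightarrow> s < sin a" if "0 < a" "a < pi" for a
    using sin_gt_zero[OF that] \<rho> by (simp add: s_def field_simps)
  have range: "s < sin a \<longleftrightarrow> u < a \<and> a < pi - u" if a: "0 < a" "a < pi" for a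
  proof (cases "a \<le> pi / 2")
    case True
    then show ?thesis using sin_mono_less_eq[of u a] u a by auto
  next
    case False
    then have "sin u < sin (pi - a) \<longleftrightarrow> u < pi - a" using sin_mono_less_eq[of u "pi - a"] u a by auto
    then show ?thesis using u a False by auto
  qed
  have AE: "AE a in lborel. ennreal (indicator {0<..<pi} a * indicator {..<\<rho>} (r / (2 * sin a)) * f a) = ennreal (f a) * indicator {u..pi-u} a"
  proof -
    have "AE a in lborel. a \<noteq> u \<and> a \<noteq> pi - u" using AE_lborel_singleton[of u] AE_lborel_singleton[of "pi - u"] by simp
    then show ?thesis
    proof eventually_elim
      case (elim a)
      show ?case
      proof (cases "0 < a \<and> a < pi")
        case True
        then show ?thesis using cond[of a] range[of a] elim u by (auto simp: indicator_def)
      next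
        case False
        then show ?thesis using u by (auto simp: indicator_def)
      qed
    qed
  qed
  have "(\<integral>\<^sup>+a. ennreal (indicator {0<..<pi} a * indicator {..<\<rho>} (r / (2 * sin a)) * f a) \<partial>lborel)
     = (\<integral>\<^sup>+a. ennreal (f a) * indicator {u..pi-u} a \<partial>lborel)"
    by (rule nn_integral_cong_AE[OF AE])
  also have "\<dots> = ennreal (F (pi - u) - F u)"
  proof (rule nn_integral_FTC_Icc)
    fix a assume "a \<in> {u..pi-u}"
    then have a: "u \<le> a" "a \<le> pi - u" by auto
    from Fd[OF a] show "(F has_real_derivative f a) (at a)" .
    have a': "0 < a" "a < pi" using a u by auto
    have "s \<le> sin a"
    proof (cases "a \<le> pi / 2")
      case True
      then have "sin u \<le> sin a" using u a by (intro sin_monotone_2pi_le) auto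
      then show ?thesis using u by simp
    next
      case False
      then have "sin u \<le> sin (pi - a)" using u a by (intro sin_monotone_2pi_le) auto
      then show ?thesis using u by simp
    qed
    then have r1: "r / (2 * sin a) \<le> \<rho>" using sin_gt_zero[OF a'] \<rho> by (simp add: s_def field_simps)
    have r0: "0 \<le> r / (2 * sin a)" using sin_gt_zero[OF a'] r by simp
    show "0 \<le> f a" unfolding f_def
      by (rule mult_nonneg_nonneg[OF AB[OF r0 r1]]) (use sin_minus_mult_cos_nonneg[of a] a' in auto)
  qed (use u in \<open>auto simp: f_def\<close>)
  also have "F (pi - u) - F u = pair_density A B \<rho> r"
  proof -
    have m: "min 1 (r / (2 * \<rho>)) = s" using s by (simp add: s_def)
    have cu: "cos u = cap_cos \<rho> r" unfolding cap_cos_def m using u cos_arcsin[of s] s by (simp add: u_def)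
    have uu: "cap_angle \<rho> r = u" using s by (simp add: cap_angle_def m u_def max_absorb2)
    have rs: "r = 2 * \<rho> * s" using \<rho> by (simp add: s_def)
    have s0: "s \<noteq> 0" using s by simp
    have pu: "sin (pi - u) = s" "cos (pi - u) = - cos u" using u by simp_all
    have "F (pi - u) - F u = r\<^sup>2 * (A * ((pi - 2 * u) / s) - B * (r / 2) * ((pi - 2 * u) / (2 * s\<^sup>2) + cos u / s))"
      unfolding F_def pu u(3) using s0 by (simp add: field_simps power2_eq_square)
    also have "\<dots> = pair_density A B \<rho> r"
      unfolding pair_density_def uu cu[symmetric] using s0 unfolding rs by (simp add: field_simps power2_eq_square)
    finally show ?thesis .
  qed
  finally show ?thesis unfolding f_def .
next
  case False
  have m: "min 1 (r / (2 * \<rho>)) = 1" using False \<rho> by (simp add: field_simps)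
  have "indicator {0<..<pi} a * indicator {..<\<rho>} (r / (2 * sin a)) = (0::real)" for a
  proof (cases "0 < a \<and> a < pi")
    case True
    then have "0 < sin a" by (intro sin_gt_zero) auto
    moreover have "\<rho> * (2 * sin a) \<le> r"
    proof -
      have "2 * \<rho> * sin a \<le> 2 * \<rho> * 1" using \<rho> by (intro mult_left_mono) auto
      then show ?thesis using False by linarith
    qed
    ultimately have "\<rho> \<le> r / (2 * sin a)" by (simp add: pos_le_divide_eq)
    then show ?thesis by simp
  qed simp
  then show ?thesis by (simp only: mult_zero_left) (simp add: pair_density_def cap_angle_def cap_cos_def m)
qed

section \<open>The area of a slice in tangent-disc coordinates\<close>

context C2_domain
begin

definition touch_density :: "complex \<Rightarrow> real \<times> real \<Rightarrow> real" where
  "touch_density v p = (norm (vel (fst p)) - \<sigma> * turn (fst p) * rad v (snd p)) * (norm v / (2 * (sin (snd p))\<^sup>2)) * (co v (fst p) - cos (snd p))"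

lemma touch_domain_measurable [measurable]: "Measurable.pred (borel \<Otimes>\<^sub>M (borel \<Otimes>\<^sub>M borel)) (\<lambda>x. snd x \<in> touch_domain (fst x))"
  unfolding touch_domain_def rad_def co_def mem_Collect_eq by measurable

lemma touch_density_measurable [measurable]: "(\<lambda>x. touch_density (fst x) (snd x)) \<in> borel_measurable (borel \<Otimes>\<^sub>M (borel \<Otimes>\<^sub>M borel))"
  unfolding touch_density_def rad_def co_def by measurable

lemma touch_map_has_derivative:
  assumes a: "0 < a" "a < pi"
  shows "(touch_map v has_derivative (\<lambda>h. fst h *\<^sub>R (of_real (norm (vel t) - \<sigma> * turn t * rad v a) * ut t)
      + snd h *\<^sub>R (- of_real (norm v / (2 * (sin a)\<^sup>2)) * (of_real (cos a) * nrm t + \<i> * sgn v)))) (at (t,a) within S)"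
proof -
  have s: "sin a \<noteq> 0" using sin_gt_zero[OF a] by simp
  have F: "(fst has_derivative fst) (at (t,a) within S)" and Sn: "(snd has_derivative snd) (at (t,a) within S)"
    by (auto intro: derivative_eq_intros)
  have g: "((\<lambda>p. \<gamma> (fst p)) has_derivative (\<lambda>h. fst h *\<^sub>R vel t)) (at (t,a) within S)"
    using has_derivative_compose[OF F, of \<gamma> "\<lambda>h. h *\<^sub>R vel t"] deriv_\<gamma>[of t] by (simp add: has_vector_derivative_def)
  have n: "((\<lambda>p. nrm (fst p)) has_derivative (\<lambda>h. fst h *\<^sub>R (- of_real (\<sigma> * turn t) * ut t))) (at (t,a) within S)"
    using has_derivative_compose[OF F, of nrm "\<lambda>h. h *\<^sub>R (- of_real (\<sigma> * turn t) * ut t)"] nrm_deriv[of t] by (simp add: has_vector_derivative_def)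
  have "(rad v has_real_derivative - (norm v * cos a / (2 * (sin a)\<^sup>2))) (at a)"
    unfolding rad_def[abs_def] using s by (auto intro!: derivative_eq_intros simp: power2_eq_square field_simps)
  then have r: "((\<lambda>p. rad v (snd p)) has_derivative (\<lambda>h. (- (norm v * cos a / (2 * (sin a)\<^sup>2))) * snd h)) (at (t,a) within S)"
    using has_derivative_compose[OF Sn, of "rad v" "(*) (- (norm v * cos a / (2 * (sin a)\<^sup>2)))"] by (simp add: has_field_derivative_def)
  have "((\<lambda>a. norm v / 2 * cot a) has_real_derivative norm v / 2 * (- inverse ((sin a)\<^sup>2))) (at a)"
    using s by (intro DERIV_cmult DERIV_cot)
  then have c: "((\<lambda>p. norm v / 2 * cot (snd p)) has_derivative (\<lambda>h. (norm v / 2 * (- inverse ((sin a)\<^sup>2))) * snd h)) (at (t,a) within S)"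
    using has_derivative_compose[OF Sn, of "\<lambda>a. norm v / 2 * cot a" "(*) (norm v / 2 * (- inverse ((sin a)\<^sup>2)))"] by (simp add: has_field_derivative_def)
  have "(touch_map v has_derivative (\<lambda>h. fst h *\<^sub>R vel t
     + (of_real (rad v a) * (fst h *\<^sub>R (- of_real (\<sigma> * turn t) * ut t)) + of_real ((- (norm v * cos a / (2 * (sin a)\<^sup>2))) * snd h) * nrm t)
     + of_real ((norm v / 2 * (- inverse ((sin a)\<^sup>2))) * snd h) * (\<i> * sgn v) - 0)) (at (t,a) within S)"
    unfolding touch_map_def[abs_def]
    using has_derivative_diff[OF has_derivative_add[OF has_derivative_add[OF g has_derivative_mult[OF has_derivative_of_real[OF r] n]]
      has_derivative_mult_left[OF has_derivative_of_real[OF c], of "\<i> * sgn v"]] has_derivative_const[of "v / 2"]] by simp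
  then show ?thesis
    by (rule has_derivative_eq_rhs, subst vel_polar)
       (simp add: fun_eq_iff scaleR_conv_of_real inverse_eq_divide algebra_simps add_divide_distrib)
qed

text \<open>The nonnegative offset speed and the cosine condition make the absolute value disappear,
  up to the orientation sign \<sigma> of modulus 1.\<close>

lemma touch_jacobian:
  assumes a: "0 < a" "a < pi" and r: "0 \<le> norm (vel t) - \<sigma> * turn t * rad v a" and c: "cos a < co v t"
  shows "\<bar>Im (cnj (of_real (norm (vel t) - \<sigma> * turn t * rad v a) * ut t) * (- of_real (norm v / (2 * (sin a)\<^sup>2)) * (of_real (cos a) * nrm t + \<i> * sgn v)))\<bar>
    = touch_density v (t,a)"
proof -
  define A where "A = norm (vel t) - \<sigma> * turn t * rad v a"
  define B where "B = norm v / (2 * (sin a)\<^sup>2)"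
  have B: "B \<ge> 0" by (simp add: B_def)
  have uu: "cnj (ut t) * ut t = 1" using complex_mult_cnj_norm[of "ut t"] by (simp add: mult.commute)
  have "cnj (ut t) * nrm t = of_real \<sigma> * \<i> * (cnj (ut t) * ut t)" by (simp add: nrm_def mult_ac)
  then have un: "cnj (ut t) * nrm t = of_real \<sigma> * \<i>" unfolding uu by simp
  have "cnj (nrm t) * sgn v = - of_real \<sigma> * \<i> * (cnj (ut t) * sgn v)" by (simp add: nrm_def mult_ac)
  then have "co v t = - \<sigma> * Re (cnj (ut t) * sgn v)" unfolding co_def by (simp add: mult.assoc del: complex_cnj_mult)
  then have ru: "Re (cnj (ut t) * sgn v) = - \<sigma> * co v t" using \<sigma>_cases by auto
  have "cnj (of_real A * ut t) * (- of_real B * (of_real (cos a) * nrm t + \<i> * sgn v))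
     = - of_real (A * B) * (of_real (cos a) * (cnj (ut t) * nrm t) + \<i> * (cnj (ut t) * sgn v))"
    by (simp add: algebra_simps)
  also have "Im \<dots> = - (A * B) * (\<sigma> * cos a + Re (cnj (ut t) * sgn v))"
    unfolding un by (simp add: algebra_simps)
  also have "\<dots> = \<sigma> * (A * B * (co v t - cos a))" unfolding ru by (simp add: algebra_simps)
  finally have "\<bar>Im (cnj (of_real A * ut t) * (- of_real B * (of_real (cos a) * nrm t + \<i> * sgn v)))\<bar> = \<bar>\<sigma>\<bar> * \<bar>A * B * (co v t - cos a)\<bar>"
    by (simp add: abs_mult)
  also have "\<dots> = A * B * (co v t - cos a)" using \<sigma>_cases r B c by (auto simp: A_def)
  finally show ?thesis by (simp add: A_def B_def touch_density_def)
qed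

text \<open>The coordinates miss only pairs with an end point on the curve and pairs whose extremal
  disc has exactly the maximal radius. The latter are the image of the set \<open>N\<close>, which
  is null because for fixed t the equation \<open>rad v a = maxrad t\<close> prescribes sin a and
  leaves finitely many angles.\<close>

lemma emeasure_Tv:
  assumes v: "v \<noteq> 0"
  shows "emeasure lborel (Tv v) = (\<integral>\<^sup>+p. ennreal (indicator (touch_domain v) p * touch_density v p) \<partial>lborel)"
proof -
  define p where "p x = of_real (norm (vel (fst x)) - \<sigma> * turn (fst x) * rad v (snd x)) * ut (fst x)" for x
  define q where "q x = - of_real (norm v / (2 * (sin (snd x))\<^sup>2)) * (of_real (cos (snd x)) * nrm (fst x) + \<i> * sgn v)" for x
  have S [measurable]: "touch_domain v \<in> sets borel"
  proof -
    have "{x \<in> space (borel \<Otimes>\<^sub>M borel). snd (v,x) \<in> touch_domain (fst (v,x))} \<in> sets (borel \<Otimes>\<^sub>M borel)" by measurable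
    then show ?thesis by (subst borel_prod[symmetric]) (simp add: space_pair_measure)
  qed
  have dm: "touch_density v \<in> borel_measurable borel"
  proof -
    have "(\<lambda>x. (\<lambda>x. touch_density (fst x) (snd x)) (v,x)) \<in> borel_measurable (borel \<Otimes>\<^sub>M borel)" by measurable
    then show ?thesis by (simp add: borel_prod)
  qed
  have jac: "indicator (touch_domain v) x * \<bar>Im (cnj (p x) * q x)\<bar> = indicator (touch_domain v) x * touch_density v x" for x
  proof (cases "x \<in> touch_domain v")
    case True
    obtain t a where x: "x = (t,a)" by (cases x)
    have ta: "0 < a" "a < pi" "rad v a < maxrad t" "cos a < co v t" using True by (auto simp: touch_domain_def x)
    have "0 \<le> rad v a" using sin_gt_zero[OF ta(1,2)] by (simp add: rad_def)
    then show ?thesis using touch_jacobian[OF ta(1,2) offset_speed_nonneg[of "rad v a" t] ta(4)] ta(3) by (simp add: x p_def q_def)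
  qed simp
  define N where "N = {x. 0 \<le> fst x \<and> fst x < 1 \<and> 0 < snd x \<and> snd x < pi \<and> rad v (snd x) = maxrad (fst x)}"
  have Nneg: "negligible N"
  proof -
    have "{x \<in> space (borel \<Otimes>\<^sub>M borel). 0 \<le> fst x \<and> fst x < 1 \<and> 0 < snd x \<and> snd x < pi \<and> rad v (snd x) = maxrad (fst x)} \<in> sets (borel \<Otimes>\<^sub>M borel)"
      unfolding rad_def by measurable
    then have Nm: "N \<in> sets (lborel \<Otimes>\<^sub>M lborel)" by (simp add: N_def space_pair_measure cong: sets_pair_measure_cong)
    have "emeasure (lborel \<Otimes>\<^sub>M lborel) N = (\<integral>\<^sup>+t. emeasure lborel (Pair t -` N) \<partial>lborel)"
      by (rule lborel.emeasure_pair_measure_alt[OF Nm])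
    also have "\<dots> = (\<integral>\<^sup>+(t::real). 0 \<partial>lborel)"
    proof (intro nn_integral_cong)
      fix t :: real
      have "Pair t -` N \<subseteq> {a. 0 < a \<and> a < pi \<and> sin a = norm v / (2 * maxrad t)}"
      proof
        fix a assume "a \<in> Pair t -` N"
        then have a: "0 < a" "a < pi" "rad v a = maxrad t" by (auto simp: N_def)
        then show "a \<in> {a. 0 < a \<and> a < pi \<and> sin a = norm v / (2 * maxrad t)}"
          using sin_gt_zero[OF a(1,2)] maxrad_pos[of t] by (auto simp: rad_def field_simps)
      qed
      then have "finite (Pair t -` N)" using sin_level_finite finite_subset by blast
      then show "emeasure lborel (Pair t -` N) = 0" by (intro emeasure_lborel_countable countable_finite)
    qed
    finally have "emeasure lborel N = 0" by (simp add: lborel_prod)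
    moreover have "N \<in> sets borel" by (subst borel_prod[symmetric]) (use Nm in \<open>simp cong: sets_pair_measure_cong\<close>)
    ultimately have "N \<in> null_sets lborel" by (intro null_setsI) auto
    then show ?thesis by (simp add: negligible_iff_null_sets null_sets_completionI)
  qed
  have "negligible (touch_map v ` N)"
  proof (rule negligible_differentiable_image_negligible[OF _ Nneg])
    show "touch_map v differentiable_on N"
      unfolding differentiable_on_def
    proof
      fix x assume "x \<in> N"
      moreover obtain t a where "x = (t,a)" by (cases x)
      ultimately show "touch_map v differentiable at x within N"
        using touch_map_has_derivative[of a v t N] unfolding differentiable_def N_def by auto
    qed
  qed simp
  moreover have "negligible (path_image \<gamma>)"
    using null_C by (simp add: negligible_iff_null_sets null_sets_completionI)
  moreover have "negligible ((\<lambda>z. - v + z) ` path_image \<gamma>)" by (rule negligible_translation) fact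
  ultimately have neg: "negligible (touch_map v ` N \<union> (path_image \<gamma> \<union> (\<lambda>z. - v + z) ` path_image \<gamma>))" by (intro negligible_Un)
  have "emeasure lborel (Tv v) = (\<integral>\<^sup>+x. ennreal (indicator (touch_domain v) x * \<bar>Im (cnj (p x) * q x)\<bar>) \<partial>lborel)"
  proof (rule emeasure_differentiable_image_complex[where \<Phi> = "touch_map v"])
    show "Tv v \<in> sets borel" by (rule borel_closed[OF closed_Tv])
    show "(touch_map v has_derivative (\<lambda>h. fst h *\<^sub>R p x + snd h *\<^sub>R q x)) (at x within touch_domain v)" if "x \<in> touch_domain v" for x
      using touch_map_has_derivative[of "snd x" v "fst x" "touch_domain v"] that by (auto simp: touch_domain_def p_def q_def)
    show "inj_on (touch_map v) (touch_domain v)" by (rule touch_map_inj[OF v])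
    show "touch_map v ` touch_domain v \<subseteq> Tv v"
    proof
      fix z assume "z \<in> touch_map v ` touch_domain v"
      then obtain t a where "(t,a) \<in> touch_domain v" "z = touch_map v (t,a)" by auto
      then show "z \<in> Tv v" using touch_map_in_Tv[OF v, of a t] by (simp add: touch_domain_def)
    qed
    show "negligible (Tv v - touch_map v ` touch_domain v)"
    proof (rule negligible_subset[OF neg], rule subsetI)
      fix z assume z: "z \<in> Tv v - touch_map v ` touch_domain v"
      show "z \<in> touch_map v ` N \<union> (path_image \<gamma> \<union> (\<lambda>z. - v + z) ` path_image \<gamma>)"
      proof (cases "z \<in> path_image \<gamma> \<or> z + v \<in> path_image \<gamma>")
        case True
        then show ?thesis by (auto intro: image_eqI[of _ _ "z + v"])
      next
        case False
        then obtain t a where ta: "0 \<le> t" "t < 1" "0 < a" "a < pi" "rad v a \<le> maxrad t" "cos a < co v t" "z = touch_map v (t,a)"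
          using Tv_touch[OF v, of z] z by blast
        then have "(t,a) \<notin> touch_domain v" using z by blast
        then have "(t,a) \<in> N" using ta by (auto simp: touch_domain_def N_def)
        then show ?thesis using ta(7) by blast
      qed
    qed
    show "(\<lambda>x. indicator (touch_domain v) x * \<bar>Im (cnj (p x) * q x)\<bar>) \<in> borel_measurable borel"
      unfolding jac by (intro borel_measurable_times borel_measurable_indicator S dm)
  qed (rule S)
  then show ?thesis unfolding jac .
qed

end

lemma arcsin_clamp_measurable [measurable]: "(\<lambda>x::real. arcsin (max 0 (min 1 x))) \<in> borel_measurable borel"
  by (intro borel_measurable_continuous_onI continuous_on_arcsin continuous_intros) auto

lemma pair_density_measurable [measurable (raw)]:
  assumes [measurable]: "A \<in> borel_measurable M" "B \<in> borel_measurable M" "\<rho> \<in> borel_measurable M" "r \<in> borel_measurable M"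
  shows "(\<lambda>x. pair_density (A x) (B x) (\<rho> x) (r x)) \<in> borel_measurable M"
  unfolding pair_density_def cap_angle_def cap_cos_def by measurable

text \<open>The coefficient of B is at most \<rho> times that of A, so A - B \<rho> \<ge> 0 suffices
  when B is positive. The comparison is sin w \<le> w for w = pi - 2 u.\<close>

lemma pair_density_nonneg:
  assumes r: "0 \<le> r" and \<rho>: "0 < \<rho>" and A: "0 \<le> A" and AB: "0 \<le> A - B * \<rho>"
  shows "0 \<le> pair_density A B \<rho> r"
proof -
  define s where "s = min 1 (r / (2 * \<rho>))"
  define u where "u = arcsin s"
  have s: "0 \<le> s" "s \<le> 1" using r \<rho> by (auto simp: s_def)
  have u: "0 \<le> u" "u \<le> pi / 2" "sin u = s" using s arcsin_bounded[of s] arcsin_le_arcsin[of 0 s] by (auto simp: u_def)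
  define w where "w = pi - 2 * u"
  have w: "0 \<le> w" using u by (simp add: w_def)
  have cu: "cos u = cap_cos \<rho> r" unfolding cap_cos_def s_def[symmetric] using cos_arcsin[of s] s by (simp add: u_def)
  have "sin w = 2 * s * cos u" using u(3) by (simp add: w_def sin_double)
  then have w2: "2 * s * cap_cos \<rho> r \<le> w" using sin_x_le_x[OF w] cu by simp
  have c0: "0 \<le> cap_cos \<rho> r" unfolding cap_cos_def s_def[symmetric] using s by (simp add: power_le_one)
  have pd: "pair_density A B \<rho> r = A * (2 * \<rho> * r * w) - B * (\<rho>\<^sup>2 * r * w + \<rho> * r\<^sup>2 * cap_cos \<rho> r)"
    using s by (simp add: pair_density_def cap_angle_def s_def[symmetric] max_absorb2 u_def[symmetric] w_def[symmetric])
  have key: "\<rho>\<^sup>2 * r * w + \<rho> * r\<^sup>2 * cap_cos \<rho> r \<le> \<rho> * (2 * \<rho> * r * w)"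
  proof (cases "r < 2 * \<rho>")
    case True
    then have "r = 2 * \<rho> * s" using \<rho> by (simp add: s_def min_def field_simps)
    then have "\<rho> * r\<^sup>2 * cap_cos \<rho> r = \<rho>\<^sup>2 * r * (2 * s * cap_cos \<rho> r)" by (simp add: power2_eq_square)
    also have "\<dots> \<le> \<rho>\<^sup>2 * r * w" using w2 r by (intro mult_left_mono) auto
    finally show ?thesis by (simp add: power2_eq_square)
  next
    case False
    then have "s = 1" using \<rho> by (simp add: s_def field_simps)
    then have "cap_cos \<rho> r = 0" by (simp add: cap_cos_def s_def)
    then show ?thesis using w r \<rho> by (simp add: power2_eq_square)
  qed
  show ?thesis
  proof (cases "B \<le> 0")
    case True
    have "B * (\<rho>\<^sup>2 * r * w + \<rho> * r\<^sup>2 * cap_cos \<rho> r) \<le> 0"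
      using True w r \<rho> c0 by (intro mult_nonpos_nonneg add_nonneg_nonneg mult_nonneg_nonneg) auto
    moreover have "0 \<le> A * (2 * \<rho> * r * w)" using A w r \<rho> by simp
    ultimately show ?thesis unfolding pd by simp
  next
    case False
    then have "B * (\<rho>\<^sup>2 * r * w + \<rho> * r\<^sup>2 * cap_cos \<rho> r) \<le> B * \<rho> * (2 * \<rho> * r * w)"
      using mult_left_mono[OF key, of B] by (simp add: mult.assoc)
    also have "\<dots> \<le> A * (2 * \<rho> * r * w)" using AB w r \<rho> by (intro mult_right_mono) auto
    finally show ?thesis unfolding pd by simp
  qed
qed

context C2_domain
begin

lemma co_polar: assumes "r > 0" shows "co (\<i> * nrm t * (of_real r * cis \<phi>)) t = cos \<phi>"
proof -
  have n: "cnj (nrm t) * nrm t = 1" using complex_mult_cnj_norm[of "nrm t"] by (simp add: mult.commute)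
  have "sgn (\<i> * nrm t * (of_real r * cis \<phi>)) = \<i> * nrm t * cis \<phi>"
    using assms by (simp add: sgn_eq norm_mult)
  then have "cnj (nrm t) * sgn (\<i> * nrm t * (of_real r * cis \<phi>)) = \<i> * (cnj (nrm t) * nrm t) * cis \<phi>" by (simp add: mult_ac)
  then show ?thesis unfolding n co_def by simp
qed

text \<open>Polar coordinates for v with zero direction \<open>\<i> * nrm t\<close> turn
  \<open>co v t\<close> into cos \<phi>. The domain condition then reads cos a < cos \<phi>, and the
  direction can be integrated out.\<close>

lemma nn_integral_touch_direction:
  fixes f :: "real \<Rightarrow> real"
  assumes [measurable]: "f \<in> borel_measurable borel" and f: "\<And>r. 0 \<le> f r" and t: "0 \<le> t" "t < 1" and a: "0 < a" "a < pi"
  shows "(\<integral>\<^sup>+v. ennreal (f (norm v)) * ennreal (indicator (touch_domain v) (t,a) * touch_density v (t,a)) \<partial>lborel)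
    = (\<integral>\<^sup>+r. ennreal (indicator {0<..} r * f r) * ennreal (indicator {..<maxrad t} (r / (2 * sin a)) *
       ((norm (vel t) - \<sigma> * turn t * (r / (2 * sin a))) * (r\<^sup>2 * (sin a - a * cos a) / (sin a)\<^sup>2))) \<partial>lborel)"
proof -
  have m1 [measurable]: "(\<lambda>v. touch_density v (t,a)) \<in> borel_measurable borel"
    unfolding touch_density_def rad_def co_def by measurable
  have m2 [measurable]: "Measurable.pred borel (\<lambda>v. (t,a) \<in> touch_domain v)"
    unfolding touch_domain_def rad_def co_def mem_Collect_eq fst_conv snd_conv by measurable
  have m3 [measurable]: "(\<lambda>v. indicator (touch_domain v) (t,a) :: real) \<in> borel_measurable borel"
    unfolding indicator_def by measurable
  have s: "sin a > 0" using a by (rule sin_gt_zero)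
  define v where "v r \<phi> = 0 + \<i> * nrm t * (of_real r * cis \<phi>)" for r \<phi> :: real
  define A where "A r = norm (vel t) - \<sigma> * turn t * (r / (2 * sin a))" for r
  define g where "g v = ennreal (f (norm v)) * ennreal (indicator (touch_domain v) (t,a) * touch_density v (t,a))" for v
  have gm: "g \<in> borel_measurable borel" unfolding g_def[abs_def] by measurable
  have nv: "norm (v r \<phi>) = \<bar>r\<bar>" for r \<phi> by (simp add: v_def norm_mult)
  have "(\<integral>\<^sup>+v. g v \<partial>lborel) = (\<integral>\<^sup>+r. \<integral>\<^sup>+\<phi>. ennreal (indicator {0<..} r * r) * indicator {-pi<..<pi} \<phi> * g (v r \<phi>) \<partial>lborel \<partial>lborel)"
    unfolding v_def by (rule nn_integral_polar[OF _ gm]) (simp add: norm_mult)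
  also have "\<dots> = (\<integral>\<^sup>+r. ennreal (indicator {0<..} r * f r) * ennreal (indicator {..<maxrad t} (r / (2 * sin a)) *
       (A r * (r\<^sup>2 * (sin a - a * cos a) / (sin a)\<^sup>2))) \<partial>lborel)"
  proof (rule nn_integral_cong)
    fix r :: real
    show "(\<integral>\<^sup>+\<phi>. ennreal (indicator {0<..} r * r) * indicator {-pi<..<pi} \<phi> * g (v r \<phi>) \<partial>lborel)
     = ennreal (indicator {0<..} r * f r) * ennreal (indicator {..<maxrad t} (r / (2 * sin a)) * (A r * (r\<^sup>2 * (sin a - a * cos a) / (sin a)\<^sup>2)))"
      (is "?I = ?J")
    proof (cases "0 < r \<and> r / (2 * sin a) < maxrad t")
      case False
      then have "ennreal (indicator {0<..} r * r) * indicator {-pi<..<pi} \<phi> * g (v r \<phi>) = 0" for \<phi>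
        by (cases "0 < r") (auto simp: g_def touch_domain_def rad_def nv)
      moreover have "?J = 0" using False by (cases "0 < r") auto
      ultimately show ?thesis by (simp only: nn_integral_const mult_zero_left)
    next
      case True
      have A: "0 \<le> A r" unfolding A_def using True s by (intro offset_speed_nonneg) auto
      define c where "c = r * f r * (A r * (r / (2 * (sin a)\<^sup>2)))"
      have c: "0 \<le> c" using True A f[of r] by (simp add: c_def)
      have "ennreal (indicator {0<..} r * r) * indicator {-pi<..<pi} \<phi> * g (v r \<phi>)
        = ennreal c * (indicator {-pi<..<pi} \<phi> * ennreal (max 0 (cos \<phi> - cos a)))" for \<phi>
      proof -
        have cv: "co (v r \<phi>) t = cos \<phi>" using co_polar[of r t \<phi>] True by (simp add: v_def)
        have "indicator (touch_domain (v r \<phi>)) (t,a) * touch_density (v r \<phi>) (t,a) = A r * (r / (2 * (sin a)\<^sup>2)) * max 0 (cos \<phi> - cos a)"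
          using True a t by (auto simp: touch_domain_def touch_density_def rad_def nv cv A_def indicator_def max_def)
        then have "ennreal (indicator {0<..} r * r) * indicator {-pi<..<pi} \<phi> * g (v r \<phi>)
          = indicator {-pi<..<pi} \<phi> * (ennreal r * (ennreal (f r) * ennreal (A r * (r / (2 * (sin a)\<^sup>2)) * max 0 (cos \<phi> - cos a))))"
          using True nv by (simp add: g_def mult_ac)
        also have "ennreal r * (ennreal (f r) * ennreal (A r * (r / (2 * (sin a)\<^sup>2)) * max 0 (cos \<phi> - cos a))) = ennreal (c * max 0 (cos \<phi> - cos a))"
          using True A f[of r] by (simp add: c_def ennreal_mult[symmetric] mult_ac)
        also have "\<dots> = ennreal c * ennreal (max 0 (cos \<phi> - cos a))" using c by (intro ennreal_mult) auto
        finally show ?thesis by (simp only: mult_ac)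
      qed
      then have "?I = (\<integral>\<^sup>+\<phi>. ennreal c * (indicator {-pi<..<pi} \<phi> * ennreal (max 0 (cos \<phi> - cos a))) \<partial>lborel)" by (simp only:)
      also have "\<dots> = ennreal c * (\<integral>\<^sup>+\<phi>. indicator {-pi<..<pi} \<phi> * ennreal (max 0 (cos \<phi> - cos a)) \<partial>lborel)"
        by (rule nn_integral_cmult) measurable
      also have "\<dots> = ennreal (c * (2 * sin a - 2 * a * cos a))"
        unfolding nn_integral_cos_cap[OF a] using c sin_minus_mult_cos_nonneg[of a] a by (intro ennreal_mult[symmetric]) auto
      also have "c * (2 * sin a - 2 * a * cos a) = f r * (A r * (r\<^sup>2 * (sin a - a * cos a) / (sin a)\<^sup>2))"
        using s by (simp add: c_def power2_eq_square field_simps)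
      also have "ennreal \<dots> = ennreal (f r) * ennreal (A r * (r\<^sup>2 * (sin a - a * cos a) / (sin a)\<^sup>2))"
        using f[of r] A sin_minus_mult_cos_nonneg[of a] a by (intro ennreal_mult mult_nonneg_nonneg divide_nonneg_nonneg) auto
      finally show ?thesis using True by simp
    qed
  qed
  finally show ?thesis unfolding g_def A_def .
qed

text \<open>The order of integration is changed until the touching point is outermost. The direction
  of v and then the inscribed angle are integrated out, leaving the distance r weighted by
  \<open>pair_density\<close>.\<close>

lemma nn_integral_Tv:
  fixes f :: "real \<Rightarrow> real"
  assumes [measurable]: "f \<in> borel_measurable borel" and f: "\<And>r. 0 \<le> f r"
  shows "(\<integral>\<^sup>+v. ennreal (f (norm v)) * emeasure lborel (Tv v) \<partial>lborel)
    = (\<integral>\<^sup>+t. \<integral>\<^sup>+r. ennreal (indicator {0<..} r * (f r * pair_density (norm (vel t)) (\<sigma> * turn t) (maxrad t) r)) \<partial>lborel \<partial>U01)"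
proof -
  define G where "G v t a = ennreal (f (norm v)) * ennreal (indicator (touch_domain v) (t,a) * touch_density v (t,a))" for v t a
  define D where "D t a r = (norm (vel t) - \<sigma> * turn t * (r / (2 * sin a))) * (r\<^sup>2 * (sin a - a * cos a) / (sin a)\<^sup>2)" for t a r :: real
  have indm: "(\<lambda>x. indicator (touch_domain (fst x)) (snd x) :: real) \<in> borel_measurable (borel \<Otimes>\<^sub>M (borel \<Otimes>\<^sub>M borel))"
    unfolding indicator_def by measurable
  have Gm [measurable]: "(\<lambda>x. G (fst x) (fst (snd x)) (snd (snd x))) \<in> borel_measurable (borel \<Otimes>\<^sub>M (borel \<Otimes>\<^sub>M borel))"
  proof -
    have "(\<lambda>x. ennreal (f (norm (fst x))) * ennreal (indicator (touch_domain (fst x)) (snd x) * touch_density (fst x) (snd x))) \<in> borel_measurable (borel \<Otimes>\<^sub>M (borel \<Otimes>\<^sub>M borel))"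
      using indm touch_density_measurable by measurable
    then show ?thesis by (simp add: G_def)
  qed
  have [measurable]: "(\<lambda>p. G v (fst p) (snd p)) \<in> borel_measurable (borel \<Otimes>\<^sub>M borel)" for v
    using measurable_compose[OF measurable_Pair1' Gm, of v] by simp
  have [measurable]: "(\<lambda>p. \<integral>\<^sup>+a. G (fst p) (snd p) a \<partial>lborel) \<in> borel_measurable (borel \<Otimes>\<^sub>M borel)"
  proof -
    have "(\<lambda>x. G (fst (fst x)) (snd (fst x)) (snd x)) \<in> borel_measurable ((borel \<Otimes>\<^sub>M borel) \<Otimes>\<^sub>M borel)"
      using measurable_compose[OF _ Gm, of "\<lambda>x. (fst (fst x), (snd (fst x), snd x))" "(borel \<Otimes>\<^sub>M borel) \<Otimes>\<^sub>M borel"] by simp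
    then show ?thesis by measurable
  qed
  have [measurable]: "(\<lambda>p. G (fst p) t (snd p)) \<in> borel_measurable (borel \<Otimes>\<^sub>M borel)" for t
    using measurable_compose[OF _ Gm, of "\<lambda>p. (fst p, (t, snd p))" "borel \<Otimes>\<^sub>M borel"] by simp
  have "(\<integral>\<^sup>+v. ennreal (f (norm v)) * emeasure lborel (Tv v) \<partial>lborel) = (\<integral>\<^sup>+v. \<integral>\<^sup>+t. \<integral>\<^sup>+a. G v t a \<partial>lborel \<partial>lborel \<partial>lborel)"
  proof (rule nn_integral_cong_AE)
    have "AE v in lborel. v \<noteq> (0::complex)" by (rule AE_lborel_singleton)
    then show "AE v in lborel. ennreal (f (norm v)) * emeasure lborel (Tv v) = (\<integral>\<^sup>+t. \<integral>\<^sup>+a. G v t a \<partial>lborel \<partial>lborel)"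
    proof eventually_elim
      case (elim v)
      have [measurable]: "(\<lambda>p. ennreal (indicator (touch_domain v) p * touch_density v p)) \<in> borel_measurable (borel \<Otimes>\<^sub>M borel)"
        using measurable_compose[OF measurable_Pair1' indm, of v] measurable_compose[OF measurable_Pair1' touch_density_measurable, of v]
        by simp
      have "ennreal (f (norm v)) * emeasure lborel (Tv v) = (\<integral>\<^sup>+p. ennreal (f (norm v)) * ennreal (indicator (touch_domain v) p * touch_density v p) \<partial>(lborel \<Otimes>\<^sub>M lborel))"
        by (subst emeasure_Tv[OF elim]) (simp add: nn_integral_cmult lborel_prod[symmetric])
      also have "\<dots> = (\<integral>\<^sup>+p. G v (fst p) (snd p) \<partial>(lborel \<Otimes>\<^sub>M lborel))" by (simp add: G_def)
      also have "\<dots> = (\<integral>\<^sup>+t. \<integral>\<^sup>+a. G v t a \<partial>lborel \<partial>lborel)"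
        by (subst lborel.nn_integral_fst[symmetric]) auto
      finally show ?case .
    qed
  qed
  also have "\<dots> = (\<integral>\<^sup>+t. \<integral>\<^sup>+v. \<integral>\<^sup>+a. G v t a \<partial>lborel \<partial>lborel \<partial>lborel)"
    by (rule lborel_pair.Fubini'[symmetric]) (simp add: case_prod_beta')
  also have "\<dots> = (\<integral>\<^sup>+t. \<integral>\<^sup>+a. \<integral>\<^sup>+v. G v t a \<partial>lborel \<partial>lborel \<partial>lborel)"
    by (intro nn_integral_cong lborel_pair.Fubini'[symmetric]) (simp add: case_prod_beta')
  also have "\<dots> = (\<integral>\<^sup>+t. indicator {0..1} t * (\<integral>\<^sup>+r. ennreal (indicator {0<..} r * (f r * pair_density (norm (vel t)) (\<sigma> * turn t) (maxrad t) r)) \<partial>lborel) \<partial>lborel)"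
  proof (rule nn_integral_cong_AE)
    \<comment> \<open>\<open>touch_domain\<close> uses the half-open period and \<open>U01\<close>
      the closed one.\<close>
    have "AE t in lborel. t \<noteq> (1::real)" by (rule AE_lborel_singleton)
    then show "AE t in lborel. (\<integral>\<^sup>+a. \<integral>\<^sup>+v. G v t a \<partial>lborel \<partial>lborel)
       = indicator {0..1} t * (\<integral>\<^sup>+r. ennreal (indicator {0<..} r * (f r * pair_density (norm (vel t)) (\<sigma> * turn t) (maxrad t) r)) \<partial>lborel)"
    proof eventually_elim
      case (elim t)
      show ?case
      proof (cases "0 \<le> t \<and> t < 1")
        case False
        then have "G v t a = 0" for v a by (auto simp: G_def touch_domain_def)
        then show ?thesis using False elim by (auto simp: indicator_def)
      next
        case True
        have inner: "(\<integral>\<^sup>+v. G v t a \<partial>lborel) = (\<integral>\<^sup>+r. ennreal (indicator {0<..} r * f r) * ennreal (indicator {0<..<pi} a * indicator {..<maxrad t} (r / (2 * sin a)) * D t a r) \<partial>lborel)" for a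
        proof (cases "0 < a \<and> a < pi")
          case False
          then have "G v t a = 0" for v by (auto simp: G_def touch_domain_def)
          moreover have "indicator {0<..<pi} a = (0::real)" using False by auto
          ultimately show ?thesis by simp
        next
          case a: True
          then have "indicator {0<..<pi} a = (1::real)" by simp
          then show ?thesis unfolding G_def using nn_integral_touch_direction[OF assms, of t a] True a by (simp add: D_def)
        qed
        have "(\<integral>\<^sup>+a. \<integral>\<^sup>+v. G v t a \<partial>lborel \<partial>lborel) = (\<integral>\<^sup>+a. \<integral>\<^sup>+r. ennreal (indicator {0<..} r * f r) * ennreal (indicator {0<..<pi} a * indicator {..<maxrad t} (r / (2 * sin a)) * D t a r) \<partial>lborel \<partial>lborel)"
          by (simp only: inner)
        also have "\<dots> = (\<integral>\<^sup>+r. \<integral>\<^sup>+a. ennreal (indicator {0<..} r * f r) * ennreal (indicator {0<..<pi} a * indicator {..<maxrad t} (r / (2 * sin a)) * D t a r) \<partial>lborel \<partial>lborel)"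
          by (rule lborel_pair.Fubini'[symmetric]) (unfold D_def, measurable)
        also have "\<dots> = (\<integral>\<^sup>+r. ennreal (indicator {0<..} r * (f r * pair_density (norm (vel t)) (\<sigma> * turn t) (maxrad t) r)) \<partial>lborel)"
        proof (intro nn_integral_cong)
          fix r :: real
          have "(\<integral>\<^sup>+a. ennreal (indicator {0<..} r * f r) * ennreal (indicator {0<..<pi} a * indicator {..<maxrad t} (r / (2 * sin a)) * D t a r) \<partial>lborel)
            = ennreal (indicator {0<..} r * f r) * (\<integral>\<^sup>+a. ennreal (indicator {0<..<pi} a * indicator {..<maxrad t} (r / (2 * sin a)) * D t a r) \<partial>lborel)"
            by (rule nn_integral_cmult) (unfold D_def, measurable)
          also have "\<dots> = ennreal (indicator {0<..} r * (f r * pair_density (norm (vel t)) (\<sigma> * turn t) (maxrad t) r))"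
          proof (cases "0 < r")
            case True
            show ?thesis unfolding D_def
              by (subst nn_integral_pair_density[OF True maxrad_pos offset_speed_nonneg]) (use f True in \<open>auto simp: ennreal_mult'\<close>)
          qed simp
          finally show "(\<integral>\<^sup>+a. ennreal (indicator {0<..} r * f r) * ennreal (indicator {0<..<pi} a * indicator {..<maxrad t} (r / (2 * sin a)) * D t a r) \<partial>lborel) = \<dots>" .
        qed
        finally show ?thesis using True by simp
      qed
    qed
  qed
  also have "\<dots> = (\<integral>\<^sup>+t. \<integral>\<^sup>+r. ennreal (indicator {0<..} r * (f r * pair_density (norm (vel t)) (\<sigma> * turn t) (maxrad t) r)) \<partial>lborel \<partial>U01)"
    by (subst nn_integral_U01) auto
  finally show ?thesis .
qed

end

section \<open>Green's formula for regularized kernels\<close>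

text \<open>A C1 transition from 1 on s \<le> 0 to 0 on s \<ge> 1: squares of positive parts are
  continuously differentiable, which keeps the derivative explicit.\<close>

definition bump :: "real \<Rightarrow> real" where "bump s = (max 0 (1 - (max 0 s)\<^sup>2))\<^sup>2"
definition dbump :: "real \<Rightarrow> real" where "dbump s = 2 * max 0 (1 - (max 0 s)\<^sup>2) * (- (2 * max 0 s))"

lemma DERIV_max_0_squared: "((\<lambda>x::real. (max 0 x)\<^sup>2) has_real_derivative 2 * max 0 x) (at x)"
proof -
  consider "x < 0" | "x = 0" | "x > 0" by linarith
  then show ?thesis
  proof cases
    case 1
    have "((\<lambda>x::real. 0) has_real_derivative 2 * max 0 x) (at x)" using 1 by simp
    moreover have "\<forall>\<^sub>F y in nhds x. (max 0 y)\<^sup>2 = (0::real)"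
      using eventually_nhds_in_open[of "{..<0}" x] 1 by (auto elim!: eventually_mono)
    ultimately show ?thesis by (subst DERIV_cong_ev[OF refl _ refl]) auto
  next
    case 2
    have "((\<lambda>h::real. (max 0 h)\<^sup>2 / h) \<longlongrightarrow> 0) (at 0)"
    proof (rule Lim_null_comparison)
      show "\<forall>\<^sub>F h in at 0. norm ((max 0 h)\<^sup>2 / h) \<le> \<bar>h\<bar>"
        by (rule always_eventually) (auto simp: max_def power2_eq_square)
      show "((\<lambda>h::real. \<bar>h\<bar>) \<longlongrightarrow> 0) (at 0)" by (rule tendsto_rabs_zero) (rule tendsto_ident_at)
    qed
    then show ?thesis using 2 by (simp add: DERIV_def)
  next
    case 3
    have "((\<lambda>x::real. x\<^sup>2) has_real_derivative 2 * max 0 x) (at x)" using 3 by (auto intro!: derivative_eq_intros)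
    moreover have "\<forall>\<^sub>F y in nhds x. (max 0 y)\<^sup>2 = (y\<^sup>2::real)"
      using eventually_nhds_in_open[of "{0<..}" x] 3 by (auto elim!: eventually_mono)
    ultimately show ?thesis by (subst DERIV_cong_ev[OF refl _ refl]) auto
  qed
qed

lemma DERIV_bump: "(bump has_real_derivative dbump s) (at s)"
proof -
  have "((\<lambda>s. 1 - (max 0 s)\<^sup>2) has_real_derivative - (2 * max 0 s)) (at s)"
    using DERIV_diff[OF DERIV_const DERIV_max_0_squared[of s], of 1] by simp
  from DERIV_chain2[OF DERIV_max_0_squared this] show ?thesis
    unfolding bump_def[abs_def] dbump_def .
qed

lemma continuous_dbump: "continuous_on A dbump"
  unfolding dbump_def[abs_def] by (intro continuous_intros)

lemma bump_le_0: "s \<le> 0 \<Longrightarrow> bump s = 1" "s \<le> 0 \<Longrightarrow> dbump s = 0"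
  by (auto simp: bump_def dbump_def max_def)

lemma bump_ge_1: assumes "1 \<le> s" shows "bump s = 0" "dbump s = 0"
proof -
  have "1 \<le> (max 0 s)\<^sup>2" using assms by (simp add: one_le_power)
  then have "max 0 (1 - (max 0 s)\<^sup>2) = 0" by simp
  then show "bump s = 0" "dbump s = 0" unfolding bump_def dbump_def by simp_all
qed

lemma wirtinger_mult:
  assumes "wirtinger g a b" "wirtinger g' a' b'"
  shows "wirtinger (\<lambda>z. g z * g' z) (\<lambda>z. a z * g' z + g z * a' z) (\<lambda>z. b z * g' z + g z * b' z)"
  unfolding wirtinger_def
proof (intro conjI allI)
  note D = wirtingerD[OF assms(1)] wirtingerD[OF assms(2)]
  show "((\<lambda>z. g z * g' z) has_derivative (\<lambda>h. (a z * g' z + g z * a' z) * h + (b z * g' z + g z * b' z) * cnj h)) (at z)" for z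
    by (rule has_derivative_eq_rhs[OF has_derivative_mult[OF D(1,5)]]) (simp add: fun_eq_iff algebra_simps)
  show "continuous_on UNIV (\<lambda>z. a z * g' z + g z * a' z)" "continuous_on UNIV (\<lambda>z. b z * g' z + g z * b' z)"
    by (intro continuous_on_add continuous_on_mult D)+
qed

text \<open>The Cauchy-Pompeiu formula needs compact support, while Green's formula sees g and b
  only on a bounded set, where multiplication by the bump changes nothing.\<close>

lemma wirtinger_cutoff:
  fixes g a b :: "complex \<Rightarrow> complex"
  assumes W: "wirtinger g a b" and Y: "Y \<ge> 0"
  obtains g' a' b' X where "wirtinger g' a' b'" "\<And>z. norm z \<ge> X \<Longrightarrow> g' z = 0" "\<And>z. norm z \<ge> X \<Longrightarrow> b' z = 0"
    "X \<ge> 0" "\<And>z. norm z \<le> Y \<Longrightarrow> g' z = g z" "\<And>z. norm z \<le> Y \<Longrightarrow> b' z = b z"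
proof -
  define \<psi> d :: "complex \<Rightarrow> complex" where "\<psi> z = of_real (bump ((norm z)\<^sup>2 - Y\<^sup>2))" and "d z = of_real (dbump ((norm z)\<^sup>2 - Y\<^sup>2))" for z
  have d\<psi>: "(\<psi> has_derivative (\<lambda>h. (d z * cnj z) * h + (d z * z) * cnj h)) (at z)" for z
  proof -
    have "((\<lambda>z. (norm z)\<^sup>2 - Y\<^sup>2) has_derivative (\<lambda>h. 2 * (z \<bullet> h))) (at z)"
      unfolding power2_norm_eq_inner by (auto intro!: derivative_eq_intros simp: inner_commute)
    from has_derivative_compose[OF this DERIV_bump[of "(norm z)\<^sup>2 - Y\<^sup>2", unfolded has_field_derivative_def]]
    have "((\<lambda>z. bump ((norm z)\<^sup>2 - Y\<^sup>2)) has_derivative (\<lambda>h. dbump ((norm z)\<^sup>2 - Y\<^sup>2) * (2 * (z \<bullet> h)))) (at z)" .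
    from has_derivative_of_real[OF this] show ?thesis
      unfolding \<psi>_def[abs_def] d_def
      by (rule has_derivative_eq_rhs) (simp add: fun_eq_iff complex_eq_iff inner_complex_def algebra_simps)
  qed
  have cd: "continuous_on UNIV d"
    unfolding d_def by (intro continuous_intros continuous_on_compose2[OF continuous_dbump[of UNIV]]) auto
  have X: "bump ((norm z)\<^sup>2 - Y\<^sup>2) = 0 \<and> dbump ((norm z)\<^sup>2 - Y\<^sup>2) = 0" if "norm z \<ge> Y + 1" for z :: complex
  proof -
    have "(Y + 1)\<^sup>2 \<le> (norm z)\<^sup>2" using that Y by (intro power_mono) auto
    then have "1 \<le> (norm z)\<^sup>2 - Y\<^sup>2" using Y by (simp add: power2_eq_square algebra_simps)
    then show ?thesis using bump_ge_1 by blast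
  qed
  have Y': "bump ((norm z)\<^sup>2 - Y\<^sup>2) = 1 \<and> dbump ((norm z)\<^sup>2 - Y\<^sup>2) = 0" if "norm z \<le> Y" for z :: complex
  proof -
    have "(norm z)\<^sup>2 \<le> Y\<^sup>2" using that by (intro power_mono) auto
    then show ?thesis using bump_le_0 by simp
  qed
  have "wirtinger \<psi> (\<lambda>z. d z * cnj z) (\<lambda>z. d z * z)"
    unfolding wirtinger_def using d\<psi> by (intro conjI allI continuous_intros cd) auto
  from wirtinger_mult[OF W this] show thesis
  proof (rule that[where X="Y + 1"])
    show "g z * \<psi> z = 0" "b z * \<psi> z + g z * (d z * z) = 0" if "Y + 1 \<le> norm z" for z
      using X[OF that] by (simp_all add: \<psi>_def d_def)
    show "g z * \<psi> z = g z" "b z * \<psi> z + g z * (d z * z) = b z" if "norm z \<le> Y" for z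
      using Y'[OF that] by (simp_all add: \<psi>_def d_def)
    show "0 \<le> Y + 1" using Y by simp
  qed
qed

section \<open>Green's formula on the domain\<close>

context C2_domain
begin

lemma integral_U01_complex:
  fixes f :: "real \<Rightarrow> complex"
  assumes "continuous_on UNIV f"
  shows "integral {0..1} f = (\<integral>t. f t \<partial>U01)"
proof -
  have [measurable]: "f \<in> borel_measurable borel" using assms by (rule borel_measurable_continuous_onI)
  have "set_integrable lborel {0..1} f"
    unfolding set_integrable_def by (intro borel_integrable_compact continuous_on_subset[OF assms]) auto
  then show ?thesis by (simp add: integral_U01 set_borel_integral_eq_integral)
qed

lemma valid_\<gamma>: "valid_path \<gamma>"
proof -
  have "\<gamma> C1_differentiable_on {0..1}"
    using C2 C1_differentiable_on_subset[of \<gamma> UNIV "{0..1}"] by (simp add: C2_simple_closed_def)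
  then show ?thesis unfolding valid_path_def by (rule C1_differentiable_imp_piecewise)
qed

lemma integral_winding:
  assumes z: "z \<notin> path_image \<gamma>"
  shows "(\<integral>t. indicator {0..1} t *\<^sub>R (vel t / (\<gamma> t - z)) \<partial>lborel) = 2 * pi * \<i> * winding_number \<gamma> z"
proof -
  have nz: "\<gamma> t - z \<noteq> 0" for t using z by auto
  have c: "continuous_on {0..1} (\<lambda>t. vel t / (\<gamma> t - z))"
    by (intro continuous_intros continuous_\<gamma> continuous_vel) (use nz in auto)
  then have "set_integrable lborel {0..1} (\<lambda>t. vel t / (\<gamma> t - z))"
    unfolding set_integrable_def by (intro borel_integrable_compact) auto
  then have "(\<integral>t. indicator {0..1} t *\<^sub>R (vel t / (\<gamma> t - z)) \<partial>lborel) = integral {0..1} (\<lambda>t. vel t / (\<gamma> t - z))"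
    using set_borel_integral_eq_integral(2) unfolding set_lebesgue_integral_def by blast
  also have "\<dots> = contour_integral \<gamma> (\<lambda>w. 1 / (w - z))"
    unfolding contour_integral_integral vel_def by (intro integral_cong) simp
  also have "\<dots> = 2 * pi * \<i> * winding_number \<gamma> z"
    using winding_number_valid_path[OF valid_\<gamma> z] by simp
  finally show ?thesis .
qed

text \<open>The winding number about interior points, a sign. Green's formula is applied twice, so
  only its square enters and no comparison with \<sigma> is made.\<close>

definition \<tau> :: real where "\<tau> = (SOME \<tau>. \<tau>\<^sup>2 = 1 \<and> (\<forall>z\<in>interior \<Omega>. winding_number \<gamma> z = of_real \<tau>))"

lemma \<tau>2: "\<tau>\<^sup>2 = 1" and winding_\<tau>: "z \<in> interior \<Omega> \<Longrightarrow> winding_number \<gamma> z = of_real \<tau>"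
proof -
  have "\<exists>\<tau>::real. \<tau>\<^sup>2 = 1 \<and> (\<forall>z\<in>interior \<Omega>. winding_number \<gamma> z = of_real \<tau>)"
  proof (rule simple_closed_path_winding_number_inside[OF simple_\<gamma>])
    assume "\<And>z. z \<in> inside (path_image \<gamma>) \<Longrightarrow> winding_number \<gamma> z = 1"
    then show ?thesis by (intro exI[of _ 1]) (simp add: interior_\<Omega>)
  next
    assume "\<And>z. z \<in> inside (path_image \<gamma>) \<Longrightarrow> winding_number \<gamma> z = - 1"
    then show ?thesis by (intro exI[of _ "-1"]) (simp add: interior_\<Omega>)
  qed
  from someI_ex[OF this] show "\<tau>\<^sup>2 = 1" "z \<in> interior \<Omega> \<Longrightarrow> winding_number \<gamma> z = of_real \<tau>"
    unfolding \<tau>_def by blast+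
qed

lemma \<Omega>_borel [measurable]: "\<Omega> \<in> sets borel" using closed_\<Omega> by (rule borel_closed)

text \<open>Off the null set of curve points the Cauchy integral of 1 along the curve is 2 pi i
  \<tau> inside and 0 outside. Weighting it with b thus restricts b to \<Omega>, and
  \<open>integral_winding_kernel\<close> evaluates the result on the curve.\<close>

lemma green:
  fixes g a b :: "complex \<Rightarrow> complex"
  assumes W: "wirtinger g a b"
  shows "(\<integral>z. indicator \<Omega> z *\<^sub>R b z \<partial>lborel) = (of_real \<tau> / (2 * \<i>)) * (\<integral>t. g (\<gamma> t) * vel t \<partial>U01)"
proof -
  note cb = wirtingerD(3)[OF W] and cg = wirtingerD(4)[OF W]
  obtain Y where Y: "\<And>z. z \<in> \<Omega> \<Longrightarrow> norm z \<le> Y" "Y \<ge> 0"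
    using compact_imp_bounded[OF compact_\<Omega>] unfolding bounded_pos by (meson less_imp_le)
  have \<gamma>Y: "norm (\<gamma> t) \<le> Y" for t
  proof -
    have "\<gamma> t \<in> \<Omega>" by (subst \<Omega>_eq) (rule UnI2, rule in_C)
    then show ?thesis by (rule Y(1))
  qed
  obtain g' a' b' X where *: "wirtinger g' a' b'" "\<And>z. norm z \<ge> X \<Longrightarrow> g' z = 0" "\<And>z. norm z \<ge> X \<Longrightarrow> b' z = 0"
    "X \<ge> 0" "\<And>z. norm z \<le> Y \<Longrightarrow> g' z = g z" "\<And>z. norm z \<le> Y \<Longrightarrow> b' z = b z"
    by (erule wirtinger_cutoff[OF W Y(2)])
  have c\<gamma>: "continuous_on UNIV \<gamma>" "continuous_on UNIV vel" by (rule continuous_\<gamma> continuous_vel)+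
  have AE: "AE z in lborel. b' z * (\<integral>t. indicator {0..1} t *\<^sub>R (vel t / (\<gamma> t - z)) \<partial>lborel) = (2 * pi * \<i> * of_real \<tau>) * (indicator \<Omega> z *\<^sub>R b z)"
    using AE_not_in[OF null_C]
  proof eventually_elim
    case (elim z)
    show ?case
    proof (cases "z \<in> \<Omega>")
      case True
      then have "z \<in> interior \<Omega>" using elim \<Omega>_eq by blast
      then show ?thesis using True Y(1)[of z] *(6)[of z] by (simp add: integral_winding[OF elim] winding_\<tau>)
    next
      case False
      then have "z \<in> outside (path_image \<gamma>)" using compl_\<Omega> by blast
      then have "winding_number \<gamma> z = 0"
        using winding_number_zero_in_outside[OF simple_path_imp_path[OF simple_\<gamma>] closed_\<gamma>] by blast
      then show ?thesis using False by (simp add: integral_winding[OF elim])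
    qed
  qed
  have [measurable]: "b \<in> borel_measurable borel" using cb by (rule borel_measurable_continuous_onI)
  have "(2 * pi * \<i> * of_real \<tau>) * (\<integral>z. indicator \<Omega> z *\<^sub>R b z \<partial>lborel) = (\<integral>z. (2 * pi * \<i> * of_real \<tau>) * (indicator \<Omega> z *\<^sub>R b z) \<partial>lborel)"
    by (rule integral_mult_right_zero[symmetric])
  also have "\<dots> = (\<integral>z. b' z * (\<integral>t. indicator {0..1} t *\<^sub>R (vel t / (\<gamma> t - z)) \<partial>lborel) \<partial>lborel)"
    by (rule integral_cong_AE[symmetric]) (use integral_winding_kernel(1)[OF c\<gamma> *(1-4)] AE in auto)
  also have "\<dots> = pi * integral {0..1} (\<lambda>t. g' (\<gamma> t) * vel t)"
    by (rule integral_winding_kernel(2)[OF c\<gamma> *(1-4)])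
  also have "integral {0..1} (\<lambda>t. g' (\<gamma> t) * vel t) = (\<integral>t. g (\<gamma> t) * vel t \<partial>U01)"
    using *(5)[OF \<gamma>Y]
    by (simp, intro integral_U01_complex continuous_intros continuous_vel continuous_on_compose2[OF cg[of UNIV] continuous_\<gamma>]) auto
  finally have "(of_real (pi * \<tau>) * (2 * \<i>)) * (\<integral>z. indicator \<Omega> z *\<^sub>R b z \<partial>lborel) = of_real pi * (\<integral>t. g (\<gamma> t) * vel t \<partial>U01)"
    by (simp add: mult_ac)
  then have *: "of_real \<tau> * (\<integral>z. indicator \<Omega> z *\<^sub>R b z \<partial>lborel) = (\<integral>t. g (\<gamma> t) * vel t \<partial>U01) / (2 * \<i>)"
    by (simp add: field_simps)
  have "of_real \<tau> * of_real \<tau> = (1::complex)" using \<tau>2 by (metis of_real_1 of_real_mult power2_eq_square)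
  then have "(\<integral>z. indicator \<Omega> z *\<^sub>R b z \<partial>lborel) = of_real \<tau> * (of_real \<tau> * (\<integral>z. indicator \<Omega> z *\<^sub>R b z \<partial>lborel))"
    by (simp only: mult.assoc[symmetric] mult_1)
  also have "\<dots> = (of_real \<tau> / (2 * \<i>)) * (\<integral>t. g (\<gamma> t) * vel t \<partial>U01)" unfolding * by simp
  finally show ?thesis .
qed

end

lemma has_derivative_radial:
  assumes "(f has_real_derivative f') (at ((norm (z - w))\<^sup>2))"
  shows "((\<lambda>z. complex_of_real (f ((norm (z - w))\<^sup>2))) has_derivative (\<lambda>h. of_real f' * (cnj (z - w) * h + (z - w) * cnj h))) (at z)"
proof -
  have "((\<lambda>z. (norm (z - w))\<^sup>2) has_derivative (\<lambda>h. 2 * ((z - w) \<bullet> h))) (at z)"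
    unfolding power2_norm_eq_inner by (auto intro!: derivative_eq_intros simp: inner_commute)
  from has_derivative_of_real[OF has_derivative_compose[OF this assms[unfolded has_field_derivative_def]]]
  show ?thesis
    by (rule has_derivative_eq_rhs) (simp add: fun_eq_iff complex_eq_iff inner_complex_def algebra_simps)
qed

section \<open>Reduction of double area integrals to the curve\<close>

context C2_domain
begin

definition ang_prod :: "real \<Rightarrow> real \<Rightarrow> real" where "ang_prod s t = - (ang_vel s t * ang_vel t s)"

abbreviation dist2 :: "real \<Rightarrow> real \<Rightarrow> real" where "dist2 s t \<equiv> (norm (\<gamma> s - \<gamma> t))\<^sup>2"

lemma dist2_ang_prod: "(dist2 s t)\<^sup>2 * ang_prod s t = Im (vel s * cnj (\<gamma> s - \<gamma> t)) * Im (vel t * cnj (\<gamma> s - \<gamma> t))"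
proof (cases "\<gamma> s = \<gamma> t")
  case False
  define d where "d = \<gamma> s - \<gamma> t"
  have d: "norm d \<noteq> 0" using False by (simp add: d_def)
  have "ang_vel t s = Im (vel s * cnj d) / (norm d)\<^sup>2" by (simp add: ang_vel_def Im_divide_eq d_def)
  moreover have "ang_vel s t = - (Im (vel t * cnj d) / (norm d)\<^sup>2)"
  proof -
    have "vel t / (\<gamma> t - \<gamma> s) = - (vel t / d)" unfolding d_def by (metis minus_diff_eq minus_divide_right)
    then show ?thesis unfolding ang_vel_def by (simp only: uminus_complex.simps Im_divide_eq)
  qed
  ultimately show ?thesis using d unfolding ang_prod_def d_def[symmetric] by (simp del: times_complex.simps add: power2_eq_square)
qed (simp add: ang_prod_def)

text \<open>Splits both velocities into components along the chord and normal to it; the normal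
  parts produce \<open>ang_prod\<close>.\<close>

lemma dist2_inner:
  "dist2 s t * Re (cnj (vel t) * vel s) = ((\<gamma> s - \<gamma> t) \<bullet> vel s) * ((\<gamma> s - \<gamma> t) \<bullet> vel t) + (dist2 s t)\<^sup>2 * ang_prod s t"
  unfolding dist2_ang_prod unfolding cmod_power2 by (simp add: inner_complex_def algebra_simps power2_eq_square)

lemma integrable_U01_continuous:
  fixes f :: "real \<Rightarrow> 'a::euclidean_space"
  assumes "continuous_on UNIV f" shows "integrable U01 f"
proof -
  have [measurable]: "f \<in> borel_measurable borel" using assms by (rule borel_measurable_continuous_onI)
  have "compact (f ` {0..1})" by (intro compact_continuous_image continuous_on_subset[OF assms]) auto
  then obtain B where B: "\<And>t. t \<in> {0..1} \<Longrightarrow> norm (f t) \<le> B" using compact_imp_bounded bounded_iff by (metis imageI)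
  show ?thesis by (rule U01.integrable_const_bound[of _ B]) (use B in \<open>auto simp: AE_U01\<close>)
qed

lemma integral_U01_FTC:
  fixes f :: "real \<Rightarrow> real"
  assumes f: "\<And>t. (f has_real_derivative f' t) (at t)" and c: "continuous_on UNIV f'"
  shows "(\<integral>t. f' t \<partial>U01) = f 1 - f 0"
proof -
  have [measurable]: "f' \<in> borel_measurable borel" using c by (rule borel_measurable_continuous_onI)
  have s: "set_integrable lborel {0..1} f'"
    unfolding set_integrable_def by (intro borel_integrable_compact continuous_on_subset[OF c]) auto
  have "(\<integral>t. f' t \<partial>U01) = integral {0..1} f'" by (simp add: integral_U01 set_borel_integral_eq_integral(2)[OF s])
  also have "(f' has_integral (f 1 - f 0)) {0..1}"
    by (rule fundamental_theorem_of_calculus)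
       (auto simp: has_real_derivative_iff_has_vector_derivative[symmetric] intro: DERIV_subset f)
  then have "integral {0..1} f' = f 1 - f 0" by (rule integral_unique)
  finally show ?thesis .
qed

lemma inner_derivative_dist2:
  shows "((\<lambda>t. dist2 s t) has_real_derivative - 2 * ((\<gamma> s - \<gamma> t) \<bullet> vel t)) (at t)"
    and "((\<lambda>t. (\<gamma> s - \<gamma> t) \<bullet> vel s) has_real_derivative - (vel t \<bullet> vel s)) (at t)"
proof -
  have d: "((\<lambda>t. \<gamma> s - \<gamma> t) has_derivative (\<lambda>h. - (h *\<^sub>R vel t))) (at t)"
    using has_derivative_diff[OF has_derivative_const deriv_\<gamma>[of t, unfolded has_vector_derivative_def], of "\<gamma> s"] by simp
  show "((\<lambda>t. dist2 s t) has_real_derivative - 2 * ((\<gamma> s - \<gamma> t) \<bullet> vel t)) (at t)"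
    unfolding power2_norm_eq_inner has_field_derivative_def
    by (rule has_derivative_eq_rhs[OF has_derivative_inner[OF d d]]) (simp add: fun_eq_iff inner_commute)
  show "((\<lambda>t. (\<gamma> s - \<gamma> t) \<bullet> vel s) has_real_derivative - (vel t \<bullet> vel s)) (at t)"
    unfolding has_field_derivative_def
    by (rule has_derivative_eq_rhs[OF has_derivative_inner_left[OF d]]) (simp add: fun_eq_iff)
qed

text \<open>The function \<open>G (dist2 s t) * (2 * ((\<gamma> s - \<gamma> t) \<bullet> vel
  s))\<close> of t is periodic, so its derivative integrates to 0. The combination 4 R P + 2 G is
  arranged so that this removes exactly the components along the chord and leaves the bounded factor
  \<open>ang_prod\<close>.\<close>

lemma chord_identity:
  assumes G: "\<And>R. 0 \<le> R \<Longrightarrow> (G has_real_derivative P R) (at R)" and P: "continuous_on {0..} P"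
  shows "(\<integral>t. (4 * dist2 s t * P (dist2 s t) + 2 * G (dist2 s t)) * Re (cnj (vel t) * vel s) \<partial>U01)
    = (\<integral>t. 4 * P (dist2 s t) * (dist2 s t)\<^sup>2 * ang_prod s t \<partial>U01)"
proof -
  have cG: "continuous_on {0..} G" using G by (intro continuous_at_imp_continuous_on ballI DERIV_isCont) auto
  define D where "D t = ((\<gamma> s - \<gamma> t) \<bullet> vel s) * ((\<gamma> s - \<gamma> t) \<bullet> vel t)" for t
  have cD2: "continuous_on UNIV (\<lambda>t. dist2 s t)" by (intro continuous_intros continuous_\<gamma>)
  have cP: "continuous_on UNIV (\<lambda>t. P (dist2 s t))" by (rule continuous_on_compose2[OF P cD2]) auto
  have cG': "continuous_on UNIV (\<lambda>t. G (dist2 s t))" by (rule continuous_on_compose2[OF cG cD2]) auto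
  have cd: "continuous_on UNIV (\<lambda>t. Re (cnj (vel t) * vel s))" by (intro continuous_intros continuous_vel)
  have cDD: "continuous_on UNIV D" unfolding D_def by (intro continuous_intros continuous_\<gamma> continuous_vel)
  define h where "h t = 4 * P (dist2 s t) * D t + 2 * G (dist2 s t) * Re (cnj (vel t) * vel s)" for t
  have ch: "continuous_on UNIV h" unfolding h_def
    by (intro continuous_on_add continuous_on_mult continuous_on_const cP cG' cd cDD)
  have "((\<lambda>t. G (dist2 s t) * (2 * ((\<gamma> s - \<gamma> t) \<bullet> vel s))) has_real_derivative - h t) (at t)" for t
  proof -
    have "((\<lambda>t. G (dist2 s t) * (2 * ((\<gamma> s - \<gamma> t) \<bullet> vel s))) has_real_derivative
       P (dist2 s t) * (- 2 * ((\<gamma> s - \<gamma> t) \<bullet> vel t)) * (2 * ((\<gamma> s - \<gamma> t) \<bullet> vel s)) + (2 * - (vel t \<bullet> vel s)) * G (dist2 s t)) (at t)"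
      by (intro DERIV_mult DERIV_chain2[OF G] DERIV_cmult inner_derivative_dist2) simp
    moreover have "P (dist2 s t) * (- 2 * ((\<gamma> s - \<gamma> t) \<bullet> vel t)) * (2 * ((\<gamma> s - \<gamma> t) \<bullet> vel s)) + (2 * - (vel t \<bullet> vel s)) * G (dist2 s t) = - h t"
    proof -
      have "vel t \<bullet> vel s = Re (cnj (vel t) * vel s)" by (simp add: inner_complex_def)
      then show ?thesis unfolding h_def D_def by (simp only:) (simp add: algebra_simps)
    qed
    ultimately show ?thesis by (simp only:)
  qed
  from integral_U01_FTC[OF this continuous_on_minus[OF ch]]
  have h0: "(\<integral>t. h t \<partial>U01) = 0" using periodic_\<gamma>[of 0] by simp
  define q where "q t = 4 * P (dist2 s t) * (dist2 s t)\<^sup>2 * ang_prod s t" for t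
  have hq: "(4 * dist2 s t * P (dist2 s t) + 2 * G (dist2 s t)) * Re (cnj (vel t) * vel s) = h t + q t" for t
  proof -
    have "(4 * r * p + 2 * g) * x = 4 * p * (r * x) + 2 * g * x" for r p g x :: real
      by (simp add: algebra_simps)
    then have "(4 * dist2 s t * P (dist2 s t) + 2 * G (dist2 s t)) * Re (cnj (vel t) * vel s)
      = 4 * P (dist2 s t) * (dist2 s t * Re (cnj (vel t) * vel s)) + 2 * G (dist2 s t) * Re (cnj (vel t) * vel s)"
      .
    then show ?thesis unfolding dist2_inner by (simp only: h_def q_def D_def distrib_left mult_ac add_ac)
  qed
  have "continuous_on UNIV (\<lambda>t. (4 * dist2 s t * P (dist2 s t) + 2 * G (dist2 s t)) * Re (cnj (vel t) * vel s) - h t)"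
    by (intro continuous_on_diff continuous_on_add continuous_on_mult continuous_on_const cP cG' cd cD2 ch)
  then have cq: "continuous_on UNIV q" by (simp only: hq add_diff_cancel_left')
  have "(\<integral>t. h t + q t \<partial>U01) = (\<integral>t. h t \<partial>U01) + (\<integral>t. q t \<partial>U01)"
    by (intro Bochner_Integration.integral_add integrable_U01_continuous ch cq)
  then show ?thesis unfolding hq h0 q_def by simp
qed

text \<open>The kernel 4 (M1 + R M2), with R the squared distance, is the Laplacian of M as a
  function of z. One Green formula in z and one in w integrate both derivatives away.\<close>

lemma double_green:
  assumes M: "\<And>R. 0 \<le> R \<Longrightarrow> (M has_real_derivative M1 R) (at R)" and M1: "\<And>R. 0 \<le> R \<Longrightarrow> (M1 has_real_derivative M2 R) (at R)"
    and cM2: "continuous_on {0..} M2"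
  shows "(\<integral>w. indicator \<Omega> w * (\<integral>z. indicator \<Omega> z * (4 * (M1 ((norm (z - w))\<^sup>2) + (norm (z - w))\<^sup>2 * M2 ((norm (z - w))\<^sup>2))) \<partial>lborel) \<partial>lborel)
    = - (\<integral>s. (\<integral>t. M (dist2 s t) * Re (cnj (vel t) * vel s) \<partial>U01) \<partial>U01)"
proof -
  define K where "K R = 4 * (M1 R + R * M2 R)" for R
  have cM: "continuous_on {0..} M" using M by (intro continuous_at_imp_continuous_on ballI DERIV_isCont) auto
  have cM1: "continuous_on {0..} M1" using M1 by (intro continuous_at_imp_continuous_on ballI DERIV_isCont) auto
  have cK: "continuous_on {0..} K" unfolding K_def by (intro continuous_intros cM1 cM2)
  have cr: "continuous_on UNIV (\<lambda>z. complex_of_real (f ((norm (z - w))\<^sup>2)))" if "continuous_on {0..} f" for f and w :: complex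
    by (intro continuous_on_of_real continuous_on_compose2[OF that]) (auto intro!: continuous_intros)
  have s1: "(\<integral>z. indicator \<Omega> z *\<^sub>R complex_of_real (K ((norm (z - w))\<^sup>2)) \<partial>lborel)
     = (of_real \<tau> / (2 * \<i>)) * (\<integral>s. (4 * cnj (\<gamma> s - w) * of_real (M1 ((norm (\<gamma> s - w))\<^sup>2))) * vel s \<partial>U01)" for w
  proof (rule green, unfold wirtinger_def, intro conjI allI)
    fix z
    have l: "((\<lambda>z. 4 * cnj (z - w)) has_derivative (\<lambda>h. 4 * cnj h)) (at z)"
      by (auto intro!: derivative_eq_intros)
    show "((\<lambda>z. 4 * cnj (z - w) * of_real (M1 ((norm (z - w))\<^sup>2))) has_derivative
       (\<lambda>h. (4 * (cnj (z - w))\<^sup>2 * of_real (M2 ((norm (z - w))\<^sup>2))) * h + complex_of_real (K ((norm (z - w))\<^sup>2)) * cnj h)) (at z)"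
    proof (rule has_derivative_eq_rhs[OF has_derivative_mult[OF l has_derivative_radial[OF M1]]])
      have "complex_of_real ((norm (z - w))\<^sup>2) = cnj (z - w) * (z - w)" by (metis complex_norm_square mult.commute)
      then have k: "complex_of_real (K ((norm (z - w))\<^sup>2)) = 4 * (of_real (M1 ((norm (z - w))\<^sup>2)) + cnj (z - w) * (z - w) * of_real (M2 ((norm (z - w))\<^sup>2)))"
        by (simp add: K_def)
      show "(\<lambda>h. 4 * cnj (z - w) * (of_real (M2 ((norm (z - w))\<^sup>2)) * (cnj (z - w) * h + (z - w) * cnj h)) + 4 * cnj h * of_real (M1 ((norm (z - w))\<^sup>2)))
         = (\<lambda>h. (4 * (cnj (z - w))\<^sup>2 * of_real (M2 ((norm (z - w))\<^sup>2))) * h + complex_of_real (K ((norm (z - w))\<^sup>2)) * cnj h)"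
        unfolding k by (simp only: fun_eq_iff power2_eq_square distrib_left distrib_right mult_ac) (simp add: algebra_simps)
    qed simp
    show "continuous_on UNIV (\<lambda>z. 4 * (cnj (z - w))\<^sup>2 * of_real (M2 ((norm (z - w))\<^sup>2)))"
      by (intro continuous_on_mult continuous_on_power continuous_on_const continuous_on_cnj continuous_on_diff continuous_on_id cr cM2)
    show "continuous_on UNIV (\<lambda>z. complex_of_real (K ((norm (z - w))\<^sup>2)))" by (rule cr[OF cK])
  qed
  have s2: "(\<integral>w. indicator \<Omega> w *\<^sub>R ((\<gamma> s - w) * of_real (M1 ((norm (\<gamma> s - w))\<^sup>2))) \<partial>lborel)
     = (of_real \<tau> / (2 * \<i>)) * (\<integral>t. (- of_real (M ((norm (\<gamma> s - \<gamma> t))\<^sup>2))) * vel t \<partial>U01)" for s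
  proof -
    have "(\<integral>w. indicator \<Omega> w *\<^sub>R ((\<gamma> s - w) * of_real (M1 ((norm (w - \<gamma> s))\<^sup>2))) \<partial>lborel)
      = (of_real \<tau> / (2 * \<i>)) * (\<integral>t. (- of_real (M ((norm (\<gamma> t - \<gamma> s))\<^sup>2))) * vel t \<partial>U01)"
    proof (rule green, unfold wirtinger_def, intro conjI allI)
      fix w
      show "((\<lambda>w. - complex_of_real (M ((norm (w - \<gamma> s))\<^sup>2))) has_derivative
        (\<lambda>h. (cnj (\<gamma> s - w) * of_real (M1 ((norm (w - \<gamma> s))\<^sup>2))) * h + ((\<gamma> s - w) * of_real (M1 ((norm (w - \<gamma> s))\<^sup>2))) * cnj h)) (at w)"
        by (rule has_derivative_eq_rhs[OF has_derivative_minus[OF has_derivative_radial[OF M]]]) (auto simp: fun_eq_iff algebra_simps)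
      show "continuous_on UNIV (\<lambda>w. cnj (\<gamma> s - w) * of_real (M1 ((norm (w - \<gamma> s))\<^sup>2)))"
        "continuous_on UNIV (\<lambda>w. (\<gamma> s - w) * of_real (M1 ((norm (w - \<gamma> s))\<^sup>2)))"
        by (intro continuous_on_mult continuous_on_const continuous_on_cnj continuous_on_diff continuous_on_id cr cM1)+
    qed
    then show ?thesis by (simp only: norm_minus_commute)
  qed
  have s2': "(\<integral>w. indicator \<Omega> w *\<^sub>R (cnj (\<gamma> s - w) * of_real (M1 ((norm (\<gamma> s - w))\<^sup>2))) \<partial>lborel)
     = (of_real \<tau> / (2 * \<i>)) * (\<integral>t. of_real (M (dist2 s t)) * cnj (vel t) \<partial>U01)" for s
  proof -
    have "(\<integral>w. indicator \<Omega> w *\<^sub>R (cnj (\<gamma> s - w) * of_real (M1 ((norm (\<gamma> s - w))\<^sup>2))) \<partial>lborel)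
      = (\<integral>w. cnj (indicator \<Omega> w *\<^sub>R ((\<gamma> s - w) * of_real (M1 ((norm (\<gamma> s - w))\<^sup>2)))) \<partial>lborel)"
      by (simp add: scaleR_conv_of_real)
    also have "\<dots> = cnj ((of_real \<tau> / (2 * \<i>)) * (\<integral>t. (- of_real (M (dist2 s t))) * vel t \<partial>U01))"
      by (simp only: Bochner_Integration.integral_cnj s2)
    also have "\<dots> = (of_real \<tau> / (2 * \<i>)) * cnj (\<integral>t. of_real (M (dist2 s t)) * vel t \<partial>U01)"
      by simp
    also have "cnj (\<integral>t. of_real (M (dist2 s t)) * vel t \<partial>U01) = (\<integral>t. of_real (M (dist2 s t)) * cnj (vel t) \<partial>U01)"
      by (simp flip: Bochner_Integration.integral_cnj)
    finally show ?thesis .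
  qed
  define F where "F w s = indicator \<Omega> w *\<^sub>R ((4 * cnj (\<gamma> s - w) * of_real (M1 ((norm (\<gamma> s - w))\<^sup>2))) * vel s)" for w s
  have intF: "integrable (lborel \<Otimes>\<^sub>M U01) (\<lambda>(w,s). F w s)"
  proof -
    obtain Y where Y: "\<And>z. z \<in> \<Omega> \<Longrightarrow> norm z \<le> Y" "Y > 0"
      using compact_imp_bounded[OF compact_\<Omega>] unfolding bounded_pos by blast
    have \<gamma>Y: "norm (\<gamma> t) \<le> Y" for t
    proof -
      have "\<gamma> t \<in> \<Omega>" by (subst \<Omega>_eq) (rule UnI2, rule in_C)
      then show ?thesis by (rule Y(1))
    qed
    obtain V where V: "V > 0" "\<And>t. norm (vel t) \<le> V" using periodic_bounded[OF continuous_vel periodic_vel] by blast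
    have "compact (M1 ` {0..(2*Y)\<^sup>2})" by (intro compact_continuous_image continuous_on_subset[OF cM1]) auto
    then obtain B where B: "B > 0" "\<And>R. 0 \<le> R \<Longrightarrow> R \<le> (2*Y)\<^sup>2 \<Longrightarrow> \<bar>M1 R\<bar> \<le> B"
      using compact_imp_bounded[of "M1 ` {0..(2*Y)\<^sup>2}"] unfolding bounded_pos by auto
    have bnd: "norm (F w s) \<le> 4 * (2 * Y) * B * V" if "w \<in> \<Omega>" for w s
    proof -
      have n: "norm (\<gamma> s - w) \<le> 2 * Y" using norm_triangle_ineq4[of "\<gamma> s" w] \<gamma>Y[of s] Y(1)[OF that] by simp
      then have "(norm (\<gamma> s - w))\<^sup>2 \<le> (2*Y)\<^sup>2" by (intro power_mono) auto
      then have "\<bar>M1 ((norm (\<gamma> s - w))\<^sup>2)\<bar> \<le> B" by (intro B) auto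
      then have "4 * norm (\<gamma> s - w) * \<bar>M1 ((norm (\<gamma> s - w))\<^sup>2)\<bar> * norm (vel s) \<le> 4 * (2 * Y) * B * V"
        using n V Y B by (intro mult_mono mult_nonneg_nonneg) auto
      moreover have "norm (F w s) = 4 * norm (\<gamma> s - w) * \<bar>M1 ((norm (\<gamma> s - w))\<^sup>2)\<bar> * norm (vel s)"
        unfolding F_def using that by (simp add: norm_mult del: complex_cnj_diff)
      ultimately show ?thesis by simp
    qed
    have "continuous_on UNIV (\<lambda>p. M1 ((norm (\<gamma> (snd p) - fst p))\<^sup>2))"
      by (rule continuous_on_compose2[OF cM1]) (auto intro!: continuous_intros continuous_on_compose2[OF continuous_\<gamma>[of UNIV]])
    then have [measurable]: "(\<lambda>p. M1 ((norm (\<gamma> (snd p) - fst p))\<^sup>2)) \<in> borel_measurable (borel \<Otimes>\<^sub>M borel)"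
      by (simp add: borel_prod borel_measurable_continuous_onI)
    have meas: "(\<lambda>(w,s). F w s) \<in> borel_measurable (lborel \<Otimes>\<^sub>M U01)"
      unfolding F_def case_prod_beta' by (simp cong: measurable_cong_sets sets_pair_measure_cong)
    have "emeasure lborel \<Omega> < \<infinity>" by (rule emeasure_compact_finite[OF compact_\<Omega>])
    then have fin: "emeasure (lborel \<Otimes>\<^sub>M U01) (\<Omega> \<times> UNIV) < \<infinity>"
      by (subst U01.emeasure_pair_measure_Times) (auto simp: emeasure_U01_UNIV)
    show ?thesis
    proof (rule integrableI_bounded_set[OF _ meas fin])
      show "AE x in lborel \<Otimes>\<^sub>M U01. x \<in> \<Omega> \<times> UNIV \<longrightarrow> norm ((\<lambda>(w,s). F w s) x) \<le> 4 * (2 * Y) * B * V"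
        by (rule AE_I2) (use bnd in auto)
      show "AE x in lborel \<Otimes>\<^sub>M U01. x \<notin> \<Omega> \<times> UNIV \<longrightarrow> (\<lambda>(w,s). F w s) x = 0"
        by (rule AE_I2) (auto simp: F_def indicator_def)
    qed simp
  qed
  interpret LU: pair_sigma_finite lborel U01 ..
  have ind: "indicator \<Omega> w *\<^sub>R (\<integral>s. (4 * cnj (\<gamma> s - w) * of_real (M1 ((norm (\<gamma> s - w))\<^sup>2))) * vel s \<partial>U01) = (\<integral>s. F w s \<partial>U01)" for w
    by (simp add: F_def)
  \<comment> \<open>Each Green formula contributes one factor c. As \<tau> is a sign, the two of
    them and the factor 4 of the Laplacian combine to -1.\<close>
  define c where "c = complex_of_real \<tau> / (2 * \<i>)"
  have circ_centre: "4 * (c * c) = -1"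
  proof -
    have "complex_of_real \<tau> * of_real \<tau> = 1" using \<tau>2 by (metis of_real_1 of_real_mult power2_eq_square)
    then show ?thesis by (simp add: c_def field_simps)
  qed
  have inner: "(\<integral>w. F w s \<partial>lborel) = 4 * c * (\<integral>t. of_real (M (dist2 s t)) * cnj (vel t) \<partial>U01) * vel s" for s
  proof -
    have "(\<integral>w. F w s \<partial>lborel) = (\<integral>w. (4 * vel s) * (indicator \<Omega> w *\<^sub>R (cnj (\<gamma> s - w) * of_real (M1 ((norm (\<gamma> s - w))\<^sup>2)))) \<partial>lborel)"
      by (rule Bochner_Integration.integral_cong[OF refl]) (simp only: F_def scaleR_conv_of_real mult_ac)
    also have "\<dots> = (4 * vel s) * (c * (\<integral>t. of_real (M (dist2 s t)) * cnj (vel t) \<partial>U01))"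
      unfolding integral_mult_right_zero s2' c_def ..
    finally show ?thesis by (simp only: mult_ac)
  qed
  let ?I = "\<integral>w. indicator \<Omega> w * (\<integral>z. indicator \<Omega> z * (K ((norm (z - w))\<^sup>2)) \<partial>lborel) \<partial>lborel"
  have cMd: "continuous_on UNIV (\<lambda>t. complex_of_real (M (dist2 s t)) * cnj (vel t))" for s
    by (intro continuous_on_mult continuous_on_of_real continuous_on_cnj continuous_vel continuous_on_compose2[OF cM])
       (auto intro!: continuous_intros continuous_\<gamma>)
  have "complex_of_real ?I = (\<integral>w. indicator \<Omega> w *\<^sub>R (\<integral>z. indicator \<Omega> z *\<^sub>R complex_of_real (K ((norm (z - w))\<^sup>2)) \<partial>lborel) \<partial>lborel)"
    by (simp add: scaleR_conv_of_real flip: integral_complex_of_real)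
  also have "\<dots> = (\<integral>w. c * (\<integral>s. F w s \<partial>U01) \<partial>lborel)"
    unfolding s1 ind[symmetric] c_def by (simp only: mult_scaleR_right)
  also have "\<dots> = c * (\<integral>w. (\<integral>s. F w s \<partial>U01) \<partial>lborel)" by (rule integral_mult_right_zero)
  also have "(\<integral>w. (\<integral>s. F w s \<partial>U01) \<partial>lborel) = (\<integral>s. (\<integral>w. F w s \<partial>lborel) \<partial>U01)"
    by (rule LU.Fubini_integral[OF intF, symmetric])
  also have "\<dots> = (\<integral>s. 4 * c * ((\<integral>t. of_real (M (dist2 s t)) * cnj (vel t) \<partial>U01) * vel s) \<partial>U01)"
    unfolding inner by (simp only: mult.assoc)
  also have "\<dots> = 4 * c * (\<integral>s. (\<integral>t. of_real (M (dist2 s t)) * cnj (vel t) \<partial>U01) * vel s \<partial>U01)"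
    by (rule integral_mult_right_zero)
  also have "c * \<dots> = (4 * (c * c)) * (\<integral>s. (\<integral>t. of_real (M (dist2 s t)) * cnj (vel t) \<partial>U01) * vel s \<partial>U01)"
    by (simp only: mult_ac)
  finally have eq: "complex_of_real ?I = - (\<integral>s. (\<integral>t. of_real (M (dist2 s t)) * cnj (vel t) \<partial>U01) * vel s \<partial>U01)"
    unfolding circ_centre by simp
  have intS: "integrable U01 (\<lambda>s. (\<integral>t. of_real (M (dist2 s t)) * cnj (vel t) \<partial>U01) * vel s)"
  proof -
    have "integrable U01 (\<lambda>s. \<integral>w. F w s \<partial>lborel)" by (rule LU.integrable_snd[OF intF])
    then have "integrable U01 (\<lambda>s. c * (\<integral>w. F w s \<partial>lborel))" by (rule integrable_mult_right)
    moreover have "c * (\<integral>w. F w s \<partial>lborel) = (4 * (c * c)) * ((\<integral>t. of_real (M (dist2 s t)) * cnj (vel t) \<partial>U01) * vel s)" for s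
      unfolding inner by (simp only: mult_ac)
    ultimately show ?thesis unfolding circ_centre by simp
  qed
  have "?I = - Re (\<integral>s. (\<integral>t. of_real (M (dist2 s t)) * cnj (vel t) \<partial>U01) * vel s \<partial>U01)"
    using arg_cong[OF eq, of Re] by simp
  also have "Re (\<integral>s. (\<integral>t. of_real (M (dist2 s t)) * cnj (vel t) \<partial>U01) * vel s \<partial>U01) =
     (\<integral>s. Re ((\<integral>t. of_real (M (dist2 s t)) * cnj (vel t) \<partial>U01) * vel s) \<partial>U01)"
    by (rule integral_Re[OF intS, symmetric])
  also have "\<dots> = (\<integral>s. (\<integral>t. M (dist2 s t) * Re (cnj (vel t) * vel s) \<partial>U01) \<partial>U01)"
  proof (rule Bochner_Integration.integral_cong[OF refl])
    fix s
    have "(\<integral>t. of_real (M (dist2 s t)) * cnj (vel t) \<partial>U01) * vel s = (\<integral>t. (of_real (M (dist2 s t)) * cnj (vel t)) * vel s \<partial>U01)"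
      by (rule integral_mult_left_zero[symmetric])
    moreover have "Re \<dots> = (\<integral>t. Re ((of_real (M (dist2 s t)) * cnj (vel t)) * vel s) \<partial>U01)"
      by (rule integral_Re[symmetric]) (intro integrable_mult_left integrable_U01_continuous cMd)
    moreover have "Re ((of_real (M (dist2 s t)) * cnj (vel t)) * vel s) = M (dist2 s t) * Re (cnj (vel t) * vel s)" for t
      by (simp add: algebra_simps)
    ultimately show "Re ((\<integral>t. of_real (M (dist2 s t)) * cnj (vel t) \<partial>U01) * vel s) = (\<integral>t. M (dist2 s t) * Re (cnj (vel t) * vel s) \<partial>U01)"
      by (simp only:)
  qed
  finally show ?thesis unfolding K_def .
qed

end

section \<open>The regularized kernel\<close>

text \<open>R stands for a squared distance throughout, so this is a smoothed distance.\<close>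

definition kS :: "real \<Rightarrow> real \<Rightarrow> real" where "kS eps R = sqrt (R + eps\<^sup>2)"

lemma kS_pos: "eps > 0 \<Longrightarrow> R \<ge> 0 \<Longrightarrow> kS eps R > 0"
  by (simp add: kS_def add_nonneg_pos)

lemma kS_squared: "R \<ge> 0 \<Longrightarrow> (kS eps R)\<^sup>2 = R + eps\<^sup>2"
  by (simp add: kS_def)

lemma kS_ge: "eps > 0 \<Longrightarrow> R \<ge> 0 \<Longrightarrow> eps \<le> kS eps R" "R \<ge> 0 \<Longrightarrow> sqrt R \<le> kS eps R"
  by (auto simp: kS_def intro!: real_le_rsqrt)

lemma DERIV_kS: "eps > 0 \<Longrightarrow> R \<ge> 0 \<Longrightarrow> (kS eps has_real_derivative 1 / (2 * kS eps R)) (at R)"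
proof -
  assume "eps > 0" "R \<ge> 0"
  then have p: "R + eps\<^sup>2 > 0" by (simp add: add_nonneg_pos)
  have "((\<lambda>R. R + eps\<^sup>2) has_real_derivative 1) (at R)" by (auto intro!: derivative_eq_intros)
  from DERIV_chain2[OF DERIV_real_sqrt[OF p] this] show ?thesis
    unfolding kS_def[abs_def] by (rule DERIV_cong) (simp add: field_simps)
qed

lemma DERIV_inverse_kS_power:
  assumes "eps > 0" "R \<ge> 0"
  shows "((\<lambda>R. inverse (kS eps R) ^ n) has_real_derivative - (real n / 2) * inverse (kS eps R) ^ (n + 2)) (at R)"
proof -
  have p: "kS eps R > 0" using assms by (rule kS_pos)
  have "((\<lambda>R. inverse (kS eps R)) has_real_derivative - (1 / 2) * inverse (kS eps R) ^ 3) (at R)"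
    using DERIV_kS[OF assms] p by (auto intro!: derivative_eq_intros simp: field_simps power3_eq_cube)
  from DERIV_power[OF this, of n]
  show ?thesis
  proof (rule DERIV_cong)
    show "real n * (- (1 / 2) * inverse (kS eps R) ^ 3 * inverse (kS eps R) ^ (n - Suc 0)) = - (real n / 2) * inverse (kS eps R) ^ (n + 2)"
      by (cases n) (simp_all add: power_add[symmetric] power3_eq_cube power2_eq_square)
  qed
qed

text \<open>\<open>kP\<close> is the derivative of \<open>kG\<close>, and \<open>kP1\<close>, \<open>kP2\<close> are the derivatives of \<open>kP\<close>. The coefficients in \<open>kP\<close> are chosen
  so that \<open>kern\<close>, which \<open>double_green\<close> and \<open>chord_identity\<close> reduce to \<open>kP\<close> on the curve, is nonnegative, decays
  like \<open>R\<^sup>-\<^sup>2\<close> and agrees with \<open>R\<^sup>-\<^sup>2\<close> in the limit.\<close>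

definition kG :: "real \<Rightarrow> real \<Rightarrow> real" where
  "kG eps R = (1/8) * (4 / eps\<^sup>2 * ln (kS eps R) + 8 / eps * inverse (kS eps R) ^ 1 - 3 * inverse (kS eps R) ^ 2)"
definition kP :: "real \<Rightarrow> real \<Rightarrow> real" where
  "kP eps R = (1/8) * (2 / eps\<^sup>2 * inverse (kS eps R) ^ 2 - 4 / eps * inverse (kS eps R) ^ 3 + 3 * inverse (kS eps R) ^ 4)"
definition kP1 :: "real \<Rightarrow> real \<Rightarrow> real" where
  "kP1 eps R = (1/8) * (- 2 / eps\<^sup>2 * inverse (kS eps R) ^ 4 + 6 / eps * inverse (kS eps R) ^ 5 - 6 * inverse (kS eps R) ^ 6)"
definition kP2 :: "real \<Rightarrow> real \<Rightarrow> real" where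
  "kP2 eps R = (1/8) * (4 / eps\<^sup>2 * inverse (kS eps R) ^ 6 - 15 / eps * inverse (kS eps R) ^ 7 + 18 * inverse (kS eps R) ^ 8)"
definition kern :: "real \<Rightarrow> real \<Rightarrow> real" where
  "kern eps R = 24 * kP eps R + 56 * R * kP1 eps R + 16 * R\<^sup>2 * kP2 eps R"

lemma kernel_derivatives:
  assumes "eps > 0" "R \<ge> 0"
  shows "(kG eps has_real_derivative kP eps R) (at R)"
    and "(kP eps has_real_derivative kP1 eps R) (at R)"
    and "(kP1 eps has_real_derivative kP2 eps R) (at R)"
proof -
  have p: "kS eps R > 0" using assms by (rule kS_pos)
  note D = DERIV_inverse_kS_power[OF assms]
  have l: "((\<lambda>R. ln (kS eps R)) has_real_derivative (1/2) * inverse (kS eps R) ^ 2) (at R)"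
    by (rule DERIV_cong[OF DERIV_chain2[where f=ln and g="kS eps", OF DERIV_ln[OF p] DERIV_kS[OF assms]]])
       (use p in \<open>simp add: field_simps power2_eq_square\<close>)
  show "(kG eps has_real_derivative kP eps R) (at R)"
    unfolding kG_def[abs_def]
    by (rule DERIV_cong[OF DERIV_cmult[OF DERIV_diff[OF DERIV_add[OF DERIV_cmult[OF l] DERIV_cmult[OF D]] DERIV_cmult[OF D]]]])
       (simp add: kP_def power3_eq_cube algebra_simps)
  show "(kP eps has_real_derivative kP1 eps R) (at R)"
    unfolding kP_def[abs_def]
    by (rule DERIV_cong[OF DERIV_cmult[OF DERIV_add[OF DERIV_diff[OF DERIV_cmult[OF D] DERIV_cmult[OF D]] DERIV_cmult[OF D]]]])
       (simp add: kP1_def algebra_simps)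
  show "(kP1 eps has_real_derivative kP2 eps R) (at R)"
    unfolding kP1_def[abs_def]
    by (rule DERIV_cong[OF DERIV_cmult[OF DERIV_diff[OF DERIV_add[OF DERIV_cmult[OF D] DERIV_cmult[OF D]] DERIV_cmult[OF D]]]])
       (simp add: kP2_def algebra_simps)
qed

lemma continuous_on_kS: "continuous_on A (kS eps)" unfolding kS_def[abs_def] by (intro continuous_intros)

lemma continuous_on_kernel:
  assumes "eps > 0" shows "continuous_on {0..} (kP eps)" "continuous_on {0..} (kP1 eps)" "continuous_on {0..} (kP2 eps)"
proof -
  have c: "continuous_on {0..} (\<lambda>R. inverse (kS eps R) ^ n)" for n
    by (intro continuous_on_power continuous_on_inverse continuous_on_kS) (use kS_pos[OF assms] in force)
  show "continuous_on {0..} (kP eps)" "continuous_on {0..} (kP1 eps)" "continuous_on {0..} (kP2 eps)"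
    unfolding kP_def[abs_def] kP1_def[abs_def] kP2_def[abs_def]
    by (intro continuous_on_mult continuous_on_add continuous_on_diff continuous_on_const c)+
qed

definition kpoly :: "real \<Rightarrow> real" where "kpoly y = 1 + 18 * y - 22 * y\<^sup>2 - 30 * y ^ 3 + 36 * y ^ 4"

text \<open>The operator P -> 24 P + 56 R P' + 16 R^2 P'' takes R^p to 8 (p + 1) (2 p + 3) R^p: it
  kills R^-1 and R^-(3/2) and multiplies R^-2 by 8. Replacing R by R + eps^2 in (2 / eps^2) R^-1
  adds -2 R^-2 to the term 3 R^-2 of \<open>kP\<close>, which explains the constant coefficient 1 of
  \<open>kpoly\<close>.\<close>

lemma kern_eq:
  assumes "eps > 0" "R \<ge> 0"
  shows "kern eps R = inverse (kS eps R) ^ 4 * kpoly (eps / kS eps R)"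
proof -
  define S where "S = kS eps R"
  have S: "S > 0" using kS_pos[OF assms] by (simp add: S_def)
  have R: "R = S\<^sup>2 - eps\<^sup>2" using kS_squared[OF assms(2), of eps] by (simp add: S_def)
  define y where "y = eps / S"
  have y: "y > 0" using assms S by (simp add: y_def)
  have e: "eps = y * S" using S by (simp add: y_def)
  show ?thesis
    unfolding kern_def kP_def kP1_def kP2_def kpoly_def S_def[symmetric] y_def[symmetric]
    unfolding R unfolding e using S y
    by (simp add: field_simps) algebra
qed

text \<open>The odd powers, which come from the 1/eps term of \<open>kP\<close>, are essential: the
  even part alone is negative at y^2 = 3/10. On [0, 1/2] the term 18 y dominates. On [1/2, 1] a
  square absorbs the two highest powers, and the remaining concave quadratic is positive.\<close>

lemma kpoly_nonneg:
  assumes "0 \<le> y" "y \<le> 1" shows "0 \<le> kpoly y"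
proof (cases "y \<le> 1/2")
  case True
  have "y\<^sup>2 \<le> (1/2)\<^sup>2" using assms True by (intro power_mono) auto
  then have "0 \<le> 1 / 2 + 18 - 22 * y - 30 * y\<^sup>2 " using True by (simp add: power2_eq_square)
  then have "0 \<le> y * (1 / 2 + 18 - 22 * y - 30 * y\<^sup>2)" using assms by simp
  then have "0 \<le> y / 2 + 18 * y - 22 * y\<^sup>2 - 30 * y ^ 3"
    by (simp add: power2_eq_square power3_eq_cube algebra_simps)
  moreover have "0 \<le> y ^ 4" using assms by simp
  ultimately show ?thesis using True unfolding kpoly_def by linarith
next
  case False
  have "0 \<le> (y - 1/2) * (1 - y)" using assms False by simp
  then have "0 \<le> 5.45 * ((y - 1/2) * (1 - y)) + 0.325 * y + 0.115" using assms by simp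
  moreover have "kpoly y = (6 * y\<^sup>2 - 2.5 * y - 1.9)\<^sup>2 + (5.45 * ((y - 1/2) * (1 - y)) + 0.325 * y + 0.115)"
    unfolding kpoly_def by (simp add: power2_eq_square power3_eq_cube power4_eq_xxxx field_simps)
  ultimately show ?thesis by simp
qed

lemma kpoly_le:
  assumes "0 \<le> y" "y \<le> 1" shows "kpoly y \<le> 55"
proof -
  have "y ^ 4 \<le> 1" "0 \<le> y\<^sup>2" "0 \<le> y ^ 3" using assms by (auto simp: power_le_one)
  then show ?thesis using assms unfolding kpoly_def by linarith
qed

lemma kern_nonneg: "eps > 0 \<Longrightarrow> R \<ge> 0 \<Longrightarrow> 0 \<le> kern eps R"
  using kern_eq[of eps R] kpoly_nonneg[of "eps / kS eps R"] kS_ge(1)[of eps R] kS_pos[of eps R] by simp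

lemma kern_le: assumes "eps > 0" "R \<ge> 0" shows "kern eps R \<le> 55 * inverse (kS eps R) ^ 4"
  using kern_eq[OF assms] kpoly_le[of "eps / kS eps R"] kS_ge(1)[OF assms] kS_pos[OF assms] assms
  by (simp add: mult.commute mult_right_mono)

text \<open>A bound uniform in eps; it provides every dominating function in the passages to the
  limit.\<close>

lemma kern_le': assumes "eps > 0" "R > 0" shows "kern eps R \<le> 55 / R\<^sup>2"
proof -
  have "R \<le> (kS eps R)\<^sup>2" using kS_squared[of R eps] assms by simp
  then have "R\<^sup>2 \<le> ((kS eps R)\<^sup>2)\<^sup>2" using assms by (intro power_mono) auto
  then have "inverse ((kS eps R) ^ 4) \<le> inverse (R\<^sup>2)" using assms by (intro le_imp_inverse_le) (auto simp: power_mult[symmetric])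
  then show ?thesis using kern_le[of eps R] assms by (simp add: power_inverse divide_inverse)
qed

lemma tendsto_kS: assumes "e \<longlonglongrightarrow> 0" shows "(\<lambda>n. kS (e n) R) \<longlonglongrightarrow> sqrt R"
proof -
  have "(\<lambda>n. sqrt (R + (e n)\<^sup>2)) \<longlonglongrightarrow> sqrt (R + 0\<^sup>2)" by (intro tendsto_intros assms)
  then show ?thesis by (simp add: kS_def)
qed

lemma tendsto_kern:
  assumes e: "e \<longlonglongrightarrow> 0" "\<And>n. e n > 0" and R: "R > 0"
  shows "(\<lambda>n. kern (e n) R) \<longlonglongrightarrow> 1 / R\<^sup>2"
proof -
  have s: "sqrt R \<noteq> 0" using R by simp
  have "(\<lambda>n. e n / kS (e n) R) \<longlonglongrightarrow> 0 / sqrt R" by (intro tendsto_intros e tendsto_kS s)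
  then have y: "(\<lambda>n. e n / kS (e n) R) \<longlonglongrightarrow> 0" by simp
  have "(\<lambda>n. inverse (kS (e n) R) ^ 4 * kpoly (e n / kS (e n) R)) \<longlonglongrightarrow> inverse (sqrt R) ^ 4 * kpoly 0"
    unfolding kpoly_def by (intro tendsto_intros tendsto_kS e y s)
  moreover have "inverse (sqrt R) ^ 4 * kpoly 0 = 1 / R\<^sup>2"
  proof -
    have "sqrt R ^ 4 = ((sqrt R)\<^sup>2)\<^sup>2" by simp
    then show ?thesis using R by (simp add: kpoly_def power_inverse divide_inverse)
  qed
  ultimately show ?thesis using kern_eq[OF e(2)] R by simp
qed

lemma kern_measurable [measurable]: "kern eps \<in> borel_measurable borel"
  unfolding kern_def kP_def kP1_def kP2_def kS_def by measurable

section \<open>The expansion over all pairs in the domain\<close>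

context C2_domain
begin

text \<open>The function f is the s-derivative of the distance of \<gamma> s and \<gamma> t, and its
  t-derivative is minus the integrand. Over one period f goes from - \<open>norm (vel s)\<close> to
  \<open>norm (vel s)\<close>, because the direction of the chord is reversed. The length of the
  curve enters the expansion through this identity.\<close>

lemma integral_norm_chord:
  assumes s: "s \<in> {0..1}"
  shows "(\<integral>t. norm (\<gamma> s - \<gamma> t) * ang_prod s t \<partial>U01) = - 2 * norm (vel s)"
proof -
  obtain M where M: "M > 0" "\<And>s t. \<bar>ang_vel s t\<bar> \<le> M" using ang_vel_bounded by blast
  obtain Y where Y: "Y > 0" "\<And>t. norm (\<gamma> t) \<le> Y" using periodic_bounded[OF continuous_\<gamma> periodic_\<gamma>] by blast
  define h where "h t = norm (\<gamma> s - \<gamma> t) * ang_prod s t" for t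
  have hm [measurable]: "h \<in> borel_measurable borel" unfolding h_def ang_prod_def by measurable
  have hB: "norm (h t) \<le> 2 * Y * (M * M)" for t
  proof -
    have "norm (\<gamma> s - \<gamma> t) \<le> 2 * Y" using norm_triangle_ineq4[of "\<gamma> s" "\<gamma> t"] Y(2)[of s] Y(2)[of t] by simp
    moreover have "\<bar>ang_prod s t\<bar> \<le> M * M" unfolding ang_prod_def abs_minus_cancel abs_mult using M by (intro mult_mono) auto
    ultimately have "norm (\<gamma> s - \<gamma> t) * \<bar>ang_prod s t\<bar> \<le> 2 * Y * (M * M)" using Y M by (intro mult_mono) auto
    then show ?thesis by (simp add: h_def abs_mult)
  qed
  have per: "h (t + 1) = h t" for t by (simp add: h_def ang_prod_def periodic_\<gamma> periodic_ang_vel)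
  define f where "f t = - Re (cis (- ang (s,t)) * vel s)" for t
  have "(\<integral>t. h t \<partial>U01) = integral {0..1} h" by (rule integral_U01_eq_integral(1)[OF hm hB])
  also have "\<dots> = integral {s..s+1} h"
    by (rule integral_periodic[symmetric, OF hm hB per]) (use s in auto)
  also have "((\<lambda>t. - h t) has_integral (f (s+1) - f s)) {s..s+1}"
  proof (rule fundamental_theorem_of_calculus_interior)
    show "continuous_on {s..s+1} f"
      unfolding f_def cis_conv_exp by (intro continuous_intros continuous_ang_snd)
    fix t assume t: "t \<in> {s<..<s+1}"
    have ne: "\<gamma> t - \<gamma> s \<noteq> 0" using \<gamma>_neq[of s t] t by auto
    have c: "cis (- ang (s,t)) = cnj (\<gamma> t - \<gamma> s) / of_real (norm (\<gamma> t - \<gamma> s))"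
    proof -
      have "cis (ang (s,t)) = sgn (\<gamma> t - \<gamma> s)" using t by (simp add: cis_ang sgn_chord)
      then have "cnj (cis (ang (s,t))) = cnj (sgn (\<gamma> t - \<gamma> s))" by simp
      then show ?thesis by (simp add: cis_cnj sgn_eq)
    qed
    have "((\<lambda>t. - ang (s,t)) has_real_derivative - ang_vel s t) (at t)"
      unfolding ang_vel_def using t by (intro DERIV_minus ang_deriv_snd) auto
    then have "((\<lambda>t. cis (- ang (s,t))) has_vector_derivative (- ang_vel s t) *\<^sub>R (\<i> * cis (- ang (s,t)))) (at t)"
      by (rule has_vector_derivative_cis)
    from bounded_linear.has_vector_derivative[OF bounded_linear_Re has_vector_derivative_mult_left[OF this, of "vel s"]]
    have "((\<lambda>t. Re (cis (- ang (s,t)) * vel s)) has_vector_derivative Re ((- ang_vel s t) *\<^sub>R (\<i> * cis (- ang (s,t))) * vel s)) (at t)" .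
    from has_vector_derivative_minus[OF this]
    have "(f has_vector_derivative - Re ((- ang_vel s t) *\<^sub>R (\<i> * cis (- ang (s,t))) * vel s)) (at t)"
      by (simp add: f_def[abs_def])
    moreover have "- Re ((- ang_vel s t) *\<^sub>R (\<i> * cis (- ang (s,t))) * vel s) = - h t"
    proof -
      define z where "z = cis (- ang (s,t)) * vel s"
      have "(- ang_vel s t) *\<^sub>R (\<i> * cis (- ang (s,t))) * vel s = of_real (- ang_vel s t) * (\<i> * z)"
        by (simp add: z_def scaleR_conv_of_real mult.assoc)
      then have 1: "- Re ((- ang_vel s t) *\<^sub>R (\<i> * cis (- ang (s,t))) * vel s) = - (ang_vel s t * Im z)" by simp
      have "z = (vel s * cnj (\<gamma> t - \<gamma> s)) / of_real (norm (\<gamma> t - \<gamma> s))" by (simp add: z_def c mult.commute)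
      then have "Im z = Im (vel s * cnj (\<gamma> t - \<gamma> s)) / norm (\<gamma> t - \<gamma> s)" by (simp only: Im_divide_of_real)
      also have "\<dots> = norm (\<gamma> t - \<gamma> s) * Im (vel s / (\<gamma> t - \<gamma> s))"
        unfolding Im_divide_eq using ne by (simp add: power2_eq_square)
      also have "Im (vel s / (\<gamma> t - \<gamma> s)) = - ang_vel t s"
      proof -
        have "vel s / (\<gamma> t - \<gamma> s) = - (vel s / (\<gamma> s - \<gamma> t))" by (metis minus_diff_eq minus_divide_right)
        then show ?thesis by (simp only: ang_vel_def uminus_complex.simps)
      qed
      finally show ?thesis unfolding 1 by (simp add: h_def ang_prod_def norm_minus_commute)
    qed
    ultimately show "(f has_vector_derivative - h t) (at t)" by simp
  qed simp
  then have "integral {s..s+1} (\<lambda>t. - h t) = f (s+1) - f s" by (rule integral_unique)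
  then have "integral {s..s+1} h = - (f (s+1) - f s)" by simp
  also have "f (s+1) - f s = 2 * norm (vel s)"
  proof -
    have u: "cis (- ang (s,s)) * vel s = of_real (norm (vel s))"
    proof -
      have "cis (- ang (s,s)) = cnj (ut s)" by (simp add: cis_cnj[symmetric] cis_ang_diag)
      then have "cis (- ang (s,s)) * vel s = of_real (norm (vel s)) * (ut s * cnj (ut s))" by (subst vel_polar) (simp add: mult_ac)
      then show ?thesis by (simp add: complex_mult_cnj_norm)
    qed
    have "ang (s,s+1) = ang (s,s) + rot" using ang_swap[of s s] by simp
    then have "cis (- ang (s,s+1)) = cis (- ang (s,s)) * cis (- rot)" by (simp add: cis_mult)
    also have "cis (- rot) = -1" using cis_rot by (simp add: cis_cnj[symmetric])
    finally have "cis (- ang (s,s+1)) * vel s = - of_real (norm (vel s))" using u by simp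
    then show ?thesis unfolding f_def u by simp
  qed
  finally show ?thesis by (simp add: h_def)
qed

end

definition krem :: "real \<Rightarrow> real \<Rightarrow> real" where
  "krem eps R = R / (kS eps R)\<^sup>2 + (2 / eps) * (R\<^sup>2 / kS eps R ^ 3 - sqrt R) - (3 / 2) * (R\<^sup>2 / kS eps R ^ 4)"

text \<open>The two explicit terms are what R^-1 and R^-(3/2) contribute to 4 P R^2 with their
  singular coefficients. On the curve they become \<open>chord_moment / eps\<^sup>2\<close> and, by
  \<open>integral_norm_chord\<close>, the length term; everything else is bounded.\<close>

lemma krem_eq: "4 * kP eps R * R\<^sup>2 = R / eps\<^sup>2 - (2 / eps) * sqrt R - krem eps R" if "eps > 0" "R \<ge> 0"
proof -
  define S where "S = kS eps R"
  have S: "S > 0" using kS_pos[OF that] by (simp add: S_def)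
  have S2: "S\<^sup>2 = R + eps\<^sup>2" using kS_squared[OF that(2)] by (simp add: S_def)
  have "R * R / (eps\<^sup>2 * S\<^sup>2) = R / eps\<^sup>2 - R / S\<^sup>2"
  proof -
    have "R / eps\<^sup>2 - R / S\<^sup>2 = R * (S\<^sup>2 - eps\<^sup>2) / (eps\<^sup>2 * S\<^sup>2)" using that S by (simp add: field_simps)
    then show ?thesis unfolding S2 by simp
  qed
  moreover have "4 * kP eps R * R\<^sup>2 = R * R / (eps\<^sup>2 * S\<^sup>2) - (2 / eps) * (R\<^sup>2 / S ^ 3) + (3 / 2) * (R\<^sup>2 / S ^ 4)"
  proof -
    have k: "x / S ^ n = x * inverse S ^ n" for x n by (simp add: divide_inverse power_inverse)
    have "4 * ((1/8) * (2 / eps\<^sup>2 * a - 4 / eps * b + 3 * c)) * R\<^sup>2 = R * R / eps\<^sup>2 * a - (2 / eps) * (R\<^sup>2 * b) + (3 / 2) * (R\<^sup>2 * c)" for a b c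
      by (simp add: algebra_simps power2_eq_square)
    then show ?thesis unfolding kP_def S_def[symmetric] divide_divide_eq_left[symmetric] k .
  qed
  ultimately show ?thesis unfolding krem_def S_def[symmetric] by (simp add: algebra_simps)
qed

text \<open>With S the smoothed distance and u = sqrt R, the difference S - u is at most eps^2 / S.
  This gain outweighs the factor 2 / eps in \<open>krem\<close>.\<close>

lemma krem_middle: assumes "eps > 0" "R \<ge> 0" shows "\<bar>R\<^sup>2 / kS eps R ^ 3 - sqrt R\<bar> \<le> 3 * eps\<^sup>2 / kS eps R"
proof -
  define S where "S = kS eps R"
  define u where "u = sqrt R"
  have S: "S > 0" using kS_pos[OF assms] by (simp add: S_def)
  have u: "0 \<le> u" "u \<le> S" using kS_ge(2)[OF assms(2), of eps] assms by (auto simp: u_def S_def)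
  have R: "R = u\<^sup>2" using assms by (simp add: u_def)
  have S2: "S\<^sup>2 = u\<^sup>2 + eps\<^sup>2" using kS_squared[OF assms(2)] by (simp add: S_def R)
  have e: "R\<^sup>2 / S ^ 3 - u = - (u * (S - u) * (S\<^sup>2 + S * u + u\<^sup>2) / S ^ 3)"
    using S by (simp add: R field_simps power2_eq_square power3_eq_cube)
  have "u * S \<le> S * S" "u * u \<le> S * S" using u S by (auto intro: mult_mono)
  then have q: "S\<^sup>2 + S * u + u\<^sup>2 \<le> 3 * S\<^sup>2" by (simp add: power2_eq_square mult.commute)
  have "(S - u) * S \<le> (S - u) * (S + u)" using u by (intro mult_left_mono) auto
  also have "\<dots> = eps\<^sup>2" using S2 by (simp add: power2_eq_square algebra_simps)
  finally have d: "(S - u) * S \<le> eps\<^sup>2" .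
  have "u * (S - u) * (S\<^sup>2 + S * u + u\<^sup>2) \<le> S * (S - u) * (3 * S\<^sup>2)"
    using u S q by (intro mult_mono mult_nonneg_nonneg add_nonneg_nonneg) auto
  also have "\<dots> \<le> eps\<^sup>2 * (3 * S\<^sup>2)" using d by (intro mult_right_mono) (auto simp: mult.commute)
  finally have "u * (S - u) * (S\<^sup>2 + S * u + u\<^sup>2) / S ^ 3 \<le> eps\<^sup>2 * (3 * S\<^sup>2) / S ^ 3" using S by (intro divide_right_mono) auto
  also have "\<dots> = 3 * eps\<^sup>2 / S" using S by (simp add: power2_eq_square power3_eq_cube)
  finally have "u * (S - u) * (S\<^sup>2 + S * u + u\<^sup>2) / S ^ 3 \<le> 3 * eps\<^sup>2 / S" .
  moreover have "0 \<le> u * (S - u) * (S\<^sup>2 + S * u + u\<^sup>2) / S ^ 3"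
    using u S by (intro divide_nonneg_nonneg mult_nonneg_nonneg add_nonneg_nonneg) auto
  ultimately show ?thesis unfolding S_def[symmetric] u_def[symmetric] e by simp
qed

lemma krem_bounded: assumes "eps > 0" "R \<ge> 0" shows "\<bar>krem eps R\<bar> \<le> 17 / 2"
proof -
  define S where "S = kS eps R"
  have S: "S > 0" using kS_pos[OF assms] by (simp add: S_def)
  have RS: "R \<le> S\<^sup>2" using kS_squared[OF assms(2), of eps] by (simp add: S_def)
  have 1: "0 \<le> R / S\<^sup>2" "R / S\<^sup>2 \<le> 1" using S RS assms by auto
  have 2: "R\<^sup>2 / S ^ 4 = (R / S\<^sup>2)\<^sup>2" by (simp add: power_divide power_mult[symmetric])
  have "(R / S\<^sup>2)\<^sup>2 \<le> 1" using 1 by (simp add: power_le_one)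
  then have 3: "0 \<le> R\<^sup>2 / S ^ 4" "R\<^sup>2 / S ^ 4 \<le> 1" using 2 by auto
  have "3 * eps\<^sup>2 / S \<le> 3 * eps" using S kS_ge(1)[OF assms] assms by (simp add: S_def[symmetric] divide_le_eq power2_eq_square)
  then have "\<bar>R\<^sup>2 / S ^ 3 - sqrt R\<bar> \<le> 3 * eps" using krem_middle[OF assms] by (simp add: S_def[symmetric])
  then have "(2 / eps) * \<bar>R\<^sup>2 / S ^ 3 - sqrt R\<bar> \<le> (2 / eps) * (3 * eps)" using assms by (intro mult_left_mono) auto
  then have "\<bar>(2 / eps) * (R\<^sup>2 / S ^ 3 - sqrt R)\<bar> \<le> 6" unfolding abs_mult using assms by simp
  then show ?thesis using 1 3 unfolding krem_def S_def[symmetric] by linarith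
qed

lemma tendsto_krem:
  assumes e: "e \<longlonglongrightarrow> 0" "\<And>n. e n > 0" and R: "R > 0"
  shows "(\<lambda>n. krem (e n) R) \<longlonglongrightarrow> - 1 / 2"
proof -
  have s: "sqrt R \<noteq> 0" using R by simp
  have m: "(\<lambda>n. (2 / e n) * (R\<^sup>2 / kS (e n) R ^ 3 - sqrt R)) \<longlonglongrightarrow> 0"
  proof (rule Lim_null_comparison)
    show "\<forall>\<^sub>F n in sequentially. norm ((2 / e n) * (R\<^sup>2 / kS (e n) R ^ 3 - sqrt R)) \<le> 6 * e n / kS (e n) R"
    proof (intro always_eventually allI)
      fix n
      have "(2 / e n) * \<bar>R\<^sup>2 / kS (e n) R ^ 3 - sqrt R\<bar> \<le> (2 / e n) * (3 * (e n)\<^sup>2 / kS (e n) R)"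
        using krem_middle[OF e(2), of R n] R e(2)[of n] by (intro mult_left_mono) auto
      also have "\<dots> = 6 * e n / kS (e n) R" using e(2)[of n] by (simp add: power2_eq_square)
      finally show "norm ((2 / e n) * (R\<^sup>2 / kS (e n) R ^ 3 - sqrt R)) \<le> 6 * e n / kS (e n) R"
        unfolding real_norm_def abs_mult using e(2)[of n] by simp
    qed
    have "(\<lambda>n. 6 * e n / kS (e n) R) \<longlonglongrightarrow> 6 * 0 / sqrt R" by (intro tendsto_intros e tendsto_kS s)
    then show "(\<lambda>n. 6 * e n / kS (e n) R) \<longlonglongrightarrow> 0" by simp
  qed
  \<comment> \<open>The three limits are 1, 0 and 3/2, whence -1/2.\<close>
  have "(\<lambda>n. krem (e n) R) \<longlonglongrightarrow> R / (sqrt R)\<^sup>2 + 0 - (3 / 2) * (R\<^sup>2 / sqrt R ^ 4)"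
    unfolding krem_def by (intro tendsto_intros m tendsto_kS e) (use s in auto)
  moreover have "sqrt R ^ 4 = R\<^sup>2"
  proof -
    have "sqrt R ^ 4 = ((sqrt R)\<^sup>2)\<^sup>2" by simp
    then show ?thesis using R by simp
  qed
  ultimately show ?thesis using R by simp
qed

context C2_domain
begin

lemma ang_prod_measurable [measurable]: "(\<lambda>p. ang_prod (fst p) (snd p)) \<in> borel_measurable (borel \<Otimes>\<^sub>M borel)"
  unfolding ang_prod_def by measurable

lemma ang_prod_bounded: "\<exists>M>0. \<forall>s t. \<bar>ang_prod s t\<bar> \<le> M"
proof -
  obtain M where M: "M > 0" "\<And>s t. \<bar>ang_vel s t\<bar> \<le> M" using ang_vel_bounded by blast
  have "\<bar>ang_prod s t\<bar> \<le> M * M" for s t unfolding ang_prod_def abs_minus_cancel abs_mult using M by (intro mult_mono) auto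
  then show ?thesis using M(1) by (intro exI[of _ "M * M"]) auto
qed

lemma chord_bounded: "\<exists>Y>0. \<forall>s t. norm (\<gamma> s - \<gamma> t) \<le> Y"
proof -
  obtain Y where Y: "Y > 0" "\<And>t. norm (\<gamma> t) \<le> Y" using periodic_bounded[OF continuous_\<gamma> periodic_\<gamma>] by blast
  have "norm (\<gamma> s - \<gamma> t) \<le> 2 * Y" for s t using norm_triangle_ineq4[of "\<gamma> s" "\<gamma> t"] Y(2)[of s] Y(2)[of t] by simp
  then show ?thesis using Y(1) by (intro exI[of _ "2 * Y"]) auto
qed

definition len :: real where "len = (\<integral>t. norm (vel t) \<partial>U01)"

definition area_pair :: "real \<Rightarrow> real" where
  "area_pair eps = (\<integral>w. indicator \<Omega> w * (\<integral>z. indicator \<Omega> z * kern eps ((norm (z - w))\<^sup>2) \<partial>lborel) \<partial>lborel)"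

text \<open>With M = 4 R \<open>kP\<close> + 2 \<open>kG\<close>, the combination treated by
  \<open>chord_identity\<close>, the kernel \<open>kern\<close> is the Laplacian 4 (M' + R M'')
  required by \<open>double_green\<close>.\<close>

lemma area_pair_eq:
  assumes e: "eps > 0"
  shows "area_pair eps = - (\<integral>s. (\<integral>t. 4 * kP eps (dist2 s t) * (dist2 s t)\<^sup>2 * ang_prod s t \<partial>U01) \<partial>U01)"
proof -
  have "area_pair eps = (\<integral>w. indicator \<Omega> w * (\<integral>z. indicator \<Omega> z * (4 * ((6 * kP eps ((norm (z - w))\<^sup>2) + 4 * (norm (z - w))\<^sup>2 * kP1 eps ((norm (z - w))\<^sup>2))
      + (norm (z - w))\<^sup>2 * (10 * kP1 eps ((norm (z - w))\<^sup>2) + 4 * (norm (z - w))\<^sup>2 * kP2 eps ((norm (z - w))\<^sup>2)))) \<partial>lborel) \<partial>lborel)"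
    unfolding area_pair_def kern_def by (simp add: algebra_simps power2_eq_square)
  also have "\<dots> = - (\<integral>s. (\<integral>t. (4 * dist2 s t * kP eps (dist2 s t) + 2 * kG eps (dist2 s t)) * Re (cnj (vel t) * vel s) \<partial>U01) \<partial>U01)"
  proof (rule double_green)
    fix R :: real assume R: "0 \<le> R"
    note D = kernel_derivatives[OF e R]
    show "((\<lambda>R. 4 * R * kP eps R + 2 * kG eps R) has_real_derivative 6 * kP eps R + 4 * R * kP1 eps R) (at R)"
      by (rule DERIV_cong[OF DERIV_add[OF DERIV_mult[OF DERIV_cmult_Id D(2)] DERIV_cmult[OF D(1)]]]) simp
    show "((\<lambda>R. 6 * kP eps R + 4 * R * kP1 eps R) has_real_derivative 10 * kP1 eps R + 4 * R * kP2 eps R) (at R)"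
      by (rule DERIV_cong[OF DERIV_add[OF DERIV_cmult[OF D(2)] DERIV_mult[OF DERIV_cmult_Id D(3)]]]) simp
  next
    show "continuous_on {0..} (\<lambda>R. 10 * kP1 eps R + 4 * R * kP2 eps R)"
      by (intro continuous_intros continuous_on_kernel[OF e])
  qed
  also have "\<dots> = - (\<integral>s. (\<integral>t. 4 * kP eps (dist2 s t) * (dist2 s t)\<^sup>2 * ang_prod s t \<partial>U01) \<partial>U01)"
    by (subst chord_identity[where G="kG eps" and P="kP eps"]) (auto intro: kernel_derivatives[OF e] continuous_on_kernel[OF e])
  finally show ?thesis .
qed

definition chord_moment :: real where
  "chord_moment = (\<integral>p. dist2 (fst p) (snd p) * ang_prod (fst p) (snd p) \<partial>(U01 \<Otimes>\<^sub>M U01))"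

lemma kS_measurable [measurable]: "kS eps \<in> borel_measurable borel" unfolding kS_def[abs_def] by measurable
lemma krem_measurable [measurable]: "krem eps \<in> borel_measurable borel" unfolding krem_def[abs_def] by measurable

lemma area_pair_expansion:
  assumes e: "eps > 0"
  shows "area_pair eps = - chord_moment / eps\<^sup>2 - 4 * len / eps + (\<integral>p. krem eps (dist2 (fst p) (snd p)) * ang_prod (fst p) (snd p) \<partial>(U01 \<Otimes>\<^sub>M U01))"
proof -
  let ?P = "U01 \<Otimes>\<^sub>M U01"
  obtain M where M: "M > 0" "\<And>s t. \<bar>ang_prod s t\<bar> \<le> M" using ang_prod_bounded by blast
  obtain Y where Y: "Y > 0" "\<And>s t. norm (\<gamma> s - \<gamma> t) \<le> Y" using chord_bounded by blast
  define f1 where "f1 p = dist2 (fst p) (snd p) * ang_prod (fst p) (snd p)" for p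
  define f2 where "f2 p = norm (\<gamma> (fst p) - \<gamma> (snd p)) * ang_prod (fst p) (snd p)" for p
  define f3 where "f3 p = krem eps (dist2 (fst p) (snd p)) * ang_prod (fst p) (snd p)" for p
  have m [measurable]: "f1 \<in> borel_measurable (borel \<Otimes>\<^sub>M borel)" "f2 \<in> borel_measurable (borel \<Otimes>\<^sub>M borel)" "f3 \<in> borel_measurable (borel \<Otimes>\<^sub>M borel)"
    unfolding f1_def f2_def f3_def by measurable
  have "\<bar>f1 p\<bar> \<le> Y\<^sup>2 * M" for p unfolding f1_def abs_mult using M Y by (intro mult_mono) (auto intro: power_mono)
  then have i1: "integrable ?P f1" by (rule U01_pair_integrable_bounded[OF m(1)])
  have "\<bar>f2 p\<bar> \<le> Y * M" for p unfolding f2_def abs_mult using M Y by (intro mult_mono) auto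
  then have i2: "integrable ?P f2" by (rule U01_pair_integrable_bounded[OF m(2)])
  have "\<bar>f3 p\<bar> \<le> (17/2) * M" for p unfolding f3_def abs_mult using M krem_bounded[OF e] by (intro mult_mono) auto
  then have i3: "integrable ?P f3" by (rule U01_pair_integrable_bounded[OF m(3)])
  define F where "F p = (1 / eps\<^sup>2) * f1 p - (2 / eps) * f2 p - f3 p" for p
  have FE: "4 * kP eps (dist2 s t) * (dist2 s t)\<^sup>2 * ang_prod s t = F (s,t)" for s t
    unfolding krem_eq[OF e zero_le_power2] F_def f1_def f2_def f3_def by (simp add: algebra_simps)
  have iF: "integrable ?P F" unfolding F_def by (intro Bochner_Integration.integrable_diff integrable_mult_right i1 i2 i3)
  have "area_pair eps = - (\<integral>s. (\<integral>t. F (s,t) \<partial>U01) \<partial>U01)" unfolding area_pair_eq[OF e] FE ..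
  also have "(\<integral>s. (\<integral>t. F (s,t) \<partial>U01) \<partial>U01) = (\<integral>p. F p \<partial>?P)" by (rule U01_pair.integral_fst'[OF iF])
  also have "\<dots> = (1 / eps\<^sup>2) * (\<integral>p. f1 p \<partial>?P) - (2 / eps) * (\<integral>p. f2 p \<partial>?P) - (\<integral>p. f3 p \<partial>?P)"
    unfolding F_def using i1 i2 i3 by simp
  also have "(\<integral>p. f2 p \<partial>?P) = (\<integral>s. (\<integral>t. f2 (s,t) \<partial>U01) \<partial>U01)" by (rule U01_pair.integral_fst'[OF i2, symmetric])
  also have "\<dots> = (\<integral>s. - 2 * norm (vel s) \<partial>U01)"
    by (rule integral_cong_AE) (auto simp: f2_def AE_U01 integral_norm_chord intro!: AE_I2)
  also have "\<dots> = - 2 * len" by (simp add: len_def)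
  finally show ?thesis by (simp add: chord_moment_def f1_def f3_def)
qed

lemma tendsto_area_pair:
  assumes e: "e \<longlonglongrightarrow> 0" "\<And>n. e n > 0"
  shows "(\<lambda>n. area_pair (e n) + chord_moment / (e n)\<^sup>2 + 4 * len / e n) \<longlonglongrightarrow> - chord_energy / 2"
proof -
  let ?P = "U01 \<Otimes>\<^sub>M U01"
  obtain M where M: "M > 0" "\<And>s t. \<bar>ang_prod s t\<bar> \<le> M" using ang_prod_bounded by blast
  have "(\<lambda>n. \<integral>p. krem (e n) (dist2 (fst p) (snd p)) * ang_prod (fst p) (snd p) \<partial>?P) \<longlonglongrightarrow> (\<integral>p. (- 1 / 2) * ang_prod (fst p) (snd p) \<partial>?P)"
  proof (rule integral_dominated_convergence[where w="\<lambda>_. (17/2) * M"])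
    show "AE p in ?P. (\<lambda>n. krem (e n) (dist2 (fst p) (snd p)) * ang_prod (fst p) (snd p)) \<longlonglongrightarrow> (- 1 / 2) * ang_prod (fst p) (snd p)"
    proof (rule AE_I2)
      fix p :: "real \<times> real"
      show "(\<lambda>n. krem (e n) (dist2 (fst p) (snd p)) * ang_prod (fst p) (snd p)) \<longlonglongrightarrow> (- 1 / 2) * ang_prod (fst p) (snd p)"
      proof (cases "\<gamma> (fst p) = \<gamma> (snd p)")
        \<comment> \<open>On the diagonal \<open>krem\<close> has another limit, but there
          \<open>ang_prod\<close> is 0 by the convention for division by 0.\<close>
        case True
        then have "ang_prod (fst p) (snd p) = 0" by (simp add: ang_prod_def ang_vel_def)
        then show ?thesis by simp
      next
        case False
        then have "dist2 (fst p) (snd p) > 0" by simp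
        from tendsto_krem[OF e this] show ?thesis by (intro tendsto_mult tendsto_const)
      qed
    qed
    show "AE p in ?P. norm (krem (e n) (dist2 (fst p) (snd p)) * ang_prod (fst p) (snd p)) \<le> (17/2) * M" for n
      unfolding real_norm_def abs_mult using M krem_bounded[OF e(2)[of n]] by (intro AE_I2 mult_mono) auto
  qed auto
  moreover have "(\<integral>p. (- 1 / 2) * ang_prod (fst p) (snd p) \<partial>?P) = - chord_energy / 2"
    by (simp add: chord_energy_def ang_prod_def)
  ultimately show ?thesis using area_pair_expansion[OF e(2)] by simp
qed

end

section \<open>Radial moments of the kernel\<close>

lemma has_bochner_integral_FTC_atLeast:
  fixes f F :: "real \<Rightarrow> real"
  assumes [measurable]: "f \<in> borel_measurable borel"
    and F: "\<And>x. a \<le> x \<Longrightarrow> (F has_real_derivative f x) (at x)" and f: "\<And>x. a \<le> x \<Longrightarrow> 0 \<le> f x"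
    and T: "(F \<longlongrightarrow> T) at_top" "F a \<le> T"
  shows "has_bochner_integral lborel (\<lambda>x. indicator {a..} x * f x) (T - F a)"
proof (rule has_bochner_integral_nn_integral)
  have "(\<integral>\<^sup>+x. ennreal (indicator {a..} x * f x) \<partial>lborel) = (\<integral>\<^sup>+x. ennreal (f x) * indicator {a..} x \<partial>lborel)"
    by (intro nn_integral_cong) (auto simp: indicator_def)
  also have "\<dots> = ennreal (T - F a)" by (rule nn_integral_FTC_atLeast[OF _ F f T(1)]) auto
  finally show "(\<integral>\<^sup>+x. ennreal (indicator {a..} x * f x) \<partial>lborel) = ennreal (T - F a)" .
qed (use f T in \<open>auto simp: indicator_def\<close>)

context
  fixes eps :: real assumes eps: "eps > 0"
begin

lemma DERIV_kS_squared: "((\<lambda>r. eps / kS eps (r\<^sup>2)) has_real_derivative - (r / eps\<^sup>2) * (eps / kS eps (r\<^sup>2)) ^ 3) (at r)"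
proof -
  have p: "kS eps (r\<^sup>2) > 0" using eps by (intro kS_pos) auto
  have "((\<lambda>r. kS eps (r\<^sup>2)) has_real_derivative 1 / (2 * kS eps (r\<^sup>2)) * (2 * r)) (at r)"
    by (rule DERIV_chain2[OF DERIV_kS[OF eps]]) (auto intro!: derivative_eq_intros)
  then show ?thesis using p eps
    by (auto intro!: derivative_eq_intros simp: field_simps power2_eq_square power3_eq_cube)
qed

lemma kern_squared: "kern eps (r\<^sup>2) = (eps / kS eps (r\<^sup>2)) ^ 4 * kpoly (eps / kS eps (r\<^sup>2)) / eps ^ 4"
  using eps by (subst kern_eq) (auto simp: power_divide divide_inverse power_inverse power_mult_distrib)

lemma kS_squared_at_top: "filterlim (\<lambda>r. kS eps (r\<^sup>2)) at_top at_top"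
proof (rule filterlim_at_top_mono)
  show "filterlim (\<lambda>r::real. r) at_top at_top" by (rule filterlim_ident)
  show "\<forall>\<^sub>F r in at_top. r \<le> kS eps (r\<^sup>2)"
    unfolding kS_def by (intro always_eventually allI real_le_rsqrt) auto
qed

lemma tendsto_kS_squared: "((\<lambda>r. eps / kS eps (r\<^sup>2)) \<longlongrightarrow> 0) at_top"
  by (rule real_tendsto_divide_at_top[OF tendsto_const kS_squared_at_top])

text \<open>The substitution y = eps / sqrt (r^2 + eps^2) turns the integrand into the polynomial -
  y \<open>kpoly\<close> y / eps^2 with antiderivative q, and r from 0 to infinity into y from 1 to
  0.\<close>

lemma kern_first_moment: "has_bochner_integral lborel (\<lambda>r. indicator {0..} r * (kern eps (r\<^sup>2) * r)) (1 / eps\<^sup>2)"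
proof -
  define q where "q y = - (y\<^sup>2 / 2 + 6 * y ^ 3 - (11 / 2) * y ^ 4 - 6 * y ^ 5 + 6 * y ^ 6) / eps\<^sup>2" for y
  define Y where "Y r = eps / kS eps (r\<^sup>2)" for r
  have dq: "(q has_real_derivative - (y * kpoly y) / eps\<^sup>2) (at y)" for y
    unfolding q_def kpoly_def using eps by (auto intro!: derivative_eq_intros simp: field_simps power2_eq_square power3_eq_cube eval_nat_numeral)
  have Y: "(Y has_real_derivative - (r / eps\<^sup>2) * Y r ^ 3) (at r)" for r
    unfolding Y_def by (rule DERIV_kS_squared)
  have Y0: "Y 0 = 1" using eps by (simp add: Y_def kS_def)
  have "has_bochner_integral lborel (\<lambda>r. indicator {0..} r * (kern eps (r\<^sup>2) * r)) (0 - q (Y 0))"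
  proof (rule has_bochner_integral_FTC_atLeast)
    fix r :: real assume r: "0 \<le> r"
    show "((\<lambda>r. q (Y r)) has_real_derivative kern eps (r\<^sup>2) * r) (at r)"
    proof (rule DERIV_cong[OF DERIV_chain2[OF dq Y]])
      show "- (Y r * kpoly (Y r)) / eps\<^sup>2 * (- (r / eps\<^sup>2) * Y r ^ 3) = kern eps (r\<^sup>2) * r"
        unfolding kern_squared Y_def[symmetric] using eps by (simp add: field_simps power2_eq_square power3_eq_cube power4_eq_xxxx)
    qed
    show "0 \<le> kern eps (r\<^sup>2) * r" using kern_nonneg[OF eps, of "r\<^sup>2"] r by simp
  next
    have "((\<lambda>r. q (Y r)) \<longlongrightarrow> q 0) at_top"
      unfolding q_def by (intro tendsto_intros) (use tendsto_kS_squared eps in \<open>auto simp: Y_def\<close>)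
    then show "((\<lambda>r. q (Y r)) \<longlongrightarrow> 0) at_top" by (simp add: q_def)
    show "q (Y 0) \<le> 0" unfolding Y0 q_def by simp
  qed measurable
  then show ?thesis by (simp add: Y0 q_def)
qed

text \<open>For r = eps tan \<phi> the quantities y and u = r y / eps are the cosine and sine of
  \<phi>. The antiderivative is u^3 times a polynomial in y, divided by eps; at infinity u = 1 and y
  = 0.\<close>

lemma kern_second_moment: "has_bochner_integral lborel (\<lambda>r. indicator {0..} r * (kern eps (r\<^sup>2) * r\<^sup>2)) (2 / eps)"
proof -
  define Y where "Y r = eps / kS eps (r\<^sup>2)" for r
  define H where "H r = (1 / eps) * ((r * Y r / eps) ^ 3 * (2 - Y r - 6 * (Y r)\<^sup>2 + 6 * Y r ^ 3))" for r
  have Y: "(Y has_real_derivative - (r / eps\<^sup>2) * Y r ^ 3) (at r)" for r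
    unfolding Y_def by (rule DERIV_kS_squared)
  have rY: "(r * Y r / eps)\<^sup>2 = 1 - (Y r)\<^sup>2" for r
  proof -
    have "kS eps (r\<^sup>2) > 0" using eps by (intro kS_pos) auto
    then have p: "r\<^sup>2 + eps\<^sup>2 > 0" using kS_squared[of "r\<^sup>2" eps] by (metis zero_le_power2 zero_less_power)
    have "(Y r)\<^sup>2 = eps\<^sup>2 / (r\<^sup>2 + eps\<^sup>2)" unfolding Y_def power_divide by (subst kS_squared) auto
    then show ?thesis using p eps by (simp add: power_divide power_mult_distrib field_simps)
  qed
  have "has_bochner_integral lborel (\<lambda>r. indicator {0..} r * (kern eps (r\<^sup>2) * r\<^sup>2)) (2 / eps - H 0)"
  proof (rule has_bochner_integral_FTC_atLeast)
    fix r :: real assume r: "0 \<le> r"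
    define y u where "y = Y r" and "u = r * Y r / eps"
    have uy: "u\<^sup>2 = 1 - y\<^sup>2" using rY by (simp add: u_def y_def)
    have dy: "(Y has_real_derivative - (u * y\<^sup>2 / eps)) (at r)"
      using Y[of r] by (simp add: u_def y_def power2_eq_square power3_eq_cube mult_ac)
    have du: "((\<lambda>r. r * Y r / eps) has_real_derivative y ^ 3 / eps) (at r)"
    proof (rule DERIV_cong[OF DERIV_cdivide[OF DERIV_mult[OF DERIV_ident dy]]])
      have "1 * Y r + - (u * y\<^sup>2 / eps) * r = y - (r * Y r / eps) * u * y" by (simp add: y_def power2_eq_square)
      also have "\<dots> = y * (1 - u\<^sup>2)" by (simp add: u_def power2_eq_square algebra_simps)
      also have "\<dots> = y ^ 3" unfolding uy by (simp add: power2_eq_square power3_eq_cube)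
      finally show "(1 * Y r + - (u * y\<^sup>2 / eps) * r) / eps = y ^ 3 / eps" by simp
    qed
    have "((\<lambda>y. 2 - y - 6 * y\<^sup>2 + 6 * y ^ 3) has_real_derivative - 1 - 12 * y + 18 * y\<^sup>2) (at y)"
      by (auto intro!: derivative_eq_intros simp: power2_eq_square)
    from DERIV_chain2[OF this[unfolded y_def] dy]
    have dp: "((\<lambda>r. 2 - Y r - 6 * (Y r)\<^sup>2 + 6 * Y r ^ 3) has_real_derivative (- 1 - 12 * y + 18 * y\<^sup>2) * - (u * y\<^sup>2 / eps)) (at r)"
      by (simp add: y_def)
    have du3: "((\<lambda>r. (r * Y r / eps) ^ 3) has_real_derivative 3 * u\<^sup>2 * (y ^ 3 / eps)) (at r)"
      using DERIV_power[OF du, of 3] by (simp add: u_def power2_eq_square mult_ac)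
    have "(H has_real_derivative (1 / eps) * (3 * u\<^sup>2 * (y ^ 3 / eps) * (2 - y - 6 * y\<^sup>2 + 6 * y ^ 3)
       + (- 1 - 12 * y + 18 * y\<^sup>2) * - (u * y\<^sup>2 / eps) * u ^ 3)) (at r)"
      using DERIV_cmult[OF DERIV_mult[OF du3 dp], of "1 / eps"] unfolding H_def[abs_def] by (simp add: y_def u_def)
    then show "(H has_real_derivative kern eps (r\<^sup>2) * r\<^sup>2) (at r)"
    proof (rule DERIV_cong)
      have k: "kern eps (r\<^sup>2) * r\<^sup>2 = u\<^sup>2 * y\<^sup>2 * kpoly y / eps\<^sup>2"
        unfolding kern_squared Y_def[symmetric] u_def y_def[symmetric] using eps
        by (simp add: field_simps power2_eq_square power4_eq_xxxx)
      have "3 * u\<^sup>2 * (y ^ 3 / eps) * (2 - y - 6 * y\<^sup>2 + 6 * y ^ 3) + (- 1 - 12 * y + 18 * y\<^sup>2) * - (u * y\<^sup>2 / eps) * u ^ 3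
        = (u\<^sup>2 * y\<^sup>2 / eps) * (3 * y * (2 - y - 6 * y\<^sup>2 + 6 * y ^ 3) + (1 + 12 * y - 18 * y\<^sup>2) * u\<^sup>2)"
        by (simp add: divide_inverse algebra_simps power2_eq_square power3_eq_cube)
      also have "3 * y * (2 - y - 6 * y\<^sup>2 + 6 * y ^ 3) + (1 + 12 * y - 18 * y\<^sup>2) * u\<^sup>2 = kpoly y"
        unfolding uy kpoly_def by (simp add: algebra_simps power2_eq_square power3_eq_cube power4_eq_xxxx)
      finally show "(1 / eps) * (3 * u\<^sup>2 * (y ^ 3 / eps) * (2 - y - 6 * y\<^sup>2 + 6 * y ^ 3)
       + (- 1 - 12 * y + 18 * y\<^sup>2) * - (u * y\<^sup>2 / eps) * u ^ 3) = kern eps (r\<^sup>2) * r\<^sup>2"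
        unfolding k by (simp add: power2_eq_square)
    qed
    show "0 \<le> kern eps (r\<^sup>2) * r\<^sup>2" using kern_nonneg[OF eps, of "r\<^sup>2"] by simp
  next
    have y0: "(Y \<longlongrightarrow> 0) at_top" unfolding Y_def by (rule tendsto_kS_squared)
    have "((\<lambda>r. sqrt (1 - (Y r)\<^sup>2)) \<longlongrightarrow> sqrt (1 - 0\<^sup>2)) at_top" by (intro tendsto_intros y0)
    moreover have "\<forall>\<^sub>F r in at_top. sqrt (1 - (Y r)\<^sup>2) = r * Y r / eps"
      using eventually_ge_at_top[of 0]
    proof eventually_elim
      case (elim r)
      have "kS eps (r\<^sup>2) > 0" using eps by (intro kS_pos) auto
      then have "0 \<le> r * Y r / eps" using elim eps by (simp add: Y_def)
      then show ?case unfolding rY[symmetric] by (simp only: real_sqrt_abs abs_of_nonneg)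
    qed
    ultimately have u1: "((\<lambda>r. r * Y r / eps) \<longlongrightarrow> 1) at_top" by (auto intro: Lim_transform_eventually)
    have "(H \<longlongrightarrow> (1 / eps) * (1 ^ 3 * (2 - 0 - 6 * 0\<^sup>2 + 6 * 0 ^ 3))) at_top"
      unfolding H_def by (intro tendsto_intros y0 u1)
    then show "(H \<longlongrightarrow> 2 / eps) at_top" by simp
    show "H 0 \<le> 2 / eps" using eps by (simp add: H_def)
  qed measurable
  then show ?thesis by (simp add: H_def)
qed

end

text \<open>The part of \<open>pair_density\<close> remaining after its terms of order \<open>r\<close> and \<open>r\<^sup>2\<close> are split off; these two terms
  produce the \<open>1/eps\<^sup>2\<close> and \<open>1/eps\<close> terms of the expansion.\<close>

definition cap1 :: "real \<Rightarrow> real" where "cap1 s = s\<^sup>2 - s * cap_angle (1/2) s"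
definition cap2 :: "real \<Rightarrow> real" where "cap2 s = s * cap_angle (1/2) s - s\<^sup>2 * cap_cos (1/2) s"

lemma pair_density_decomposition:
  assumes "\<rho> > 0"
  shows "pair_density A B \<rho> r = 2 * pi * (\<rho> * A - B * \<rho>\<^sup>2 / 2) * r - 2 * A * r\<^sup>2
    + 8 * A * \<rho>\<^sup>2 * cap1 (r / (2 * \<rho>)) + 4 * B * \<rho> ^ 3 * cap2 (r / (2 * \<rho>))"
proof -
  define u c where "u = cap_angle (1/2) (r / (2 * \<rho>))" and "c = cap_cos (1/2) (r / (2 * \<rho>))"
  have u: "cap_angle \<rho> r = u" "cap_cos \<rho> r = c" by (simp_all add: u_def c_def cap_angle_def cap_cos_def)
  show ?thesis unfolding pair_density_def u cap1_def cap2_def u_def[symmetric] c_def[symmetric]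
    using assms by (simp add: field_simps power2_eq_square power3_eq_cube)
qed

text \<open>The area of a segment of the unit disc with half-chord s.\<close>

definition segm :: "real \<Rightarrow> real" where "segm s = arcsin s - s * sqrt (1 - s\<^sup>2)"

lemma cap_inside:
  assumes "0 \<le> s" "s \<le> 1" shows "cap1 s = s * (s - arcsin s)" "cap2 s = s * segm s"
  using assms by (simp_all add: cap1_def cap2_def segm_def cap_angle_def cap_cos_def power2_eq_square algebra_simps)

lemma cap_outside:
  assumes "1 \<le> s" shows "cap1 s = s\<^sup>2 - s * (pi / 2)" "cap2 s = s * (pi / 2)"
  using assms by (simp_all add: cap1_def cap2_def cap_angle_def cap_cos_def)

lemma DERIV_segm: assumes "0 < s" "s < 1" shows "(segm has_real_derivative 2 * s\<^sup>2 / sqrt (1 - s\<^sup>2)) (at s)"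
proof -
  have s2: "s\<^sup>2 < 1" using assms by (simp add: power_less_one_iff)
  define q where "q = sqrt (1 - s\<^sup>2)"
  have q: "q > 0" "q\<^sup>2 = 1 - s\<^sup>2" using s2 by (auto simp: q_def)
  have "((\<lambda>s. 1 - s\<^sup>2) has_real_derivative - (2 * s)) (at s)" by (auto intro!: derivative_eq_intros)
  from DERIV_chain2[OF DERIV_real_sqrt this] have dq: "((\<lambda>s. sqrt (1 - s\<^sup>2)) has_real_derivative inverse q / 2 * - (2 * s)) (at s)"
    using s2 by (simp add: q_def)
  have "(segm has_real_derivative inverse q - (1 * q + inverse q / 2 * - (2 * s) * s)) (at s)"
    unfolding segm_def[abs_def] q_def using assms
    by (intro DERIV_diff DERIV_mult DERIV_ident DERIV_arcsin dq[unfolded q_def]) auto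
  then show ?thesis
  proof (rule DERIV_cong)
    have "inverse q - (1 * q + inverse q / 2 * - (2 * s) * s) = (1 - q\<^sup>2 + s\<^sup>2) / q" using q(1) by (simp add: field_simps power2_eq_square)
    then show "inverse q - (1 * q + inverse q / 2 * - (2 * s) * s) = 2 * s\<^sup>2 / sqrt (1 - s\<^sup>2)" unfolding q(2) by (simp add: q_def)
  qed
qed

lemma continuous_segm: "continuous_on {0..1} segm"
  unfolding segm_def by (intro continuous_intros continuous_on_arcsin) auto

text \<open>For s \<le> 1/2 a comparison of derivatives gives even 4 s^3. For larger s the trivial
  bound pi/2 is below 13/8, which fixes the constant 13.\<close>

lemma segm_bounds:
  assumes s: "0 \<le> s" "s \<le> 1"
  shows "s \<le> arcsin s" "arcsin s - s \<le> segm s" "segm s \<le> 13 * s ^ 3"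
proof -
  have a: "0 \<le> arcsin s" "arcsin s \<le> pi / 2" using arcsin_le_arcsin[of 0 s] arcsin_bounded[of s] s by auto
  show "s \<le> arcsin s" using sin_x_le_x[OF a(1)] s by simp
  have "s * sqrt (1 - s\<^sup>2) \<le> s * 1" using s by (intro mult_left_mono) auto
  then show "arcsin s - s \<le> segm s" by (simp add: segm_def)
  show "segm s \<le> 13 * s ^ 3"
  proof (cases "s \<le> 1/2")
    case True
    have "(\<lambda>s. 4 * s ^ 3 - segm s) 0 \<le> (\<lambda>s. 4 * s ^ 3 - segm s) s"
    proof (rule DERIV_nonneg_imp_increasing_open[OF s(1)])
      fix x assume x: "0 < x" "x < s"
      have x2: "x\<^sup>2 \<le> (1/2)\<^sup>2" using x True by (intro power_mono) auto
      have q: "1/2 \<le> sqrt (1 - x\<^sup>2)" using x2 by (intro real_le_rsqrt) (simp add: power2_eq_square)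
      have "((\<lambda>s. 4 * s ^ 3 - segm s) has_real_derivative 4 * (3 * x\<^sup>2) - 2 * x\<^sup>2 / sqrt (1 - x\<^sup>2)) (at x)"
        using x s by (intro DERIV_diff DERIV_cmult DERIV_segm) (auto intro!: derivative_eq_intros simp: power2_eq_square)
      moreover have "0 \<le> 4 * (3 * x\<^sup>2) - 2 * x\<^sup>2 / sqrt (1 - x\<^sup>2)"
      proof -
        have "2 * x\<^sup>2 / sqrt (1 - x\<^sup>2) \<le> 2 * x\<^sup>2 / (1/2)" using q by (intro divide_left_mono q mult_pos_pos) (simp, linarith, simp)
        also have "\<dots> = 4 * x\<^sup>2" by simp
        also have "\<dots> \<le> 4 * (3 * x\<^sup>2)" by simp
        finally show ?thesis by (simp only: diff_ge_0_iff_ge)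
      qed
      ultimately show "\<exists>y. ((\<lambda>s. 4 * s ^ 3 - segm s) has_real_derivative y) (at x) \<and> 0 \<le> y" by blast
    next
      show "continuous_on {0..s} (\<lambda>s. 4 * s ^ 3 - segm s)"
        by (intro continuous_intros continuous_on_subset[OF continuous_segm]) (use s in auto)
    qed
    then have "segm s \<le> 4 * s ^ 3" by (simp add: segm_def)
    moreover have "0 \<le> s ^ 3" using s by simp
    ultimately show ?thesis by linarith
  next
    case False
    then have "(1/2) ^ 3 \<le> s ^ 3" by (intro power_mono) auto
    moreover have "0 \<le> s * sqrt (1 - s\<^sup>2)" using s by (simp add: power_le_one)
    then have "segm s \<le> pi / 2" using a unfolding segm_def by linarith
    moreover have "pi / 2 \<le> 13 * (1/2) ^ 3" using pi_less_4 pi_approx by (simp add: power3_eq_cube)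
    ultimately show ?thesis by linarith
  qed
qed

text \<open>The cap functions are of order s^4 at 0 and grow at most quadratically, so after
  division by s^4 this integrable function dominates them.\<close>

definition capw :: "real \<Rightarrow> real" where "capw s = indicator {0..1} s * 13 + 4 * (indicator {1..} s * (1 / s\<^sup>2))"

lemma inverse_square_integral: "has_bochner_integral lborel (\<lambda>s::real. indicator {1..} s * (1 / s\<^sup>2)) 1"
proof -
  have "has_bochner_integral lborel (\<lambda>s::real. indicator {1..} s * (1 / s\<^sup>2)) (0 - (- (1 / 1)))"
  proof (rule has_bochner_integral_FTC_atLeast[where F="\<lambda>s. - (1 / s)"])
    show "((\<lambda>s. - (1 / s)) has_real_derivative 1 / s\<^sup>2) (at s)" if "1 \<le> s" for s :: real
      using that by (auto intro!: derivative_eq_intros simp: power2_eq_square)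
    show "((\<lambda>s::real. - (1 / s)) \<longlongrightarrow> 0) at_top"
      using tendsto_minus[OF real_tendsto_divide_at_top[OF tendsto_const[of 1] filterlim_ident]] by simp
  qed auto
  then show ?thesis by simp
qed

lemma inverse_cube_integral: "has_bochner_integral lborel (\<lambda>s::real. indicator {1..} s * (1 / s ^ 3)) (1 / 2)"
proof -
  have "has_bochner_integral lborel (\<lambda>s::real. indicator {1..} s * (1 / s ^ 3)) (0 - (- (1 / (2 * 1\<^sup>2))))"
  proof (rule has_bochner_integral_FTC_atLeast[where F="\<lambda>s. - (1 / (2 * s\<^sup>2))"])
    show "((\<lambda>s. - (1 / (2 * s\<^sup>2))) has_real_derivative 1 / s ^ 3) (at s)" if "1 \<le> s" for s :: real
      using that by (auto intro!: derivative_eq_intros simp: field_simps power2_eq_square power3_eq_cube)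
    show "((\<lambda>s::real. - (1 / (2 * s\<^sup>2))) \<longlongrightarrow> 0) at_top"
    proof -
      have "((\<lambda>s::real. 1 / s) \<longlongrightarrow> 0) at_top" by (rule real_tendsto_divide_at_top[OF tendsto_const filterlim_ident])
      from tendsto_mult_right_zero[OF tendsto_mult_zero[OF this this], of "- (1 / 2)"]
      show ?thesis by (simp add: power2_eq_square)
    qed
  qed auto
  then show ?thesis by simp
qed

lemma capw_integrable: "integrable lborel capw"
proof -
  have "integrable lborel (\<lambda>s::real. indicator {0..1} s * (13::real))"
    by (intro integrable_mult_left) (simp add: integrable_indicator_iff)
  moreover have "integrable lborel (\<lambda>s::real. indicator {1..} s * (1 / s\<^sup>2))"
    using inverse_square_integral by (rule integrable.intros)
  ultimately show ?thesis unfolding capw_def[abs_def] by (intro Bochner_Integration.integrable_add integrable_mult_right)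
qed

lemma capw_nonneg: "0 \<le> capw s" by (simp add: capw_def)

lemma cap_measurable [measurable]: "cap1 \<in> borel_measurable borel" "cap2 \<in> borel_measurable borel"
  unfolding cap1_def[abs_def] cap2_def[abs_def] cap_angle_def cap_cos_def by measurable

lemma cap_le:
  assumes s: "s > 0" shows "\<bar>cap1 s\<bar> \<le> s ^ 4 * capw s" "\<bar>cap2 s\<bar> \<le> s ^ 4 * capw s"
proof -
  have "\<bar>cap1 s\<bar> \<le> s ^ 4 * capw s \<and> \<bar>cap2 s\<bar> \<le> s ^ 4 * capw s"
  proof (cases "s \<le> 1")
    case True
    have b: "s \<le> arcsin s" "arcsin s - s \<le> segm s" "segm s \<le> 13 * s ^ 3" using segm_bounds[of s] s True by auto
    have "\<bar>s - arcsin s\<bar> \<le> 13 * s ^ 3" "\<bar>segm s\<bar> \<le> 13 * s ^ 3" using b by auto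
    then have "s * \<bar>s - arcsin s\<bar> \<le> s * (13 * s ^ 3)" "s * \<bar>segm s\<bar> \<le> s * (13 * s ^ 3)" using s by auto
    moreover have "s * (13 * s ^ 3) = s ^ 4 * 13" by (simp add: power3_eq_cube power4_eq_xxxx)
    moreover have "s ^ 4 * 13 \<le> s ^ 4 * capw s" using True s by (intro mult_left_mono) (auto simp: capw_def)
    ultimately have "s * \<bar>s - arcsin s\<bar> \<le> s ^ 4 * capw s" "s * \<bar>segm s\<bar> \<le> s ^ 4 * capw s" by linarith+
    then show ?thesis using cap_inside[of s] True s by (simp add: abs_mult)
  next
    case False
    then have w: "s ^ 4 * capw s = 4 * s\<^sup>2" by (simp add: capw_def power2_eq_square power4_eq_xxxx)
    define p where "p = s * (pi / 2)"
    have p: "p \<le> s * 2" "0 \<le> p" unfolding p_def using s pi_less_4 by (auto intro: mult_left_mono)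
    have s2: "s \<le> s\<^sup>2" using False by (simp add: power2_eq_square)
    have "cap1 s = s\<^sup>2 - p" "cap2 s = p" using cap_outside[of s] False by (auto simp: p_def)
    then show ?thesis using p s2 s unfolding w by linarith
  qed
  then show "\<bar>cap1 s\<bar> \<le> s ^ 4 * capw s" "\<bar>cap2 s\<bar> \<le> s ^ 4 * capw s" by auto
qed

section \<open>Limits of the remainder moments\<close>

definition kern_moment :: "(real \<Rightarrow> real) \<Rightarrow> real \<Rightarrow> real" where
  "kern_moment e \<eta> = (\<integral>s. indicator {0<..} s * (kern \<eta> (s\<^sup>2) * e s) \<partial>lborel)"

lemma kern_measurable_pair [measurable (raw)]:
  assumes [measurable]: "e \<in> borel_measurable M" "R \<in> borel_measurable M"
  shows "(\<lambda>x. kern (e x) (R x)) \<in> borel_measurable M"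
  unfolding kern_def kP_def kP1_def kP2_def kS_def by measurable

context
  fixes e :: "real \<Rightarrow> real"
  assumes em [measurable]: "e \<in> borel_measurable borel" and e: "\<And>s. s > 0 \<Longrightarrow> \<bar>e s\<bar> \<le> s ^ 4 * capw s"
begin

lemma kern_moment_dominated:
  assumes "\<eta> > 0" shows "norm (indicator {0<..} s * (kern \<eta> (s\<^sup>2) * e s)) \<le> 55 * capw s"
proof (cases "s > 0")
  case True
  have "\<bar>kern \<eta> (s\<^sup>2)\<bar> \<le> 55 / (s\<^sup>2)\<^sup>2" using kern_le'[OF assms, of "s\<^sup>2"] kern_nonneg[OF assms, of "s\<^sup>2"] True by simp
  then have "\<bar>kern \<eta> (s\<^sup>2)\<bar> * \<bar>e s\<bar> \<le> 55 / (s\<^sup>2)\<^sup>2 * (s ^ 4 * capw s)" using e[OF True] by (intro mult_mono) auto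
  also have "\<dots> = 55 * capw s" using True by (simp add: power_mult[symmetric])
  finally show ?thesis using True by (simp add: abs_mult)
qed (use capw_nonneg in simp)

lemma kern_moment_integrable: "\<eta> > 0 \<Longrightarrow> integrable lborel (\<lambda>s. indicator {0<..} s * (kern \<eta> (s\<^sup>2) * e s))"
  by (rule Bochner_Integration.integrable_bound[of _ "\<lambda>s. 55 * capw s"])
     (use kern_moment_dominated capw_nonneg in \<open>auto intro!: capw_integrable integrable_mult_right AE_I2 simp del: norm_mult\<close>)

lemma kern_moment_bounded:
  assumes "\<eta> > 0" shows "\<bar>kern_moment e \<eta>\<bar> \<le> (\<integral>s. 55 * capw s \<partial>lborel)"
  unfolding kern_moment_def real_norm_def[symmetric]
  by (rule Bochner_Integration.integral_norm_bound_integral[OF kern_moment_integrable[OF assms] _ kern_moment_dominated[OF assms]])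
     (intro integrable_mult_right capw_integrable)

lemma tendsto_kern_moment:
  assumes "\<eta> \<longlonglongrightarrow> 0" "\<And>n. \<eta> n > 0"
  shows "(\<lambda>n. kern_moment e (\<eta> n)) \<longlonglongrightarrow> (\<integral>s. indicator {0<..} s * (e s / s ^ 4) \<partial>lborel)"
  unfolding kern_moment_def
proof (rule integral_dominated_convergence[where w="\<lambda>s. 55 * capw s"])
  show "AE s in lborel. (\<lambda>n. indicator {0<..} s * (kern (\<eta> n) (s\<^sup>2) * e s)) \<longlonglongrightarrow> indicator {0<..} s * (e s / s ^ 4)"
  proof (rule AE_I2)
    fix s :: real
    show "(\<lambda>n. indicator {0<..} s * (kern (\<eta> n) (s\<^sup>2) * e s)) \<longlonglongrightarrow> indicator {0<..} s * (e s / s ^ 4)"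
    proof (cases "s > 0")
      case True
      have "(\<lambda>n. kern (\<eta> n) (s\<^sup>2)) \<longlonglongrightarrow> 1 / (s\<^sup>2)\<^sup>2" by (rule tendsto_kern[OF assms]) (use True in simp)
      then have "(\<lambda>n. indicator {0<..} s * (kern (\<eta> n) (s\<^sup>2) * e s)) \<longlonglongrightarrow> indicator {0<..} s * (1 / (s\<^sup>2)\<^sup>2 * e s)"
        by (intro tendsto_intros)
      then show ?thesis by (simp add: power_mult[symmetric])
    qed simp
  qed
  show "integrable lborel (\<lambda>s. 55 * capw s)" by (intro integrable_mult_right capw_integrable)
qed (use kern_moment_dominated[OF assms(2)] in \<open>auto intro!: AE_I2 simp del: norm_mult\<close>)

lemma tail_integrable: "integrable lborel (\<lambda>s. indicator {0..} s * (e s / s ^ 4))"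
proof (rule Bochner_Integration.integrable_bound[OF capw_integrable])
  show "AE s in lborel. norm (indicator {0..} s * (e s / s ^ 4)) \<le> norm (capw s)"
  proof (rule AE_I2)
    fix s
    show "norm (indicator {0..} s * (e s / s ^ 4)) \<le> norm (capw s)"
      using e[of s] capw_nonneg[of s] by (cases "s > 0") (auto simp: abs_mult divide_le_eq mult.commute indicator_def)
  qed
qed measurable

lemma integral_tail:
  assumes F: "continuous_on {0..1} F" "\<And>s. 0 < s \<Longrightarrow> s < 1 \<Longrightarrow> (F has_real_derivative e s / s ^ 4) (at s)"
    and tail: "has_bochner_integral lborel (\<lambda>s. indicator {1..} s * (e s / s ^ 4)) c"
  shows "(\<integral>s. indicator {0<..} s * (e s / s ^ 4) \<partial>lborel) = F 1 - F 0 + c"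
proof -
  have i: "set_integrable lborel {0..1} (\<lambda>s. e s / s ^ 4)"
    unfolding set_integrable_def
    by (rule Bochner_Integration.integrable_bound[OF tail_integrable]) (auto simp: indicator_def)
  have "((\<lambda>s. e s / s ^ 4) has_integral (F 1 - F 0)) {0..1}"
    by (rule fundamental_theorem_of_calculus_interior[OF _ F(1)])
       (auto simp: has_real_derivative_iff_has_vector_derivative[symmetric] F(2))
  then have "(LINT s:{0..1}|lborel. e s / s ^ 4) = F 1 - F 0"
    using set_borel_integral_eq_integral(2)[OF i] by (simp add: integral_unique)
  then have h: "has_bochner_integral lborel (\<lambda>s. indicator {0..1} s * (e s / s ^ 4)) (F 1 - F 0)"
    using i unfolding set_integrable_def set_lebesgue_integral_def by (simp add: has_bochner_integral_iff)
  have "(\<integral>s. indicator {0<..} s * (e s / s ^ 4) \<partial>lborel) = (\<integral>s. indicator {0..1} s * (e s / s ^ 4) + indicator {1..} s * (e s / s ^ 4) \<partial>lborel)"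
  proof (rule integral_cong_AE)
    have "AE s in lborel. s \<noteq> (1::real)" by (rule AE_lborel_singleton)
    then show "AE s in lborel. indicator {0<..} s * (e s / s ^ 4) = indicator {0..1} s * (e s / s ^ 4) + indicator {1..} s * (e s / s ^ 4)"
      by eventually_elim (auto simp: indicator_def)
  qed auto
  also have "\<dots> = F 1 - F 0 + c" using has_bochner_integral_add[OF h tail] by (rule has_bochner_integral_integral_eq)
  finally show ?thesis .
qed

end

text \<open>The antiderivatives below divide by powers of s and take the value 0 at s = 0 by the
  convention for division by 0; a linear bound shows that this is also the limit.\<close>

lemma continuous_on_squeeze_0:
  fixes F :: "real \<Rightarrow> real"
  assumes F0: "F 0 = 0" and c: "continuous_on {0<..1} F" and b: "\<And>s. 0 < s \<Longrightarrow> s \<le> 1 \<Longrightarrow> \<bar>F s\<bar> \<le> C * s"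
  shows "continuous_on {0..1} F"
  unfolding continuous_on_eq_continuous_within
proof
  fix s :: real assume s: "s \<in> {0..1}"
  show "continuous (at s within {0..1}) F"
  proof (cases "s = 0")
    case False
    then have "continuous (at s within {0<..1}) F" using c s by (simp add: continuous_on_eq_continuous_within)
    moreover have "at s within {0..1} = at s within {0<..1}"
      by (rule at_within_nhd[of _ "{0<..}"]) (use s False in auto)
    ultimately show ?thesis by simp
  next
    case True
    have "(F \<longlongrightarrow> 0) (at 0 within {0..1})"
    proof (rule Lim_null_comparison)
      show "\<forall>\<^sub>F s in at 0 within {0..1}. norm (F s) \<le> C * s"
        using b by (auto simp: eventually_at_filter)
      show "((\<lambda>s. C * s) \<longlongrightarrow> 0) (at 0 within {0..1})" by (auto intro!: tendsto_eq_intros)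
    qed
    then show ?thesis using True F0 by (simp add: continuous_within)
  qed
qed

lemma arcsin_le_linear: assumes "0 \<le> s" "s \<le> 1" shows "arcsin s \<le> 14 * s"
proof -
  have "s ^ 3 \<le> s" using assms power_decreasing[of 1 3 s] by simp
  then show ?thesis using segm_bounds[OF assms] by linarith
qed

text \<open>The antiderivative \<open>arcsin s - segm s / (2 * s\<^sup>2)\<close> gives pi/4 on
  [0,1], and the tail from 1 on gives another pi/4. This number turns the total turning of the curve
  into the constant of the theorem.\<close>

lemma cap2_tail: "(\<integral>s. indicator {0<..} s * (cap2 s / s ^ 4) \<partial>lborel) = pi / 2"
proof -
  define F where "F s = arcsin s - segm s / (2 * s\<^sup>2)" for s
  have tail: "has_bochner_integral lborel (\<lambda>s::real. indicator {1..} s * (cap2 s / s ^ 4)) (pi / 2 * (1 / 2))"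
    by (rule has_bochner_integral_cong[THEN iffD1, OF refl _ refl has_bochner_integral_mult_right[OF inverse_cube_integral, of "pi / 2"]])
       (auto simp: indicator_def cap_outside power3_eq_cube power4_eq_xxxx)
  have "(\<integral>s. indicator {0<..} s * (cap2 s / s ^ 4) \<partial>lborel) = F 1 - F 0 + pi / 2 * (1 / 2)"
  proof (rule integral_tail[OF cap_measurable(2) cap_le(2) _ _ tail])
    show "continuous_on {0..1} F"
    proof (rule continuous_on_squeeze_0)
      show "continuous_on {0<..1} F" unfolding F_def
        by (intro continuous_intros continuous_on_arcsin continuous_on_subset[OF continuous_segm]) auto
      show "F 0 = 0" by (simp add: F_def)
      show "\<bar>F s\<bar> \<le> 21 * s" if s: "0 < s" "s \<le> 1" for s
      proof -
        have b: "s \<le> arcsin s" "arcsin s - s \<le> segm s" "segm s \<le> 13 * s ^ 3" using segm_bounds[of s] s by auto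
        have "segm s / (2 * s\<^sup>2) \<le> 13 * s ^ 3 / (2 * s\<^sup>2)" using b s by (intro divide_right_mono) auto
        also have "\<dots> = (13 / 2) * s" using s by (simp add: power2_eq_square power3_eq_cube)
        finally have "segm s / (2 * s\<^sup>2) \<le> (13 / 2) * s" .
        moreover have "0 \<le> segm s / (2 * s\<^sup>2)" using b by simp
        ultimately show ?thesis using arcsin_le_linear[of s] b s unfolding F_def by linarith
      qed
    qed
    fix s :: real assume s: "0 < s" "s < 1"
    have s2: "s\<^sup>2 < 1" using s by (simp add: power_less_one_iff)
    define q where "q = sqrt (1 - s\<^sup>2)"
    have q: "q > 0" using s2 by (simp add: q_def)
    have "(F has_real_derivative inverse q - (2 * s\<^sup>2 / q * (2 * s\<^sup>2) - segm s * (2 * (2 * s))) / ((2 * s\<^sup>2) * (2 * s\<^sup>2))) (at s)"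
      unfolding F_def[abs_def] q_def using s
      by (intro DERIV_diff DERIV_arcsin DERIV_divide DERIV_segm) (auto intro!: derivative_eq_intros)
    then show "(F has_real_derivative cap2 s / s ^ 4) (at s)"
    proof (rule DERIV_cong)
      show "inverse q - (2 * s\<^sup>2 / q * (2 * s\<^sup>2) - segm s * (2 * (2 * s))) / ((2 * s\<^sup>2) * (2 * s\<^sup>2)) = cap2 s / s ^ 4"
        using s q by (simp add: cap_inside field_simps power2_eq_square power4_eq_xxxx)
    qed
  qed
  then show ?thesis by (simp add: F_def segm_def)
qed

text \<open>The part over [0,1] is pi/4 - 1 and the tail is 1 - pi/4. Their cancellation removes the
  radii \<open>maxrad\<close> from the limit of the constant term.\<close>

lemma cap1_tail: "(\<integral>s. indicator {0<..} s * (cap1 s / s ^ 4) \<partial>lborel) = 0"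
proof -
  define F where "F s = (arcsin s - s) / (2 * s\<^sup>2) + (sqrt (1 - s\<^sup>2) - 1) / (2 * s)" for s
  have tail: "has_bochner_integral lborel (\<lambda>s::real. indicator {1..} s * (cap1 s / s ^ 4)) (1 - pi / 2 * (1 / 2))"
    by (rule has_bochner_integral_cong[THEN iffD1, OF refl _ refl has_bochner_integral_diff[OF inverse_square_integral has_bochner_integral_mult_right[OF inverse_cube_integral, of "pi / 2"]]])
       (auto simp: indicator_def cap_outside field_simps power2_eq_square power3_eq_cube power4_eq_xxxx)
  have "(\<integral>s. indicator {0<..} s * (cap1 s / s ^ 4) \<partial>lborel) = F 1 - F 0 + (1 - pi / 2 * (1 / 2))"
  proof (rule integral_tail[OF cap_measurable(1) cap_le(1) _ _ tail])
    show "continuous_on {0..1} F"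
    proof (rule continuous_on_squeeze_0)
      show "continuous_on {0<..1} F" unfolding F_def
        by (intro continuous_intros continuous_on_arcsin) auto
      show "F 0 = 0" by (simp add: F_def)
      show "\<bar>F s\<bar> \<le> 7 * s" if s: "0 < s" "s \<le> 1" for s
      proof -
        have b: "s \<le> arcsin s" "arcsin s - s \<le> segm s" "segm s \<le> 13 * s ^ 3" using segm_bounds[of s] s by auto
        have "(arcsin s - s) / (2 * s\<^sup>2) \<le> 13 * s ^ 3 / (2 * s\<^sup>2)" using b s by (intro divide_right_mono) auto
        also have "\<dots> = (13 / 2) * s" using s by (simp add: power2_eq_square power3_eq_cube)
        finally have 1: "(arcsin s - s) / (2 * s\<^sup>2) \<le> (13 / 2) * s" .
        have 2: "0 \<le> (arcsin s - s) / (2 * s\<^sup>2)" using b by simp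
        have "1 - s\<^sup>2 \<le> sqrt (1 - s\<^sup>2)"
          using s by (intro real_le_rsqrt) (auto simp: power2_eq_square mult_le_one mult_left_le_one_le)
        then have "- s\<^sup>2 / (2 * s) \<le> (sqrt (1 - s\<^sup>2) - 1) / (2 * s)" using s by (intro divide_right_mono) auto
        then have 3: "- (s / 2) \<le> (sqrt (1 - s\<^sup>2) - 1) / (2 * s)" using s by (simp add: power2_eq_square)
        have 4: "(sqrt (1 - s\<^sup>2) - 1) / (2 * s) \<le> 0" using s by (intro divide_nonpos_pos) auto
        show ?thesis using 1 2 3 4 s unfolding F_def by linarith
      qed
    qed
    fix s :: real assume s: "0 < s" "s < 1"
    have s2: "s\<^sup>2 < 1" using s by (simp add: power_less_one_iff)
    define q where "q = sqrt (1 - s\<^sup>2)"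
    have q: "q > 0" "q * q = 1 - s * s" using s2 by (auto simp: q_def power2_eq_square)
    have "((\<lambda>s. 1 - s\<^sup>2) has_real_derivative - (2 * s)) (at s)" by (auto intro!: derivative_eq_intros)
    from DERIV_chain2[OF DERIV_real_sqrt this] have dq: "((\<lambda>s. sqrt (1 - s\<^sup>2)) has_real_derivative inverse q / 2 * - (2 * s)) (at s)"
      using s2 by (simp add: q_def)
    have "(F has_real_derivative ((inverse q - 1) * (2 * s\<^sup>2) - (arcsin s - s) * (2 * (2 * s))) / ((2 * s\<^sup>2) * (2 * s\<^sup>2))
       + ((inverse q / 2 * - (2 * s) - 0) * (2 * s) - (sqrt (1 - s\<^sup>2) - 1) * 2) / ((2 * s) * (2 * s))) (at s)"
      unfolding F_def[abs_def] using s DERIV_arcsin[of s]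
      by (intro DERIV_add DERIV_diff DERIV_divide dq DERIV_const DERIV_ident) (auto intro!: derivative_eq_intros simp: q_def)
    then show "(F has_real_derivative cap1 s / s ^ 4) (at s)"
    proof (rule DERIV_cong)
      define a where "a = arcsin s"
      have "(inverse q - 1) * (2 * s\<^sup>2) / ((2 * s\<^sup>2) * (2 * s\<^sup>2)) = (inverse q - 1) / (2 * s\<^sup>2)" using s by (simp add: field_simps power2_eq_square power4_eq_xxxx)
      moreover have "((inverse q / 2 * - (2 * s) - 0) * (2 * s) - (q - 1) * 2) / ((2 * s) * (2 * s)) = - (inverse q - 1) / (2 * s\<^sup>2)"
      proof -
        have "(inverse q / 2 * - (2 * s) - 0) * (2 * s) - (q - 1) * 2 = - 2 * (inverse q * (s * s + q * q) - 1)"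
          using q(1) by (simp add: field_simps)
        also have "\<dots> = - 2 * (inverse q - 1)" unfolding q(2) by simp
        finally have e: "(inverse q / 2 * - (2 * s) - 0) * (2 * s) - (q - 1) * 2 = - 2 * (inverse q - 1)" .
        have "- 2 * x / ((2 * s) * (2 * s)) = - x / (2 * s\<^sup>2)" for x using s by (simp add: field_simps power2_eq_square)
        then show ?thesis unfolding e .
      qed
      moreover have "(a - s) * (2 * (2 * s)) / ((2 * s\<^sup>2) * (2 * s\<^sup>2)) = (a - s) / s ^ 3"
        using s by (simp add: field_simps power2_eq_square power3_eq_cube)
      ultimately have "((inverse q - 1) * (2 * s\<^sup>2) - (a - s) * (2 * (2 * s))) / ((2 * s\<^sup>2) * (2 * s\<^sup>2))
       + ((inverse q / 2 * - (2 * s) - 0) * (2 * s) - (q - 1) * 2) / ((2 * s) * (2 * s)) = - ((a - s) / s ^ 3)"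
        unfolding diff_divide_distrib[of "(inverse q - 1) * (2 * s\<^sup>2)"] by (simp only:)
      also have "\<dots> = cap1 s / s ^ 4" using s by (simp add: cap_inside a_def field_simps power3_eq_cube power4_eq_xxxx)
      finally show "((inverse q - 1) * (2 * s\<^sup>2) - (arcsin s - s) * (2 * (2 * s))) / ((2 * s\<^sup>2) * (2 * s\<^sup>2))
       + ((inverse q / 2 * - (2 * s) - 0) * (2 * s) - (sqrt (1 - s\<^sup>2) - 1) * 2) / ((2 * s) * (2 * s)) = cap1 s / s ^ 4"
        by (simp only: a_def q_def)
    qed
  qed
  also have "\<dots> = 0" by (simp add: F_def field_simps)
  finally show ?thesis .
qed

text \<open>The kernel is homogeneous of degree -4 in distance and eps jointly. Discs of radius
  \<rho> are thereby reduced to radius 1/2, at the price of replacing eps by eps / (2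
  \<rho>).\<close>

lemma kern_scale:
  assumes "eps > 0" "l > 0" shows "kern eps ((l * s)\<^sup>2) = kern (eps / l) (s\<^sup>2) / l ^ 4"
proof -
  have "(l * s)\<^sup>2 + eps\<^sup>2 = l\<^sup>2 * (s\<^sup>2 + (eps / l)\<^sup>2)" using assms by (simp add: power_mult_distrib power_divide distrib_left)
  then have S: "kS eps ((l * s)\<^sup>2) = l * kS (eps / l) (s\<^sup>2)" using assms by (simp add: kS_def real_sqrt_mult)
  have "kern eps ((l * s)\<^sup>2) = inverse (l * kS (eps / l) (s\<^sup>2)) ^ 4 * kpoly (eps / (l * kS (eps / l) (s\<^sup>2)))"
    using assms by (subst kern_eq) (simp_all only: S zero_le_power2)
  also have "\<dots> = inverse l ^ 4 * (inverse (kS (eps / l) (s\<^sup>2)) ^ 4 * kpoly (eps / l / kS (eps / l) (s\<^sup>2)))"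
    by (simp add: inverse_mult_distrib power_mult_distrib)
  also have "\<dots> = inverse l ^ 4 * kern (eps / l) (s\<^sup>2)" using assms by (subst kern_eq) auto
  finally show ?thesis by (simp add: divide_inverse power_inverse)
qed

lemma scaled_kern_moment:
  assumes "eps > 0" "l > 0" and int: "integrable lborel (\<lambda>s. indicator {0<..} s * (kern (eps / l) (s\<^sup>2) * e s))"
  shows "has_bochner_integral lborel (\<lambda>r. indicator {0<..} r * (kern eps (r\<^sup>2) * e (r / l))) (kern_moment e (eps / l) / l ^ 3)"
proof -
  have "has_bochner_integral lborel (\<lambda>s. indicator {0<..} s * (kern (eps / l) (s\<^sup>2) * e s) / l ^ 4) (kern_moment e (eps / l) / l ^ 4)"
    using has_bochner_integral_integrable[OF int] unfolding kern_moment_def by (intro has_bochner_integral_divide) auto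
  moreover have "indicator {0<..} s * (kern (eps / l) (s\<^sup>2) * e s) / l ^ 4 = indicator {0<..} (0 + l * s) * (kern eps ((0 + l * s)\<^sup>2) * e ((0 + l * s) / l))" for s
    using assms kern_scale[OF assms(1,2), of s] by (simp add: indicator_def zero_less_mult_iff)
  moreover have "kern_moment e (eps / l) / l ^ 4 = (kern_moment e (eps / l) / l ^ 3) /\<^sub>R \<bar>l\<bar>"
    using assms by (simp add: field_simps power3_eq_cube power4_eq_xxxx)
  ultimately have "has_bochner_integral lborel (\<lambda>s. indicator {0<..} (0 + l * s) * (kern eps ((0 + l * s)\<^sup>2) * e ((0 + l * s) / l))) ((kern_moment e (eps / l) / l ^ 3) /\<^sub>R \<bar>l\<bar>)"
    by (simp only:)
  then show ?thesis
    by (subst lborel_has_bochner_integral_real_affine_iff[of l _ _ 0]) (use assms in auto)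
qed

definition touch_total :: "real \<Rightarrow> real \<Rightarrow> real \<Rightarrow> real \<Rightarrow> real" where
  "touch_total eps A B \<rho> = 2 * pi * (\<rho> * A - B * \<rho>\<^sup>2 / 2) / eps\<^sup>2 - 4 * A / eps
     + ((A / \<rho>) * kern_moment cap1 (eps / (2 * \<rho>)) + (B / 2) * kern_moment cap2 (eps / (2 * \<rho>)))"

lemma kern_pair_density_integral:
  assumes e: "eps > 0" and \<rho>: "\<rho> > 0"
  shows "has_bochner_integral lborel (\<lambda>r. indicator {0<..} r * (kern eps (r\<^sup>2) * pair_density A B \<rho> r)) (touch_total eps A B \<rho>)"
proof -
  define l where "l = 2 * \<rho>"
  have l: "l > 0" "eps / l > 0" using \<rho> e by (auto simp: l_def)
  have i1: "has_bochner_integral lborel (\<lambda>r. indicator {0<..} r * (kern eps (r\<^sup>2) * cap1 (r / l))) (kern_moment cap1 (eps / l) / l ^ 3)"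
    by (rule scaled_kern_moment[OF e l(1) kern_moment_integrable[OF cap_measurable(1) cap_le(1) l(2)]])
  have i2: "has_bochner_integral lborel (\<lambda>r. indicator {0<..} r * (kern eps (r\<^sup>2) * cap2 (r / l))) (kern_moment cap2 (eps / l) / l ^ 3)"
    by (rule scaled_kern_moment[OF e l(1) kern_moment_integrable[OF cap_measurable(2) cap_le(2) l(2)]])
  define c where "c = 2 * pi * (\<rho> * A - B * \<rho>\<^sup>2 / 2)"
  have cap: "8 * A * \<rho>\<^sup>2 * (x / l ^ 3) = (A / \<rho>) * x" "4 * B * \<rho> ^ 3 * (x / l ^ 3) = (B / 2) * x" for x
    using \<rho> by (simp_all add: l_def field_simps power2_eq_square power3_eq_cube)
  have "has_bochner_integral lborel (\<lambda>r. c * (indicator {0..} r * (kern eps (r\<^sup>2) * r)) - 2 * A * (indicator {0..} r * (kern eps (r\<^sup>2) * r\<^sup>2))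
      + 8 * A * \<rho>\<^sup>2 * (indicator {0<..} r * (kern eps (r\<^sup>2) * cap1 (r / l))) + 4 * B * \<rho> ^ 3 * (indicator {0<..} r * (kern eps (r\<^sup>2) * cap2 (r / l))))
     (c * (1 / eps\<^sup>2) - 2 * A * (2 / eps) + 8 * A * \<rho>\<^sup>2 * (kern_moment cap1 (eps / l) / l ^ 3) + 4 * B * \<rho> ^ 3 * (kern_moment cap2 (eps / l) / l ^ 3))"
    (is "has_bochner_integral lborel ?f ?I")
    by (intro has_bochner_integral_add has_bochner_integral_diff has_bochner_integral_mult_right kern_first_moment kern_second_moment i1 i2 e)
  moreover have "?f r = indicator {0<..} r * (kern eps (r\<^sup>2) * pair_density A B \<rho> r)" for r
  proof (cases "r > 0")
    case True
    then show ?thesis unfolding pair_density_decomposition[OF \<rho>] c_def[symmetric] l_def[symmetric] by (simp add: algebra_simps)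
  next
    case False
    then show ?thesis by (cases "r = 0") auto
  qed
  moreover have "?I = touch_total eps A B \<rho>" unfolding touch_total_def cap c_def by (simp add: l_def)
  ultimately show ?thesis by (simp only:)
qed

lemma kern_moment_measurable [measurable]:
  assumes [measurable]: "e \<in> borel_measurable borel" shows "kern_moment e \<in> borel_measurable borel"
  unfolding kern_moment_def[abs_def] by measurable

section \<open>The expansion over the pairs on a common circle\<close>

context C2_domain
begin

definition touch_area :: "real \<Rightarrow> real" where
  "touch_area eps = (\<integral>t. touch_total eps (norm (vel t)) (\<sigma> * turn t) (maxrad t) \<partial>U01)"

lemma bounds_obtain:
  obtains V K where "V > 0" "\<And>t. norm (vel t) \<le> V" "K > 0" "\<And>t. \<bar>\<sigma> * turn t\<bar> \<le> K"
proof -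
  obtain V where V: "V > 0" "\<And>t. norm (vel t) \<le> V" using periodic_bounded[OF continuous_vel periodic_vel] by blast
  obtain K where K: "K > 0" "\<And>t. \<bar>turn t\<bar> \<le> K" using turn_bounded by blast
  have "\<bar>\<sigma> * turn t\<bar> \<le> K" for t using K(2)[of t] \<sigma>_cases by (auto simp: abs_mult)
  then show thesis using that V K(1) by blast
qed

text \<open>2 pi times the integral of the offset speed over radii from 0 to
  \<open>maxrad t\<close>, that is, the area swept per unit of parameter by the inner normal segment
  of that length.\<close>

definition touch_first :: "real \<Rightarrow> real" where
  "touch_first t = 2 * pi * (maxrad t * norm (vel t) - \<sigma> * turn t * (maxrad t)\<^sup>2 / 2)"

definition touch_rest :: "real \<Rightarrow> real \<Rightarrow> real" where
  "touch_rest eps t = (norm (vel t) / maxrad t) * kern_moment cap1 (eps / (2 * maxrad t)) + (\<sigma> * turn t / 2) * kern_moment cap2 (eps / (2 * maxrad t))"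

lemma touch_total_eq: "touch_total eps (norm (vel t)) (\<sigma> * turn t) (maxrad t) = touch_first t / eps\<^sup>2 - (4 / eps) * norm (vel t) + touch_rest eps t"
  by (simp add: touch_total_def touch_first_def touch_rest_def)

lemma touch_measurable [measurable]: "touch_first \<in> borel_measurable borel" "touch_rest eps \<in> borel_measurable borel"
  unfolding touch_first_def[abs_def] touch_rest_def[abs_def] by measurable

lemma touch_rest_bounded: "\<exists>C. \<forall>eps>0. \<forall>t. \<bar>touch_rest eps t\<bar> \<le> C"
proof -
  obtain V K where VK: "V > 0" "\<And>t. norm (vel t) \<le> V" "K > 0" "\<And>t. \<bar>\<sigma> * turn t\<bar> \<le> K" by (rule bounds_obtain) blast
  define w where "w = (\<integral>s. 55 * capw s \<partial>lborel)"
  have w: "0 \<le> w" unfolding w_def using capw_nonneg by (intro Bochner_Integration.integral_nonneg) auto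
  have "\<bar>touch_rest eps t\<bar> \<le> (V / \<rho>0) * w + (K / 2) * w" if e: "eps > 0" for eps t
  proof -
    have e': "eps / (2 * maxrad t) > 0" using e maxrad_pos[of t] by simp
    have m: "\<bar>kern_moment cap1 (eps / (2 * maxrad t))\<bar> \<le> w" "\<bar>kern_moment cap2 (eps / (2 * maxrad t))\<bar> \<le> w"
      unfolding w_def by (rule kern_moment_bounded[OF _ _ e']; (rule cap_measurable cap_le)?; assumption?)+
    have "norm (vel t) / maxrad t \<le> V / \<rho>0" using VK(1,2) maxrad_ge[of t] \<rho>0(1) by (intro frac_le) auto
    moreover have "0 \<le> norm (vel t) / maxrad t" using maxrad_pos[of t] by simp
    ultimately have 1: "\<bar>(norm (vel t) / maxrad t) * kern_moment cap1 (eps / (2 * maxrad t))\<bar> \<le> (V / \<rho>0) * w"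
      unfolding abs_mult using m(1) by (intro mult_mono) auto
    have "\<bar>\<sigma> * turn t / 2\<bar> \<le> K / 2" using VK(4)[of t] by simp
    then have 2: "\<bar>(\<sigma> * turn t / 2) * kern_moment cap2 (eps / (2 * maxrad t))\<bar> \<le> (K / 2) * w"
      unfolding abs_mult[of "\<sigma> * turn t / 2"] using m(2) by (intro mult_mono) auto
    show ?thesis unfolding touch_rest_def using 1 2 by linarith
  qed
  then show ?thesis by blast
qed

lemma touch_integrable:
  "integrable U01 touch_first" "integrable U01 (\<lambda>t. norm (vel t))" "eps > 0 \<Longrightarrow> integrable U01 (touch_rest eps)"
proof -
  obtain V K where VK: "V > 0" "\<And>t. norm (vel t) \<le> V" "K > 0" "\<And>t. \<bar>\<sigma> * turn t\<bar> \<le> K" by (rule bounds_obtain) blast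
  show "integrable U01 (\<lambda>t. norm (vel t))" by (rule integrable_U01_bounded[of _ V]) (use VK in auto)
  show "eps > 0 \<Longrightarrow> integrable U01 (touch_rest eps)"
    using touch_rest_bounded by (metis integrable_U01_bounded real_norm_def touch_measurable(2))
  have R: "\<bar>maxrad t\<bar> \<le> \<Omega>rad" for t using maxrad_le[of t] maxrad_pos[of t] by simp
  have "norm (touch_first t) \<le> 2 * pi * (\<Omega>rad * V + K * \<Omega>rad\<^sup>2 / 2)" for t
  proof -
    have 1: "\<bar>maxrad t * norm (vel t)\<bar> \<le> \<Omega>rad * V" unfolding abs_mult using R[of t] VK(2)[of t] by (intro mult_mono) auto
    have "(maxrad t)\<^sup>2 \<le> \<Omega>rad\<^sup>2" using R[of t] maxrad_pos[of t] by (intro power_mono) auto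
    then have "\<bar>\<sigma> * turn t * (maxrad t)\<^sup>2\<bar> \<le> K * \<Omega>rad\<^sup>2"
      unfolding abs_mult[of "\<sigma> * turn t"] using VK(3,4) by (intro mult_mono) auto
    then have "\<bar>maxrad t * norm (vel t) - \<sigma> * turn t * (maxrad t)\<^sup>2 / 2\<bar> \<le> \<Omega>rad * V + K * \<Omega>rad\<^sup>2 / 2" using 1 by linarith
    then have "2 * pi * \<bar>maxrad t * norm (vel t) - \<sigma> * turn t * (maxrad t)\<^sup>2 / 2\<bar> \<le> 2 * pi * (\<Omega>rad * V + K * \<Omega>rad\<^sup>2 / 2)" by (intro mult_left_mono) auto
    then show ?thesis unfolding touch_first_def real_norm_def abs_mult by simp
  qed
  then show "integrable U01 touch_first" by (intro integrable_U01_bounded) auto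
qed

lemma kern_pair_density_nonneg:
  assumes "eps > 0"
  shows "0 \<le> indicator {0<..} r * (kern eps (r\<^sup>2) * pair_density (norm (vel t)) (\<sigma> * turn t) (maxrad t) r)"
  using kern_nonneg[OF assms, of "r\<^sup>2"] pair_density_nonneg[of r "maxrad t" "norm (vel t)" "\<sigma> * turn t"] maxrad_pos[of t] offset_speed_nonneg[of "maxrad t" t]
  by (cases "r > 0") auto

lemma touch_total_nonneg:
  assumes "eps > 0" shows "0 \<le> touch_total eps (norm (vel t)) (\<sigma> * turn t) (maxrad t)"
  unfolding has_bochner_integral_integral_eq[OF kern_pair_density_integral[OF assms maxrad_pos], symmetric]
  by (rule Bochner_Integration.integral_nonneg) (rule kern_pair_density_nonneg[OF assms])

lemma nn_integral_touch:
  assumes e: "eps > 0"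
  shows "(\<integral>\<^sup>+v. ennreal (kern eps ((norm v)\<^sup>2)) * emeasure lborel (Tv v) \<partial>lborel) = ennreal (touch_area eps)"
proof -
  have "(\<integral>\<^sup>+v. ennreal (kern eps ((norm v)\<^sup>2)) * emeasure lborel (Tv v) \<partial>lborel)
    = (\<integral>\<^sup>+t. \<integral>\<^sup>+r. ennreal (indicator {0<..} r * (kern eps (r\<^sup>2) * pair_density (norm (vel t)) (\<sigma> * turn t) (maxrad t) r)) \<partial>lborel \<partial>U01)"
    by (rule nn_integral_Tv) (auto intro: kern_nonneg[OF e])
  also have "\<dots> = (\<integral>\<^sup>+t. ennreal (touch_total eps (norm (vel t)) (\<sigma> * turn t) (maxrad t)) \<partial>U01)"
  proof (intro nn_integral_cong)
    fix t
    note h = kern_pair_density_integral[OF e maxrad_pos, of "norm (vel t)" "\<sigma> * turn t" t]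
    show "(\<integral>\<^sup>+r. ennreal (indicator {0<..} r * (kern eps (r\<^sup>2) * pair_density (norm (vel t)) (\<sigma> * turn t) (maxrad t) r)) \<partial>lborel)
       = ennreal (touch_total eps (norm (vel t)) (\<sigma> * turn t) (maxrad t))"
      using nn_integral_eq_integral[OF integrable.intros[OF h]] kern_pair_density_nonneg[OF e] has_bochner_integral_integral_eq[OF h] by simp
  qed
  also have "\<dots> = ennreal (touch_area eps)"
    unfolding touch_area_def
    by (rule nn_integral_eq_integral)
       (auto simp: touch_total_eq[symmetric] touch_total_nonneg[OF e], simp add: touch_total_eq touch_integrable e)
  finally show ?thesis .
qed

text \<open>In the limit the term with \<open>cap1\<close> vanishes and the term with
  \<open>cap2\<close> is pi/2 times half of \<sigma> \<open>turn\<close>. The integral of \<sigma>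
  \<open>turn\<close> is 2 \<sigma> \<open>rot\<close> = 2 pi, whence pi^2/2.\<close>

lemma tendsto_touch_area:
  assumes e: "e \<longlonglongrightarrow> 0" "\<And>n. e n > 0"
  shows "(\<lambda>n. touch_area (e n) - (\<integral>t. touch_first t \<partial>U01) / (e n)\<^sup>2 + 4 * len / e n) \<longlonglongrightarrow> pi\<^sup>2 / 2"
proof -
  obtain C where C: "\<And>eps t. eps > 0 \<Longrightarrow> \<bar>touch_rest eps t\<bar> \<le> C" using touch_rest_bounded by blast
  have "(\<lambda>n. \<integral>t. touch_rest (e n) t \<partial>U01) \<longlonglongrightarrow> (\<integral>t. (norm (vel t) / maxrad t) * 0 + (\<sigma> * turn t / 2) * (pi / 2) \<partial>U01)"
  proof (rule integral_dominated_convergence[where w="\<lambda>_. C"])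
    show "AE t in U01. (\<lambda>n. touch_rest (e n) t) \<longlonglongrightarrow> (norm (vel t) / maxrad t) * 0 + (\<sigma> * turn t / 2) * (pi / 2)"
    proof (rule AE_I2)
      fix t
      have "(\<lambda>n. e n / (2 * maxrad t)) \<longlonglongrightarrow> 0 / (2 * maxrad t)" by (intro tendsto_intros e) (use maxrad_pos[of t] in simp)
      then have l: "(\<lambda>n. e n / (2 * maxrad t)) \<longlonglongrightarrow> 0" by simp
      have p: "e n / (2 * maxrad t) > 0" for n using e(2)[of n] maxrad_pos[of t] by simp
      have "(\<lambda>n. kern_moment cap1 (e n / (2 * maxrad t))) \<longlonglongrightarrow> 0"
        using tendsto_kern_moment[OF cap_measurable(1) cap_le(1) l p] by (simp only: cap1_tail)
      moreover have "(\<lambda>n. kern_moment cap2 (e n / (2 * maxrad t))) \<longlonglongrightarrow> pi / 2"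
        using tendsto_kern_moment[OF cap_measurable(2) cap_le(2) l p] by (simp only: cap2_tail)
      ultimately show "(\<lambda>n. touch_rest (e n) t) \<longlonglongrightarrow> (norm (vel t) / maxrad t) * 0 + (\<sigma> * turn t / 2) * (pi / 2)"
        unfolding touch_rest_def by (intro tendsto_intros)
    qed
    show "AE t in U01. norm (touch_rest (e n) t) \<le> C" for n using C[OF e(2)] by simp
  qed auto
  moreover have "(\<integral>t. (norm (vel t) / maxrad t) * 0 + (\<sigma> * turn t / 2) * (pi / 2) \<partial>U01) = pi\<^sup>2 / 2"
  proof -
    have "(\<integral>t. (norm (vel t) / maxrad t) * 0 + (\<sigma> * turn t / 2) * (pi / 2) \<partial>U01) = (\<integral>t. (\<sigma> * pi / 4) * turn t \<partial>U01)"
      by (rule Bochner_Integration.integral_cong[OF refl]) simp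
    also have "\<dots> = (\<sigma> * pi / 4) * (2 * (\<sigma> * pi))" by (simp add: integral_turn rot_eq)
    also have "\<dots> = \<sigma>\<^sup>2 * pi\<^sup>2 / 2" by (simp add: power2_eq_square)
    finally show ?thesis using \<sigma>2 by simp
  qed
  moreover have "touch_area (e n) - (\<integral>t. touch_first t \<partial>U01) / (e n)\<^sup>2 + 4 * len / e n = (\<integral>t. touch_rest (e n) t \<partial>U01)" for n
  proof -
    have "touch_area (e n) = (\<integral>t. touch_first t \<partial>U01) / (e n)\<^sup>2 - (4 / e n) * (\<integral>t. norm (vel t) \<partial>U01) + (\<integral>t. touch_rest (e n) t \<partial>U01)"
      unfolding touch_area_def touch_total_eq using touch_integrable(3)[OF e(2)[of n]] touch_integrable(1,2) by simp
    then show ?thesis by (simp add: len_def)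
  qed
  ultimately show ?thesis by (simp only:)
qed

end

section \<open>Comparison of the two expansions\<close>

lemma nn_integral_lborel_translate:
  fixes c :: "'a::euclidean_space"
  assumes [measurable]: "f \<in> borel_measurable borel"
  shows "(\<integral>\<^sup>+x. f x \<partial>lborel) = (\<integral>\<^sup>+x. f (c + x) \<partial>lborel)"
proof -
  have "(\<integral>\<^sup>+x. f x \<partial>lborel) = (\<integral>\<^sup>+x. f x \<partial>distr lborel borel ((+) c))" by (simp add: lborel_distr_plus)
  also have "\<dots> = (\<integral>\<^sup>+x. f (c + x) \<partial>lborel)" by (rule nn_integral_distr) auto
  finally show ?thesis .
qed

context C2_domain
begin

definition kern_pair :: "real \<Rightarrow> complex \<times> complex \<Rightarrow> real" where "kern_pair eps p = kern eps ((norm (fst p - snd p))\<^sup>2)"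

lemma kern_pair_measurable [measurable]: "kern_pair eps \<in> borel_measurable (borel \<Otimes>\<^sub>M borel)"
  unfolding kern_pair_def[abs_def] by measurable

lemma kern_pair_nonneg: "eps > 0 \<Longrightarrow> 0 \<le> kern_pair eps p" unfolding kern_pair_def by (intro kern_nonneg) auto

lemma linked_sets [measurable]: "linked \<in> sets (borel \<Otimes>\<^sub>M borel)"
  by (subst borel_prod) (rule borel_closed[OF compact_imp_closed[OF compact_linked]])

lemma NT_sets [measurable]: "NT \<Omega> \<in> sets (borel \<Otimes>\<^sub>M borel)"
  unfolding NT_eq by measurable

lemma \<Omega>_finite: "emeasure lborel \<Omega> < \<infinity>" by (rule emeasure_compact_finite[OF compact_\<Omega>])

lemma nn_integral_area_pair:
  assumes e: "eps > 0"
  shows "(\<integral>\<^sup>+p. indicator (\<Omega> \<times> \<Omega>) p * ennreal (kern_pair eps p) \<partial>(lborel \<Otimes>\<^sub>M lborel)) = ennreal (area_pair eps)" "0 \<le> area_pair eps"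
proof -
  define g where "g p = indicator \<Omega> (fst p) * (indicator \<Omega> (snd p) * kern eps ((norm (snd p - fst p))\<^sup>2))" for p
  have gm [measurable]: "g \<in> borel_measurable (borel \<Otimes>\<^sub>M borel)" unfolding g_def[abs_def] by measurable
  have g0: "0 \<le> g p" for p unfolding g_def using kern_nonneg[OF e] by simp
  have geq: "g p = indicator (\<Omega> \<times> \<Omega>) p * kern_pair eps p" for p
    by (cases p) (simp add: g_def kern_pair_def indicator_times norm_minus_commute)
  have kb: "\<bar>kern eps R\<bar> \<le> 55 * inverse eps ^ 4" if "R \<ge> 0" for R
  proof -
    have "inverse (kS eps R) \<le> inverse eps" using kS_ge(1)[OF e that] e by (rule le_imp_inverse_le)
    then have "inverse (kS eps R) ^ 4 \<le> inverse eps ^ 4" using kS_pos[OF e that] by (intro power_mono) auto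
    then show ?thesis using kern_le[OF e that] kern_nonneg[OF e that] by simp
  qed
  have int: "integrable (lborel \<Otimes>\<^sub>M lborel) g"
  proof (rule integrableI_bounded_set[where A="\<Omega> \<times> \<Omega>" and B="55 * inverse eps ^ 4"])
    show "emeasure (lborel \<Otimes>\<^sub>M lborel) (\<Omega> \<times> \<Omega>) < \<infinity>"
      using \<Omega>_finite by (subst lborel.emeasure_pair_measure_Times) (auto simp: ennreal_mult_less_top)
    show "AE p in lborel \<Otimes>\<^sub>M lborel. p \<in> \<Omega> \<times> \<Omega> \<longrightarrow> norm (g p) \<le> 55 * inverse eps ^ 4"
      using kb by (auto simp: g_def)
    show "AE p in lborel \<Otimes>\<^sub>M lborel. p \<notin> \<Omega> \<times> \<Omega> \<longrightarrow> g p = 0"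
      by (rule AE_I2) (auto simp: g_def indicator_def)
  qed measurable
  have "(\<integral>p. g p \<partial>(lborel \<Otimes>\<^sub>M lborel)) = (\<integral>w. (\<integral>z. g (w,z) \<partial>lborel) \<partial>lborel)" by (rule lborel_pair.integral_fst'[OF int, symmetric])
  also have "\<dots> = area_pair eps" by (simp add: g_def area_pair_def)
  finally have eq: "(\<integral>p. g p \<partial>(lborel \<Otimes>\<^sub>M lborel)) = area_pair eps" .
  show "0 \<le> area_pair eps" unfolding eq[symmetric] by (rule Bochner_Integration.integral_nonneg) (rule g0)
  have "(\<integral>\<^sup>+p. indicator (\<Omega> \<times> \<Omega>) p * ennreal (kern_pair eps p) \<partial>(lborel \<Otimes>\<^sub>M lborel)) = (\<integral>\<^sup>+p. ennreal (g p) \<partial>(lborel \<Otimes>\<^sub>M lborel))"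
    by (intro nn_integral_cong) (simp add: geq indicator_def)
  also have "\<dots> = ennreal (area_pair eps)" using nn_integral_eq_integral[OF int] g0 eq by simp
  finally show "(\<integral>\<^sup>+p. indicator (\<Omega> \<times> \<Omega>) p * ennreal (kern_pair eps p) \<partial>(lborel \<Otimes>\<^sub>M lborel)) = ennreal (area_pair eps)" .
qed

lemma nn_integral_linked:
  assumes e: "eps > 0"
  shows "(\<integral>\<^sup>+p. indicator linked p * ennreal (kern_pair eps p) \<partial>(lborel \<Otimes>\<^sub>M lborel)) = ennreal (touch_area eps)"
proof -
  have "(\<integral>\<^sup>+p. indicator linked p * ennreal (kern_pair eps p) \<partial>(lborel \<Otimes>\<^sub>M lborel)) = (\<integral>\<^sup>+z. \<integral>\<^sup>+w. indicator linked (z,w) * ennreal (kern_pair eps (z,w)) \<partial>lborel \<partial>lborel)"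
    by (rule lborel.nn_integral_fst[symmetric]) measurable
  also have "\<dots> = (\<integral>\<^sup>+z. \<integral>\<^sup>+v. indicator linked (z,z+v) * ennreal (kern eps ((norm v)\<^sup>2)) \<partial>lborel \<partial>lborel)"
  proof (rule nn_integral_cong)
    fix z
    have "(\<integral>\<^sup>+w. indicator linked (z,w) * ennreal (kern_pair eps (z,w)) \<partial>lborel) = (\<integral>\<^sup>+v. indicator linked (z,z+v) * ennreal (kern_pair eps (z,z+v)) \<partial>lborel)"
      by (rule nn_integral_lborel_translate) measurable
    then show "(\<integral>\<^sup>+w. indicator linked (z,w) * ennreal (kern_pair eps (z,w)) \<partial>lborel) = (\<integral>\<^sup>+v. indicator linked (z,z+v) * ennreal (kern eps ((norm v)\<^sup>2)) \<partial>lborel)"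
      by (simp add: kern_pair_def)
  qed
  also have "\<dots> = (\<integral>\<^sup>+v. \<integral>\<^sup>+z. indicator linked (z,z+v) * ennreal (kern eps ((norm v)\<^sup>2)) \<partial>lborel \<partial>lborel)"
    by (rule lborel_pair.Fubini'[symmetric]) measurable
  also have "\<dots> = (\<integral>\<^sup>+v. ennreal (kern eps ((norm v)\<^sup>2)) * emeasure lborel (Tv v) \<partial>lborel)"
  proof (intro nn_integral_cong)
    fix v
    have "indicator linked (z,z+v) * ennreal (kern eps ((norm v)\<^sup>2)) = ennreal (kern eps ((norm v)\<^sup>2)) * indicator (Tv v) z" for z
      by (simp add: Tv_def indicator_def)
    then show "(\<integral>\<^sup>+z. indicator linked (z,z+v) * ennreal (kern eps ((norm v)\<^sup>2)) \<partial>lborel) = ennreal (kern eps ((norm v)\<^sup>2)) * emeasure lborel (Tv v)"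
      using borel_closed[OF closed_Tv[of v]] by (simp add: nn_integral_cmult_indicator)
  qed
  also have "\<dots> = ennreal (touch_area eps)" by (rule nn_integral_touch[OF e])
  finally show ?thesis .
qed

lemma nn_integral_NT:
  assumes e: "eps > 0"
  shows "(\<integral>\<^sup>+p. indicator (NT \<Omega>) p * ennreal (kern_pair eps p) \<partial>(lborel \<Otimes>\<^sub>M lborel)) = ennreal (area_pair eps - touch_area eps)"
    and "0 \<le> area_pair eps - touch_area eps"
proof -
  have t0: "0 \<le> touch_area eps" unfolding touch_area_def using touch_total_nonneg[OF e] by (intro Bochner_Integration.integral_nonneg) auto
  have "(\<integral>\<^sup>+p. indicator (\<Omega> \<times> \<Omega>) p * ennreal (kern_pair eps p) \<partial>(lborel \<Otimes>\<^sub>M lborel))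
    = (\<integral>\<^sup>+p. indicator (NT \<Omega>) p * ennreal (kern_pair eps p) + indicator linked p * ennreal (kern_pair eps p) \<partial>(lborel \<Otimes>\<^sub>M lborel))"
    using linked_subset by (intro nn_integral_cong) (auto simp: NT_eq indicator_def)
  also have "\<dots> = (\<integral>\<^sup>+p. indicator (NT \<Omega>) p * ennreal (kern_pair eps p) \<partial>(lborel \<Otimes>\<^sub>M lborel)) + (\<integral>\<^sup>+p. indicator linked p * ennreal (kern_pair eps p) \<partial>(lborel \<Otimes>\<^sub>M lborel))"
    by (rule nn_integral_add) measurable
  finally have eq: "ennreal (area_pair eps) = (\<integral>\<^sup>+p. indicator (NT \<Omega>) p * ennreal (kern_pair eps p) \<partial>(lborel \<Otimes>\<^sub>M lborel)) + ennreal (touch_area eps)"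
    unfolding nn_integral_area_pair[OF e] nn_integral_linked[OF e] .
  then have "ennreal (touch_area eps) \<le> ennreal (area_pair eps)" by simp
  then show "0 \<le> area_pair eps - touch_area eps" using nn_integral_area_pair(2)[OF e] by simp
  have "ennreal (area_pair eps - touch_area eps) = ennreal (area_pair eps) - ennreal (touch_area eps)" by (rule ennreal_minus[OF t0, symmetric])
  also have "\<dots> = (\<integral>\<^sup>+p. indicator (NT \<Omega>) p * ennreal (kern_pair eps p) \<partial>(lborel \<Otimes>\<^sub>M lborel))"
    unfolding eq by (rule ennreal_add_diff_cancel_right) simp
  finally show "(\<integral>\<^sup>+p. indicator (NT \<Omega>) p * ennreal (kern_pair eps p) \<partial>(lborel \<Otimes>\<^sub>M lborel)) = ennreal (area_pair eps - touch_area eps)" ..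
qed

definition collar :: "real \<Rightarrow> complex set" where "collar \<delta> = {z\<in>\<Omega>. infdist z (path_image \<gamma>) \<le> \<delta>}"

lemma closed_collar: "closed (collar \<delta>)"
proof -
  have "collar \<delta> = \<Omega> \<inter> {z. infdist z (path_image \<gamma>) \<le> \<delta>}" by (auto simp: collar_def)
  moreover have "closed {z. infdist z (path_image \<gamma>) \<le> \<delta>}" by (intro closed_Collect_le continuous_intros)
  ultimately show ?thesis using closed_\<Omega> by auto
qed

lemma collar_borel [measurable]: "collar \<delta> \<in> sets borel" by (rule borel_closed[OF closed_collar])

text \<open>If the disc about z of radius \<open>norm (z - w)\<close> misses the curve, it lies in
  \<Omega>; it contains the circle with diameter from z to w, so the pair would be linked.\<close>

lemma NT_near: assumes "(z,w) \<in> NT \<Omega>" shows "z \<in> collar (norm (z - w))"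
proof (rule ccontr)
  assume n: "z \<notin> collar (norm (z - w))"
  have zw: "z \<in> \<Omega>" "(z,w) \<notin> linked" using assms unfolding NT_eq by auto
  have disj: "cball z (norm (z - w)) \<inter> path_image \<gamma> = {}"
  proof (rule ccontr)
    assume "cball z (norm (z - w)) \<inter> path_image \<gamma> \<noteq> {}"
    then obtain c where c: "c \<in> path_image \<gamma>" "dist z c \<le> norm (z - w)" by auto
    then have "infdist z (path_image \<gamma>) \<le> norm (z - w)" by (rule infdist_le2)
    then show False using n zw by (simp add: collar_def)
  qed
  have "connected (cball z (norm (z - w)))" by (intro convex_connected convex_cball)
  then have "cball z (norm (z - w)) \<subseteq> interior \<Omega> \<or> cball z (norm (z - w)) \<subseteq> - \<Omega>" by (rule connected_cases[OF _ disj])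
  moreover have "z \<in> cball z (norm (z - w))" by simp
  ultimately have sub: "cball z (norm (z - w)) \<subseteq> \<Omega>" using zw interior_subset by blast
  have d: "dist ((z + w) / 2) z = norm (z - w) / 2" "dist ((z + w) / 2) w = norm (z - w) / 2"
  proof -
    have "(z + w) / 2 - z = - ((z - w) / 2)" "(z + w) / 2 - w = (z - w) / 2" by (simp_all add: field_simps)
    then show "dist ((z + w) / 2) z = norm (z - w) / 2" "dist ((z + w) / 2) w = norm (z - w) / 2"
      unfolding dist_norm by (simp_all only: norm_minus_cancel norm_divide norm_numeral)
  qed
  have "sphere ((z + w) / 2) (norm (z - w) / 2) \<subseteq> \<Omega>"
  proof
    fix x assume "x \<in> sphere ((z + w) / 2) (norm (z - w) / 2)"
    then have "dist z x \<le> norm (z - w)" using dist_triangle[of z x "(z + w) / 2"] d(1) by (simp add: dist_commute)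
    then show "x \<in> \<Omega>" using sub by auto
  qed
  then have "(z,w) \<in> linked" by (intro linkedI[OF _ d]) auto
  then show False using zw by simp
qed

lemma tendsto_collar: "(\<lambda>n. measure lborel (collar (1 / real (Suc n)))) \<longlonglongrightarrow> 0"
proof -
  have fin: "emeasure lborel (collar \<delta>) \<noteq> \<infinity>" for \<delta>
    using emeasure_mono[of "collar \<delta>" \<Omega> lborel] \<Omega>_finite by (auto simp: collar_def top_unique)
  have "(\<lambda>n. measure lborel (collar (1 / real (Suc n)))) \<longlonglongrightarrow> measure lborel (\<Inter>n. collar (1 / real (Suc n)))"
  proof (rule Lim_measure_decseq)
    show "decseq (\<lambda>n. collar (1 / real (Suc n)))"
    proof (rule decseq_SucI)
      fix n
      have "1 / real (Suc (Suc n)) \<le> 1 / real (Suc n)" by (intro divide_left_mono) auto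
      then show "collar (1 / real (Suc (Suc n))) \<subseteq> collar (1 / real (Suc n))" by (auto simp: collar_def)
    qed
  qed (use fin in auto)
  moreover have "(\<Inter>n. collar (1 / real (Suc n))) \<subseteq> path_image \<gamma>"
  proof
    fix z assume z: "z \<in> (\<Inter>n. collar (1 / real (Suc n)))"
    have "infdist z (path_image \<gamma>) \<le> 0"
    proof (rule field_le_epsilon)
      fix e :: real assume "0 < e"
      then obtain n where "inverse (real (Suc n)) < e" using reals_Archimedean by blast
      then show "infdist z (path_image \<gamma>) \<le> 0 + e" using z by (auto simp: collar_def inverse_eq_divide intro: order_trans less_imp_le)
    qed
    then have "infdist z (path_image \<gamma>) = 0" using infdist_nonneg[of z "path_image \<gamma>"] by linarith
    moreover have "closed (path_image \<gamma>)" using simple_\<gamma> by (simp add: closed_simple_path_image)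
    ultimately show "z \<in> path_image \<gamma>" using in_closed_iff_infdist_zero[OF _ C_ne] by blast
  qed
  then have "(\<Inter>n. collar (1 / real (Suc n))) \<in> null_sets lborel"
    by (rule null_sets_subset[OF null_C, rotated]) measurable
  ultimately show ?thesis by (simp add: measure_def null_setsD1)
qed

lemma nn_integral_kern_plane:
  assumes e: "eps > 0"
  shows "(\<integral>\<^sup>+w. ennreal (kern_pair eps (z,w)) \<partial>lborel) = ennreal (2 * pi / eps\<^sup>2)"
proof -
  note h = kern_first_moment[OF e]
  have nn: "0 \<le> indicator {0..} r * (kern eps (r\<^sup>2) * r)" for r using kern_nonneg[OF e, of "r\<^sup>2"] by (auto simp: indicator_def)
  have "(\<integral>\<^sup>+w. ennreal (kern_pair eps (z,w)) \<partial>lborel) = (\<integral>\<^sup>+r. \<integral>\<^sup>+\<phi>. ennreal (indicator {0<..} r * r) * indicator {-pi<..<pi} \<phi> * ennreal (kern_pair eps (z, z + 1 * (of_real r * cis \<phi>))) \<partial>lborel \<partial>lborel)"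
    by (rule nn_integral_polar) auto
  also have "\<dots> = (\<integral>\<^sup>+r. ennreal (indicator {0..} r * (kern eps (r\<^sup>2) * r)) * ennreal (2 * pi) \<partial>lborel)"
  proof (intro nn_integral_cong)
    fix r :: real
    have "ennreal (indicator {0<..} r * r) * indicator {-pi<..<pi} \<phi> * ennreal (kern_pair eps (z, z + 1 * (of_real r * cis \<phi>)))
      = ennreal (indicator {0..} r * (kern eps (r\<^sup>2) * r)) * indicator {-pi<..<pi} \<phi>" for \<phi>
      using kern_nonneg[OF e, of "r\<^sup>2"]
      by (cases "r > 0") (auto simp: kern_pair_def norm_mult indicator_def mult.commute ennreal_mult'')
    then show "(\<integral>\<^sup>+\<phi>. ennreal (indicator {0<..} r * r) * indicator {-pi<..<pi} \<phi> * ennreal (kern_pair eps (z, z + 1 * (of_real r * cis \<phi>))) \<partial>lborel)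
       = ennreal (indicator {0..} r * (kern eps (r\<^sup>2) * r)) * ennreal (2 * pi)"
      by (simp only:) (simp add: nn_integral_cmult_indicator)
  qed
  also have "\<dots> = (\<integral>\<^sup>+r. ennreal (indicator {0..} r * (kern eps (r\<^sup>2) * r)) \<partial>lborel) * ennreal (2 * pi)"
    by (rule nn_integral_multc) measurable
  also have "(\<integral>\<^sup>+r. ennreal (indicator {0..} r * (kern eps (r\<^sup>2) * r)) \<partial>lborel) = ennreal (1 / eps\<^sup>2)"
    using nn_integral_eq_integral[OF integrable.intros[OF h]] nn has_bochner_integral_integral_eq[OF h] by simp
  also have "ennreal (1 / eps\<^sup>2) * ennreal (2 * pi) = ennreal (2 * pi / eps\<^sup>2)" using e by (simp add: ennreal_mult[symmetric])
  finally show ?thesis .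
qed

text \<open>Pairs closer than \<delta> have their first point in the collar, and the kernel has
  total mass 2 pi / eps^2 around each point. For the other pairs the kernel is at most 55 /
  \<delta>^4.\<close>

lemma NT_bound:
  assumes e: "eps > 0" and d: "\<delta> > 0"
  shows "area_pair eps - touch_area eps \<le> measure lborel (collar \<delta>) * (2 * pi / eps\<^sup>2) + 55 / \<delta> ^ 4 * (measure lborel \<Omega>)\<^sup>2"
proof -
  have fin: "emeasure lborel (collar \<delta>) = ennreal (measure lborel (collar \<delta>))"
    using emeasure_mono[of "collar \<delta>" \<Omega> lborel] \<Omega>_finite by (intro emeasure_eq_ennreal_measure) (auto simp: collar_def top_unique)
  have fin\<Omega>: "emeasure lborel \<Omega> = ennreal (measure lborel \<Omega>)" using \<Omega>_finite by (intro emeasure_eq_ennreal_measure) auto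
  have "indicator (NT \<Omega>) p * ennreal (kern_pair eps p) \<le> indicator (collar \<delta>) (fst p) * ennreal (kern_pair eps p) + ennreal (55 / \<delta> ^ 4) * indicator (\<Omega> \<times> \<Omega>) p" for p
  proof (cases "p \<in> NT \<Omega>")
    case True
    obtain z w where p: "p = (z,w)" by (cases p)
    have zw: "p \<in> \<Omega> \<times> \<Omega>" using True unfolding NT_eq by auto
    show ?thesis
    proof (cases "norm (z - w) \<le> \<delta>")
      case le: True
      then have "z \<in> collar \<delta>" using NT_near[of z w] True by (auto simp: p collar_def)
      then show ?thesis using True by (simp add: p)
    next
      case False
      have r: "\<delta>\<^sup>2 \<le> (norm (z - w))\<^sup>2" using False d by (intro power_mono) auto
      have "kern_pair eps p \<le> 55 / ((norm (z - w))\<^sup>2)\<^sup>2" unfolding kern_pair_def p fst_conv snd_conv using False d by (intro kern_le'[OF e]) auto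
      also have "\<dots> \<le> 55 / (\<delta>\<^sup>2)\<^sup>2" using d False r by (intro divide_left_mono power_mono mult_pos_pos) auto
      finally have "kern_pair eps p \<le> 55 / \<delta> ^ 4" by (simp add: power_mult[symmetric])
      then have "ennreal (kern_pair eps p) \<le> ennreal (55 / \<delta> ^ 4)" by (rule ennreal_leI)
      then show ?thesis using True zw by (simp add: add_increasing)
    qed
  qed simp
  then have "ennreal (area_pair eps - touch_area eps) \<le> (\<integral>\<^sup>+p. indicator (collar \<delta>) (fst p) * ennreal (kern_pair eps p) + ennreal (55 / \<delta> ^ 4) * indicator (\<Omega> \<times> \<Omega>) p \<partial>(lborel \<Otimes>\<^sub>M lborel))"
    unfolding nn_integral_NT(1)[OF e, symmetric] by (rule nn_integral_mono)
  also have "\<dots> = (\<integral>\<^sup>+p. indicator (collar \<delta>) (fst p) * ennreal (kern_pair eps p) \<partial>(lborel \<Otimes>\<^sub>M lborel)) + (\<integral>\<^sup>+p. ennreal (55 / \<delta> ^ 4) * indicator (\<Omega> \<times> \<Omega>) p \<partial>(lborel \<Otimes>\<^sub>M lborel))"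
    by (rule nn_integral_add) measurable
  also have "(\<integral>\<^sup>+p. indicator (collar \<delta>) (fst p) * ennreal (kern_pair eps p) \<partial>(lborel \<Otimes>\<^sub>M lborel)) = (\<integral>\<^sup>+z. \<integral>\<^sup>+w. indicator (collar \<delta>) z * ennreal (kern_pair eps (z,w)) \<partial>lborel \<partial>lborel)"
    by (subst lborel.nn_integral_fst[symmetric]) simp_all
  also have "\<dots> = (\<integral>\<^sup>+z. ennreal (2 * pi / eps\<^sup>2) * indicator (collar \<delta>) z \<partial>lborel)"
  proof (rule nn_integral_cong)
    fix z
    have "(\<integral>\<^sup>+w. indicator (collar \<delta>) z * ennreal (kern_pair eps (z,w)) \<partial>lborel) = indicator (collar \<delta>) z * (\<integral>\<^sup>+w. ennreal (kern_pair eps (z,w)) \<partial>lborel)"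
      by (rule nn_integral_cmult) measurable
    then show "(\<integral>\<^sup>+w. indicator (collar \<delta>) z * ennreal (kern_pair eps (z,w)) \<partial>lborel) = ennreal (2 * pi / eps\<^sup>2) * indicator (collar \<delta>) z"
      unfolding nn_integral_kern_plane[OF e] by (simp only: mult.commute)
  qed
  also have "\<dots> = ennreal (2 * pi / eps\<^sup>2) * emeasure lborel (collar \<delta>)" by (rule nn_integral_cmult_indicator) simp
  also have "(\<integral>\<^sup>+p. ennreal (55 / \<delta> ^ 4) * indicator (\<Omega> \<times> \<Omega>) p \<partial>(lborel \<Otimes>\<^sub>M lborel)) = ennreal (55 / \<delta> ^ 4) * (emeasure lborel \<Omega> * emeasure lborel \<Omega>)"
    by (subst nn_integral_cmult_indicator) (auto simp: lborel.emeasure_pair_measure_Times)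
  also have "ennreal (2 * pi / eps\<^sup>2) * emeasure lborel (collar \<delta>) + ennreal (55 / \<delta> ^ 4) * (emeasure lborel \<Omega> * emeasure lborel \<Omega>)
    = ennreal (measure lborel (collar \<delta>) * (2 * pi / eps\<^sup>2) + 55 / \<delta> ^ 4 * (measure lborel \<Omega>)\<^sup>2)"
    unfolding fin fin\<Omega> using d by (simp add: ennreal_mult[symmetric] ennreal_plus[symmetric] power2_eq_square mult.commute del: ennreal_plus)
  finally show ?thesis using d by (subst (asm) ennreal_le_iff) auto
qed

end

section \<open>Removal of the regularization\<close>

context C2_domain
begin

text \<open>In the difference the length terms cancel literally. The combined coefficient \<beta> of
  1/eps^2 is not computed: - \<beta> is the limit of eps^2 times a nonnegative quantity and is at
  most 2 pi times the area of every collar, hence 0.\<close>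

lemma tendsto_NT:
  assumes e: "e \<longlonglongrightarrow> 0" "\<And>n. e n > 0"
  shows "(\<lambda>n. area_pair (e n) - touch_area (e n)) \<longlonglongrightarrow> - chord_energy / 2 - pi\<^sup>2 / 2"
proof -
  define N where "N n = area_pair (e n) - touch_area (e n)" for n
  define \<beta> where "\<beta> = chord_moment + (\<integral>t. touch_first t \<partial>U01)"
  have "(\<lambda>n. (area_pair (e n) + chord_moment / (e n)\<^sup>2 + 4 * len / e n) - (touch_area (e n) - (\<integral>t. touch_first t \<partial>U01) / (e n)\<^sup>2 + 4 * len / e n))
     \<longlonglongrightarrow> - chord_energy / 2 - pi\<^sup>2 / 2"
    by (rule tendsto_diff[OF tendsto_area_pair[OF e] tendsto_touch_area[OF e]])
  then have lim: "(\<lambda>n. N n + \<beta> / (e n)\<^sup>2) \<longlonglongrightarrow> - chord_energy / 2 - pi\<^sup>2 / 2"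
    by (simp add: N_def \<beta>_def add_divide_distrib algebra_simps)
  have e2: "(\<lambda>n. (e n)\<^sup>2) \<longlonglongrightarrow> 0" using tendsto_power[OF e(1), of 2] by simp
  have "(\<lambda>n. (e n)\<^sup>2 * (N n + \<beta> / (e n)\<^sup>2) - \<beta>) \<longlonglongrightarrow> 0 * (- chord_energy / 2 - pi\<^sup>2 / 2) - \<beta>"
    by (intro tendsto_intros e2 lim)
  moreover have "(e n)\<^sup>2 * (N n + \<beta> / (e n)\<^sup>2) - \<beta> = (e n)\<^sup>2 * N n" for n
    using e(2)[of n] by (simp add: distrib_left)
  ultimately have lim2: "(\<lambda>n. (e n)\<^sup>2 * N n) \<longlonglongrightarrow> - \<beta>" by simp
  have "0 \<le> - \<beta>"
    by (rule tendsto_lowerbound[OF lim2]) (use nn_integral_NT(2)[OF e(2)] in \<open>auto simp: N_def\<close>)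
  moreover have "- \<beta> \<le> 0"
  proof -
    have b: "- \<beta> \<le> measure lborel (collar \<delta>) * (2 * pi)" if d: "\<delta> > 0" for \<delta>
    proof (rule tendsto_le[OF _ _ lim2])
      have "(\<lambda>n. measure lborel (collar \<delta>) * (2 * pi) + (e n)\<^sup>2 * (55 / \<delta> ^ 4 * (measure lborel \<Omega>)\<^sup>2)) \<longlonglongrightarrow> measure lborel (collar \<delta>) * (2 * pi) + 0 * (55 / \<delta> ^ 4 * (measure lborel \<Omega>)\<^sup>2)"
        by (intro tendsto_intros e2)
      then show "(\<lambda>n. measure lborel (collar \<delta>) * (2 * pi) + (e n)\<^sup>2 * (55 / \<delta> ^ 4 * (measure lborel \<Omega>)\<^sup>2)) \<longlonglongrightarrow> measure lborel (collar \<delta>) * (2 * pi)" by simp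
      show "\<forall>\<^sub>F n in sequentially. (e n)\<^sup>2 * N n \<le> measure lborel (collar \<delta>) * (2 * pi) + (e n)\<^sup>2 * (55 / \<delta> ^ 4 * (measure lborel \<Omega>)\<^sup>2)"
      proof (intro always_eventually allI)
        fix n
        have "(e n)\<^sup>2 * N n \<le> (e n)\<^sup>2 * (measure lborel (collar \<delta>) * (2 * pi / (e n)\<^sup>2) + 55 / \<delta> ^ 4 * (measure lborel \<Omega>)\<^sup>2)"
          unfolding N_def by (intro mult_left_mono NT_bound[OF e(2) d]) auto
        also have "\<dots> = measure lborel (collar \<delta>) * (2 * pi) + (e n)\<^sup>2 * (55 / \<delta> ^ 4 * (measure lborel \<Omega>)\<^sup>2)"
          using e(2)[of n] by (simp add: distrib_left)
        finally show "(e n)\<^sup>2 * N n \<le> measure lborel (collar \<delta>) * (2 * pi) + (e n)\<^sup>2 * (55 / \<delta> ^ 4 * (measure lborel \<Omega>)\<^sup>2)" .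
      qed
    qed simp
    have "(\<lambda>n. measure lborel (collar (1 / real (Suc n))) * (2 * pi)) \<longlonglongrightarrow> 0 * (2 * pi)"
      by (intro tendsto_intros tendsto_collar)
    then have "(\<lambda>n. measure lborel (collar (1 / real (Suc n))) * (2 * pi)) \<longlonglongrightarrow> 0" by simp
    then show ?thesis by (rule tendsto_lowerbound) (use b in auto)
  qed
  ultimately have "\<beta> = 0" by simp
  then show ?thesis using lim by (simp add: N_def)
qed

lemma NT_integral:
  "integrable (lborel \<Otimes>\<^sub>M lborel) (\<lambda>p. indicator (NT \<Omega>) p * (1 / norm (fst p - snd p) ^ 4))"
  "(\<integral>p. indicator (NT \<Omega>) p * (1 / norm (fst p - snd p) ^ 4) \<partial>(lborel \<Otimes>\<^sub>M lborel)) = - chord_energy / 2 - pi\<^sup>2 / 2"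
proof -
  let ?L = "lborel \<Otimes>\<^sub>M lborel :: (complex \<times> complex) measure"
  define e :: "nat \<Rightarrow> real" where "e n = inverse (real (Suc n))" for n
  have e: "e \<longlonglongrightarrow> 0" "\<And>n. e n > 0" unfolding e_def by (rule LIMSEQ_inverse_real_of_nat) simp
  define c where "c = - chord_energy / 2 - pi\<^sup>2 / 2"
  define h where "h p = indicator (NT \<Omega>) p * (1 / norm (fst p - snd p) ^ 4)" for p :: "complex \<times> complex"
  have hm [measurable]: "h \<in> borel_measurable (borel \<Otimes>\<^sub>M borel)" unfolding h_def[abs_def] by measurable
  have ne: "norm (fst p - snd p) > 0" if "p \<in> NT \<Omega>" for p
  proof -
    obtain z w where p: "p = (z,w)" by (cases p)
    have "z \<noteq> w"
    proof
      assume "z = w"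
      then have "(z,z) \<in> NT \<Omega>" using that p by simp
      then have "z \<in> \<Omega>" "(z,z) \<notin> linked" unfolding NT_eq by auto
      \<comment> \<open>The degenerate circle of radius 0 links z to itself, so
        \<open>NT \<Omega>\<close> contains no diagonal pair.\<close>
      then show False using linkedI[of 0 z z z] by simp
    qed
    then show ?thesis by (simp add: p)
  qed
  have conv: "(\<lambda>n. indicator (NT \<Omega>) p * kern_pair (e n) p) \<longlonglongrightarrow> h p" for p
  proof (cases "p \<in> NT \<Omega>")
    case True
    have "(\<lambda>n. kern (e n) ((norm (fst p - snd p))\<^sup>2)) \<longlonglongrightarrow> 1 / ((norm (fst p - snd p))\<^sup>2)\<^sup>2"
      by (rule tendsto_kern[OF e]) (use ne[OF True] in simp)
    then show ?thesis using True by (simp add: h_def kern_pair_def power_mult[symmetric])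
  qed (simp add: h_def)
  have lim: "(\<lambda>n. area_pair (e n) - touch_area (e n)) \<longlonglongrightarrow> c" unfolding c_def by (rule tendsto_NT[OF e])
  have hnn: "0 \<le> h p" for p by (simp add: h_def)
  have nnN: "(\<integral>\<^sup>+p. ennreal (indicator (NT \<Omega>) p * kern_pair (e n) p) \<partial>?L) = ennreal (area_pair (e n) - touch_area (e n))" for n
    unfolding nn_integral_NT(1)[OF e(2), symmetric] by (intro nn_integral_cong) (auto simp: indicator_def)
  have "(\<integral>\<^sup>+p. ennreal (h p) \<partial>?L) = (\<integral>\<^sup>+p. liminf (\<lambda>n. ennreal (indicator (NT \<Omega>) p * kern_pair (e n) p)) \<partial>?L)"
  proof (rule nn_integral_cong)
    fix p
    have "(\<lambda>n. ennreal (indicator (NT \<Omega>) p * kern_pair (e n) p)) \<longlonglongrightarrow> ennreal (h p)" by (intro tendsto_ennrealI conv)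
    then show "ennreal (h p) = liminf (\<lambda>n. ennreal (indicator (NT \<Omega>) p * kern_pair (e n) p))"
      by (intro lim_imp_Liminf[symmetric]) auto
  qed
  also have "\<dots> \<le> liminf (\<lambda>n. \<integral>\<^sup>+p. ennreal (indicator (NT \<Omega>) p * kern_pair (e n) p) \<partial>?L)"
    by (rule nn_integral_liminf) measurable
  also have "\<dots> = ennreal c"
    unfolding nnN by (rule lim_imp_Liminf[OF _ tendsto_ennrealI[OF lim]]) auto
  finally have "(\<integral>\<^sup>+p. ennreal (h p) \<partial>?L) \<le> ennreal c" .
  then have fin: "(\<integral>\<^sup>+p. ennreal (norm (h p)) \<partial>?L) < \<infinity>" using hnn by (simp add: order_le_less_trans[OF _ ennreal_less_top])
  have int: "integrable ?L h" by (rule integrableI_bounded[OF _ fin]) measurable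
  \<comment> \<open>Integrability of h, just obtained from Fatou's lemma, makes 55 h an admissible
    majorant and turns the inequality into convergence.\<close>
  have "(\<lambda>n. \<integral>p. indicator (NT \<Omega>) p * kern_pair (e n) p \<partial>?L) \<longlonglongrightarrow> (\<integral>p. h p \<partial>?L)"
  proof (rule integral_dominated_convergence[where w="\<lambda>p. 55 * h p"])
    show "AE p in ?L. (\<lambda>n. indicator (NT \<Omega>) p * kern_pair (e n) p) \<longlonglongrightarrow> h p" by (intro AE_I2 conv)
    show "AE p in ?L. norm (indicator (NT \<Omega>) p * kern_pair (e n) p) \<le> 55 * h p" for n
    proof (rule AE_I2)
      fix p
      show "norm (indicator (NT \<Omega>) p * kern_pair (e n) p) \<le> 55 * h p"
      proof (cases "p \<in> NT \<Omega>")
        case True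
        have "kern_pair (e n) p \<le> 55 / ((norm (fst p - snd p))\<^sup>2)\<^sup>2" unfolding kern_pair_def by (rule kern_le'[OF e(2)]) (use ne[OF True] in simp)
        then show ?thesis using True kern_pair_nonneg[OF e(2)] by (simp add: h_def power_mult[symmetric])
      qed (simp add: h_def)
    qed
  qed (use int in auto)
  moreover have "(\<integral>p. indicator (NT \<Omega>) p * kern_pair (e n) p \<partial>?L) = area_pair (e n) - touch_area (e n)" for n
  proof -
    have "(\<integral>p. indicator (NT \<Omega>) p * kern_pair (e n) p \<partial>?L) = enn2real (\<integral>\<^sup>+p. ennreal (indicator (NT \<Omega>) p * kern_pair (e n) p) \<partial>?L)"
      by (rule integral_eq_nn_integral) (auto simp: kern_pair_nonneg[OF e(2)])
    then show ?thesis unfolding nnN using nn_integral_NT(2)[OF e(2)] by simp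
  qed
  ultimately have "(\<integral>p. h p \<partial>?L) = c" using LIMSEQ_unique[OF _ lim] by simp
  then show "integrable ?L (\<lambda>p. indicator (NT \<Omega>) p * (1 / norm (fst p - snd p) ^ 4))"
    "(\<integral>p. indicator (NT \<Omega>) p * (1 / norm (fst p - snd p) ^ 4) \<partial>?L) = - chord_energy / 2 - pi\<^sup>2 / 2"
    using int unfolding h_def[abs_def] c_def by auto
qed

end

section \<open>Transfer to the length measure, and the theorem\<close>

context C2_curve
begin

lemma length_measure_eq: "length_measure \<gamma> = distr (density U01 (\<lambda>t. ennreal (norm (vel t)))) borel \<gamma>"
proof -
  have "density U01 (\<lambda>t. ennreal (norm (vel t))) = density lborel (\<lambda>t. indicator {0..1} t * ennreal (norm (vel t)))"
    unfolding U01_def by (rule density_density_eq) measurable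
  also have "\<dots> = density lborel (\<lambda>t. ennreal (indicator {0..1} t * norm (vel t)))"
    by (rule density_cong) (auto simp: indicator_def)
  finally show ?thesis by (simp add: length_measure_def vel_def)
qed

lemma length_measure_pair:
  "length_measure \<gamma> \<Otimes>\<^sub>M length_measure \<gamma>
   = distr (density (U01 \<Otimes>\<^sub>M U01) (\<lambda>p. ennreal (norm (vel (fst p)) * norm (vel (snd p))))) (borel \<Otimes>\<^sub>M borel) (\<lambda>p. (\<gamma> (fst p), \<gamma> (snd p)))"
proof -
  let ?D = "density U01 (\<lambda>t. ennreal (norm (vel t)))"
  obtain V where V: "V > 0" "\<And>t. norm (vel t) \<le> V" using periodic_bounded[OF continuous_vel periodic_vel] by blast
  have fin: "finite_measure ?D"
  proof
    have "emeasure ?D (space ?D) = (\<integral>\<^sup>+t. ennreal (norm (vel t)) \<partial>U01)" by (simp add: emeasure_density)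
    also have "\<dots> \<le> (\<integral>\<^sup>+t. ennreal V \<partial>U01)" using V by (intro nn_integral_mono ennreal_leI)
    also have "\<dots> < \<infinity>" by (simp add: emeasure_U01_UNIV)
    finally show "emeasure ?D (space ?D) \<noteq> \<infinity>" by simp
  qed
  have sf: "sigma_finite_measure ?D" using fin by (rule finite_measure.axioms)
  have fin2: "finite_measure (distr ?D borel \<gamma>)" by (rule finite_measure.finite_measure_distr[OF fin]) measurable
  have sf2: "sigma_finite_measure (distr ?D borel \<gamma>)" using fin2 by (rule finite_measure.axioms)
  have "length_measure \<gamma> \<Otimes>\<^sub>M length_measure \<gamma> = distr (?D \<Otimes>\<^sub>M ?D) (borel \<Otimes>\<^sub>M borel) (\<lambda>(s,t). (\<gamma> s, \<gamma> t))"
    unfolding length_measure_eq by (rule pair_measure_distr[OF _ _ sf2]) measurable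
  also have "?D \<Otimes>\<^sub>M ?D = density (U01 \<Otimes>\<^sub>M U01) (\<lambda>(s,t). ennreal (norm (vel s)) * ennreal (norm (vel t)))"
    by (rule pair_measure_density[OF _ _ U01.sigma_finite_measure_axioms sf]) measurable
  also have "(\<lambda>(s,t). ennreal (norm (vel s)) * ennreal (norm (vel t))) = (\<lambda>p. ennreal (norm (vel (fst p)) * norm (vel (snd p))))"
    by (auto simp: ennreal_mult)
  finally show ?thesis by (simp add: case_prod_beta')
qed

lemma angle_energy_integral:
  fixes f :: "complex \<times> complex \<Rightarrow> real"
  defines "f \<equiv> \<lambda>(x,y). angle_function \<gamma> x y * sin (angle_function \<gamma> x y) / norm (y - x) ^ 2"
  shows "set_integrable (length_measure \<gamma> \<Otimes>\<^sub>M length_measure \<gamma>) (path_image \<gamma> \<times> path_image \<gamma>) f"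
    and "set_lebesgue_integral (length_measure \<gamma> \<Otimes>\<^sub>M length_measure \<gamma>) (path_image \<gamma> \<times> path_image \<gamma>) f
       = - 2 * chord_energy - 2 * rot\<^sup>2"
proof -
  let ?C = "path_image \<gamma> \<times> path_image \<gamma>" and ?U = "U01 \<Otimes>\<^sub>M U01"
  define F where "F p = indicator ?C p *\<^sub>R f p" for p
  define D where "D p = norm (vel (fst p)) * norm (vel (snd p))" for p
  define T where "T p = (\<gamma> (fst p), \<gamma> (snd p))" for p
  have [measurable]: "D \<in> borel_measurable (borel \<Otimes>\<^sub>M borel)" unfolding D_def[abs_def] by measurable
  have [measurable]: "T \<in> (borel \<Otimes>\<^sub>M borel) \<rightarrow>\<^sub>M (borel \<Otimes>\<^sub>M borel)" unfolding T_def[abs_def] by measurable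
  have C: "simple_path \<gamma>" using C2 by (simp add: C2_simple_closed_def)
  have closed: "closed ?C" using closed_simple_path_image[OF C] by (intro closed_Times)
  \<comment> \<open>Off the curve the values of the angle function are unspecified, so measurability
    is available only after multiplication by the indicator.\<close>
  define a where "a p = indicator ?C p *\<^sub>R angle_function \<gamma> (fst p) (snd p)" for p
  have "a \<in> borel_measurable borel"
    unfolding a_def using continuous_angle_function
    by (intro borel_measurable_continuous_on_indicator borel_closed closed) (simp add: case_prod_beta')
  then have am [measurable]: "a \<in> borel_measurable (borel \<Otimes>\<^sub>M borel)" by (simp add: borel_prod)
  have Feq: "F = (\<lambda>p. a p * sin (a p) / norm (snd p - fst p) ^ 2)"
    by (rule ext) (auto simp: F_def a_def f_def indicator_def case_prod_beta')
  have Fm [measurable]: "F \<in> borel_measurable (borel \<Otimes>\<^sub>M borel)" unfolding Feq by measurable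
  have L: "length_measure \<gamma> \<Otimes>\<^sub>M length_measure \<gamma> = distr (density ?U (\<lambda>p. ennreal (D p))) (borel \<Otimes>\<^sub>M borel) T"
    unfolding length_measure_pair D_def T_def ..
  have DF: "D p *\<^sub>R F (T p) = energy (fst p) (snd p)" for p
  proof -
    have "\<gamma> t \<in> path_image \<gamma>" for t using range_\<gamma> by blast
    then show ?thesis by (simp add: D_def F_def T_def f_def energy_def angle_fun_def)
  qed
  obtain B where B: "\<And>s t. \<bar>energy s t\<bar> \<le> B" using energy_bounded by blast
  have intE: "integrable ?U (\<lambda>p. energy (fst p) (snd p))" by (rule U01_pair_integrable_bounded[of _ B]) (use B in auto)
  have "integrable (density ?U (\<lambda>p. ennreal (D p))) (\<lambda>p. F (T p))"
    by (subst integrable_density) (auto simp: DF[simplified] intE, auto simp: D_def)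
  then have "integrable (length_measure \<gamma> \<Otimes>\<^sub>M length_measure \<gamma>) F"
    unfolding L by (subst integrable_distr_eq) auto
  then show "set_integrable (length_measure \<gamma> \<Otimes>\<^sub>M length_measure \<gamma>) ?C f"
    unfolding set_integrable_def F_def .
  have "set_lebesgue_integral (length_measure \<gamma> \<Otimes>\<^sub>M length_measure \<gamma>) ?C f = integral\<^sup>L (length_measure \<gamma> \<Otimes>\<^sub>M length_measure \<gamma>) F"
    unfolding set_lebesgue_integral_def F_def ..
  also have "\<dots> = (\<integral>p. F (T p) \<partial>density ?U (\<lambda>p. ennreal (D p)))"
    unfolding L by (rule integral_distr) auto
  also have "\<dots> = (\<integral>p. D p *\<^sub>R F (T p) \<partial>?U)"
    by (rule integral_density) (auto simp: D_def)
  also have "\<dots> = - 2 * chord_energy - 2 * rot\<^sup>2" unfolding DF by (rule integral_energy)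
  finally show "set_lebesgue_integral (length_measure \<gamma> \<Otimes>\<^sub>M length_measure \<gamma>) ?C f = - 2 * chord_energy - 2 * rot\<^sup>2" .
qed

end

theorem proposition3:
  fixes \<gamma> :: "real \<Rightarrow> complex" and \<Omega> C :: "complex set" and \<theta> :: "complex \<Rightarrow> complex \<Rightarrow> real"
  assumes "C2_simple_closed \<gamma>"
    and "C = path_image \<gamma>"
    and "\<theta> = angle_function \<gamma>"
    and "compact_domain \<Omega>"
    and "frontier \<Omega> = C"
  shows "set_integrable (length_measure \<gamma> \<Otimes>\<^sub>M length_measure \<gamma>) (C \<times> C)
           (\<lambda>(x, y). \<theta> x y * sin (\<theta> x y) / norm (y - x) ^ 2) \<and>
         set_integrable (lborel \<Otimes>\<^sub>M lborel) (NT \<Omega>) (\<lambda>(z, w). 1 / norm (z - w) ^ 4) \<and>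
         set_lebesgue_integral (length_measure \<gamma> \<Otimes>\<^sub>M length_measure \<gamma>) (C \<times> C)
           (\<lambda>(x, y). \<theta> x y * sin (\<theta> x y) / norm (y - x) ^ 2)
         = 4 * set_lebesgue_integral (lborel \<Otimes>\<^sub>M lborel) (NT \<Omega>) (\<lambda>(z, w). 1 / norm (z - w) ^ 4)"
proof -
  interpret C2_domain \<gamma> \<Omega>
    using assms by unfold_locales auto
  \<comment> \<open>With this, the value -2 \<open>chord_energy\<close> - 2 pi^2 of the left side is
    four times - \<open>chord_energy\<close> / 2 - pi^2 / 2.\<close>
  have "rot\<^sup>2 = pi\<^sup>2" using \<sigma>2 by (simp add: rot_eq power_mult_distrib)
  then show ?thesis
    using angle_energy_integral NT_integral assms(2,3)
    unfolding set_integrable_def set_lebesgue_integral_def by (simp add: case_prod_beta')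
qed

end
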